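(* Let $n\ge2$ be an integer, $a\in\mathbb R\setminus\{0\}$, and for $\varepsilon\in\mathbb R$ small let $$\Omega_\varepsilon=\{(x,y)\in\mathbb R^2:0<y<1+\varepsilon(\cos x+a\cos(nx))\}.$$ Put $\Lambda_n(a)=-\dfrac{\sinh(n/2)}{a\,n^2\sinh(1/2)}$ and $N_n(\lambda)=\#\{c\in(-1,1):U_{n-1}(c)=\lambda\}$. Assume that $U_{n-1}'(c)\neq0$ for every $c\in(-1,1)$ with $U_{n-1}(c)=\Lambda_n(a)$, and that $\Lambda_n(a)\notin\{n,(-1)^{n-1}n\}$. Then there exists $\varepsilon_0>0$ such that, for every $0<|\varepsilon|<\varepsilon_0$, the Robin function $R_{\Omega_\varepsilon}$ has exactly $$2+2N_n(\Lambda_n(a))$$ nondegenerate critical points in one spatial period. Moreover, for $|a|$ sufficiently small there are exactly two critical points per period, whereas for $|a|$ sufficiently large there are exactly $2n$ critical points per period (in both cases for all sufficiently small $\varepsilon\ne0$, depending on $a$).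
   Context: $U_{n-1}$ is the Chebyshev polynomial of the second kind, $\sin(nx)=\sin x\,U_{n-1}(\cos x)$. For a planar channel domain $D$, the Robin function is $R_D(z)=\lim_{\zeta\to z}\big(G_D(z,\zeta)+\frac1{2\pi}\log|z-\zeta|\big)$, with $G_D$ the (minimal positive) Dirichlet Green function, $-\Delta_zG_D(\cdot,\zeta)=\delta_\zeta$, $G_D=0$ on $\partial D$. $R_{\Omega_\varepsilon}$ is $2\pi$-periodic in $x$; "in one spatial period" means counted modulo $2\pi$ in $x$. *)

theory Defs
  imports "HOL-Analysis.Analysis" "HOL-Computational_Algebra.Polynomial"
begin

text \<open>The plane is identified with the complex numbers, \<open>(x, y) = x + \<i> y\<close>.\<close>

section \<open>Chebyshev polynomials of the second kind\<close>

fun cheb_U :: "nat \<Rightarrow> real poly" where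
  "cheb_U 0 = 1"
| "cheb_U (Suc 0) = [:0, 2:]"
| "cheb_U (Suc (Suc m)) = [:0, 2:] * cheb_U (Suc m) - cheb_U m"

lemma sin_cheb_U: "sin (real (Suc m) * x) = sin x * poly (cheb_U m) (cos x)"
proof (induction m rule: cheb_U.induct)
  case 1
  then show ?case by simp
next
  case 2
  then show ?case by (simp add: sin_double)
next
  case (3 m)
  have "sin (real (Suc (Suc (Suc m))) * x) + sin (real (Suc m) * x)
      = 2 * cos x * sin (real (Suc (Suc m)) * x)"
    using sin_add[of "real (Suc (Suc m)) * x" x] sin_diff[of "real (Suc (Suc m)) * x" x]
    by (simp add: algebra_simps)
  with 3 show ?case by (simp add: algebra_simps)
qed

text \<open>The trigonometric identity characterises the polynomial.\<close>

lemma cheb_U_unique: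
  assumes "\<And>x. sin (real (Suc m) * x) = sin x * poly p (cos x)"
  shows "p = cheb_U m"
proof -
  have "poly (p - cheb_U m) c = 0" if "c \<in> {-1<..<1}" for c
  proof -
    have "sin (arccos c) \<noteq> 0" "cos (arccos c) = c"
      using that by (auto simp: sin_arccos_nonzero)
    then show ?thesis
      using assms[of "arccos c"] sin_cheb_U[of m "arccos c"] by simp
  qed
  then have "{-1<..<1} \<subseteq> {c. poly (p - cheb_U m) c = 0}" by blast
  moreover have "infinite {-1<..<1::real}" by (simp add: infinite_Ioo)
  ultimately have "infinite {c. poly (p - cheb_U m) c = 0}"
    using infinite_super by blast
  then show ?thesis using poly_roots_finite[of "p - cheb_U m"] by fastforce
qed

section \<open>Green function and Robin function of a planar domain\<close>

definition dir_deriv :: "complex \<Rightarrow> (complex \<Rightarrow> real) \<Rightarrow> complex \<Rightarrow> real" where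
  "dir_deriv v f z = deriv (\<lambda>t::real. f (z + t *\<^sub>R v)) 0"

definition laplacian :: "(complex \<Rightarrow> real) \<Rightarrow> complex \<Rightarrow> real" where
  "laplacian f z = dir_deriv 1 (dir_deriv 1 f) z + dir_deriv \<i> (dir_deriv \<i> f) z"

text \<open>
  \<open>C\<^sup>\<infinity>\<close>: all iterated directional derivatives exist and are Frechet differentiable
  (hence continuous).
\<close>

definition smooth :: "(complex \<Rightarrow> real) \<Rightarrow> bool" where
  "smooth f \<longleftrightarrow> (\<forall>vs. foldr dir_deriv vs f differentiable_on UNIV)"

definition test_function :: "complex set \<Rightarrow> (complex \<Rightarrow> real) \<Rightarrow> bool" where
  "test_function D \<phi> \<longleftrightarrow> smooth \<phi> \<and>
     compact (closure {z. \<phi> z \<noteq> 0}) \<and> closure {z. \<phi> z \<noteq> 0} \<subseteq> D"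

definition locally_integrable :: "complex set \<Rightarrow> (complex \<Rightarrow> real) \<Rightarrow> bool" where
  "locally_integrable D u \<longleftrightarrow> (\<forall>K. compact K \<and> K \<subseteq> D \<longrightarrow> set_integrable lborel K u)"

text \<open>\<open>-\<Delta>u = \<delta>\<^sub>\<zeta>\<close> in \<open>D\<close>, in the sense of distributions.\<close>

definition neg_laplacian_eq_delta :: "complex set \<Rightarrow> complex \<Rightarrow> (complex \<Rightarrow> real) \<Rightarrow> bool" where
  "neg_laplacian_eq_delta D \<zeta> u \<longleftrightarrow> locally_integrable D u \<and>
     (\<forall>\<phi>. test_function D \<phi> \<longrightarrow> - (LINT z:D|lborel. u z * laplacian \<phi> z) = \<phi> \<zeta>)"

text \<open>
  Continuity off the pole selects the pointwise representative of the distributional solution.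
  Only boundary points in the plane are constrained; on an unbounded domain this and positivity
  do not determine \<open>u\<close>, whence the minimality in \<open>is_green_function\<close>.
\<close>

definition positive_dirichlet_solution :: "complex set \<Rightarrow> complex \<Rightarrow> (complex \<Rightarrow> real) \<Rightarrow> bool" where
  "positive_dirichlet_solution D \<zeta> u \<longleftrightarrow>
     continuous_on (D - {\<zeta>}) u \<and>
     (\<forall>z \<in> D - {\<zeta>}. 0 < u z) \<and>
     neg_laplacian_eq_delta D \<zeta> u \<and>
     (\<forall>p \<in> frontier D. (u \<longlongrightarrow> 0) (at p within D))"

definition is_green_function :: "complex set \<Rightarrow> complex \<Rightarrow> (complex \<Rightarrow> real) \<Rightarrow> bool" where
  "is_green_function D \<zeta> u \<longleftrightarrow> positive_dirichlet_solution D \<zeta> u \<and>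
     (\<forall>v. positive_dirichlet_solution D \<zeta> v \<longrightarrow> (\<forall>z \<in> D - {\<zeta>}. u z \<le> v z))"

text \<open>
  By minimality any two functions satisfying \<open>is_green_function D \<zeta>\<close> agree on \<open>D - {\<zeta>}\<close>, so
  the choice matters only at the pole and off \<open>D\<close>. The pole is the second argument.
\<close>

definition green_function :: "complex set \<Rightarrow> complex \<Rightarrow> complex \<Rightarrow> real" where
  "green_function D z \<zeta> = (SOME u. is_green_function D \<zeta> u) z"

definition robin_function :: "complex set \<Rightarrow> complex \<Rightarrow> real" where
  "robin_function D z =
     Lim (at z) (\<lambda>\<zeta>. green_function D z \<zeta> + 1 / (2 * pi) * ln (cmod (z - \<zeta>)))"

section \<open>Critical points\<close>

definition critical_point :: "(complex \<Rightarrow> real) \<Rightarrow> complex \<Rightarrow> bool" where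
  "critical_point f z \<longleftrightarrow> (GDERIV f z :> 0)"

text \<open>\<open>H\<close> is the Hessian of \<open>f\<close> at \<open>z\<close>, the derivative of the gradient field \<open>g\<close>.\<close>

definition nondegenerate_critical_point :: "(complex \<Rightarrow> real) \<Rightarrow> complex \<Rightarrow> bool" where
  "nondegenerate_critical_point f z \<longleftrightarrow> critical_point f z \<and>
     (\<exists>g H. (\<forall>\<^sub>F w in nhds z. GDERIV f w :> g w) \<and> (g has_derivative H) (at z) \<and> bij H)"

section \<open>The perturbed channels\<close>

definition channel :: "nat \<Rightarrow> real \<Rightarrow> real \<Rightarrow> complex set" where
  "channel n a \<epsilon> =
     {z. 0 < Im z \<and> Im z < 1 + \<epsilon> * (cos (Re z) + a * cos (real n * Re z))}"

definition Lambda :: "nat \<Rightarrow> real \<Rightarrow> real" where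
  "Lambda n a = - (sinh (real n / 2) / (a * (real n)\<^sup>2 * sinh (1 / 2)))"

definition N_count :: "nat \<Rightarrow> real \<Rightarrow> nat" where
  "N_count n l = card {c \<in> {-1<..<1}. poly (cheb_U (n - 1)) c = l}"

text \<open>The half-open strip \<open>0 \<le> x < 2\<pi>\<close> is a fundamental domain for \<open>x\<close> modulo \<open>2\<pi>\<close>.\<close>

definition critical_points_per_period :: "nat \<Rightarrow> real \<Rightarrow> real \<Rightarrow> complex set" where
  "critical_points_per_period n a \<epsilon> =
     {z \<in> channel n a \<epsilon>. 0 \<le> Re z \<and> Re z < 2 * pi \<and>
        critical_point (robin_function (channel n a \<epsilon>)) z}"

end

theory Submission
  imports Defs "HOL-Complex_Analysis.Complex_Analysis"
begin

text \<open>
  Straighten the channel by a conformal map \<open>F\<close> of a strip \<open>0 < Im w < \<rho>\<close> onto it, odd, real on the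
  real axis and commuting with \<open>w \<mapsto> w + 2\<pi>\<close>. The boundary condition on \<open>Im w = \<rho>\<close> is a fixed point
  equation in a Banach algebra of exponentially weighted Fourier coefficients; the contraction
  principle gives \<open>F w = w + \<epsilon> (sin w / sinh 1 + a sin (n w) / sinh n) + O(\<epsilon>\<^sup>2)\<close> on a fixed strip
  around the real axis that contains \<open>0 \<le> Im w \<le> \<rho>\<close>.

  Pulling back the Green function of the half plane by \<open>exp (\<pi> w / \<rho>)\<close> shows that, up to a nonvanishing
  factor, the gradient of the Robin function at \<open>F w\<close> is \<open>cnj T + \<i> \<kappa> cot (\<kappa> Im w)\<close> with
  \<open>T = F'' / F'\<close> and \<open>\<kappa> = \<pi> / \<rho>\<close>. Since \<open>T = O(\<epsilon>)\<close>, the imaginary part of this equation defines a curve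
  \<open>Im w = 1/2 + O(\<epsilon>)\<close> over the \<open>Re w\<close>-axis. On that curve the real part, divided by \<open>\<epsilon>\<close>, is a small
  Lipschitz perturbation of a multiple of \<open>sin u (U\<^bsub>n-1\<^esub> (cos u) - \<Lambda>\<^sub>n(a))\<close>. The hypotheses say that all
  zeros of this function are simple, so their number in \<open>[0, 2\<pi>)\<close> is stable; symmetry keeps the zeros
  at the endpoints \<open>0\<close> and \<open>2\<pi>\<close> fixed. Finally \<open>\<bar>U\<^bsub>n-1\<^esub>\<bar> \<le> n\<close> on \<open>[-1, 1]\<close> settles small \<open>a\<close>, and the sign
  changes of \<open>U\<^bsub>n-1\<^esub>\<close> at the points where \<open>\<bar>sin (n x)\<bar> = 1\<close> settle large \<open>a\<close>.
\<close>

section \<open>A weighted Wiener algebra\<close>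

no_notation Infinite_Set_Sum.abs_summable_on (infix "abs'_summable'_on" 50)

text \<open>Counting zeros of the gradient and testing the Hessian takes several derivatives of the
  conformal map up to the boundary, with constants uniform in \<epsilon>. The weight 2 ^
  \<bar>k\<bar> provides them: a Fourier series on the line Im w = \<rho> with this weight continues
  across the line by ln 2, and \<rho> + ln 2 > 3/2, so all estimates live on \<bar>Im w\<bar> < 3/2
  and each further derivative costs one Cauchy estimate on a slightly narrower strip. Multiplication
  by \<i> gives the trace of the horizontal displacement real coefficients, which keeps the algebra
  real.

  A second obstacle is the Green function. It is defined as the least positive distributional
  solution on an unbounded domain, so the explicit formula has to be compared with every competitor.
  The difference is weakly harmonic across the pole but only known to be continuous off it; smooth
  mean value kernels remove that singularity and yield the maximum principle.

  The critical heights are only shown to be Lipschitz in u. Persistence of simple zeros is therefore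
  formulated for perturbations that are small together with their Lipschitz constant.\<close>

definition wt :: "int \<Rightarrow> real" where "wt k = 2 ^ nat \<bar>k\<bar>"

lemma wt_ge_1: "1 \<le> wt k" and wt_pos: "0 < wt k" and wt_0 [simp]: "wt 0 = 1"
  by (auto simp: wt_def)

lemma wt_uminus [simp]: "wt (- k) = wt k"
  by (simp add: wt_def)

text \<open>Submultiplicativity of the weight is what makes the weighted space closed under
  convolution.\<close>

lemma wt_add: "wt (j + k) \<le> wt j * wt k"
proof -
  have "nat \<bar>j + k\<bar> \<le> nat \<bar>j\<bar> + nat \<bar>k\<bar>" by linarith
  then have "(2::real) ^ nat \<bar>j + k\<bar> \<le> 2 ^ (nat \<bar>j\<bar> + nat \<bar>k\<bar>)"
    by (intro power_increasing) auto
  then show ?thesis by (simp add: wt_def power_add)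
qed

definition wsummable :: "(int \<Rightarrow> real) \<Rightarrow> bool" where
  "wsummable x \<longleftrightarrow> (\<lambda>k. \<bar>x k\<bar> * wt k) summable_on UNIV"

definition wnorm :: "(int \<Rightarrow> real) \<Rightarrow> real" where
  "wnorm x = (\<Sum>\<^sub>\<infinity>k. \<bar>x k\<bar> * wt k)"

lemma wsummableI:
  assumes "\<And>A. finite A \<Longrightarrow> (\<Sum>k\<in>A. \<bar>x k\<bar> * wt k) \<le> c"
  shows "wsummable x" "wnorm x \<le> c"
proof -
  show *: "wsummable x" unfolding wsummable_def
    using assms wt_pos by (intro nonneg_bdd_above_summable_on bdd_aboveI2[where M = c]) (auto simp: less_imp_le)
  show "wnorm x \<le> c" unfolding wnorm_def
    using * assms by (intro infsum_le_finite_sums) (auto simp: wsummable_def)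
qed

lemma wsummable_bound:
  assumes "wsummable x" "finite A"
  shows "(\<Sum>k\<in>A. \<bar>x k\<bar> * wt k) \<le> wnorm x"
  unfolding wnorm_def using assms wt_pos
  by (intro finite_sum_le_infsum) (auto simp: wsummable_def less_imp_le)

lemma wsummable_add:
  assumes "wsummable x" "wsummable y"
  shows "wsummable (\<lambda>k. x k + y k)" "wnorm (\<lambda>k. x k + y k) \<le> wnorm x + wnorm y"
proof -
  have "(\<Sum>k\<in>A. \<bar>x k + y k\<bar> * wt k) \<le> wnorm x + wnorm y" if "finite A" for A
  proof -
    have "(\<Sum>k\<in>A. \<bar>x k + y k\<bar> * wt k) \<le> (\<Sum>k\<in>A. \<bar>x k\<bar> * wt k + \<bar>y k\<bar> * wt k)"
      using wt_pos by (intro sum_mono) (simp add: ring_distribs[symmetric] less_imp_le)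
    also have "\<dots> \<le> wnorm x + wnorm y"
      using wsummable_bound[OF assms(1) that] wsummable_bound[OF assms(2) that]
      by (simp add: sum.distrib)
    finally show ?thesis .
  qed
  from wsummableI[OF this] show "wsummable (\<lambda>k. x k + y k)" "wnorm (\<lambda>k. x k + y k) \<le> wnorm x + wnorm y" by auto
qed

lemma wsummable_scale:
  assumes "wsummable x"
  shows "wsummable (\<lambda>k. c * x k)" "wnorm (\<lambda>k. c * x k) = \<bar>c\<bar> * wnorm x"
proof -
  have eq: "(\<lambda>k. \<bar>c * x k\<bar> * wt k) = (\<lambda>k. \<bar>c\<bar> * (\<bar>x k\<bar> * wt k))" by (simp add: abs_mult mult_ac)
  show "wsummable (\<lambda>k. c * x k)"
    using assms unfolding wsummable_def eq by (rule summable_on_cmult_right)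
  show "wnorm (\<lambda>k. c * x k) = \<bar>c\<bar> * wnorm x"
    unfolding wnorm_def eq by (rule infsum_cmult_right')
qed

lemma wsummable_single [simp]:
  "wsummable (\<lambda>k. if k = j then c else 0)" "wnorm (\<lambda>k. if k = j then c else 0) = \<bar>c\<bar> * wt j"
proof -
  have "((\<lambda>k. \<bar>if k = j then c else 0\<bar> * wt k) has_sum (\<bar>c\<bar> * wt j)) UNIV"
    by (rule has_sum_finite_neutralI[where B = "{j}"]) auto
  then show "wsummable (\<lambda>k. if k = j then c else 0)" "wnorm (\<lambda>k. if k = j then c else 0) = \<bar>c\<bar> * wt j"
    unfolding wsummable_def wnorm_def by (auto simp: infsumI summable_on_def)
qed

text \<open>Sequences growing at most like the weight act on the weighted space: C * \<bar>x k\<bar>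
  * wt k is a summable majorant of the terms.\<close>

lemma wsummable_pair:
  fixes g :: "int \<Rightarrow> 'c::banach"
  assumes "wsummable x" "\<And>k. norm (g k) \<le> C * wt k"
  shows "(\<lambda>k. x k *\<^sub>R g k) abs_summable_on UNIV"
    and "norm (\<Sum>\<^sub>\<infinity>k. x k *\<^sub>R g k) \<le> C * wnorm x"
proof -
  have C: "(\<lambda>k. C * (\<bar>x k\<bar> * wt k)) summable_on UNIV"
    using assms(1) unfolding wsummable_def by (rule summable_on_cmult_right)
  have le: "norm (x k *\<^sub>R g k) \<le> C * (\<bar>x k\<bar> * wt k)" for k
    using mult_left_mono[OF assms(2)[of k], of "\<bar>x k\<bar>"] by (simp add: mult_ac)
  show *: "(\<lambda>k. x k *\<^sub>R g k) abs_summable_on UNIV"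
    by (rule summable_on_comparison_test[OF C]) (use le in auto)
  have "norm (\<Sum>\<^sub>\<infinity>k. x k *\<^sub>R g k) \<le> (\<Sum>\<^sub>\<infinity>k. norm (x k *\<^sub>R g k))"
    by (rule norm_infsum_bound[OF *])
  also have "\<dots> \<le> (\<Sum>\<^sub>\<infinity>k. C * (\<bar>x k\<bar> * wt k))"
    by (rule infsum_mono[OF * C le])
  also have "\<dots> = C * wnorm x" unfolding wnorm_def by (rule infsum_cmult_right')
  finally show "norm (\<Sum>\<^sub>\<infinity>k. x k *\<^sub>R g k) \<le> C * wnorm x" .
qed

definition conv :: "(int \<Rightarrow> real) \<Rightarrow> (int \<Rightarrow> real) \<Rightarrow> int \<Rightarrow> real" where
  "conv x y m = (\<Sum>\<^sub>\<infinity>j. x j * y (m - j))"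

text \<open>Reindexes a product family by the output index m = j + l of a convolution.\<close>

lemma bij_shear: "bij_betw (\<lambda>(j, m). (j, m - j)) UNIV (UNIV :: (int \<times> int) set)"
  by (rule bij_betwI[where g = "\<lambda>(j, l). (j, j + l)"]) auto

text \<open>After the shear, \<open>wt_add\<close> with m = j + (m - j) bounds the family by the
  product of the two weighted series, whose sum is the product of the norms.\<close>

lemma conv_summable_pairs:
  assumes "wsummable x" "wsummable y"
  shows "(\<lambda>(j, m). \<bar>x j * y (m - j)\<bar> * wt m) summable_on UNIV"
    and "(\<Sum>\<^sub>\<infinity>(j, m). \<bar>x j * y (m - j)\<bar> * wt m) \<le> wnorm x * wnorm y"
proof -
  let ?f = "\<lambda>(j, l). (\<bar>x j\<bar> * wt j) * (\<bar>y l\<bar> * wt l)"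
  have fpos: "?f p \<ge> 0" for p by (auto simp: case_prod_beta wt_pos less_imp_le)
  have "?f abs_summable_on (UNIV \<times> UNIV)"
  proof (rule iffD2[OF Infinite_Sum.abs_summable_on_Sigma_iff], intro conjI ballI)
    fix j show "(\<lambda>l. ?f (j, l)) abs_summable_on UNIV"
      using assms(2) wt_pos unfolding wsummable_def
      by (simp add: abs_mult less_imp_le summable_on_cmult_right)
  next
    have "(\<lambda>j. (\<bar>x j\<bar> * wt j) * wnorm y) summable_on UNIV"
      using assms(1) unfolding wsummable_def by (rule summable_on_cmult_left)
    moreover have "wnorm y \<ge> 0" unfolding wnorm_def by (rule infsum_nonneg) (simp add: wt_pos less_imp_le)
    ultimately show "(\<lambda>j. \<Sum>\<^sub>\<infinity>l. norm (?f (j, l))) abs_summable_on UNIV"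
      using wt_pos by (simp add: abs_mult less_imp_le infsum_cmult_right' wnorm_def)
  qed
  then have f: "?f summable_on UNIV"
    using fpos by simp
  have "infsum ?f UNIV = (\<Sum>\<^sub>\<infinity>j. \<Sum>\<^sub>\<infinity>l. ?f (j, l))"
    using infsum_Sigma_banach[of ?f UNIV "\<lambda>_. UNIV"] f by simp
  also have "\<dots> = wnorm x * wnorm y"
    by (simp add: infsum_cmult_right' infsum_cmult_left' wnorm_def)
  finally have fsum: "infsum ?f UNIV = wnorm x * wnorm y" .
  let ?g = "\<lambda>(j, m). ?f (j, m - j)"
  have g: "?g summable_on UNIV" "infsum ?g UNIV = wnorm x * wnorm y"
    using summable_on_reindex_bij_betw[OF bij_shear, of ?f] infsum_reindex_bij_betw[OF bij_shear, of ?f] f fsum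
    by (simp_all add: case_prod_unfold)
  have le: "(\<lambda>(j, m). \<bar>x j * y (m - j)\<bar> * wt m) p \<le> ?g p" for p
  proof -
    obtain j m where p: "p = (j, m)" by force
    have "\<bar>x j * y (m - j)\<bar> * wt m \<le> \<bar>x j * y (m - j)\<bar> * (wt j * wt (m - j))"
      using wt_add[of j "m - j"] by (intro mult_left_mono) auto
    then show ?thesis by (simp add: p abs_mult mult_ac)
  qed
  show s: "(\<lambda>(j, m). \<bar>x j * y (m - j)\<bar> * wt m) summable_on UNIV"
    by (rule summable_on_comparison_test[OF g(1) le]) (auto simp: wt_pos less_imp_le)
  show "(\<Sum>\<^sub>\<infinity>(j, m). \<bar>x j * y (m - j)\<bar> * wt m) \<le> wnorm x * wnorm y"
    using infsum_mono[OF s g(1) le] g(2) by simp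
qed

text \<open>Interchange of summation, legal because the growth bound on \<open>g\<close> makes the
  double family absolutely summable. All ring axioms of the algebra are later reduced to this
  identity.\<close>

lemma conv_pairing:
  fixes g :: "int \<Rightarrow> 'c::banach"
  assumes "wsummable x" "wsummable y" "\<And>k. norm (g k) \<le> C * wt k"
  shows "(\<Sum>\<^sub>\<infinity>m. conv x y m *\<^sub>R g m) = (\<Sum>\<^sub>\<infinity>j. x j *\<^sub>R (\<Sum>\<^sub>\<infinity>l. y l *\<^sub>R g (j + l)))"
proof -
  let ?h = "\<lambda>(j, m). (x j * y (m - j)) *\<^sub>R g m"
  have le: "norm (?h p) \<le> C * (\<lambda>(j, m). \<bar>x j * y (m - j)\<bar> * wt m) p" for p
  proof -
    obtain j m where p: "p = (j, m)" by force
    show ?thesis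
      using mult_left_mono[OF assms(3)[of m], of "\<bar>x j * y (m - j)\<bar>"] by (simp add: p mult_ac)
  qed
  have "?h abs_summable_on UNIV"
    by (rule summable_on_comparison_test[OF summable_on_cmult_right[OF conv_summable_pairs(1)[OF assms(1,2)], of C]])
       (use le in auto)
  then have h: "?h summable_on UNIV \<times> UNIV" by (simp add: abs_summable_summable)
  have g': "\<bar>a\<bar> \<le> 1 * wt m" if "\<bar>a\<bar> \<le> 1" for a m using wt_ge_1[of m] that by linarith
  have conv_s: "(\<lambda>j. x j * y (m - j)) summable_on UNIV" for m
  proof -
    have "(\<lambda>j. (\<lambda>(j, m). \<bar>x j * y (m - j)\<bar> * wt m) (j, m)) summable_on UNIV"
      using summable_on_SigmaD1[of "\<lambda>m j. (\<lambda>(j, m). \<bar>x j * y (m - j)\<bar> * wt m) (j, m)" UNIV "\<lambda>_. UNIV" m]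
        summable_on_swap[of "\<lambda>(j, m). \<bar>x j * y (m - j)\<bar> * wt m" UNIV UNIV]
        conv_summable_pairs(1)[OF assms(1,2)] by (simp add: case_prod_beta wt_pos less_imp_le)
    then have "(\<lambda>j. \<bar>x j * y (m - j)\<bar>) summable_on UNIV"
      using wt_pos[of m] by (simp add: summable_on_cmult_left' less_imp_neq[symmetric])
    then show ?thesis
      using summable_on_iff_abs_summable_on_real[of "\<lambda>j. x j * y (m - j)" UNIV] by simp
  qed
  have "(\<Sum>\<^sub>\<infinity>m. conv x y m *\<^sub>R g m) = (\<Sum>\<^sub>\<infinity>m. \<Sum>\<^sub>\<infinity>j. ?h (j, m))"
    unfolding conv_def by (simp add: infsum_scaleR_left conv_s)
  also have "\<dots> = (\<Sum>\<^sub>\<infinity>j. \<Sum>\<^sub>\<infinity>m. ?h (j, m))"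
    using infsum_swap_banach[of "\<lambda>j m. ?h (j, m)" UNIV UNIV] h by (simp add: case_prod_beta)
  also have "\<dots> = (\<Sum>\<^sub>\<infinity>j. x j *\<^sub>R (\<Sum>\<^sub>\<infinity>l. y l *\<^sub>R g (j + l)))"
  proof (rule infsum_cong)
    fix j
    have "(\<Sum>\<^sub>\<infinity>m. ?h (j, m)) = (\<Sum>\<^sub>\<infinity>l. ?h (j, j + l))"
      by (rule infsum_reindex_bij_betw[symmetric], rule bij_betwI[where g = "\<lambda>m. m - j"]) auto
    also have "\<dots> = (\<Sum>\<^sub>\<infinity>l. x j *\<^sub>R (y l *\<^sub>R g (j + l)))" by simp
    also have "\<dots> = x j *\<^sub>R (\<Sum>\<^sub>\<infinity>l. y l *\<^sub>R g (j + l))" by (rule infsum_scaleR_right)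
    finally show "(\<Sum>\<^sub>\<infinity>m. ?h (j, m)) = x j *\<^sub>R (\<Sum>\<^sub>\<infinity>l. y l *\<^sub>R g (j + l))" .
  qed
  finally show ?thesis .
qed

lemma wsummable_conv:
  assumes "wsummable x" "wsummable y"
  shows "wsummable (conv x y)" "wnorm (conv x y) \<le> wnorm x * wnorm y"
proof -
  let ?f = "\<lambda>(j, m). \<bar>x j * y (m - j)\<bar> * wt m"
  have f: "?f summable_on UNIV" by (rule conv_summable_pairs[OF assms])
  have f': "(\<lambda>(m, j). ?f (j, m)) summable_on UNIV \<times> UNIV"
    using f summable_on_swap[of ?f UNIV UNIV] by (simp add: case_prod_beta)
  have sm: "(\<lambda>m. \<Sum>\<^sub>\<infinity>j. ?f (j, m)) summable_on UNIV"
    using summable_on_Sigma_banach[of "\<lambda>m j. ?f (j, m)" UNIV "\<lambda>_. UNIV"] f' by simp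
  have ss: "(\<lambda>j. ?f (j, m)) summable_on UNIV" for m
    using summable_on_SigmaD1[of "\<lambda>m j. ?f (j, m)" UNIV "\<lambda>_. UNIV" m] f' by simp
  have le: "\<bar>conv x y m\<bar> * wt m \<le> (\<Sum>\<^sub>\<infinity>j. ?f (j, m))" for m
  proof -
    have a: "(\<lambda>j. x j * y (m - j)) abs_summable_on UNIV"
      using ss[of m] wt_pos[of m] by (simp add: summable_on_cmult_left' less_imp_neq[symmetric])
    have "\<bar>conv x y m\<bar> * wt m \<le> (\<Sum>\<^sub>\<infinity>j. norm (x j * y (m - j))) * wt m"
      unfolding conv_def using norm_infsum_bound[OF a] wt_pos[of m] by (intro mult_right_mono) auto
    also have "\<dots> = (\<Sum>\<^sub>\<infinity>j. ?f (j, m))" by (simp add: infsum_cmult_left')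
    finally show ?thesis .
  qed
  show s: "wsummable (conv x y)" unfolding wsummable_def
    by (rule summable_on_comparison_test[OF sm le]) (auto simp: wt_pos less_imp_le)
  have "wnorm (conv x y) \<le> (\<Sum>\<^sub>\<infinity>m. \<Sum>\<^sub>\<infinity>j. ?f (j, m))" unfolding wnorm_def
    by (rule infsum_mono[OF s[unfolded wsummable_def] sm le])
  also have "\<dots> = infsum ?f UNIV"
    using infsum_swap_banach[of "\<lambda>j m. ?f (j, m)" UNIV UNIV] f
      infsum_Sigma_banach[of ?f UNIV "\<lambda>_. UNIV"] by (simp add: case_prod_beta)
  also have "\<dots> \<le> wnorm x * wnorm y" by (rule conv_summable_pairs[OF assms])
  finally show "wnorm (conv x y) \<le> wnorm x * wnorm y" .
qed

section \<open>Banach space structure on weighted sequences\<close>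

typedef wiener = "{x. wsummable x}" morphisms coef Wiener
  using wsummable_single[of 0 0] by blast

setup_lifting type_definition_wiener

lemma coef_wsummable [simp]: "wsummable (coef x)"
  using coef by blast

lemma wiener_eqI: "(\<And>k. coef x k = coef y k) \<Longrightarrow> x = y"
  by (simp add: coef_inject[symmetric] ext)

instantiation wiener :: real_normed_vector
begin

lift_definition zero_wiener :: wiener is "\<lambda>_. 0"
  using wsummable_single[of 0 0] by simp
lift_definition plus_wiener :: "wiener \<Rightarrow> wiener \<Rightarrow> wiener" is "\<lambda>x y k. x k + y k"
  by (rule wsummable_add)
lift_definition uminus_wiener :: "wiener \<Rightarrow> wiener" is "\<lambda>x k. - x k"
  using wsummable_scale(1)[of _ "-1"] by simp
lift_definition minus_wiener :: "wiener \<Rightarrow> wiener \<Rightarrow> wiener" is "\<lambda>x y k. x k - y k"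
  using wsummable_add(1)[OF _ wsummable_scale(1)[of _ "-1"]] by simp
lift_definition scaleR_wiener :: "real \<Rightarrow> wiener \<Rightarrow> wiener" is "\<lambda>c x k. c * x k"
  by (rule wsummable_scale)
lift_definition norm_wiener :: "wiener \<Rightarrow> real" is wnorm .

definition sgn_wiener :: "wiener \<Rightarrow> wiener" where
  "sgn_wiener x = scaleR (inverse (norm x)) x"
definition dist_wiener :: "wiener \<Rightarrow> wiener \<Rightarrow> real" where
  "dist_wiener x y = norm (x - y)"
definition uniformity_wiener :: "(wiener \<times> wiener) filter" where
  "uniformity_wiener = (INF e\<in>{0<..}. principal {(x, y). dist x y < e})"
definition open_wiener :: "wiener set \<Rightarrow> bool" where
  "open_wiener U \<longleftrightarrow> (\<forall>x\<in>U. \<forall>\<^sub>F (x', y) in uniformity. x' = x \<longrightarrow> y \<in> U)"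

lemma coef_le_norm: "\<bar>coef x k\<bar> * wt k \<le> norm x"
  using wsummable_bound[of "coef x" "{k}"] by (simp add: norm_wiener.rep_eq)

instance
proof
  fix x y z :: wiener and a b :: real
  show "norm x = 0 \<longleftrightarrow> x = 0"
  proof
    assume "norm x = 0"
    then have "coef x k = 0" for k using coef_le_norm[of x k] wt_pos[of k]
      by (simp add: mult_le_0_iff)
    then show "x = 0" by (intro wiener_eqI) (simp add: zero_wiener.rep_eq)
  next
    assume "x = 0"
    then show "norm x = 0" by (simp add: norm_wiener.rep_eq zero_wiener.rep_eq wnorm_def)
  qed
  show "norm (x + y) \<le> norm x + norm y" by transfer (rule wsummable_add)
  show "norm (a *\<^sub>R x) = \<bar>a\<bar> * norm x" by transfer (rule wsummable_scale)
qed (auto simp: sgn_wiener_def dist_wiener_def uniformity_wiener_def open_wiener_def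
    zero_wiener.rep_eq plus_wiener.rep_eq uminus_wiener.rep_eq minus_wiener.rep_eq
    scaleR_wiener.rep_eq algebra_simps intro!: wiener_eqI)

end

lemmas coef_simps [simp] = zero_wiener.rep_eq plus_wiener.rep_eq uminus_wiener.rep_eq
  minus_wiener.rep_eq scaleR_wiener.rep_eq

lemma coef_le: "\<bar>coef x k\<bar> \<le> norm x"
  using coef_le_norm[of x k] mult_left_mono[OF wt_ge_1[of k], of "\<bar>coef x k\<bar>"] by simp

lemma norm_wiener_le:
  assumes "\<And>A. finite A \<Longrightarrow> (\<Sum>k\<in>A. \<bar>coef x k\<bar> * wt k) \<le> c"
  shows "norm x \<le> c"
  using wsummableI(2)[OF assms] by (simp add: norm_wiener.rep_eq)

instance wiener :: banach
proof
  fix X :: "nat \<Rightarrow> wiener"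
  assume X: "Cauchy X"
  have "Cauchy (\<lambda>n. coef (X n) k)" for k
  proof (rule metric_CauchyI)
    fix e :: real assume "0 < e"
    then obtain M where "\<And>m n. m \<ge> M \<Longrightarrow> n \<ge> M \<Longrightarrow> dist (X m) (X n) < e"
      using metric_CauchyD[OF X] by blast
    then show "\<exists>M. \<forall>m\<ge>M. \<forall>n\<ge>M. dist (coef (X m) k) (coef (X n) k) < e"
      using coef_le[of "X _ - X _" k] by (metis dist_norm minus_wiener.rep_eq real_norm_def le_less_trans)
  qed
  then have "\<forall>k. \<exists>l. (\<lambda>n. coef (X n) k) \<longlonglongrightarrow> l"
    using Cauchy_convergent convergent_def by blast
  then obtain l where l: "\<And>k. (\<lambda>n. coef (X n) k) \<longlonglongrightarrow> l k" by metis
  \<comment> \<open>Fatou for finite index sets: the Cauchy bound on X n - X m passes to the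
    coordinatewise limit in m, uniformly in the index set A.\<close>
  have close: "\<exists>M. \<forall>n\<ge>M. \<forall>A. finite A \<longrightarrow> (\<Sum>k\<in>A. \<bar>coef (X n) k - l k\<bar> * wt k) \<le> e" if e: "e > 0" for e
  proof -
    obtain M where M: "\<And>m n. m \<ge> M \<Longrightarrow> n \<ge> M \<Longrightarrow> dist (X m) (X n) < e"
      using metric_CauchyD[OF X e] by blast
    have "(\<Sum>k\<in>A. \<bar>coef (X n) k - l k\<bar> * wt k) \<le> e" if "n \<ge> M" "finite A" for n A
    proof (rule tendsto_upperbound)
      show "(\<lambda>m. \<Sum>k\<in>A. \<bar>coef (X n) k - coef (X m) k\<bar> * wt k) \<longlonglongrightarrow> (\<Sum>k\<in>A. \<bar>coef (X n) k - l k\<bar> * wt k)"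
        by (intro tendsto_intros l)
      show "\<forall>\<^sub>F m in sequentially. (\<Sum>k\<in>A. \<bar>coef (X n) k - coef (X m) k\<bar> * wt k) \<le> e"
      proof (rule eventually_sequentiallyI)
        fix m assume "M \<le> m"
        then have "norm (X n - X m) \<le> e" using M that by (fastforce simp: dist_norm)
        then show "(\<Sum>k\<in>A. \<bar>coef (X n) k - coef (X m) k\<bar> * wt k) \<le> e"
          using wsummable_bound[of "coef (X n - X m)" A] that
          by (simp add: norm_wiener.rep_eq del: minus_wiener.rep_eq) (simp add: minus_wiener.rep_eq)
      qed
    qed simp
    then show ?thesis by blast
  qed
  obtain M where M: "\<And>A. finite A \<Longrightarrow> (\<Sum>k\<in>A. \<bar>coef (X M) k - l k\<bar> * wt k) \<le> 1"
    using close[of 1] by auto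
  have "wsummable (\<lambda>k. coef (X M) k - l k)" by (rule wsummableI(1)[OF M])
  then have "wsummable (\<lambda>k. coef (X M) k + (-1) * (coef (X M) k - l k))"
    by (intro wsummable_add wsummable_scale) simp_all
  then have "wsummable l" by simp
  then have cl: "coef (Wiener l) = l" by (simp add: Wiener_inverse)
  have "X \<longlonglongrightarrow> Wiener l"
  proof (rule metric_LIMSEQ_I)
    fix e :: real assume "0 < e"
    then obtain M where M: "\<And>n A. n \<ge> M \<Longrightarrow> finite A \<Longrightarrow> (\<Sum>k\<in>A. \<bar>coef (X n) k - l k\<bar> * wt k) \<le> e / 2"
      using close[of "e/2"] by auto
    have "norm (X n - Wiener l) \<le> e / 2" if "n \<ge> M" for n
      by (rule norm_wiener_le) (use M[OF that] cl in simp)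
    then show "\<exists>M. \<forall>n\<ge>M. dist (X n) (Wiener l) < e"
      using \<open>0 < e\<close> by (intro exI[of _ M]) (force simp: dist_norm)
  qed
  then show "convergent X" by (rule convergentI)
qed

section \<open>Pairings with sequences of controlled growth and the ring structure\<close>

definition pairing :: "wiener \<Rightarrow> (int \<Rightarrow> 'c::banach) \<Rightarrow> 'c" where
  "pairing x g = (\<Sum>\<^sub>\<infinity>k. coef x k *\<^sub>R g k)"

definition wbdd :: "(int \<Rightarrow> 'c::banach) \<Rightarrow> bool" where
  "wbdd g \<longleftrightarrow> (\<exists>C. \<forall>k. norm (g k) \<le> C * wt k)"

definition unit_vec :: "int \<Rightarrow> int \<Rightarrow> real" where
  "unit_vec j k = (if k = j then 1 else 0)"

lemma pairing_unit_vec: "pairing x (unit_vec j) = coef x j"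
proof -
  have "((\<lambda>k. coef x k *\<^sub>R unit_vec j k) has_sum (coef x j)) UNIV"
    by (rule has_sum_finite_neutralI[where B = "{j}"]) (auto simp: unit_vec_def)
  then show ?thesis unfolding pairing_def by (rule infsumI)
qed

lemma wbdd_unit_vec: "wbdd (unit_vec j)"
  unfolding wbdd_def using wt_pos by (intro exI[of _ 1]) (auto simp: unit_vec_def wt_ge_1 less_imp_le)

lemma pairing_summable: "wbdd g \<Longrightarrow> (\<lambda>k. coef x k *\<^sub>R g k) summable_on UNIV"
  unfolding wbdd_def using wsummable_pair(1)[of "coef x" g] abs_summable_summable by fastforce

lemma norm_pairing: "(\<And>k. norm (g k) \<le> C * wt k) \<Longrightarrow> norm (pairing x g) \<le> C * norm x"
  unfolding pairing_def norm_wiener.rep_eq by (rule wsummable_pair) simp_all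

lemma wbdd_shift: "wbdd g \<Longrightarrow> wbdd (\<lambda>l. g (j + l))"
proof -
  assume "wbdd g"
  then obtain C where C: "\<And>k. norm (g k) \<le> C * wt k" by (auto simp: wbdd_def)
  have "C \<ge> 0" using C[of 0] norm_ge_zero[of "g 0"] by (simp del: norm_ge_zero)
  have "norm (g (j + l)) \<le> (C * wt j) * wt l" for l
    using C[of "j + l"] mult_left_mono[OF wt_add[of j l] \<open>C \<ge> 0\<close>] by (simp add: mult_ac)
  then show ?thesis unfolding wbdd_def by blast
qed

lemma wbdd_pairing_shift: "wbdd g \<Longrightarrow> wbdd (\<lambda>j. pairing y (\<lambda>l. g (j + l)))"
proof -
  assume "wbdd g"
  then obtain C where C: "\<And>k. norm (g k) \<le> C * wt k" by (auto simp: wbdd_def)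
  have "C \<ge> 0" using C[of 0] norm_ge_zero[of "g 0"] by (simp del: norm_ge_zero)
  have "norm (g (j + l)) \<le> (C * wt j) * wt l" for j l
    using C[of "j + l"] mult_left_mono[OF wt_add[of j l] \<open>C \<ge> 0\<close>] by (simp add: mult_ac)
  from norm_pairing[OF this, of y] show ?thesis unfolding wbdd_def
    by (intro exI[of _ "C * norm y"]) (simp add: mult_ac)
qed

lemma pairing_add: "wbdd g \<Longrightarrow> pairing (x + y) g = pairing x g + pairing y g"
  unfolding pairing_def by (simp add: scaleR_add_left infsum_add pairing_summable)

lemma pairing_scaleR: "pairing (c *\<^sub>R x) g = c *\<^sub>R pairing x g"
  unfolding pairing_def by (simp add: infsum_scaleR_right flip: scaleR_scaleR)

lemma pairing_scaleR_right: "pairing x (\<lambda>k. c *\<^sub>R g k) = c *\<^sub>R pairing x g"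
  unfolding pairing_def by (simp add: mult.commute flip: infsum_scaleR_right)

lemma pairing_add_right: "wbdd g \<Longrightarrow> wbdd h \<Longrightarrow> pairing x (\<lambda>k. g k + h k) = pairing x g + pairing x h"
  unfolding pairing_def by (simp add: scaleR_add_right infsum_add pairing_summable)

instantiation wiener :: times
begin
lift_definition times_wiener :: "wiener \<Rightarrow> wiener \<Rightarrow> wiener" is conv
  by (rule wsummable_conv)
instance ..
end

lemma pairing_times:
  "wbdd g \<Longrightarrow> pairing (x * y) g = pairing x (\<lambda>j. pairing y (\<lambda>l. g (j + l)))"
  unfolding wbdd_def pairing_def times_wiener.rep_eq using conv_pairing[of "coef x" "coef y" g] by auto

text \<open>Unit vectors are admissible test sequences, so pairings separate points. Associativity,
  commutativity and distributivity become rearrangements of iterated pairings.\<close>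

lemma wiener_eq_pairing: "(\<And>g::int \<Rightarrow> real. wbdd g \<Longrightarrow> pairing x g = pairing y g) \<Longrightarrow> x = y"
  by (rule wiener_eqI) (metis pairing_unit_vec wbdd_unit_vec)

lift_definition wsingle :: "int \<Rightarrow> wiener" is "\<lambda>j k. if k = j then 1 else 0" by simp

lemma pairing_wsingle [simp]: "pairing (wsingle j) g = g j"
proof -
  have "((\<lambda>k. coef (wsingle j) k *\<^sub>R g k) has_sum (g j)) UNIV"
    by (rule has_sum_finite_neutralI[where B = "{j}"]) (auto simp: wsingle.rep_eq)
  then show ?thesis unfolding pairing_def by (rule infsumI)
qed

lemma norm_wsingle [simp]: "norm (wsingle j) = wt j"
  by transfer simp

text \<open>Fubini for the absolutely summable family coef x j * coef y l * g (j + l); this is the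
  content of commutativity.\<close>

lemma pairing_swap:
  assumes "wbdd g"
  shows "pairing x (\<lambda>j. pairing y (\<lambda>l. g (j + l))) = pairing y (\<lambda>l. pairing x (\<lambda>j. g (j + l)))"
proof -
  obtain C where C: "\<And>k. norm (g k) \<le> C * wt k" using assms by (auto simp: wbdd_def)
  have "C \<ge> 0" using C[of 0] norm_ge_zero[of "g 0"] by (simp del: norm_ge_zero)
  have C2: "norm (g (j + l)) \<le> (C * wt j) * wt l" for j l
    using C[of "j + l"] mult_left_mono[OF wt_add[of j l] \<open>C \<ge> 0\<close>] by (simp add: mult_ac)
  have s: "(\<lambda>(j, l). (\<bar>coef x j\<bar> * wt j) * (\<bar>coef y l\<bar> * wt l)) summable_on UNIV \<times> UNIV"
  proof (rule summable_on_SigmaI)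
    show "((\<lambda>l. (case (j, l) of (j, l) \<Rightarrow> (\<bar>coef x j\<bar> * wt j) * (\<bar>coef y l\<bar> * wt l)))
        has_sum (\<bar>coef x j\<bar> * wt j) * wnorm (coef y)) UNIV" for j
      using coef_wsummable[of y] unfolding wsummable_def wnorm_def prod.case
      by (intro has_sum_cmult_right has_sum_infsum)
    show "(\<lambda>j. (\<bar>coef x j\<bar> * wt j) * wnorm (coef y)) summable_on UNIV"
      using coef_wsummable[of x] unfolding wsummable_def by (rule summable_on_cmult_left)
  qed (auto simp: wt_pos less_imp_le)
  have "(\<lambda>(j, l). coef x j *\<^sub>R coef y l *\<^sub>R g (j + l)) abs_summable_on UNIV \<times> UNIV"
  proof (rule summable_on_comparison_test[OF summable_on_cmult_right[OF s, of C]])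
    fix p :: "int \<times> int"
    obtain j l where "p = (j, l)" by force
    then show "norm (case p of (j, l) \<Rightarrow> coef x j *\<^sub>R coef y l *\<^sub>R g (j + l))
       \<le> C * (case p of (j, l) \<Rightarrow> (\<bar>coef x j\<bar> * wt j) * (\<bar>coef y l\<bar> * wt l))"
      using mult_left_mono[OF C2[of j l], of "\<bar>coef x j\<bar> * \<bar>coef y l\<bar>"] by (simp add: mult_ac abs_mult)
  qed auto
  then have "(\<lambda>(j, l). coef x j *\<^sub>R coef y l *\<^sub>R g (j + l)) summable_on UNIV \<times> UNIV"
    by (rule abs_summable_summable)
  note sw = infsum_swap_banach[OF this]
  have "coef y l *\<^sub>R coef x j *\<^sub>R g (j + l) = coef x j *\<^sub>R coef y l *\<^sub>R g (j + l)" for j l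
    by (rule scaleR_left_commute)
  then show ?thesis unfolding pairing_def infsum_scaleR_right[symmetric]
    using sw by (simp only:)
qed

instantiation wiener :: "{comm_ring_1, real_normed_algebra_1}"
begin

definition one_wiener :: wiener where "one_wiener = wsingle 0"

instance
proof
  fix x y z :: wiener and a :: real
  show "x * y * z = x * (y * z)"
    by (rule wiener_eq_pairing) (simp add: pairing_times wbdd_shift wbdd_pairing_shift add.assoc)
  show "x * y = y * x"
  proof (rule wiener_eq_pairing)
    fix g :: "int \<Rightarrow> real" assume "wbdd g"
    then show "pairing (x * y) g = pairing (y * x) g"
      by (simp add: pairing_times pairing_swap[of g x y]) (simp add: add.commute)
  qed
  show "x * 1 = x"
    by (rule wiener_eq_pairing) (simp add: pairing_times one_wiener_def)
  show "1 * x = x"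
    by (rule wiener_eq_pairing) (simp add: pairing_times one_wiener_def)
  show "(x + y) * z = x * z + y * z"
    by (rule wiener_eq_pairing) (simp add: pairing_times pairing_add wbdd_pairing_shift)
  have d: "x * (y + z) = x * y + x * z" for x y z :: wiener
    by (rule wiener_eq_pairing)
      (simp add: pairing_times pairing_add wbdd_pairing_shift wbdd_shift pairing_add_right)
  then show "x * (y + z) = x * y + x * z" .
  show "a *\<^sub>R x * y = a *\<^sub>R (x * y)"
    by (rule wiener_eq_pairing) (simp add: pairing_times pairing_scaleR)
  show "x * a *\<^sub>R y = a *\<^sub>R (x * y)"
  proof (rule wiener_eq_pairing)
    fix g :: "int \<Rightarrow> real" assume "wbdd g"
    then show "pairing (x * a *\<^sub>R y) g = pairing (a *\<^sub>R (x * y)) g"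
      using pairing_scaleR_right[of x a "\<lambda>j. pairing y (\<lambda>l. g (j + l))"]
      by (simp add: pairing_times pairing_scaleR)
  qed
  show "(0::wiener) \<noteq> 1"
  proof
    assume "(0::wiener) = 1"
    then have "coef 0 0 = coef (wsingle 0) 0" by (simp only: one_wiener_def)
    then show False by (simp add: wsingle.rep_eq)
  qed
  show "norm (x * y) \<le> norm x * norm y" by transfer (rule wsummable_conv)
  show "norm (1::wiener) = 1" by (simp add: one_wiener_def)
qed

end

section \<open>The boundary equation and its solution\<close>

lemma pairing_bounded_linear: "wbdd g \<Longrightarrow> bounded_linear (\<lambda>x. pairing x g)"
proof -
  assume g: "wbdd g"
  then obtain C where "\<And>k. norm (g k) \<le> C * wt k" by (auto simp: wbdd_def)
  then have "norm (pairing x g) \<le> norm x * C" for x using norm_pairing[of g C x] by (simp add: mult.commute)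
  then show ?thesis using g by (intro bounded_linear_intro[of _ C]) (auto simp: pairing_add pairing_scaleR)
qed

text \<open>A continuous multiplicative map may be applied to the exponential series term by term.
  It serves twice: for the index reversal and for evaluation at a boundary point.\<close>

lemma exp_homomorphism:
  fixes h :: "'a::{real_normed_algebra_1,banach} \<Rightarrow> 'b::{real_normed_algebra_1,banach}"
  assumes "bounded_linear h" "\<And>x y. h (x * y) = h x * h y" "h 1 = 1"
  shows "h (exp x) = exp (h x)"
proof -
  interpret bounded_linear h by fact
  have "h (x ^ n) = h x ^ n" for n by (induction n) (simp_all add: assms)
  moreover have "(\<lambda>n. h (x ^ n /\<^sub>R fact n)) sums h (exp x)"
    by (rule sums[OF exp_converges])
  ultimately have "(\<lambda>n. h x ^ n /\<^sub>R fact n) sums h (exp x)" by (simp add: scaleR)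
  then show ?thesis using exp_converges sums_unique2 by blast
qed

text \<open>In the unit ball y ^ m - z ^ m has norm at most m * norm (y - z), and the series of m /
  m! sums to e.\<close>

lemma norm_exp_diff:
  fixes y z :: "'a::{real_normed_algebra_1, comm_ring_1, banach}"
  assumes "norm y \<le> 1" "norm z \<le> 1"
  shows "norm (exp y - exp z) \<le> exp 1 * norm (y - z)"
proof -
  have "(\<lambda>n. 1 /\<^sub>R fact n) sums exp (1::real)" using exp_converges[of "1::real"] by simp
  then have "(\<lambda>n. (\<lambda>m. real m / fact m) (Suc n)) sums exp (1::real)"
    by (simp add: field_simps del: of_nat_Suc)
  then have "(\<lambda>m. real m / fact m) sums exp 1" by (subst (asm) sums_Suc_iff) simp
  then have S: "(\<lambda>m. real m / fact m * norm (y - z)) sums (exp 1 * norm (y - z))" by (rule sums_mult2)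
  have D: "(\<lambda>m. (y ^ m - z ^ m) /\<^sub>R fact m) sums (exp y - exp z)"
    using sums_diff[OF exp_converges[of y] exp_converges[of z]] by (simp add: scaleR_diff_right)
  have le: "norm ((y ^ m - z ^ m) /\<^sub>R fact m) \<le> real m / fact m * norm (y - z)" for m
    using norm_power_diff[OF assms, of m]
    by (simp add: divide_inverse mult.commute[of _ "inverse (fact m)"] mult.assoc mult_left_mono)
  have "norm (\<Sum>m. (y ^ m - z ^ m) /\<^sub>R fact m) \<le> (\<Sum>m. real m / fact m * norm (y - z))"
    using S le by (intro norm_suminf_le) (auto simp: sums_iff)
  then show ?thesis using S D by (simp add: sums_iff)
qed

text \<open>The substitution u -> -u on Fourier series. A sequence fixed by it is a cosine series,
  which is what allows a sine series built from the positive indices alone to reproduce the boundary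
  data.\<close>

lift_definition wreflect :: "wiener \<Rightarrow> wiener" is "\<lambda>x k. x (- k)"
  unfolding wsummable_def
  using summable_on_reindex_bij_betw[of uminus UNIV UNIV "\<lambda>k. \<bar>_ k\<bar> * wt k"] by (simp add: bij_uminus)

lemma norm_wreflect [simp]: "norm (wreflect x) = norm x"
  by transfer
    (use infsum_reindex_bij_betw[of uminus UNIV UNIV "\<lambda>k. \<bar>_ k\<bar> * wt k"] in \<open>simp add: wnorm_def bij_uminus\<close>)

lemma pairing_wreflect: "pairing (wreflect x) g = pairing x (\<lambda>k. g (- k))"
  unfolding pairing_def wreflect.rep_eq
  using infsum_reindex_bij_betw[of uminus UNIV UNIV "\<lambda>k. coef x k *\<^sub>R g (- k)"] by (simp add: bij_uminus)

lemma wbdd_uminus: "wbdd g \<Longrightarrow> wbdd (\<lambda>k. g (- k))"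
  unfolding wbdd_def by (metis wt_uminus)

lemma wreflect_times: "wreflect (x * y) = wreflect x * wreflect y"
  by (rule wiener_eq_pairing) (simp add: pairing_wreflect pairing_times wbdd_uminus add.commute)

lemma wreflect_simps [simp]:
  "wreflect (x + y) = wreflect x + wreflect y" "wreflect (- x) = - wreflect x"
  "wreflect (c *\<^sub>R x) = c *\<^sub>R wreflect x" "wreflect (wsingle j) = wsingle (- j)"
  by (auto intro!: wiener_eqI simp: wreflect.rep_eq wsingle.rep_eq)

lemma wreflect_exp [simp]: "wreflect (exp x) = exp (wreflect x)"
  by (rule exp_homomorphism)
    (auto simp: wreflect_times one_wiener_def intro!: bounded_linear_intro[of _ 1])

section \<open>Hyperbolic multipliers with bounds uniform in the frequency\<close>

lemma le_sinh_real: "0 \<le> x \<Longrightarrow> x \<le> sinh (x::real)"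
proof -
  assume "0 \<le> x"
  have "sinh 0 - 0 \<le> sinh x - x"
  proof (rule DERIV_nonneg_imp_nondecreasing[OF \<open>0 \<le> x\<close>])
    fix t :: real
    show "\<exists>y. ((\<lambda>t. sinh t - t) has_real_derivative y) (at t) \<and> 0 \<le> y"
      by (intro exI[of _ "cosh t - 1"] conjI) (auto intro!: derivative_eq_intros simp: cosh_real_ge_1)
  qed
  then show ?thesis by simp
qed

text \<open>sinh x \<ge> 3/4 gives 1 \<le> 3 * sinh x ^ 2, and cosh x ^ 2 = 1 + sinh x ^ 2.\<close>

lemma cosh_le_2_sinh: "3/4 \<le> x \<Longrightarrow> cosh (x::real) \<le> 2 * sinh x"
proof -
  assume x: "3/4 \<le> x"
  have s: "3/4 \<le> sinh x" using le_sinh_real[of x] x by linarith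
  have "cosh x ^ 2 \<le> (2 * sinh x) ^ 2"
    using power_mono[OF s, of 2] by (simp add: cosh_square_eq power_mult_distrib power_divide)
  then show ?thesis by (rule power2_le_imp_le) (use x in simp)
qed

text \<open>The cut-off at \<open>3/4\<close> keeps the multiplier bounded for all \<open>\<rho>\<close>; it is inactive when \<open>\<bar>\<rho> - 1\<bar> \<le> 1/20\<close>.\<close>

definition coth_mult :: "real \<Rightarrow> int \<Rightarrow> real" where
  "coth_mult \<rho> k = (if k = 0 then 0 else cosh (of_int k * max (3/4) \<rho>) / sinh (of_int k * max (3/4) \<rho>))"

lemma coth_mult_uminus: "coth_mult \<rho> (- k) = - coth_mult \<rho> k"
  by (simp add: coth_mult_def)

lemma coth_mult_le_pos: "0 < k \<Longrightarrow> \<bar>coth_mult \<rho> k\<bar> \<le> 2"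
proof -
  assume k: "0 < k"
  have "3/4 \<le> of_int k * max (3/4) \<rho>"
    using mult_mono[of 1 "real_of_int k" "3/4" "max (3/4) \<rho>"] k by simp
  moreover from this have "0 < sinh (of_int k * max (3/4) \<rho>)" by simp
  ultimately show ?thesis using k cosh_le_2_sinh[of "of_int k * max (3/4) \<rho>"]
    by (simp add: coth_mult_def divide_le_eq)
qed

lemma coth_mult_le: "\<bar>coth_mult \<rho> k\<bar> \<le> 2"
  using coth_mult_le_pos[of k \<rho>] coth_mult_le_pos[of "-k" \<rho>] coth_mult_uminus[of \<rho> k]
  by (cases k "0::int" rule: linorder_cases) (auto simp: coth_mult_def)

lemma DERIV_coth_scaled:
  assumes "0 < k * t" shows "((\<lambda>t. cosh (k * t) / sinh (k * t)) has_real_derivative - k / sinh (k * t) ^ 2) (at t)"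
proof -
  have "sinh (k * t) \<noteq> 0" using assms by (metis less_irrefl sinh_real_zero_iff)
  moreover from this have "((k * sinh (k * t)) * sinh (k * t) - cosh (k * t) * (k * cosh (k * t))) / sinh (k * t) ^ 2
      = - k / sinh (k * t) ^ 2"
    using cosh_square_eq[of "k * t"] by (simp add: power2_eq_square algebra_simps divide_simps)
  ultimately show ?thesis
    by (auto intro!: derivative_eq_intros simp: power2_eq_square mult_ac)
qed

text \<open>The derivative in t has size k / sinh (k t) ^ 2. Since sinh (k t) \<ge> 3 k / 4, this is
  at most 16 / (9 k), so one constant works for all frequencies.\<close>

lemma coth_mult_lipschitz:
  assumes "3/4 \<le> \<rho>" "3/4 \<le> \<rho>'"
  shows "\<bar>coth_mult \<rho> k - coth_mult \<rho>' k\<bar> \<le> 2 * \<bar>\<rho> - \<rho>'\<bar>"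
proof -
  have pos: "\<bar>coth_mult \<rho> k - coth_mult \<rho>' k\<bar> \<le> 2 * \<bar>\<rho> - \<rho>'\<bar>" if k: "0 < k" for k
  proof -
    have "norm ((\<lambda>t. cosh (of_int k * t) / sinh (of_int k * t)) \<rho> - (\<lambda>t. cosh (of_int k * t) / sinh (of_int k * t)) \<rho>')
       \<le> 2 * norm (\<rho> - \<rho>')"
    proof (rule field_differentiable_bound[where S = "{3/4..}" and f' = "\<lambda>t. - of_int k / sinh (of_int k * t) ^ 2"])
      fix t :: real assume "t \<in> {3/4..}"
      then have t: "3/4 \<le> t" by simp
      have kt: "3/4 * of_int k \<le> of_int k * t" "0 < of_int k * t" using t k by auto
      show "((\<lambda>t. cosh (of_int k * t) / sinh (of_int k * t)) has_field_derivative - of_int k / sinh (of_int k * t) ^ 2)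
        (at t within {3/4..})"
        using DERIV_coth_scaled[OF kt(2)] by (rule has_field_derivative_at_within)
      have "3/4 * of_int k \<le> sinh (of_int k * t)" using le_sinh_real[of "of_int k * t"] kt by linarith
      then have "(3/4 * of_int k) ^ 2 \<le> sinh (of_int k * t) ^ 2" using k by (intro power_mono) auto
      moreover have "of_int k \<le> 2 * (3/4 * real_of_int k) ^ 2"
        using k mult_mono[of 1 "real_of_int k" 1 "real_of_int k"] mult_left_mono[of 1 "real_of_int k" "real_of_int k"]
        by (simp add: power2_eq_square)
      ultimately have "of_int k \<le> 2 * sinh (of_int k * t) ^ 2" by linarith
      then show "norm (- of_int k / sinh (of_int k * t) ^ 2) \<le> 2"
        using kt k by (simp add: divide_le_eq)
    qed (use assms in auto)
    then show ?thesis using k assms by (simp add: coth_mult_def max_def)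
  qed
  consider "k = 0" | "0 < k" | "0 < - k" by linarith
  then show ?thesis
  proof cases
    case 3
    from pos[OF this] show ?thesis unfolding coth_mult_uminus by linarith
  qed (use pos in \<open>auto simp: coth_mult_def\<close>)
qed

text \<open>In the derivative k cosh / sinh ^ 2 both k \<le> 4/3 * sinh and cosh \<le> 2 * sinh
  hold, which gives 8/3.\<close>

lemma csch_lipschitz:
  assumes "3/4 \<le> \<rho>" "3/4 \<le> \<rho>'" "0 < (k::nat)"
  shows "\<bar>1 / sinh (real k * \<rho>) - 1 / sinh (real k * \<rho>')\<bar> \<le> 3 * \<bar>\<rho> - \<rho>'\<bar>"
proof -
  have "norm ((\<lambda>t. 1 / sinh (real k * t)) \<rho> - (\<lambda>t. 1 / sinh (real k * t)) \<rho>') \<le> 3 * norm (\<rho> - \<rho>')"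
  proof (rule field_differentiable_bound[where S = "{3/4..}" and f' = "\<lambda>t. - (real k * cosh (real k * t)) / sinh (real k * t) ^ 2"])
    fix t :: real assume "t \<in> {3/4..}"
    then have t: "3/4 \<le> t" by simp
    have kt: "3/4 * real k \<le> real k * t" "0 < real k * t" "3/4 \<le> real k * t"
      using t assms(3) mult_mono[of 1 "real k" "3/4" t] by auto
    have s: "3/4 * real k \<le> sinh (real k * t)" using le_sinh_real[of "real k * t"] kt by linarith
    have s0: "0 < sinh (real k * t)" using kt by simp
    then show "((\<lambda>t. 1 / sinh (real k * t)) has_field_derivative - (real k * cosh (real k * t)) / sinh (real k * t) ^ 2) (at t within {3/4..})"
      by (auto intro!: derivative_eq_intros simp: power2_eq_square mult_ac)
    have "real k * cosh (real k * t) \<le> (4/3 * sinh (real k * t)) * (2 * sinh (real k * t))"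
      using s s0 cosh_le_2_sinh[OF kt(3)] by (intro mult_mono) auto
    also have "\<dots> \<le> 3 * sinh (real k * t) ^ 2" by (simp add: power2_eq_square)
    finally show "norm (- (real k * cosh (real k * t)) / sinh (real k * t) ^ 2) \<le> 3"
      using s0 by (simp add: divide_le_eq abs_mult)
  qed (use assms in auto)
  then show ?thesis by simp
qed

lift_definition cothm :: "real \<Rightarrow> wiener \<Rightarrow> wiener" is "\<lambda>\<rho> x k. coth_mult \<rho> k * x k"
proof -
  fix \<rho> x assume x: "wsummable x"
  show "wsummable (\<lambda>k. coth_mult \<rho> k * x k)"
    using x unfolding wsummable_def
    by (rule summable_on_comparison_test[OF summable_on_cmult_right[where c = 2]])
      (use mult_right_mono[OF coth_mult_le] wt_pos in \<open>auto simp: abs_mult less_imp_le mult.assoc\<close>)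
qed

lemma norm_multiplier_le:
  assumes "\<And>k. \<bar>coef y k\<bar> \<le> C * \<bar>coef x k\<bar>" "0 \<le> C"
  shows "norm y \<le> C * norm x"
proof (rule norm_wiener_le)
  fix A :: "int set" assume A: "finite A"
  have "(\<Sum>k\<in>A. \<bar>coef y k\<bar> * wt k) \<le> (\<Sum>k\<in>A. C * (\<bar>coef x k\<bar> * wt k))"
    using assms(1) wt_pos by (intro sum_mono) (simp add: mult.assoc[symmetric] less_imp_le mult_right_mono)
  also have "\<dots> \<le> C * norm x"
    using wsummable_bound[of "coef x" A] A assms(2)
    by (simp add: norm_wiener.rep_eq mult_left_mono flip: sum_distrib_left)
  finally show "(\<Sum>k\<in>A. \<bar>coef y k\<bar> * wt k) \<le> C * norm x" .
qed

lemma norm_cothm: "norm (cothm \<rho> x) \<le> 2 * norm x"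
  by (rule norm_multiplier_le) (auto simp: cothm.rep_eq abs_mult mult_right_mono coth_mult_le)

lemma cothm_diff: "cothm \<rho> (x - y) = cothm \<rho> x - cothm \<rho> y"
  by (rule wiener_eqI) (simp add: cothm.rep_eq algebra_simps)

lemma norm_cothm_diff:
  assumes "3/4 \<le> \<rho>" "3/4 \<le> \<rho>'"
  shows "norm (cothm \<rho> x - cothm \<rho>' x) \<le> 2 * \<bar>\<rho> - \<rho>'\<bar> * norm x"
  by (rule norm_multiplier_le)
    (use coth_mult_lipschitz[OF assms] in
      \<open>auto simp: cothm.rep_eq abs_mult mult_right_mono simp flip: left_diff_distrib\<close>)

lemma wreflect_cothm: "wreflect (cothm \<rho> x) = - cothm \<rho> (wreflect x)"
  by (rule wiener_eqI) (simp add: wreflect.rep_eq cothm.rep_eq coth_mult_uminus)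

text \<open>
  If \<open>x\<close> is the trace of \<open>Im F - 1\<close> on \<open>Im w = \<rho>\<close>, then \<open>\<rho> = 1 + x\<^sub>0\<close> and \<open>cothm \<rho> x\<close> is the trace of
  \<open>\<i> (Re F - Re w)\<close>, so that the boundary condition reads \<open>channel_op n a \<epsilon> x = x\<close>.
\<close>

definition channel_op :: "nat \<Rightarrow> real \<Rightarrow> real \<Rightarrow> wiener \<Rightarrow> wiener" where
  "channel_op n a \<epsilon> x = (let y = cothm (1 + coef x 0) x in
     (\<epsilon> / 2) *\<^sub>R (wsingle 1 * exp y + wsingle (-1) * exp (- y)
       + a *\<^sub>R (wsingle (int n) * exp (real n *\<^sub>R y) + wsingle (- int n) * exp (- (real n *\<^sub>R y)))))"

text \<open>Fourier coefficients of cos u + a cos (n u), the first-order profile of the upper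
  boundary.\<close>

definition channel_lin :: "nat \<Rightarrow> real \<Rightarrow> wiener" where
  "channel_lin n a = (1/2) *\<^sub>R (wsingle 1 + wsingle (-1) + a *\<^sub>R (wsingle (int n) + wsingle (- int n)))"

lemma wsingle_exp_diff:
  fixes y z :: wiener
  assumes "norm y \<le> 1" "norm z \<le> 1"
  shows "norm (wsingle j * exp y - wsingle j * exp z) \<le> wt j * (exp 1 * norm (y - z))"
proof -
  have "norm (wsingle j * exp y - wsingle j * exp z) = norm (wsingle j * (exp y - exp z))"
    by (simp add: right_diff_distrib)
  also have "\<dots> \<le> wt j * norm (exp y - exp z)"
    using norm_mult_ineq[of "wsingle j"] by simp
  also have "\<dots> \<le> wt j * (exp 1 * norm (y - z))"
    using norm_exp_diff[OF assms] wt_pos[of j] by (intro mult_left_mono) auto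
  finally show ?thesis .
qed

text \<open>The radius 1 / (10 n) keeps n times the norm of \<open>y\<close> below 1, so all
  exponentials are compared inside the unit ball. The factor 3 arises because the multiplier itself
  depends on \<open>x\<close> through \<rho>: 2 comes from the change of its argument and 1 from the
  change of \<rho>. The norm of \<open>wsingle (int n)\<close> contributes 2 ^ n, the exponent n
  contributes n.\<close>

lemma channel_op_lipschitz:
  assumes n: "2 \<le> n" and x: "norm x \<le> 1 / (10 * real n)" and x': "norm x' \<le> 1 / (10 * real n)"
  shows "norm (channel_op n a \<epsilon> x - channel_op n a \<epsilon> x') \<le> \<bar>\<epsilon>\<bar> * (3 * exp 1 * (2 + \<bar>a\<bar> * 2 ^ n * real n)) * norm (x - x')"
proof -
  define y where "y = cothm (1 + coef x 0) x"
  define y' where "y' = cothm (1 + coef x' 0) x'"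
  have "1 / (10 * real n) \<le> 1 / 20" using n by (simp add: field_simps)
  then have small: "norm x \<le> 1/20" "norm x' \<le> 1/20" using x x' by linarith+
  have \<rho>: "3/4 \<le> 1 + coef x 0" "3/4 \<le> 1 + coef x' 0"
    using coef_le[of x 0] coef_le[of x' 0] small by linarith+
  have "y - y' = cothm (1 + coef x 0) (x - x') + (cothm (1 + coef x 0) x' - cothm (1 + coef x' 0) x')"
    by (simp add: y_def y'_def cothm_diff)
  then have "norm (y - y') \<le> 2 * norm (x - x') + 2 * \<bar>coef (x - x') 0\<bar> * norm x'"
    using norm_triangle_ineq[of "cothm (1 + coef x 0) (x - x')" "cothm (1 + coef x 0) x' - cothm (1 + coef x' 0) x'"]
      norm_cothm[of "1 + coef x 0" "x - x'"] norm_cothm_diff[OF \<rho>, of x'] by simp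
  moreover have "\<bar>coef (x - x') 0\<bar> * norm x' \<le> norm (x - x') * (1/2)"
    using small(2) coef_le[of "x - x'" 0] by (intro mult_mono) auto
  ultimately have yy: "norm (y - y') \<le> 3 * norm (x - x')" by linarith
  have ny: "real n * norm y \<le> 1" "real n * norm y' \<le> 1"
    using norm_cothm[of "1 + coef x 0" x] norm_cothm[of "1 + coef x' 0" x'] x x' n
      mult_left_mono[of "norm y" "2 * (1 / (10 * real n))" "real n"]
      mult_left_mono[of "norm y'" "2 * (1 / (10 * real n))" "real n"]
    by (auto simp: y_def y'_def)
  have ny1: "norm y \<le> 1" "norm y' \<le> 1"
    using ny n mult_right_mono[of 1 "real n" "norm y"] mult_right_mono[of 1 "real n" "norm y'"] by auto
  define E where "E = exp 1 * norm (y - y')"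
  have d: "norm (wsingle 1 * exp y - wsingle 1 * exp y') \<le> 2 * E"
    "norm (wsingle (-1) * exp (-y) - wsingle (-1) * exp (-y')) \<le> 2 * E"
    "norm (wsingle (int n) * exp (real n *\<^sub>R y) - wsingle (int n) * exp (real n *\<^sub>R y')) \<le> 2 ^ n * (real n * E)"
    "norm (wsingle (- int n) * exp (-(real n *\<^sub>R y)) - wsingle (- int n) * exp (-(real n *\<^sub>R y'))) \<le> 2 ^ n * (real n * E)"
    using wsingle_exp_diff[of y y' 1] wsingle_exp_diff[of "-y" "-y'" "-1"]
      wsingle_exp_diff[of "real n *\<^sub>R y" "real n *\<^sub>R y'" "int n"]
      wsingle_exp_diff[of "-(real n *\<^sub>R y)" "-(real n *\<^sub>R y')" "- int n"] ny ny1
    by (simp_all add: E_def wt_def norm_minus_commute mult_ac flip: scaleR_diff_right)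
  have "channel_op n a \<epsilon> x - channel_op n a \<epsilon> x' = (\<epsilon> / 2) *\<^sub>R
      ((wsingle 1 * exp y - wsingle 1 * exp y') + (wsingle (-1) * exp (-y) - wsingle (-1) * exp (-y'))
      + a *\<^sub>R ((wsingle (int n) * exp (real n *\<^sub>R y) - wsingle (int n) * exp (real n *\<^sub>R y'))
       + (wsingle (- int n) * exp (-(real n *\<^sub>R y)) - wsingle (- int n) * exp (-(real n *\<^sub>R y')))))"
    by (simp add: channel_op_def Let_def y_def y'_def algebra_simps)
  also have "norm \<dots> \<le> (\<bar>\<epsilon>\<bar> / 2) * ((2 * E + 2 * E) + \<bar>a\<bar> * (2 ^ n * (real n * E) + 2 ^ n * (real n * E)))"
    unfolding norm_scaleR abs_divide
    by (intro mult_mono order_trans[OF norm_triangle_ineq] add_mono d order_refl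
          order_trans[OF eq_refl[OF norm_scaleR]]) auto
  also have "\<dots> = \<bar>\<epsilon>\<bar> * (2 + \<bar>a\<bar> * 2 ^ n * real n) * E" by (simp add: algebra_simps)
  also have "\<dots> \<le> \<bar>\<epsilon>\<bar> * (2 + \<bar>a\<bar> * 2 ^ n * real n) * (exp 1 * (3 * norm (x - x')))"
    unfolding E_def using yy by (intro mult_left_mono) auto
  also have "\<dots> = \<bar>\<epsilon>\<bar> * (3 * exp 1 * (2 + \<bar>a\<bar> * 2 ^ n * real n)) * norm (x - x')"
    by (simp only: mult_ac)
  finally show ?thesis .
qed

lemma cothm_0 [simp]: "cothm \<rho> 0 = 0"
  by (rule wiener_eqI) (simp add: cothm.rep_eq)

lemma channel_op_0: "channel_op n a \<epsilon> 0 = \<epsilon> *\<^sub>R channel_lin n a"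
  by (simp add: channel_op_def channel_lin_def)

lemma norm_channel_lin: "norm (channel_lin n a) \<le> 2 + \<bar>a\<bar> * 2 ^ n"
proof -
  have "norm (wsingle 1 + wsingle (-1) + a *\<^sub>R (wsingle (int n) + wsingle (- int n))) \<le> (2 + 2) + \<bar>a\<bar> * (2 ^ n + 2 ^ n)"
    by (intro order_trans[OF norm_triangle_ineq] add_mono order_trans[OF eq_refl[OF norm_scaleR]] mult_left_mono)
      (simp_all add: wt_def)
  then show ?thesis unfolding channel_lin_def norm_scaleR by simp
qed

lemma wreflect_channel_op: "wreflect (channel_op n a \<epsilon> x) = channel_op n a \<epsilon> (wreflect x)"
  by (simp add: channel_op_def Let_def wreflect_times wreflect_cothm wreflect.rep_eq algebra_simps)

text \<open>For small \<epsilon> the operator contracts a fixed ball by 1/2. The quadratic remainder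
  costs nothing extra: the fixed point minus \<epsilon> times the linear profile is the difference
  of the operator at \<open>x\<close> and at 0, hence of size \<bar>\<epsilon>\<bar> times the norm
  of \<open>x\<close>.\<close>

lemma channel_op_fixed_point:
  assumes n: "2 \<le> n"
  shows "\<exists>\<epsilon>1>0. \<exists>C\<ge>0. \<forall>\<epsilon>. \<bar>\<epsilon>\<bar> < \<epsilon>1 \<longrightarrow> (\<exists>x. channel_op n a \<epsilon> x = x \<and> wreflect x = x \<and>
    norm x \<le> 1/20 \<and> norm x \<le> C * \<bar>\<epsilon>\<bar> \<and> norm (x - \<epsilon> *\<^sub>R channel_lin n a) \<le> C * \<epsilon>\<^sup>2)"
proof -
  define B where "B = 3 * exp 1 * (2 + \<bar>a\<bar> * 2 ^ n * real n)"
  define A where "A = 2 + \<bar>a\<bar> * 2 ^ n"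
  define r where "r = 1 / (10 * real n)"
  have pos: "0 < B" "0 < A" "0 < r" using n
    by (auto simp: B_def A_def r_def intro!: mult_pos_pos add_pos_nonneg)
  define \<epsilon>1 where "\<epsilon>1 = min (1 / (2 * B)) (r / (2 * A))"
  have \<epsilon>1: "0 < \<epsilon>1" using pos by (simp add: \<epsilon>1_def)
  \<comment> \<open>2 A controls the fixed point to first order, 2 A B its distance from the linear
    profile.\<close>
  define C where "C = 2 * A * B + 2 * A"
  have C: "0 \<le> C" "2 * A \<le> C" "2 * A * B \<le> C" using pos by (auto simp: C_def)
  have "\<exists>x. channel_op n a \<epsilon> x = x \<and> wreflect x = x \<and>
    norm x \<le> 1/20 \<and> norm x \<le> C * \<bar>\<epsilon>\<bar> \<and> norm (x - \<epsilon> *\<^sub>R channel_lin n a) \<le> C * \<epsilon>\<^sup>2" if \<epsilon>: "\<bar>\<epsilon>\<bar> < \<epsilon>1" for \<epsilon>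
  proof -
    have eB: "\<bar>\<epsilon>\<bar> * B \<le> 1/2" and eA: "\<bar>\<epsilon>\<bar> * A \<le> r / 2"
      using \<epsilon> pos by (auto simp: \<epsilon>1_def field_simps)
    have lip: "norm (channel_op n a \<epsilon> x - channel_op n a \<epsilon> x') \<le> \<bar>\<epsilon>\<bar> * B * norm (x - x')"
      if "norm x \<le> r" "norm x' \<le> r" for x x'
      using channel_op_lipschitz[OF n, of x x' a \<epsilon>] that unfolding B_def r_def by simp
    have lip2: "norm (channel_op n a \<epsilon> x - channel_op n a \<epsilon> x') \<le> 1/2 * norm (x - x')"
      if "norm x \<le> r" "norm x' \<le> r" for x x'
      using lip[OF that] mult_right_mono[OF eB, of "norm (x - x')"] by simp
    have T0: "norm (channel_op n a \<epsilon> 0) \<le> \<bar>\<epsilon>\<bar> * A"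
      using norm_channel_lin[of n a] by (simp add: channel_op_0 A_def mult_left_mono)
    have bound: "norm (channel_op n a \<epsilon> x) \<le> \<bar>\<epsilon>\<bar> * A + 1/2 * norm x" if "norm x \<le> r" for x
      using lip2[OF that, of 0] T0 pos norm_triangle_sub[of "channel_op n a \<epsilon> x" "channel_op n a \<epsilon> 0"] by simp
    have "\<exists>!x. x \<in> cball 0 r \<and> channel_op n a \<epsilon> x = x"
    proof (rule Banach_fix)
      show "complete (cball (0::wiener) r)" by (simp add: complete_eq_closed)
      show "channel_op n a \<epsilon> ` cball 0 r \<subseteq> cball 0 r"
        using bound eA by (fastforce simp: dist_norm)
      show "\<And>x y. x \<in> cball 0 r \<Longrightarrow> y \<in> cball 0 r \<Longrightarrow> dist (channel_op n a \<epsilon> x) (channel_op n a \<epsilon> y) \<le> 1/2 * dist x y"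
        using lip2 by (auto simp: dist_norm)
    qed (use pos in auto)
    then obtain x where x: "norm x \<le> r" "channel_op n a \<epsilon> x = x"
      and uniq: "\<And>x'. norm x' \<le> r \<Longrightarrow> channel_op n a \<epsilon> x' = x' \<Longrightarrow> x' = x"
      by (elim ex1E) (metis mem_cball_0)
    \<comment> \<open>The reflected sequence is a fixed point in the same ball, so uniqueness
      supplies the symmetry.\<close>
    have "wreflect x = x" by (rule uniq) (simp_all add: x flip: wreflect_channel_op)
    moreover have "r \<le> 1/20" using n by (simp add: r_def field_simps)
    then have "norm x \<le> 1/20" using x(1) by linarith
    moreover have n2: "norm x \<le> 2 * A * \<bar>\<epsilon>\<bar>" using bound[OF x(1)] unfolding x(2) by (simp add: mult_ac)
    then have "norm x \<le> C * \<bar>\<epsilon>\<bar>" using mult_right_mono[OF C(2), of "\<bar>\<epsilon>\<bar>"] by simp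
    moreover have "norm (x - \<epsilon> *\<^sub>R channel_lin n a) \<le> C * \<epsilon>\<^sup>2"
    proof -
      have "norm (x - \<epsilon> *\<^sub>R channel_lin n a) \<le> \<bar>\<epsilon>\<bar> * B * norm x"
        using lip[of x 0] x pos by (simp add: channel_op_0)
      also have "\<dots> \<le> \<bar>\<epsilon>\<bar> * B * (2 * A * \<bar>\<epsilon>\<bar>)" using n2 pos by (intro mult_left_mono) auto
      also have "\<dots> = (2 * A * B) * \<epsilon>\<^sup>2" by (simp add: power2_eq_square)
      also have "\<dots> \<le> C * \<epsilon>\<^sup>2" using C by (intro mult_right_mono) auto
      finally show ?thesis .
    qed
    ultimately show ?thesis using x by blast
  qed
  then show ?thesis using \<epsilon>1 C by blast
qed

section \<open>Boundary values and their holomorphic extension\<close>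

lemma infsum_int_split:
  fixes f :: "int \<Rightarrow> 'a::banach"
  assumes "f summable_on UNIV"
  shows "(\<lambda>m. f (int (Suc m)) + f (- int (Suc m))) sums (infsum f UNIV - f 0)"
proof -
  have p: "inj (\<lambda>m. int (Suc m))" "inj (\<lambda>m. - int (Suc m))" by (auto simp: inj_def)
  define P where "P = range (\<lambda>m. int (Suc m))"
  define M where "M = range (\<lambda>m. - int (Suc m))"
  have U: "UNIV = {0} \<union> (P \<union> M)"
  proof -
    have "k \<in> {0} \<union> (P \<union> M)" for k
    proof (cases k "0::int" rule: linorder_cases)
      case less
      then have "k = - int (Suc (nat (- k - 1)))" by simp
      then show ?thesis unfolding M_def by blast
    next
      case greater
      then have "k = int (Suc (nat (k - 1)))" by simp
      then show ?thesis unfolding P_def by blast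
    qed simp
    then show ?thesis by blast
  qed
  have disj: "P \<inter> M = {}" "{0} \<inter> (P \<union> M) = {}" by (auto simp: P_def M_def)
  have s: "f summable_on P" "f summable_on M"
    using assms summable_on_subset_banach by blast+
  have sp: "(\<lambda>m. f (int (Suc m))) sums infsum f P"
    using s(1) has_sum_reindex[OF p(1), of f "infsum f P"]
    by (intro has_sum_imp_sums) (auto simp: P_def o_def)
  have sm: "(\<lambda>m. f (- int (Suc m))) sums infsum f M"
    using s(2) has_sum_reindex[OF p(2), of f "infsum f M"]
    by (intro has_sum_imp_sums) (auto simp: M_def o_def)
  have "infsum f UNIV = f 0 + (infsum f P + infsum f M)"
    unfolding U using infsum_Un_disjoint[OF _ _ disj(2), of f] infsum_Un_disjoint[OF s disj(1)]
      summable_on_Un_disjoint[OF s disj(1)] by simp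
  then show ?thesis using sums_add[OF sp sm] by simp
qed

text \<open>The value of the Fourier series at the real point u. It is a character of the algebra
  and thus commutes with \<open>exp\<close>, which turns the fixed point equation into a pointwise
  boundary condition.\<close>

definition wev :: "real \<Rightarrow> wiener \<Rightarrow> complex" where
  "wev u x = pairing x (\<lambda>k. cis (of_int k * u))"

lemma wbdd_cis: "wbdd (\<lambda>k. cis (of_int k * u))"
  unfolding wbdd_def by (intro exI[of _ 1]) (simp add: wt_ge_1)

lemma wev_bounded_linear: "bounded_linear (wev u)"
  unfolding wev_def[abs_def] by (rule pairing_bounded_linear[OF wbdd_cis])

lemma wev_wsingle [simp]: "wev u (wsingle j) = cis (of_int j * u)"
  by (simp add: wev_def)

lemma wev_times [simp]: "wev u (x * y) = wev u x * wev u y"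
proof -
  have "pairing y (\<lambda>l. cis (of_int (j + l) * u)) = cis (of_int j * u) * pairing y (\<lambda>l. cis (of_int l * u))" for j
    unfolding pairing_def
    by (simp add: distrib_right flip: cis_mult infsum_cmult_right')
  then show ?thesis
    unfolding wev_def pairing_times[OF wbdd_cis]
    unfolding pairing_def by (simp flip: infsum_cmult_left')
qed

lemma wev_exp [simp]: "wev u (exp x) = exp (wev u x)"
  by (rule exp_homomorphism[OF wev_bounded_linear]) (simp_all add: one_wiener_def)

lemma wev_sums:
  "(\<lambda>m. coef x (int (Suc m)) *\<^sub>R cis (of_nat (Suc m) * u) + coef x (- int (Suc m)) *\<^sub>R cis (- of_nat (Suc m) * u))
    sums (wev u x - of_real (coef x 0))"
  using infsum_int_split[OF pairing_summable[OF wbdd_cis[of u], of x]]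
  by (simp add: wev_def pairing_def scaleR_conv_of_real del: of_nat_Suc)

text \<open>The displacement F w - w. It is real on the real axis; the denominators are chosen so
  that on Im w = \<rho> the imaginary part is the cosine series of \<open>x\<close> without its
  mean. The mean is absorbed by the height \<rho> = 1 + \<open>x\<^sub>0\<close>.\<close>

definition wseries :: "wiener \<Rightarrow> real \<Rightarrow> complex \<Rightarrow> complex" where
  "wseries x \<rho> w = (\<Sum>m. of_real (2 * coef x (int (Suc m)) / sinh (real (Suc m) * \<rho>)) * sin (of_nat (Suc m) * w))"

lemma cmod_sin_of_nat_le: "\<bar>Im w\<bar> \<le> 3/2 \<Longrightarrow> cmod (sin (of_nat k * w)) \<le> exp (3/2 * real k)"
proof -
  assume "\<bar>Im w\<bar> \<le> 3/2"
  then have "real k * \<bar>Im w\<bar> \<le> 3/2 * real k" using mult_left_mono[of "\<bar>Im w\<bar>" "3/2" "real k"] by simp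
  then have "exp \<bar>Im (of_nat k * w)\<bar> \<le> exp (3/2 * real k)" by (simp add: abs_mult)
  moreover have "cmod (sin (of_nat k * w)) \<le> exp \<bar>Im (of_nat k * w)\<bar>"
    using cmod_sin_le_exp[of 1 "of_nat k * w"] by simp
  ultimately show ?thesis by (rule order_trans[rotated])
qed

lemma csch_le_exp: "1/2 \<le> t \<Longrightarrow> 1 / sinh t \<le> 4 * exp (- (t::real))"
proof -
  assume t: "1/2 \<le> t"
  have "2 \<le> exp (2 * t)" using exp_ge_add_one_self[of "2 * t"] t by linarith
  then have "2 \<le> exp t * exp t" by (metis exp_add mult_2)
  then have "2 * exp (- t) \<le> exp t"
    by (simp add: exp_minus field_simps)
  then have "exp t / 4 \<le> sinh t" by (simp add: sinh_def)
  moreover have "0 < exp t / 4" by simp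
  ultimately have "1 / sinh t \<le> 1 / (exp t / 4)" by (intro divide_left_mono) (use t in auto)
  then show ?thesis by (simp add: exp_minus field_simps)
qed

text \<open>The quotient sin (k w) / sinh (k \<rho>) grows at most like exp (k (3/2 - 9/10)), and
  3/5 < 2/3 \<le> ln 2, so the weight 2 ^ k dominates it. The constant is 2 from the definition of
  the series times 4 from \<open>csch_le_exp\<close>.\<close>

lemma wseries_term_le:
  assumes w: "\<bar>Im w\<bar> \<le> 3/2" and \<rho>: "9/10 \<le> \<rho>"
  shows "cmod (of_real (2 * coef x (int (Suc m)) / sinh (real (Suc m) * \<rho>)) * sin (of_nat (Suc m) * w))
    \<le> 8 * (\<bar>coef x (int (Suc m))\<bar> * wt (int (Suc m)))"
proof -
  define k where "k = Suc m"
  have "1 * (9/10) \<le> real k * \<rho>" using \<rho> by (intro mult_mono) (auto simp: k_def)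
  then have k\<rho>: "1/2 \<le> real k * \<rho>" by simp
  then have sp: "0 < sinh (real k * \<rho>)" by simp
  have k9: "9/10 * real k \<le> real k * \<rho>" using mult_right_mono[OF \<rho>, of "real k"] by (simp add: mult.commute)
  have "1 / sinh (real k * \<rho>) * exp (3/2 * real k) \<le> 4 * exp (- (real k * \<rho>)) * exp (3/2 * real k)"
    by (intro mult_right_mono csch_le_exp[OF k\<rho>]) simp
  also have "\<dots> = 4 * exp (3/2 * real k - real k * \<rho>)" by (simp flip: exp_add)
  also have "\<dots> \<le> 4 * exp (real k * ln 2)"
  proof -
    have "3/2 * real k - real k * \<rho> \<le> real k * (2/3)" using k9 by linarith
    also have "\<dots> \<le> real k * ln 2" using ln2_ge_two_thirds by (intro mult_left_mono) auto
    finally show ?thesis by simp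
  qed
  also have "exp (real k * ln 2) = 2 ^ k" by (simp add: exp_of_nat_mult)
  finally have E: "1 / sinh (real k * \<rho>) * exp (3/2 * real k) \<le> 4 * 2 ^ k" .
  have "cmod (of_real (2 * coef x (int k) / sinh (real k * \<rho>)) * sin (of_nat k * w))
    = 2 * \<bar>coef x (int k)\<bar> * (1 / sinh (real k * \<rho>) * cmod (sin (of_nat k * w)))"
    using sp by (simp add: norm_mult norm_divide)
  also have "\<dots> \<le> 2 * \<bar>coef x (int k)\<bar> * (1 / sinh (real k * \<rho>) * exp (3/2 * real k))"
    using cmod_sin_of_nat_le[OF w, of k] sp by (intro mult_left_mono) auto
  also have "\<dots> \<le> 2 * \<bar>coef x (int k)\<bar> * (4 * 2 ^ k)"
    using E by (intro mult_left_mono) auto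
  finally show ?thesis unfolding k_def[symmetric] by (simp add: wt_def)
qed

lemma coef_wt_summable:
  "summable (\<lambda>m. \<bar>coef x (int (Suc m))\<bar> * wt (int (Suc m)))"
  "(\<Sum>m. \<bar>coef x (int (Suc m))\<bar> * wt (int (Suc m))) \<le> norm x"
proof -
  have b: "(\<Sum>m<N. \<bar>coef x (int (Suc m))\<bar> * wt (int (Suc m))) \<le> norm x" for N
  proof -
    have "(\<Sum>m<N. \<bar>coef x (int (Suc m))\<bar> * wt (int (Suc m)))
      = (\<Sum>k\<in>(\<lambda>m. int (Suc m)) ` {..<N}. \<bar>coef x k\<bar> * wt k)"
      by (subst sum.reindex) (auto simp: inj_on_def)
    also have "\<dots> \<le> norm x" using wsummable_bound[of "coef x"] by (simp add: norm_wiener.rep_eq)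
    finally show ?thesis .
  qed
  show s: "summable (\<lambda>m. \<bar>coef x (int (Suc m))\<bar> * wt (int (Suc m)))"
    by (rule summableI_nonneg_bounded[OF _ b]) (simp add: wt_pos less_imp_le)
  show "(\<Sum>m. \<bar>coef x (int (Suc m))\<bar> * wt (int (Suc m))) \<le> norm x"
    by (rule suminf_le_const[OF s b])
qed

lemma wseries_summable:
  assumes "\<bar>Im w\<bar> \<le> 3/2" "9/10 \<le> \<rho>"
  shows "summable (\<lambda>m. of_real (2 * coef x (int (Suc m)) / sinh (real (Suc m) * \<rho>)) * sin (of_nat (Suc m) * w))"
  by (rule summable_comparison_test'[OF summable_mult[OF coef_wt_summable(1)[of x], of 8] wseries_term_le[OF assms]])

lemma cmod_wseries_le:
  assumes "\<bar>Im w\<bar> \<le> 3/2" "9/10 \<le> \<rho>"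
  shows "cmod (wseries x \<rho> w) \<le> 8 * norm x"
proof -
  have "cmod (wseries x \<rho> w) \<le> (\<Sum>m. 8 * (\<bar>coef x (int (Suc m))\<bar> * wt (int (Suc m))))"
    unfolding wseries_def
    by (rule norm_suminf_le[OF wseries_term_le[OF assms] summable_mult[OF coef_wt_summable(1)]])
  also have "\<dots> \<le> 8 * norm x"
    using coef_wt_summable[of x] by (subst suminf_mult) auto
  finally show ?thesis .
qed

lemma wseries_holomorphic:
  assumes "9/10 \<le> \<rho>"
  shows "wseries x \<rho> holomorphic_on {w. \<bar>Im w\<bar> < 3/2}"
proof (rule holomorphic_uniform_sequence)
  show op: "open {w. \<bar>Im w\<bar> < 3/2}"
    by (intro open_Collect_less continuous_intros)
  let ?f = "\<lambda>m w. of_real (2 * coef x (int (Suc m)) / sinh (real (Suc m) * \<rho>)) * sin (of_nat (Suc m) * w)"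
  show "(\<lambda>w. \<Sum>m<N. ?f m w) holomorphic_on {w. \<bar>Im w\<bar> < 3/2}" for N
    by (intro holomorphic_intros)
  fix z assume "z \<in> {w. \<bar>Im w\<bar> < 3/2}"
  then obtain d where d: "d > 0" "cball z d \<subseteq> {w. \<bar>Im w\<bar> < 3/2}"
    using op open_contains_cball by blast
  have "uniform_limit (cball z d) (\<lambda>N w. \<Sum>m<N. ?f m w) (\<lambda>w. suminf (\<lambda>m. ?f m w)) sequentially"
  proof (rule Weierstrass_m_test)
    show "summable (\<lambda>m. 8 * (\<bar>coef x (int (Suc m))\<bar> * wt (int (Suc m))))"
      by (rule summable_mult[OF coef_wt_summable(1)])
    fix m w assume "w \<in> cball z d"
    then have "\<bar>Im w\<bar> \<le> 3/2" using d by force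
    then show "cmod (?f m w) \<le> 8 * (\<bar>coef x (int (Suc m))\<bar> * wt (int (Suc m)))"
      by (rule wseries_term_le[OF _ assms])
  qed
  then show "\<exists>d>0. cball z d \<subseteq> {w. \<bar>Im w\<bar> < 3/2} \<and>
      uniform_limit (cball z d) (\<lambda>N w. \<Sum>m<N. ?f m w) (wseries x \<rho>) sequentially"
    using d unfolding wseries_def[abs_def] by blast
qed

lemma wseries_diff_scaleR:
  assumes "\<bar>Im w\<bar> \<le> 3/2" "9/10 \<le> \<rho>"
  shows "wseries (x - c *\<^sub>R y) \<rho> w = wseries x \<rho> w - of_real c * wseries y \<rho> w"
proof -
  let ?f = "\<lambda>x m. of_real (2 * coef x (int (Suc m)) / sinh (real (Suc m) * \<rho>)) * sin (of_nat (Suc m) * w)"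
  have "(\<lambda>m. ?f x m - of_real c * ?f y m) sums (wseries x \<rho> w - of_real c * wseries y \<rho> w)"
    unfolding wseries_def by (intro sums_diff sums_mult summable_sums wseries_summable[OF assms])
  moreover have "?f x m - of_real c * ?f y m = ?f (x - c *\<^sub>R y) m" for m
    by (simp add: diff_divide_distrib algebra_simps del: of_nat_Suc)
  ultimately show ?thesis unfolding wseries_def by (simp add: sums_iff del: of_nat_Suc)
qed

lemma wseries_channel_lin:
  assumes "2 \<le> n"
  shows "wseries (channel_lin n a) \<rho> w = sin w / of_real (sinh \<rho>) + of_real a * sin (of_nat n * w) / of_real (sinh (real n * \<rho>))"
proof -
  let ?g = "\<lambda>m. sin (of_nat (Suc m) * w) / of_real (sinh (real (Suc m) * \<rho>))"
  have "(\<lambda>m. (if m = 0 then ?g m else 0) + of_real a * (if m = n - 1 then ?g m else 0)) sums (?g 0 + of_real a * ?g (n - 1))"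
    by (intro sums_add sums_mult sums_single)
  moreover have "of_real (2 * coef (channel_lin n a) (int (Suc m)) / sinh (real (Suc m) * \<rho>)) * sin (of_nat (Suc m) * w)
     = (if m = 0 then ?g m else 0) + of_real a * (if m = n - 1 then ?g m else 0)" for m
    using assms by (auto simp: channel_lin_def wsingle.rep_eq)
  moreover have "?g 0 = sin w / of_real (sinh \<rho>)" "?g (n - 1) = sin (of_nat n * w) / of_real (sinh (real n * \<rho>))"
    using assms by auto
  ultimately show ?thesis unfolding wseries_def by (simp only: sums_iff times_divide_eq_right)
qed

lemma sin_of_nat_cnj: "sin (of_nat k * cnj w) = cnj (sin (of_nat k * w))"
  by (simp add: cnj_sin)

lemma wseries_symmetries:
  assumes "\<bar>Im w\<bar> \<le> 3/2" "9/10 \<le> \<rho>"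
  shows "wseries x \<rho> (- w) = - wseries x \<rho> w" "wseries x \<rho> (cnj w) = cnj (wseries x \<rho> w)"
    "wseries x \<rho> (w + 2 * pi) = wseries x \<rho> w"
proof -
  note S = summable_sums[OF wseries_summable[OF assms, of x]]
  show "wseries x \<rho> (- w) = - wseries x \<rho> w"
    unfolding wseries_def using sums_minus[OF S] by (simp add: sums_iff del: of_nat_Suc)
  show "wseries x \<rho> (cnj w) = cnj (wseries x \<rho> w)"
    unfolding wseries_def using bounded_linear.sums[OF bounded_linear_cnj S]
    by (simp add: sums_iff sin_of_nat_cnj del: of_nat_Suc)
  have "sin (of_nat k * (w + 2 * of_real pi)) = sin (of_nat k * w)" for k
    using sin.plus_of_nat[of "of_nat k * w" k] by (simp add: algebra_simps)
  then show "wseries x \<rho> (w + 2 * pi) = wseries x \<rho> w"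
    unfolding wseries_def by (simp del: of_nat_Suc)
qed

text \<open>In sin (k (u + \<i> \<rho>)) the imaginary part carries sinh (k \<rho>), cancelling the
  denominator, while the real part carries cosh (k \<rho>) and leaves the factor coth (k \<rho>).
  Multiplying the resulting sine series by \<i> gives real odd coefficients.\<close>

lemma wseries_top_line:
  assumes x: "wreflect x = x" "norm x \<le> 1/20" and \<rho>: "\<rho> = 1 + coef x 0"
  shows "of_real (Im (u + \<i> * \<rho> + wseries x \<rho> (u + \<i> * \<rho>))) = 1 + wev u x"
    and "\<i> * of_real (Re (wseries x \<rho> (u + \<i> * \<rho>))) = wev u (cothm \<rho> x)"
proof -
  have \<rho>b: "9/10 \<le> \<rho>" "3/4 \<le> \<rho>" "\<rho> \<le> 3/2" using coef_le[of x 0] x(2) \<rho> by linarith+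
  have sym: "coef x (- k) = coef x k" for k
    using arg_cong[OF x(1), of "\<lambda>y. coef y k"] by (simp add: wreflect.rep_eq)
  let ?t = "\<lambda>m. of_real (2 * coef x (int (Suc m)) / sinh (real (Suc m) * \<rho>)) * sin (of_nat (Suc m) * (u + \<i> * \<rho>))"
  have S: "?t sums wseries x \<rho> (u + \<i> * \<rho>)"
    unfolding wseries_def by (intro summable_sums wseries_summable) (use \<rho>b in auto)
  have nz: "sinh (real (Suc m) * \<rho>) \<noteq> 0" for m using \<rho>b by simp
  have re_im: "Re (sin (of_nat k * (u + \<i> * \<rho>))) = sin (real k * u) * cosh (real k * \<rho>)"
     "Im (sin (of_nat k * (u + \<i> * \<rho>))) = cos (real k * u) * sinh (real k * \<rho>)" for k
    by (simp_all add: Re_sin Im_sin cosh_def sinh_def exp_minus)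
  have Im: "(\<lambda>m. 2 * coef x (int (Suc m)) * cos (real (Suc m) * u)) sums Im (wseries x \<rho> (u + \<i> * \<rho>))"
    using sums_Im[OF S] nz by (simp add: re_im mult.assoc del: of_nat_Suc)
  have Re: "(\<lambda>m. 2 * coef x (int (Suc m)) / sinh (real (Suc m) * \<rho>) * (sin (real (Suc m) * u) * cosh (real (Suc m) * \<rho>)))
      sums Re (wseries x \<rho> (u + \<i> * \<rho>))"
    using sums_Re[OF S] by (simp add: re_im del: of_nat_Suc)
  have "(\<lambda>m. of_real (2 * coef x (int (Suc m)) * cos (real (Suc m) * u))) sums (wev u x - of_real (coef x 0))"
    using wev_sums[of x u] by (simp add: sym scaleR_conv_of_real cis.ctr complex_eq_iff Complex_eq algebra_simps del: of_nat_Suc)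
  moreover have "(\<lambda>m. of_real (2 * coef x (int (Suc m)) * cos (real (Suc m) * u))) sums (of_real (Im (wseries x \<rho> (u + \<i> * \<rho>))) :: complex)"
    using Im by (rule sums_of_real)
  ultimately have "wev u x - of_real (coef x 0) = of_real (Im (wseries x \<rho> (u + \<i> * \<rho>)))"
    by (rule sums_unique2)
  then show "of_real (Im (u + \<i> * \<rho> + wseries x \<rho> (u + \<i> * \<rho>))) = 1 + wev u x"
    by (simp add: \<rho> algebra_simps)
  have "coef (cothm \<rho> x) (int (Suc m)) *\<^sub>R cis (real (Suc m) * u) + coef (cothm \<rho> x) (- int (Suc m)) *\<^sub>R cis (- real (Suc m) * u)
    = \<i> * of_real (2 * coef x (int (Suc m)) / sinh (real (Suc m) * \<rho>) * (sin (real (Suc m) * u) * cosh (real (Suc m) * \<rho>)))" for m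
    using \<rho>b sym[of "int (Suc m)"]
    by (simp add: cothm.rep_eq coth_mult_uminus complex_eq_iff del: of_nat_Suc) (simp add: coth_mult_def max_def)
  then have "(\<lambda>m. \<i> * of_real (2 * coef x (int (Suc m)) / sinh (real (Suc m) * \<rho>) * (sin (real (Suc m) * u) * cosh (real (Suc m) * \<rho>))))
    sums (wev u (cothm \<rho> x) - of_real (coef (cothm \<rho> x) 0))"
    using wev_sums[of "cothm \<rho> x" u] by (simp del: of_nat_Suc)
  moreover have "(\<lambda>m. \<i> * of_real (2 * coef x (int (Suc m)) / sinh (real (Suc m) * \<rho>) * (sin (real (Suc m) * u) * cosh (real (Suc m) * \<rho>))))
    sums (\<i> * of_real (Re (wseries x \<rho> (u + \<i> * \<rho>))))"
    by (intro sums_mult sums_of_real Re)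
  ultimately have "wev u (cothm \<rho> x) - of_real (coef (cothm \<rho> x) 0) = \<i> * of_real (Re (wseries x \<rho> (u + \<i> * \<rho>)))"
    by (rule sums_unique2)
  \<comment> \<open>The zero mode of \<open>cothm\<close> vanishes, which fixes the horizontal
    translation of the map.\<close>
  then show "\<i> * of_real (Re (wseries x \<rho> (u + \<i> * \<rho>))) = wev u (cothm \<rho> x)"
    by (simp add: cothm.rep_eq coth_mult_def)
qed

lemma channel_map_exists:
  fixes n :: nat and a :: real
  assumes n: "2 \<le> n"
  shows "\<exists>\<epsilon>1>0. \<exists>C\<ge>0. \<forall>\<epsilon>. \<bar>\<epsilon>\<bar> < \<epsilon>1 \<longrightarrow> (\<exists>\<rho> F. \<bar>\<rho> - 1\<bar> \<le> 1/20 \<and> \<bar>\<rho> - 1\<bar> \<le> C * \<bar>\<epsilon>\<bar> \<and>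
    F holomorphic_on {w. \<bar>Im w\<bar> < 3/2} \<and>
    (\<forall>w. \<bar>Im w\<bar> < 3/2 \<longrightarrow> F (- w) = - F w \<and> F (cnj w) = cnj (F w) \<and> F (w + 2 * pi) = F w + 2 * pi \<and>
       cmod (F w - w - of_real \<epsilon> * (sin w / of_real (sinh 1) + of_real a * sin (of_nat n * w) / of_real (sinh (real n)))) \<le> C * \<epsilon>\<^sup>2) \<and>
    (\<forall>u::real. Im (F (u + \<i> * \<rho>)) = 1 + \<epsilon> * (cos (Re (F (u + \<i> * \<rho>))) + a * cos (real n * Re (F (u + \<i> * \<rho>))))))"
proof -
  obtain \<epsilon>1 C where \<epsilon>1: "\<epsilon>1 > 0" and C: "C \<ge> 0" and fp: "\<And>\<epsilon>. \<bar>\<epsilon>\<bar> < \<epsilon>1 \<Longrightarrow> \<exists>x. channel_op n a \<epsilon> x = x \<and> wreflect x = x \<and>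
    norm x \<le> 1/20 \<and> norm x \<le> C * \<bar>\<epsilon>\<bar> \<and> norm (x - \<epsilon> *\<^sub>R channel_lin n a) \<le> C * \<epsilon>\<^sup>2"
    using channel_op_fixed_point[OF n, of a] by metis
  define E where "E = exp (3/2) + \<bar>a\<bar> * exp (3/2 * real n)"
  \<comment> \<open>8 C comes from the tail of the fixed point, 3 C E from replacing \<rho> by 1 in
    the leading term; the last C makes K also bound \<rho> - 1.\<close>
  define K where "K = 8 * C + 3 * C * E + C"
  have E: "E \<ge> 0" by (simp add: E_def)
  have K: "K \<ge> 0" "C \<le> K" using C E by (auto simp: K_def)
  show ?thesis
  proof (rule exI[of _ \<epsilon>1], rule conjI, rule \<epsilon>1, rule exI[of _ K], rule conjI, rule K(1), rule allI, rule impI)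
    fix \<epsilon> assume "\<bar>\<epsilon>\<bar> < \<epsilon>1"
    then obtain x where x: "channel_op n a \<epsilon> x = x" "wreflect x = x" "norm x \<le> 1/20" "norm x \<le> C * \<bar>\<epsilon>\<bar>"
      "norm (x - \<epsilon> *\<^sub>R channel_lin n a) \<le> C * \<epsilon>\<^sup>2" using fp by blast
    define \<rho> where "\<rho> = 1 + coef x 0"
    define F where "F w = w + wseries x \<rho> w" for w
    have \<rho>1: "\<bar>\<rho> - 1\<bar> \<le> 1/20" "\<bar>\<rho> - 1\<bar> \<le> C * \<bar>\<epsilon>\<bar>" using coef_le[of x 0] x by (auto simp: \<rho>_def)
    then have \<rho>9: "9/10 \<le> \<rho>" "3/4 \<le> \<rho>" by linarith+
    have top: "Im (F (u + \<i> * \<rho>)) = 1 + \<epsilon> * (cos (Re (F (u + \<i> * \<rho>))) + a * cos (real n * Re (F (u + \<i> * \<rho>))))" for u :: real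
    proof -
      define s where "s = Re (wseries x \<rho> (u + \<i> * \<rho>))"
      have Re: "Re (F (u + \<i> * \<rho>)) = u + s" by (simp add: F_def s_def)
      \<comment> \<open>With this purely imaginary trace, multiplying cis u by exp (\<i> s) moves
        the argument to u + s = Re F. The fixed point equation therefore evaluates the boundary
        profile at the image point and not at the parameter u.\<close>
      have Y: "wev u (cothm \<rho> x) = \<i> * of_real s"
        using wseries_top_line(2)[OF x(2,3) \<rho>_def] by (simp add: s_def)
      interpret bounded_linear "wev u" by (rule wev_bounded_linear)
      have "wev u x = wev u (channel_op n a \<epsilon> x)" by (simp add: x(1))
      also have "\<dots> = (\<epsilon> / 2) *\<^sub>R (cis u * exp (\<i> * s) + cis (- u) * exp (- (\<i> * s))
          + a *\<^sub>R (cis (real n * u) * exp (real n *\<^sub>R (\<i> * s)) + cis (- (real n * u)) * exp (- (real n *\<^sub>R (\<i> * s)))))"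
        by (simp add: channel_op_def Let_def scaleR add neg Y flip: \<rho>_def)
      also have "cis u * exp (\<i> * s) = cis (u + s)" by (simp add: cis_conv_exp algebra_simps flip: exp_add)
      also have "cis (- u) * exp (- (\<i> * s)) = cis (- (u + s))" by (simp add: cis_conv_exp algebra_simps flip: exp_add)
      also have "cis (real n * u) * exp (real n *\<^sub>R (\<i> * s)) = cis (real n * (u + s))"
        by (simp add: cis_conv_exp algebra_simps scaleR_conv_of_real flip: exp_add)
      also have "cis (- (real n * u)) * exp (- (real n *\<^sub>R (\<i> * s))) = cis (- (real n * (u + s)))"
        by (simp add: cis_conv_exp algebra_simps scaleR_conv_of_real flip: exp_add)
      also have "(\<epsilon> / 2) *\<^sub>R (cis (u + s) + cis (- (u + s)) + a *\<^sub>R (cis (real n * (u + s)) + cis (- (real n * (u + s)))))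
        = of_real (\<epsilon> * (cos (u + s) + a * cos (real n * (u + s))))"
        unfolding complex_eq_iff by (simp only: cis.simps plus_complex.simps scaleR_complex.simps
          Re_complex_of_real Im_complex_of_real cos_minus sin_minus) (simp add: algebra_simps)
      finally have wx: "wev u x = of_real (\<epsilon> * (cos (u + s) + a * cos (real n * (u + s))))" .
      have "complex_of_real (Im (F (u + \<i> * \<rho>))) = 1 + wev u x"
        using wseries_top_line(1)[OF x(2,3) \<rho>_def, of u] by (simp add: F_def)
      then have "Im (F (u + \<i> * \<rho>)) = 1 + \<epsilon> * (cos (u + s) + a * cos (real n * (u + s)))"
        unfolding wx by (metis Re_complex_of_real of_real_1 of_real_add)
      then show ?thesis unfolding Re .
    qed
    have approx: "cmod (F w - w - of_real \<epsilon> * (sin w / of_real (sinh 1) + of_real a * sin (of_nat n * w) / of_real (sinh (real n)))) \<le> K * \<epsilon>\<^sup>2"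
      if w: "\<bar>Im w\<bar> < 3/2" for w
    proof -
      have w': "\<bar>Im w\<bar> \<le> 3/2" using w by simp
      define L where "L \<rho> = sin w / of_real (sinh \<rho>) + of_real a * sin (of_nat n * w) / of_real (sinh (real n * \<rho>))" for \<rho> :: real
      have "F w - w - of_real \<epsilon> * L 1 = wseries (x - \<epsilon> *\<^sub>R channel_lin n a) \<rho> w + of_real \<epsilon> * (L \<rho> - L 1)"
        unfolding wseries_diff_scaleR[OF w' \<rho>9(1)] wseries_channel_lin[OF n] by (simp add: F_def L_def algebra_simps)
      also have "cmod \<dots> \<le> 8 * (C * \<epsilon>\<^sup>2) + \<bar>\<epsilon>\<bar> * cmod (L \<rho> - L 1)"
        using cmod_wseries_le[OF w' \<rho>9(1), of "x - \<epsilon> *\<^sub>R channel_lin n a"] x(5)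
        by (intro order_trans[OF norm_triangle_ineq] add_mono) (auto simp: norm_mult)
      \<comment> \<open>Since \<rho> - 1 is itself of order \<epsilon>, freezing \<rho> at 1 in a
        term already multiplied by \<epsilon> costs only second order.\<close>
      also have "cmod (L \<rho> - L 1) \<le> 3 * (C * \<bar>\<epsilon>\<bar>) * E"
      proof -
        have "L \<rho> - L 1 = of_real (1 / sinh (real 1 * \<rho>) - 1 / sinh (real 1 * 1)) * sin (of_nat 1 * w)
          + of_real (1 / sinh (real n * \<rho>) - 1 / sinh (real n * 1)) * (of_real a * sin (of_nat n * w))"
          by (simp add: L_def left_diff_distrib)
        also have "cmod \<dots> \<le> \<bar>1 / sinh (real 1 * \<rho>) - 1 / sinh (real 1 * 1)\<bar> * cmod (sin (of_nat 1 * w))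
          + \<bar>1 / sinh (real n * \<rho>) - 1 / sinh (real n * 1)\<bar> * (\<bar>a\<bar> * cmod (sin (of_nat n * w)))"
          by (rule order_trans[OF norm_triangle_ineq]) (simp only: norm_mult norm_of_real order_refl)
        also have "\<dots> \<le> (3 * \<bar>\<rho> - 1\<bar>) * exp (3/2 * real 1) + (3 * \<bar>\<rho> - 1\<bar>) * (\<bar>a\<bar> * exp (3/2 * real n))"
          using n \<rho>9 by (intro add_mono mult_mono csch_lipschitz cmod_sin_of_nat_le[OF w'] order_refl) auto
        also have "\<dots> = 3 * \<bar>\<rho> - 1\<bar> * E" by (simp add: E_def algebra_simps)
        also have "\<dots> \<le> 3 * (C * \<bar>\<epsilon>\<bar>) * E" using \<rho>1(2) E by (intro mult_right_mono) auto
        finally show ?thesis .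
      qed
      then have "8 * (C * \<epsilon>\<^sup>2) + \<bar>\<epsilon>\<bar> * cmod (L \<rho> - L 1) \<le> 8 * (C * \<epsilon>\<^sup>2) + \<bar>\<epsilon>\<bar> * (3 * (C * \<bar>\<epsilon>\<bar>) * E)"
        by (intro add_left_mono mult_left_mono) auto
      also have "\<dots> = (8 * C + 3 * C * E) * \<epsilon>\<^sup>2"
        by (simp add: algebra_simps power2_eq_square)
      also have "\<dots> \<le> K * \<epsilon>\<^sup>2" using C by (intro mult_right_mono) (auto simp: K_def)
      finally show ?thesis by (simp add: L_def)
    qed
    have "F holomorphic_on {w. \<bar>Im w\<bar> < 3/2}"
      unfolding F_def[abs_def] by (intro holomorphic_intros wseries_holomorphic[OF \<rho>9(1)])
    then show "\<exists>\<rho> F. \<bar>\<rho> - 1\<bar> \<le> 1/20 \<and> \<bar>\<rho> - 1\<bar> \<le> K * \<bar>\<epsilon>\<bar> \<and>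
    F holomorphic_on {w. \<bar>Im w\<bar> < 3/2} \<and>
    (\<forall>w. \<bar>Im w\<bar> < 3/2 \<longrightarrow> F (- w) = - F w \<and> F (cnj w) = cnj (F w) \<and> F (w + 2 * pi) = F w + 2 * pi \<and>
       cmod (F w - w - of_real \<epsilon> * (sin w / of_real (sinh 1) + of_real a * sin (of_nat n * w) / of_real (sinh (real n)))) \<le> K * \<epsilon>\<^sup>2) \<and>
    (\<forall>u::real. Im (F (u + \<i> * \<rho>)) = 1 + \<epsilon> * (cos (Re (F (u + \<i> * \<rho>))) + a * cos (real n * Re (F (u + \<i> * \<rho>)))))"
      using \<rho>1 mult_right_mono[OF K(2), of "\<bar>\<epsilon>\<bar>"] top approx
        wseries_symmetries[OF _ \<rho>9(1), of _ x]
      by (intro exI[of _ \<rho>] exI[of _ F]) (auto simp: F_def)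
  qed
qed

section \<open>Green's identities for test functions\<close>

lemma lborel_integral_translate:
  fixes f :: "complex \<Rightarrow> real"
  assumes "f \<in> borel_measurable borel"
  shows "(\<integral>z. f (z + c) \<partial>lborel) = (\<integral>z. f z \<partial>lborel)"
proof -
  have "(\<integral>z. f z \<partial>lborel) = (\<integral>z. f z \<partial>(distr lborel borel ((+) c)))"
    by (simp add: lborel_distr_plus)
  also have "\<dots> = (\<integral>z. f (c + z) \<partial>lborel)"
    using assms by (intro integral_distr) auto
  finally show ?thesis by (simp add: add.commute)
qed

lemma integrable_compact_support:
  fixes f :: "complex \<Rightarrow> real"
  assumes "continuous_on UNIV f" "\<And>z. norm z > R \<Longrightarrow> f z = 0"
  shows "integrable lborel f"
proof -
  have "set_integrable lborel (cball 0 R) f"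
    unfolding set_integrable_def
    by (intro borel_integrable_compact continuous_on_subset[OF assms(1)]) auto
  moreover have "(\<lambda>z. indicat_real (cball 0 R) z *\<^sub>R f z) = f"
    using assms(2) by (fastforce simp: indicator_def)
  ultimately show ?thesis by (simp only: set_integrable_def)
qed

text \<open>Translation invariance makes the integrals of all difference quotients vanish.\<close>

lemma integral_directional_derivative_eq_0:
  fixes V W :: "complex \<Rightarrow> real"
  assumes W: "continuous_on UNIV W" and V: "continuous_on UNIV V"
    and deriv: "\<And>z. ((\<lambda>t. V (z + t *\<^sub>R v)) has_real_derivative W z) (at 0)"
    and supp: "\<And>z. norm z > R \<Longrightarrow> V z = 0" "\<And>z. norm z > R \<Longrightarrow> W z = 0"
  shows "(\<integral>z. W z \<partial>lborel) = 0"
proof -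
  define s where "s n = inverse (real (Suc n))" for n
  have s: "0 < s n" "s n \<le> 1" for n by (auto simp: s_def field_simps)
  have s_lim: "s \<longlonglongrightarrow> 0" unfolding s_def[abs_def] by (rule LIMSEQ_inverse_real_of_nat)
  define X where "X n z = (V (z + s n *\<^sub>R v) - V z) / s n" for n z
  have "bounded (W ` cball 0 R)"
    by (intro compact_imp_bounded compact_continuous_image continuous_on_subset[OF W]) auto
  then obtain M0 where "\<forall>y\<in>W ` cball 0 R. norm y \<le> M0"
    unfolding bounded_iff by blast
  then have M0: "\<And>z. z \<in> cball 0 R \<Longrightarrow> \<bar>W z\<bar> \<le> M0" by simp
  define M where "M = max M0 0"
  have M: "\<bar>W z\<bar> \<le> M" for z
    using M0[of z] supp(2)[of z] by (cases "norm z > R") (auto simp: M_def)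
  have M_nonneg: "0 \<le> M" by (simp add: M_def)
  have deriv': "((\<lambda>t. V (z + t *\<^sub>R v)) has_real_derivative W (z + t *\<^sub>R v)) (at t)" for z t
    using deriv[of "z + t *\<^sub>R v"] DERIV_at_within_shift[of "\<lambda>t'. V (z + t' *\<^sub>R v)" "W (z + t *\<^sub>R v)" t 0 UNIV]
    by (simp add: algebra_simps)
  have X_le: "\<bar>X n z\<bar> \<le> M" for n z
  proof -
    have "norm (V (z + s n *\<^sub>R v) - V (z + 0 *\<^sub>R v)) \<le> M * norm (s n - 0)"
      by (rule field_differentiable_bound[where S = UNIV and f' = "\<lambda>t. W (z + t *\<^sub>R v)" and f = "\<lambda>t. V (z + t *\<^sub>R v)"])
        (use deriv' M in auto)
    then show ?thesis using s[of n] by (simp add: X_def divide_le_eq)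
  qed
  have X_0: "X n z = 0" if "norm z > R + norm v" for n z
  proof -
    have "norm (s n *\<^sub>R v) \<le> norm v" using s[of n] mult_right_mono[of "s n" 1 "norm v"] by simp
    then have "norm (z + s n *\<^sub>R v) > R"
      using that norm_triangle_ineq2[of z "- (s n *\<^sub>R v)"] by simp
    moreover have "norm z > R" using that norm_ge_zero[of v] by linarith
    ultimately show ?thesis using supp by (simp add: X_def)
  qed
  have V_meas: "V \<in> borel_measurable borel" using V by (rule borel_measurable_continuous_onI)
  have V_int: "integrable lborel V" by (rule integrable_compact_support[OF V supp(1)])
  have V_tr: "integrable lborel (\<lambda>z. V (z + c))" for c
  proof (rule integrable_compact_support)
    show "continuous_on UNIV (\<lambda>z. V (z + c))"
      by (intro continuous_on_compose2[OF V] continuous_intros) auto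
    show "V (z + c) = 0" if "norm z > R + norm c" for z
      by (intro supp(1)) (use that norm_triangle_ineq2[of z "-c"] in auto)
  qed
  have "(\<lambda>n. \<integral>z. X n z \<partial>lborel) \<longlonglongrightarrow> (\<integral>z. W z \<partial>lborel)"
  proof (rule integral_dominated_convergence)
    show "W \<in> borel_measurable lborel" using W by (simp add: borel_measurable_continuous_onI)
    show "X n \<in> borel_measurable lborel" for n
      unfolding X_def[abs_def] using V_int V_tr by (intro borel_measurable_divide borel_measurable_diff) auto
    show "integrable lborel (\<lambda>z. M * indicat_real (cball 0 (R + norm v)) z :: real)"
      by (intro integrable_mult_right integrable_real_indicator) (auto simp: emeasure_lborel_cball_finite[unfolded infinity_ennreal_def])
    show "AE z in lborel. (\<lambda>n. X n z) \<longlonglongrightarrow> W z"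
    proof (rule AE_I2)
      fix z
      have "filterlim s (at 0) sequentially"
      proof (rule filterlim_atI[OF s_lim])
        show "\<forall>\<^sub>F n in sequentially. s n \<noteq> 0" using s(1) by (simp add: less_imp_neq[symmetric])
      qed
      moreover have "((\<lambda>h. (V (z + h *\<^sub>R v) - V z) / h) \<longlongrightarrow> W z) (at 0)"
        using deriv[of z] by (simp add: has_field_derivative_iff)
      ultimately show "(\<lambda>n. X n z) \<longlonglongrightarrow> W z"
        unfolding X_def by (rule filterlim_compose[rotated])
    qed
    show "AE z in lborel. norm (X n z) \<le> M * indicat_real (cball 0 (R + norm v)) z" for n
      using X_le X_0 M_nonneg by (intro AE_I2) (auto simp: indicator_def)
  qed
  moreover have "(\<integral>z. X n z \<partial>lborel) = 0" for n
    using V_tr[of "s n *\<^sub>R v"] V_int lborel_integral_translate[OF V_meas, of "s n *\<^sub>R v"]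
    by (simp add: X_def)
  ultimately show ?thesis by (simp add: LIMSEQ_const_iff)
qed

lemma eventually_line_in_open:
  assumes "open S" "z \<in> S"
  shows "\<forall>\<^sub>F t in nhds 0. z + t *\<^sub>R (v::complex) \<in> S"
proof -
  have "open ((\<lambda>t::real. z + t *\<^sub>R v) -` S)"
    by (intro open_vimage assms continuous_intros)
  then show ?thesis unfolding eventually_nhds using assms(2) by (intro exI[of _ "(\<lambda>t. z + t *\<^sub>R v) -` S"]) auto
qed

lemma test_function_dir_deriv:
  assumes "test_function D \<phi>"
  shows "((\<lambda>t. \<phi> (z + t *\<^sub>R v)) has_real_derivative dir_deriv v \<phi> z) (at 0)"
    and "((\<lambda>t. dir_deriv v \<phi> (z + t *\<^sub>R v)) has_real_derivative dir_deriv v (dir_deriv v \<phi>) z) (at 0)"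
    and "continuous_on UNIV \<phi>" "continuous_on UNIV (dir_deriv v \<phi>)" "continuous_on UNIV (dir_deriv v (dir_deriv v \<phi>))"
proof -
  have sm: "foldr dir_deriv vs \<phi> differentiable_on UNIV" for vs
    using assms by (simp add: test_function_def smooth_def)
  have d: "((\<lambda>t. f (z + t *\<^sub>R v)) has_real_derivative dir_deriv v f z) (at 0)"
    if "f differentiable_on UNIV" for f :: "complex \<Rightarrow> real"
  proof -
    have "f differentiable (at z)" using that by (simp add: differentiable_on_def)
    then obtain f' where f': "(f has_derivative f') (at z)" by (auto simp: differentiable_def)
    have "((\<lambda>t::real. f (z + t *\<^sub>R v)) has_derivative (\<lambda>t. f' (t *\<^sub>R v))) (at 0)"
      by (rule has_derivative_compose[where g = f, of "\<lambda>t. z + t *\<^sub>R v"])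
        (use f' in \<open>auto intro!: derivative_eq_intros\<close>)
    moreover have "(\<lambda>t. f' (t *\<^sub>R v)) = (*) (f' v)"
      using has_derivative_bounded_linear[OF f'] by (auto simp: linear_simps)
    ultimately have "((\<lambda>t::real. f (z + t *\<^sub>R v)) has_real_derivative f' v) (at 0)"
      by (simp only: has_field_derivative_def)
    then show ?thesis unfolding dir_deriv_def by (metis DERIV_imp_deriv)
  qed
  show "((\<lambda>t. \<phi> (z + t *\<^sub>R v)) has_real_derivative dir_deriv v \<phi> z) (at 0)"
    using d[of \<phi>] sm[of "[]"] by simp
  show "((\<lambda>t. dir_deriv v \<phi> (z + t *\<^sub>R v)) has_real_derivative dir_deriv v (dir_deriv v \<phi>) z) (at 0)"
    using d[of "dir_deriv v \<phi>"] sm[of "[v]"] by simp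
  show "continuous_on UNIV \<phi>" using sm[of "[]"] by (simp add: differentiable_imp_continuous_on)
  show "continuous_on UNIV (dir_deriv v \<phi>)" using sm[of "[v]"] by (simp add: differentiable_imp_continuous_on)
  show "continuous_on UNIV (dir_deriv v (dir_deriv v \<phi>))" using sm[of "[v, v]"] by (simp add: differentiable_imp_continuous_on)
qed

lemma dir_deriv_eq_0:
  assumes "open S" "z \<in> S" "\<And>w. w \<in> S \<Longrightarrow> f w = 0"
  shows "dir_deriv v f z = 0"
proof -
  have "\<forall>\<^sub>F t in nhds 0. z + t *\<^sub>R v \<in> S" by (rule eventually_line_in_open[OF assms(1,2)])
  then have "\<forall>\<^sub>F t in nhds 0. f (z + t *\<^sub>R v) = 0" by eventually_elim (rule assms(3))
  then have "deriv (\<lambda>t::real. f (z + t *\<^sub>R v)) 0 = deriv (\<lambda>t::real. 0) 0"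
    by (intro deriv_cong_ev) auto
  then show ?thesis by (simp add: dir_deriv_def)
qed

lemma test_function_support:
  assumes "test_function D \<phi>"
  obtains K where "compact K" "K \<subseteq> D" "\<And>z. z \<notin> K \<Longrightarrow> \<phi> z = 0"
    "\<And>v z. z \<notin> K \<Longrightarrow> dir_deriv v \<phi> z = 0" "\<And>v z. z \<notin> K \<Longrightarrow> dir_deriv v (dir_deriv v \<phi>) z = 0"
proof
  define K where "K = closure {z. \<phi> z \<noteq> 0}"
  show "compact K" "K \<subseteq> D" using assms by (auto simp: test_function_def K_def)
  have op: "open (- K)" unfolding K_def by (rule open_Compl[OF closed_closure])
  show 0: "\<phi> z = 0" if "z \<notin> K" for z
    using that closure_subset[of "{z. \<phi> z \<noteq> 0}"] by (auto simp: K_def)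
  show 1: "dir_deriv v \<phi> z = 0" if "z \<notin> K" for v z
    using that 0 by (intro dir_deriv_eq_0[OF op]) auto
  show "dir_deriv v (dir_deriv v \<phi>) z = 0" if "z \<notin> K" for v z
    by (rule dir_deriv_eq_0[OF op]) (use that 1 in auto)
qed

lemma has_derivative_eventually_0:
  fixes f :: "complex \<Rightarrow> real"
  assumes "open S" "z \<in> S" "\<And>w. w \<in> S \<Longrightarrow> f w = 0"
  shows "((\<lambda>t. f (z + t *\<^sub>R v)) has_real_derivative 0) (at 0)"
proof -
  have "\<forall>\<^sub>F t in nhds 0. z + t *\<^sub>R v \<in> S" by (rule eventually_line_in_open[OF assms(1,2)])
  then have "\<forall>\<^sub>F t in nhds 0. f (z + t *\<^sub>R v) = 0" by eventually_elim (rule assms(3))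
  moreover have "((\<lambda>t::real. 0::real) has_real_derivative 0) (at 0)" by simp
  ultimately show ?thesis by (subst DERIV_cong_ev[OF refl _ refl]) auto
qed

text \<open>The function u * \<phi>' - \<phi> * u', with primes for the derivative along v, has
  derivative u * \<phi>'' - \<phi> * u'' along v. It has compact support in D and extends by 0 to
  the plane, so the integral of that derivative vanishes. Working in one direction at a time keeps
  second order information one-dimensional; v = 1 and v = \<i> add up to the Laplacian.\<close>

lemma test_function_green_identity:
  assumes D: "open D" and \<phi>: "test_function D \<phi>"
    and u: "\<And>z. z \<in> D \<Longrightarrow> ((\<lambda>t. u (z + t *\<^sub>R v)) has_real_derivative p z) (at 0)"
    and p: "\<And>z. z \<in> D \<Longrightarrow> ((\<lambda>t. p (z + t *\<^sub>R v)) has_real_derivative q z) (at 0)"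
    and cont: "continuous_on D u" "continuous_on D p" "continuous_on D q"
  shows "set_integrable lborel D (\<lambda>z. u z * dir_deriv v (dir_deriv v \<phi>) z)"
    and "set_integrable lborel D (\<lambda>z. \<phi> z * q z)"
    and "(LINT z:D|lborel. u z * dir_deriv v (dir_deriv v \<phi>) z) = (LINT z:D|lborel. \<phi> z * q z)"
proof -
  obtain K where K: "compact K" "K \<subseteq> D" "\<And>z. z \<notin> K \<Longrightarrow> \<phi> z = 0"
    "\<And>v z. z \<notin> K \<Longrightarrow> dir_deriv v \<phi> z = 0" "\<And>v z. z \<notin> K \<Longrightarrow> dir_deriv v (dir_deriv v \<phi>) z = 0"
    using test_function_support[OF \<phi>] by blast
  obtain R where R: "\<And>z. z \<in> K \<Longrightarrow> norm z \<le> R"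
    using compact_imp_bounded[OF K(1)] by (auto simp: bounded_iff)
  have op: "open (- K)" using K(1) by (simp add: compact_imp_closed open_Compl)
  have cover: "UNIV = D \<union> - K" using K(2) by auto
  note test = test_function_dir_deriv[OF \<phi>]
  define ext where "ext f z = (if z \<in> D then f z else 0)" for f :: "complex \<Rightarrow> real" and z
  have cext: "continuous_on UNIV (ext f)" if "continuous_on D f" "\<And>z. z \<notin> K \<Longrightarrow> f z = 0" for f
  proof -
    have "continuous_on D (ext f)"
      using that(1) by (rule continuous_on_eq) (simp add: ext_def)
    moreover have "continuous_on (- K) (ext f)"
      by (rule continuous_on_eq[OF continuous_on_const[of _ 0]]) (use that(2) in \<open>auto simp: ext_def\<close>)
    ultimately show ?thesis unfolding cover using D op by (intro continuous_on_open_Un)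
  qed
  have ext_0: "ext f z = 0" if "norm z > R" "\<And>z. z \<notin> K \<Longrightarrow> f z = 0" for f z
    using R[of z] that by (cases "z \<in> K") (auto simp: ext_def)
  have set_int: "set_integrable lborel D f" and set_lint: "(LINT z:D|lborel. f z) = (\<integral>z. ext f z \<partial>lborel)"
    if "continuous_on D f" "\<And>z. z \<notin> K \<Longrightarrow> f z = 0" for f
  proof -
    have eq: "(\<lambda>z. indicat_real D z *\<^sub>R f z) = ext f" by (auto simp: ext_def indicator_def)
    show "set_integrable lborel D f" unfolding set_integrable_def eq
      by (rule integrable_compact_support[OF cext[OF that]]) (use ext_0 that in auto)
    show "(LINT z:D|lborel. f z) = (\<integral>z. ext f z \<partial>lborel)"
      unfolding set_lebesgue_integral_def eq ..
  qed
  have cs: "continuous_on D (\<lambda>z. u z * dir_deriv v (dir_deriv v \<phi>) z)" "continuous_on D (\<lambda>z. \<phi> z * q z)"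
    "continuous_on D (\<lambda>z. u z * dir_deriv v \<phi> z - \<phi> z * p z)"
    "continuous_on D (\<lambda>z. u z * dir_deriv v (dir_deriv v \<phi>) z - \<phi> z * q z)"
    by (intro continuous_intros cont continuous_on_subset[OF test(3)] continuous_on_subset[OF test(4)]
        continuous_on_subset[OF test(5)] subset_UNIV)+
  show i1: "set_integrable lborel D (\<lambda>z. u z * dir_deriv v (dir_deriv v \<phi>) z)"
    by (rule set_int[OF cs(1)]) (simp add: K)
  show i2: "set_integrable lborel D (\<lambda>z. \<phi> z * q z)"
    by (rule set_int[OF cs(2)]) (simp add: K)
  let ?V = "\<lambda>z. u z * dir_deriv v \<phi> z - \<phi> z * p z"
  let ?W = "\<lambda>z. u z * dir_deriv v (dir_deriv v \<phi>) z - \<phi> z * q z"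
  have "(\<integral>z. ext ?W z \<partial>lborel) = 0"
  proof (rule integral_directional_derivative_eq_0[where V = "ext ?V" and R = R])
    show "continuous_on UNIV (ext ?W)" by (rule cext[OF cs(4)]) (simp add: K)
    show "continuous_on UNIV (ext ?V)" by (rule cext[OF cs(3)]) (simp add: K)
    show "ext ?V z = 0" "ext ?W z = 0" if "norm z > R" for z using that by (auto intro!: ext_0 simp: K)
    show "((\<lambda>t. ext ?V (z + t *\<^sub>R v)) has_real_derivative ext ?W z) (at 0)" for z
    proof (cases "z \<in> D")
      case True
      have "((\<lambda>t. ?V (z + t *\<^sub>R v)) has_real_derivative ?W z) (at 0)"
        using DERIV_diff[OF DERIV_mult[OF u[OF True] test(2)[where z = z and v = v]] DERIV_mult[OF test(1)[where z = z and v = v] p[OF True]]]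
        by (simp add: algebra_simps)
      moreover have "\<forall>\<^sub>F t in nhds 0. ext ?V (z + t *\<^sub>R v) = ?V (z + t *\<^sub>R v)"
        using eventually_line_in_open[OF D True, of v] by eventually_elim (simp add: ext_def)
      ultimately show ?thesis using True
        by (subst DERIV_cong_ev[OF refl _ refl, where g = "\<lambda>t. ?V (z + t *\<^sub>R v)"]) (auto simp: ext_def)
    next
      case False
      then have "((\<lambda>t. ext ?V (z + t *\<^sub>R v)) has_real_derivative 0) (at 0)"
        using K by (intro has_derivative_eventually_0[OF op]) (auto simp: ext_def)
      then show ?thesis using False by (simp add: ext_def)
    qed
  qed
  then have "(LINT z:D|lborel. ?W z) = 0"
    using set_lint[OF cs(4)] by (simp add: K)
  then show "(LINT z:D|lborel. u z * dir_deriv v (dir_deriv v \<phi>) z) = (LINT z:D|lborel. \<phi> z * q z)"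
    using set_integral_diff(2)[OF i1 i2] by simp
qed

lemma emeasure_lborel_norm_square_le:

  \<comment> \<open>Integration of radial functions and the logarithmic singularity\<close>
  "emeasure lborel {z::complex. (norm (z - c))\<^sup>2 \<le> a} = ennreal (pi * max 0 a)"
proof (cases "0 \<le> a")
  case True
  have "{z::complex. (norm (z - c))\<^sup>2 \<le> a} = cball c (sqrt a)"
    using True by (auto simp: dist_norm norm_minus_commute real_le_rsqrt intro: real_sqrt_le_iff[THEN iffD1] sqrt_le_D)
  then show ?thesis using True emeasure_cball[of "sqrt a" c] by (simp add: unit_ball_vol_2)
next
  case False
  then have "{z::complex. (norm (z - c))\<^sup>2 \<le> a} = {}" by (auto simp: not_le) (smt (verit) zero_le_power2)
  then show ?thesis using False by simp
qed

lemma sets_borel_atMost: "sets (borel :: real measure) = sigma_sets UNIV (range atMost)"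
  using arg_cong[OF borel_eq_atMost[where 'a = real], of sets] by (simp add: sets_measure_of)

text \<open>A disc of squared radius a has area \<pi> a. In the variable "squared distance" planar
  measure is therefore \<pi> times length, and it suffices to compare the measures on
  half-lines.\<close>

lemma distr_norm_square:
  "distr lborel borel (\<lambda>z::complex. (norm (z - c))\<^sup>2) = density lborel (\<lambda>t. ennreal pi * indicator {0..} t)"
proof (rule measure_eqI_generator_eq[where E = "range atMost" and \<Omega> = UNIV and A = "\<lambda>n. {..real n}"])
  show "Int_stable (range atMost :: real set set)"
  proof (rule Int_stableI)
    fix A B :: "real set" assume "A \<in> range atMost" "B \<in> range atMost"
    then obtain a b where "A = {..a}" "B = {..b}" by auto
    then have "A \<inter> B = {..min a b}" by auto
    then show "A \<inter> B \<in> range atMost" by simp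
  qed
  show "emeasure (distr lborel borel (\<lambda>z::complex. (norm (z - c))\<^sup>2)) X
    = emeasure (density lborel (\<lambda>t. ennreal pi * indicator {0..} t)) X" if "X \<in> range atMost" for X
  proof -
    obtain a where X: "X = {..a}" using \<open>X \<in> range atMost\<close> by auto
    have "emeasure (density lborel (\<lambda>t. ennreal pi * indicator {0..} t)) X
      = (\<integral>\<^sup>+t. ennreal pi * indicator {0..a} t \<partial>lborel)"
      by (subst emeasure_density) (auto simp: X indicator_def intro!: nn_integral_cong)
    also have "\<dots> = ennreal pi * ennreal (max 0 a)"
      by (subst nn_integral_cmult) (auto simp: max_def not_le ennreal_neg)
    finally show ?thesis
      using emeasure_lborel_norm_square_le[of c a]
      by (simp add: emeasure_distr X vimage_def ennreal_mult)
  qed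
  show "(\<Union>i. {..real i}) = UNIV" by (auto intro: real_arch_simple)
  show "emeasure (distr lborel borel (\<lambda>z::complex. (norm (z - c))\<^sup>2)) {..real i} \<noteq> \<infinity>" for i
    using emeasure_lborel_norm_square_le[of c "real i"] by (simp add: emeasure_distr vimage_def)
qed (auto simp flip: sets_borel_atMost)

lemma nn_integral_radial:
  assumes "g \<in> borel_measurable borel"
  shows "(\<integral>\<^sup>+z. g ((norm (z - c))\<^sup>2) \<partial>(lborel :: complex measure)) = ennreal pi * (\<integral>\<^sup>+t. g t * indicator {0..} t \<partial>lborel)"
proof -
  have "(\<integral>\<^sup>+z. g ((norm (z - c))\<^sup>2) \<partial>(lborel :: complex measure))
    = (\<integral>\<^sup>+t. g t \<partial>distr lborel borel (\<lambda>z::complex. (norm (z - c))\<^sup>2))"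
    using assms by (subst nn_integral_distr) auto
  also have "\<dots> = (\<integral>\<^sup>+t. (ennreal pi * indicator {0..} t) * g t \<partial>lborel)"
    unfolding distr_norm_square using assms by (subst nn_integral_density) auto
  also have "\<dots> = ennreal pi * (\<integral>\<^sup>+t. g t * indicator {0..} t \<partial>lborel)"
    using assms by (subst nn_integral_cmult[symmetric]) (auto intro!: nn_integral_cong simp: mult_ac)
  finally show ?thesis .
qed

lemma nn_integral_inverse_sqrt:
  assumes "0 < b"
  shows "(\<integral>\<^sup>+t. ennreal (1 / sqrt t) * indicator {0<..<b} t \<partial>lborel) < \<infinity>"
proof -
  have "set_integrable lborel (einterval 0 (ereal b)) (\<lambda>t. 1 / sqrt t)"
  proof (rule interval_integral_FTC_nonneg(1)[where F = "\<lambda>t. 2 * sqrt t" and A = 0 and B = "2 * sqrt b"])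
    show "DERIV (\<lambda>t. 2 * sqrt t) x :> 1 / sqrt x" if "0 < ereal x" for x
      using that by (auto intro!: derivative_eq_intros simp: field_simps)
    show "isCont (\<lambda>t. 1 / sqrt t) x" if "0 < ereal x" for x
      using that by (auto intro!: continuous_intros)
    have "((\<lambda>t. 2 * sqrt t) \<longlongrightarrow> 2 * sqrt 0) (at_right 0)" "((\<lambda>t. 2 * sqrt t) \<longlongrightarrow> 2 * sqrt b) (at_left b)"
      by (intro tendsto_intros)+
    then show "(((\<lambda>t. 2 * sqrt t) \<circ> real_of_ereal) \<longlongrightarrow> 0) (at_right 0)"
      "(((\<lambda>t. 2 * sqrt t) \<circ> real_of_ereal) \<longlongrightarrow> 2 * sqrt b) (at_left (ereal b))"
      by (simp_all add: zero_ereal_def ereal_tendsto_simps)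
    show "AE x in lborel. 0 < ereal x \<longrightarrow> ereal x < ereal b \<longrightarrow> 0 \<le> 1 / sqrt x"
      by (intro AE_I2) auto
  qed (use assms in auto)
  moreover have "einterval 0 (ereal b) = {0<..<b}" by (auto simp: einterval_def)
  ultimately have "integrable lborel (\<lambda>t. indicat_real {0<..<b} t *\<^sub>R (1 / sqrt t))"
    by (simp add: set_integrable_def)
  then have "(\<integral>\<^sup>+t. ennreal (norm (indicat_real {0<..<b} t *\<^sub>R (1 / sqrt t))) \<partial>lborel) < \<infinity>"
    by (simp only: integrable_iff_bounded)
  also have "(\<integral>\<^sup>+t. ennreal (norm (indicat_real {0<..<b} t *\<^sub>R (1 / sqrt t))) \<partial>lborel)
    = (\<integral>\<^sup>+t. ennreal (1 / sqrt t) * indicator {0<..<b} t \<partial>lborel)"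
    by (intro nn_integral_cong) (auto simp: indicator_def)
  finally show ?thesis .
qed

text \<open>In the variable t = squared distance the integrand is 1 / sqrt t. The enlarged bound R ^
  2 + 1 lets an open interval contain the value on the boundary circle, also for R = 0.\<close>

lemma inverse_norm_integrable:
  "set_integrable lborel (cball c R) (\<lambda>z::complex. 1 / norm (z - c))"
proof (cases "0 \<le> R")
  case R: True
  have "(\<integral>\<^sup>+z. ennreal (norm (indicat_real (cball c R) z *\<^sub>R (1 / norm (z - c)))) \<partial>lborel)
    \<le> (\<integral>\<^sup>+z. (\<lambda>t. ennreal (1 / sqrt t) * indicator {0<..<R\<^sup>2 + 1} t) ((norm (z - c))\<^sup>2) \<partial>lborel)"
  proof (intro nn_integral_mono)
    fix z :: complex
    show "ennreal (norm (indicat_real (cball c R) z *\<^sub>R (1 / norm (z - c))))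
      \<le> ennreal (1 / sqrt ((norm (z - c))\<^sup>2)) * indicator {0<..<R\<^sup>2 + 1} ((norm (z - c))\<^sup>2)"
    proof (cases "z \<in> cball c R \<and> z \<noteq> c")
      case True
      then have "(norm (z - c))\<^sup>2 \<le> R\<^sup>2" by (intro power_mono) (auto simp: dist_norm norm_minus_commute)
      then show ?thesis using True by (auto simp: indicator_def)
    qed (auto simp: indicator_def)
  qed
  also have "\<dots> = ennreal pi * (\<integral>\<^sup>+t. ennreal (1 / sqrt t) * indicator {0<..<R\<^sup>2 + 1} t * indicator {0..} t \<partial>lborel)"
    by (rule nn_integral_radial) auto
  also have "(\<integral>\<^sup>+t. ennreal (1 / sqrt t) * indicator {0<..<R\<^sup>2 + 1} t * indicator {0..} t \<partial>lborel)
    = (\<integral>\<^sup>+t. ennreal (1 / sqrt t) * indicator {0<..<R\<^sup>2 + 1} t \<partial>lborel)"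
    by (intro nn_integral_cong) (auto simp: indicator_def)
  also have "ennreal pi * \<dots> < \<infinity>"
    using nn_integral_inverse_sqrt[of "R\<^sup>2 + 1"]
    by (intro ennreal_mult_less_top[THEN iffD2, unfolded infinity_ennreal_def[symmetric]]) (auto simp: add_pos_nonneg add_nonneg_pos)
  finally have fin: "(\<integral>\<^sup>+z. ennreal (norm (indicat_real (cball c R) z *\<^sub>R (1 / norm (z - c)))) \<partial>lborel) < \<infinity>" .
  have "(\<lambda>z. indicat_real (cball c R) z *\<^sub>R (1 / norm (z - c))) \<in> borel_measurable lborel"
    by (intro borel_measurable_scaleR borel_measurable_indicator borel_measurable_divide borel_measurable_const)
      (auto intro!: borel_measurable_continuous_onI continuous_intros)
  then show ?thesis using fin
    unfolding set_integrable_def integrable_iff_bounded by blast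
next
  case False
  then show ?thesis by (simp add: set_integrable_def)
qed

text \<open>ln y \<le> y - 1 at y = x and at y = 1 / x. At x = 0 both sides are 0 by the conventions
  for \<open>ln\<close> and division, so no exceptional point arises in integrability
  proofs.\<close>

lemma abs_ln_le: "0 \<le> (x::real) \<Longrightarrow> \<bar>ln x\<bar> \<le> 1 / x + x"
proof -
  assume "0 \<le> x"
  show ?thesis
  proof (cases "x = 0")
    case False
    then have x: "0 < x" using \<open>0 \<le> x\<close> by simp
    have "ln x \<le> x - 1" "ln (1 / x) \<le> 1 / x - 1" using x by (auto intro!: ln_le_minus_one)
    moreover have "ln (1 / x) = - ln x" using x by (simp add: ln_div)
    moreover have "0 < 1 / x" using x by simp
    ultimately show ?thesis using x by linarith
  qed simp
qed

lemma ln_norm_integrable: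
  assumes "bounded K" "K \<in> sets borel"
  shows "set_integrable lborel K (\<lambda>z::complex. ln (norm (z - c)))"
proof -
  obtain R where R: "K \<subseteq> cball c R"
    using bounded_subset_ballD[OF assms(1), of c] ball_subset_cball by blast
  have "set_integrable lborel (cball c R) (\<lambda>z. 1 / norm (z - c) + norm (z - c))"
  proof (intro set_integral_add inverse_norm_integrable)
    show "set_integrable lborel (cball c R) (\<lambda>z. norm (z - c))"
      unfolding set_integrable_def by (intro borel_integrable_compact continuous_intros) simp
  qed
  then have "set_integrable lborel K (\<lambda>z. 1 / norm (z - c) + norm (z - c))"
    by (rule set_integrable_subset) (use R assms in auto)
  then show ?thesis
  proof (rule set_integrable_bound)
    show "set_borel_measurable lborel K (\<lambda>z. ln (norm (z - c)))"
      unfolding set_borel_measurable_def using assms(2) by measurable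
    show "AE z in lborel. z \<in> K \<longrightarrow> norm (ln (norm (z - c))) \<le> norm (1 / norm (z - c) + norm (z - c))"
      using abs_ln_le[of "norm (_ - c)"] by (intro AE_I2) (auto intro: order_trans[OF _ abs_ge_self])
  qed
qed

lemma green_identity_UNIV:
  assumes "test_function D \<phi>"
    and "\<And>z. ((\<lambda>t. u (z + t *\<^sub>R v)) has_real_derivative p z) (at 0)"
    and "\<And>z. ((\<lambda>t. p (z + t *\<^sub>R v)) has_real_derivative q z) (at 0)"
    and "continuous_on UNIV u" "continuous_on UNIV p" "continuous_on UNIV q"
  shows "integrable lborel (\<lambda>z. u z * dir_deriv v (dir_deriv v \<phi>) z)"
    and "integrable lborel (\<lambda>z. \<phi> z * q z)"
    and "(\<integral>z. u z * dir_deriv v (dir_deriv v \<phi>) z \<partial>lborel) = (\<integral>z. \<phi> z * q z \<partial>lborel)"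
proof -
  have "test_function UNIV \<phi>" using assms(1) by (simp add: test_function_def)
  from test_function_green_identity[OF open_UNIV this assms(2,3) assms(4-6)]
  show "integrable lborel (\<lambda>z. u z * dir_deriv v (dir_deriv v \<phi>) z)"
    "integrable lborel (\<lambda>z. \<phi> z * q z)"
    "(\<integral>z. u z * dir_deriv v (dir_deriv v \<phi>) z \<partial>lborel) = (\<integral>z. \<phi> z * q z \<partial>lborel)"
    by (simp_all add: set_integrable_def set_lebesgue_integral_def)
qed

text \<open>Adding d ^ 2 to the squared distance smooths the logarithm at its pole. The Laplacian of
  the smoothed function is a positive kernel of total mass 2 \<pi> that concentrates at \<zeta> as d
  tends to 0.\<close>

lemma laplacian_log_regularized:
  fixes d :: real
  assumes d: "0 < d" and \<phi>: "test_function D \<phi>"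
  shows "integrable lborel (\<lambda>z. ln ((norm (z - \<zeta>))\<^sup>2 + d\<^sup>2) / 2 * laplacian \<phi> z)"
    and "integrable lborel (\<lambda>z. \<phi> z * (2 * d\<^sup>2 / ((norm (z - \<zeta>))\<^sup>2 + d\<^sup>2)\<^sup>2))"
    and "(\<integral>z. ln ((norm (z - \<zeta>))\<^sup>2 + d\<^sup>2) / 2 * laplacian \<phi> z \<partial>lborel)
      = (\<integral>z. \<phi> z * (2 * d\<^sup>2 / ((norm (z - \<zeta>))\<^sup>2 + d\<^sup>2)\<^sup>2) \<partial>lborel)"
proof -
  define N where "N z = (norm (z - \<zeta>))\<^sup>2 + d\<^sup>2" for z
  have N: "N z = (Re z - Re \<zeta>)\<^sup>2 + (Im z - Im \<zeta>)\<^sup>2 + d\<^sup>2" for z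
    by (simp add: N_def cmod_power2)
  have Npos: "0 < N z" for z using d by (simp add: N add_nonneg_pos)
  have Nc: "continuous_on UNIV N" unfolding N_def by (intro continuous_intros)
  define u where "u z = ln (N z) / 2" for z
  have uc: "continuous_on UNIV u" unfolding u_def
    by (intro continuous_intros Nc) (use Npos in \<open>auto simp: less_imp_neq[symmetric]\<close>)
  define p1 where "p1 z = (Re z - Re \<zeta>) / N z" for z
  define p2 where "p2 z = (Im z - Im \<zeta>) / N z" for z
  define q1 where "q1 z = 1 / N z - 2 * (Re z - Re \<zeta>)\<^sup>2 / (N z)\<^sup>2" for z
  define q2 where "q2 z = 1 / N z - 2 * (Im z - Im \<zeta>)\<^sup>2 / (N z)\<^sup>2" for z
  have Nne: "N z \<noteq> 0" for z using Npos[of z] by simp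
  have cs: "continuous_on UNIV p1" "continuous_on UNIV p2" "continuous_on UNIV q1" "continuous_on UNIV q2"
    unfolding p1_def p2_def q1_def q2_def by (intro continuous_intros Nc; simp add: Nne)+
  have dN1: "((\<lambda>t. N (z + t *\<^sub>R 1)) has_real_derivative 2 * (Re z - Re \<zeta>)) (at 0)" for z
    unfolding N by (auto intro!: derivative_eq_intros)
  have dN2: "((\<lambda>t. N (z + t *\<^sub>R \<i>)) has_real_derivative 2 * (Im z - Im \<zeta>)) (at 0)" for z
    unfolding N by (auto intro!: derivative_eq_intros)
  have u1: "((\<lambda>t. u (z + t *\<^sub>R 1)) has_real_derivative p1 z) (at 0)" for z
    unfolding u_def
    by (rule DERIV_cong[OF DERIV_cdivide[OF DERIV_chain2[where f = ln, OF DERIV_ln_divide[OF Npos] dN1[of z]], of 2]])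
      (use Nne[of z] in \<open>simp add: p1_def field_simps\<close>)
  have u2: "((\<lambda>t. u (z + t *\<^sub>R \<i>)) has_real_derivative p2 z) (at 0)" for z
    unfolding u_def
    by (rule DERIV_cong[OF DERIV_cdivide[OF DERIV_chain2[where f = ln, OF DERIV_ln_divide[OF Npos] dN2[of z]], of 2]])
      (use Nne[of z] in \<open>simp add: p2_def field_simps\<close>)
  have p1: "((\<lambda>t. p1 (z + t *\<^sub>R 1)) has_real_derivative q1 z) (at 0)" for z
  proof -
    have "((\<lambda>t. Re (z + t *\<^sub>R 1) - Re \<zeta>) has_real_derivative 1) (at 0)"
      by (auto intro!: derivative_eq_intros)
    from DERIV_divide[OF this dN1 Nne] show ?thesis unfolding p1_def
      by (rule DERIV_cong) (use Nne[of z] in \<open>simp add: q1_def field_simps power2_eq_square\<close>)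
  qed
  have p2: "((\<lambda>t. p2 (z + t *\<^sub>R \<i>)) has_real_derivative q2 z) (at 0)" for z
  proof -
    have "((\<lambda>t. Im (z + t *\<^sub>R \<i>) - Im \<zeta>) has_real_derivative 1) (at 0)"
      by (auto intro!: derivative_eq_intros)
    from DERIV_divide[OF this dN2 Nne] show ?thesis unfolding p2_def
      by (rule DERIV_cong) (use Nne[of z] in \<open>simp add: q2_def field_simps power2_eq_square\<close>)
  qed
  note g1 = green_identity_UNIV[OF \<phi> u1 p1 uc cs(1,3)]
  note g2 = green_identity_UNIV[OF \<phi> u2 p2 uc cs(2,4)]
  have qq: "q1 z + q2 z = 2 * d\<^sup>2 / (N z)\<^sup>2" for z
  proof -
    have "q1 z + q2 z = (N z - 2 * (Re z - Re \<zeta>)\<^sup>2 + (N z - 2 * (Im z - Im \<zeta>)\<^sup>2)) / (N z)\<^sup>2"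
      using Nne[of z] by (simp add: q1_def q2_def add_divide_distrib diff_divide_distrib power2_eq_square[of "N z"])
    also have "N z - 2 * (Re z - Re \<zeta>)\<^sup>2 + (N z - 2 * (Im z - Im \<zeta>)\<^sup>2) = 2 * d\<^sup>2" by (simp add: N)
    finally show ?thesis .
  qed
  have "integrable lborel (\<lambda>z. u z * laplacian \<phi> z)"
    using Bochner_Integration.integrable_add[OF g1(1) g2(1)] by (simp add: laplacian_def ring_distribs)
  then show "integrable lborel (\<lambda>z. ln ((norm (z - \<zeta>))\<^sup>2 + d\<^sup>2) / 2 * laplacian \<phi> z)"
    by (simp only: u_def N_def)
  have "integrable lborel (\<lambda>z. \<phi> z * (q1 z + q2 z))"
    using Bochner_Integration.integrable_add[OF g1(2) g2(2)] by (simp add: ring_distribs)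
  then show "integrable lborel (\<lambda>z. \<phi> z * (2 * d\<^sup>2 / ((norm (z - \<zeta>))\<^sup>2 + d\<^sup>2)\<^sup>2))"
    by (simp only: qq N_def)
  have "(\<integral>z. u z * laplacian \<phi> z \<partial>lborel) = (\<integral>z. \<phi> z * (q1 z + q2 z) \<partial>lborel)"
    using Bochner_Integration.integral_add[OF g1(1) g2(1)] Bochner_Integration.integral_add[OF g1(2) g2(2)] g1(3) g2(3)
    by (simp add: laplacian_def ring_distribs)
  then show "(\<integral>z. ln ((norm (z - \<zeta>))\<^sup>2 + d\<^sup>2) / 2 * laplacian \<phi> z \<partial>lborel)
      = (\<integral>z. \<phi> z * (2 * d\<^sup>2 / ((norm (z - \<zeta>))\<^sup>2 + d\<^sup>2)\<^sup>2) \<partial>lborel)"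
    by (simp only: qq u_def N_def)
qed

text \<open>As a function of t = squared distance the kernel has the explicit antiderivative - 2 d ^
  2 / (t + d ^ 2).\<close>

lemma integral_approximate_identity:
  fixes d R :: real
  assumes d: "0 < d" and R: "0 \<le> R"
  shows "(\<integral>z. indicat_real (cball \<zeta> R) z * (2 * d\<^sup>2 / ((norm (z - \<zeta>))\<^sup>2 + d\<^sup>2)\<^sup>2) \<partial>(lborel :: complex measure))
    = 2 * pi * (R\<^sup>2 / (R\<^sup>2 + d\<^sup>2))"
proof -
  let ?g = "\<lambda>t. ennreal (2 * d\<^sup>2 / (t + d\<^sup>2)\<^sup>2) * indicator {0..R\<^sup>2} t"
  have pos: "0 < t + d\<^sup>2" if "0 \<le> t" for t using that d by (simp add: add_nonneg_pos)
  have "(\<integral>\<^sup>+z. ennreal (indicat_real (cball \<zeta> R) z * (2 * d\<^sup>2 / ((norm (z - \<zeta>))\<^sup>2 + d\<^sup>2)\<^sup>2)) \<partial>(lborel :: complex measure))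
    = (\<integral>\<^sup>+z. ?g ((norm (z - \<zeta>))\<^sup>2) \<partial>lborel)"
  proof (intro nn_integral_cong)
    fix z :: complex
    have "z \<in> cball \<zeta> R \<longleftrightarrow> (norm (z - \<zeta>))\<^sup>2 \<le> R\<^sup>2"
      using R abs_le_square_iff[of "norm (z - \<zeta>)" R] by (simp add: dist_norm norm_minus_commute)
    then show "ennreal (indicat_real (cball \<zeta> R) z * (2 * d\<^sup>2 / ((norm (z - \<zeta>))\<^sup>2 + d\<^sup>2)\<^sup>2)) = ?g ((norm (z - \<zeta>))\<^sup>2)"
      by (auto simp: indicator_def)
  qed
  also have "\<dots> = ennreal pi * (\<integral>\<^sup>+t. ?g t * indicator {0..} t \<partial>lborel)"
    by (rule nn_integral_radial) auto
  also have "(\<integral>\<^sup>+t. ?g t * indicator {0..} t \<partial>lborel) = (\<integral>\<^sup>+t. ?g t \<partial>lborel)"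
    by (intro nn_integral_cong) (auto simp: indicator_def)
  also have "\<dots> = ennreal ((- 2 * d\<^sup>2 / (R\<^sup>2 + d\<^sup>2)) - (- 2 * d\<^sup>2 / (0 + d\<^sup>2)))"
  proof (rule nn_integral_FTC_Icc)
    fix x :: real assume "x \<in> {0..R\<^sup>2}"
    then have x: "0 \<le> x" by simp
    show "((\<lambda>t. - 2 * d\<^sup>2 / (t + d\<^sup>2)) has_real_derivative 2 * d\<^sup>2 / (x + d\<^sup>2)\<^sup>2) (at x)"
      using pos[OF x] by (auto intro!: derivative_eq_intros simp: power2_eq_square)
  qed auto
  also have "(- 2 * d\<^sup>2 / (R\<^sup>2 + d\<^sup>2)) - (- 2 * d\<^sup>2 / (0 + d\<^sup>2)) = 2 * (R\<^sup>2 / (R\<^sup>2 + d\<^sup>2))"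
    using d pos[of "R\<^sup>2"] by (simp add: field_simps)
  also have "ennreal pi * ennreal (2 * (R\<^sup>2 / (R\<^sup>2 + d\<^sup>2))) = ennreal (2 * pi * (R\<^sup>2 / (R\<^sup>2 + d\<^sup>2)))"
    by (simp add: ennreal_mult[symmetric] mult_ac)
  finally show ?thesis
    by (subst integral_eq_nn_integral) (auto intro!: borel_measurable_times borel_measurable_divide borel_measurable_indicator)
qed

lemma test_function_lipschitz:
  assumes "test_function D \<phi>"
  shows "\<exists>M\<ge>0. \<forall>z w. \<bar>\<phi> z - \<phi> w\<bar> \<le> M * norm (z - w)"
proof -
  obtain K where K: "compact K" "K \<subseteq> D" "\<And>z. z \<notin> K \<Longrightarrow> \<phi> z = 0"
    "\<And>v z. z \<notin> K \<Longrightarrow> dir_deriv v \<phi> z = 0" "\<And>v z. z \<notin> K \<Longrightarrow> dir_deriv v (dir_deriv v \<phi>) z = 0"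
    using test_function_support[OF assms] by blast
  have "\<exists>M\<ge>0. \<forall>z. \<bar>dir_deriv v \<phi> z\<bar> \<le> M" for v
  proof -
    have "bounded (dir_deriv v \<phi> ` K)"
      by (intro compact_imp_bounded compact_continuous_image K(1) continuous_on_subset[OF test_function_dir_deriv(4)[OF assms]]) auto
    then obtain M where "\<forall>y\<in>dir_deriv v \<phi> ` K. norm y \<le> M" unfolding bounded_iff by blast
    then have "\<bar>dir_deriv v \<phi> z\<bar> \<le> max M 0" for z
      using K(4)[of z v] by (cases "z \<in> K") auto
    then show ?thesis by (intro exI[of _ "max M 0"]) auto
  qed
  then obtain M where M: "\<And>v. M v \<ge> 0" "\<And>v z. \<bar>dir_deriv v \<phi> z\<bar> \<le> M v" by metis
  have line: "\<bar>\<phi> (z + t *\<^sub>R v) - \<phi> z\<bar> \<le> M v * \<bar>t\<bar>" for z v t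
  proof -
    have "((\<lambda>t. \<phi> (z + t *\<^sub>R v)) has_real_derivative dir_deriv v \<phi> (z + s *\<^sub>R v)) (at s)" for s
      using test_function_dir_deriv(1)[OF assms, of "z + s *\<^sub>R v" v]
        DERIV_at_within_shift[of "\<lambda>t'. \<phi> (z + t' *\<^sub>R v)" "dir_deriv v \<phi> (z + s *\<^sub>R v)" s 0 UNIV]
      by (simp add: algebra_simps)
    then have "norm (\<phi> (z + t *\<^sub>R v) - \<phi> (z + 0 *\<^sub>R v)) \<le> M v * norm (t - 0)"
      by (intro field_differentiable_bound[where S = UNIV and f = "\<lambda>t. \<phi> (z + t *\<^sub>R v)" and f' = "\<lambda>s. dir_deriv v \<phi> (z + s *\<^sub>R v)"])
        (use M in auto)
    then show ?thesis by simp
  qed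
  have "\<bar>\<phi> z - \<phi> w\<bar> \<le> (M 1 + M \<i>) * norm (z - w)" for z w
  proof -
    have z: "z = (w + Re (z - w) *\<^sub>R 1) + Im (z - w) *\<^sub>R \<i>" by (simp add: complex_eq_iff)
    have "\<bar>\<phi> z - \<phi> w\<bar> \<le> \<bar>\<phi> z - \<phi> (w + Re (z - w) *\<^sub>R 1)\<bar> + \<bar>\<phi> (w + Re (z - w) *\<^sub>R 1) - \<phi> w\<bar>" by linarith
    also have "\<dots> \<le> M \<i> * \<bar>Im (z - w)\<bar> + M 1 * \<bar>Re (z - w)\<bar>"
      using line[of "w + Re (z - w) *\<^sub>R 1" "Im (z - w)" \<i>] line[of w "Re (z - w)" 1] z by (intro add_mono) auto
    also have "\<dots> \<le> M \<i> * norm (z - w) + M 1 * norm (z - w)"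
      using M(1) by (intro add_mono mult_left_mono abs_Im_le_cmod abs_Re_le_cmod)
    finally show ?thesis by (simp add: algebra_simps)
  qed
  then show ?thesis using M(1) by (intro exI[of _ "M 1 + M \<i>"]) auto
qed

lemma AE_lborel_neq: "AE z in lborel. z \<noteq> (c::complex)"
  by (rule AE_I[of _ _ "{c}"]) auto

text \<open>Limit d -> 0 of the regularized identity. On the left the integrable logarithm
  dominates; on the right the kernel concentrates and returns the value at \<zeta>.\<close>

lemma ln_norm_laplacian:
  assumes \<phi>: "test_function D \<phi>"
  shows "integrable lborel (\<lambda>z. ln (norm (z - \<zeta>)) * laplacian \<phi> z)"
    and "(\<integral>z. ln (norm (z - \<zeta>)) * laplacian \<phi> z \<partial>lborel) = 2 * pi * \<phi> \<zeta>"
proof -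
  obtain K where K: "compact K" "K \<subseteq> D" "\<And>z. z \<notin> K \<Longrightarrow> \<phi> z = 0"
    "\<And>v z. z \<notin> K \<Longrightarrow> dir_deriv v \<phi> z = 0" "\<And>v z. z \<notin> K \<Longrightarrow> dir_deriv v (dir_deriv v \<phi>) z = 0"
    using test_function_support[OF \<phi>] by blast
  obtain R where R: "0 < R" "K \<subseteq> cball \<zeta> R"
    using bounded_subset_ballD[OF compact_imp_bounded[OF K(1)], of \<zeta>] ball_subset_cball by blast
  define B where "B = cball \<zeta> R"
  have B: "bounded B" "B \<in> sets borel" by (auto simp: B_def)
  have \<phi>0: "\<phi> z = 0" "laplacian \<phi> z = 0" if "z \<notin> B" for z
  proof -
    have "z \<notin> K" using that R by (auto simp: B_def)
    then show "\<phi> z = 0" "laplacian \<phi> z = 0" using K by (simp_all add: laplacian_def)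
  qed
  have lc: "continuous_on UNIV (laplacian \<phi>)"
    unfolding laplacian_def[abs_def] by (intro continuous_intros test_function_dir_deriv(5)[OF \<phi>])
  have "bounded (laplacian \<phi> ` B)"
    unfolding B_def by (intro compact_imp_bounded compact_continuous_image continuous_on_subset[OF lc]) auto
  then obtain M where M: "\<forall>y\<in>laplacian \<phi> ` B. norm y \<le> M" unfolding bounded_iff by blast
  obtain M' where M': "M' \<ge> 0" "\<And>z w. \<bar>\<phi> z - \<phi> w\<bar> \<le> M' * norm (z - w)"
    using test_function_lipschitz[OF \<phi>] by blast
  define d where "d n = inverse (real (Suc n))" for n
  have d: "0 < d n" "d n \<le> 1" for n by (auto simp: d_def field_simps)
  have d_lim: "d \<longlonglongrightarrow> 0" unfolding d_def[abs_def] by (rule LIMSEQ_inverse_real_of_nat)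
  define k where "k n z = 2 * (d n)\<^sup>2 / ((norm (z - \<zeta>))\<^sup>2 + (d n)\<^sup>2)\<^sup>2" for n and z :: complex
  define L where "L n z = ln ((norm (z - \<zeta>))\<^sup>2 + (d n)\<^sup>2) / 2" for n and z :: complex
  note reg = laplacian_log_regularized[where \<zeta> = \<zeta>, OF d(1) \<phi>, folded k_def L_def]
  define w where "w z = indicat_real B z *\<^sub>R (M * (\<bar>ln (norm (z - \<zeta>))\<bar> + ln (R\<^sup>2 + 1)))" for z
  have meas: "(\<lambda>z. ln (norm (z - \<zeta>)) * laplacian \<phi> z) \<in> borel_measurable lborel"
    using lc by (intro borel_measurable_times borel_measurable_ln) (auto intro: borel_measurable_continuous_onI)
  have w_int: "integrable lborel w"
  proof -
    have "set_integrable lborel B (\<lambda>z. M * (\<bar>ln (norm (z - \<zeta>))\<bar> + ln (R\<^sup>2 + 1)))"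
    proof (intro set_integrable_mult_right set_integral_add)
      show "set_integrable lborel B (\<lambda>z. \<bar>ln (norm (z - \<zeta>))\<bar>)"
        by (rule set_integrable_abs[OF ln_norm_integrable[OF B]])
      show "set_integrable lborel B (\<lambda>z. ln (R\<^sup>2 + 1))"
        unfolding set_integrable_def B_def by (intro borel_integrable_compact) auto
    qed
    then show ?thesis unfolding w_def set_integrable_def .
  qed
  have lim: "AE z in lborel. (\<lambda>n. L n z * laplacian \<phi> z) \<longlonglongrightarrow> ln (norm (z - \<zeta>)) * laplacian \<phi> z"
    using AE_lborel_neq[of \<zeta>]
  proof eventually_elim
    case (elim z)
    have "(\<lambda>n. ln ((norm (z - \<zeta>))\<^sup>2 + (d n)\<^sup>2) / 2) \<longlonglongrightarrow> ln ((norm (z - \<zeta>))\<^sup>2 + 0\<^sup>2) / 2"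
      by (intro tendsto_intros d_lim) (use elim in auto)
    then have "(\<lambda>n. L n z) \<longlonglongrightarrow> ln (norm (z - \<zeta>))"
      using elim by (simp add: L_def ln_realpow)
    then show ?case by (intro tendsto_intros)
  qed
  have bound: "AE z in lborel. norm (L n z * laplacian \<phi> z) \<le> w z" for n
    using AE_lborel_neq[of \<zeta>]
  proof eventually_elim
    case (elim z)
    show ?case
    proof (cases "z \<in> B")
      case True
      then have r: "0 < norm (z - \<zeta>)" "norm (z - \<zeta>) \<le> R" using elim by (auto simp: B_def dist_norm norm_minus_commute)
      have "(norm (z - \<zeta>))\<^sup>2 + (d n)\<^sup>2 \<le> R\<^sup>2 + 1\<^sup>2" using r d[of n] by (intro add_mono power_mono) auto
      then have "ln ((norm (z - \<zeta>))\<^sup>2 + (d n)\<^sup>2) \<le> ln (R\<^sup>2 + 1)" using r by (subst ln_le_cancel_iff) (auto simp: add_pos_nonneg add_nonneg_pos)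
      moreover have "ln ((norm (z - \<zeta>))\<^sup>2) \<le> ln ((norm (z - \<zeta>))\<^sup>2 + (d n)\<^sup>2)"
        using r by (subst ln_le_cancel_iff) (auto simp: add_pos_nonneg)
      then have "2 * ln (norm (z - \<zeta>)) \<le> ln ((norm (z - \<zeta>))\<^sup>2 + (d n)\<^sup>2)" using r by (simp add: ln_realpow)
      moreover have "0 \<le> ln (R\<^sup>2 + 1)" by simp
      ultimately have "\<bar>L n z\<bar> \<le> \<bar>ln (norm (z - \<zeta>))\<bar> + ln (R\<^sup>2 + 1)" unfolding L_def by linarith
      moreover have "\<bar>laplacian \<phi> z\<bar> \<le> M" using M True by simp
      ultimately have "\<bar>laplacian \<phi> z\<bar> * \<bar>L n z\<bar> \<le> M * (\<bar>ln (norm (z - \<zeta>))\<bar> + ln (R\<^sup>2 + 1))"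
        by (intro mult_mono) auto
      then show ?thesis using True by (simp add: w_def abs_mult mult.commute)
    qed (simp add: \<phi>0 w_def)
  qed
  have Lm: "(\<lambda>z. L n z * laplacian \<phi> z) \<in> borel_measurable lborel" for n
    using reg(1)[of n] by (rule borel_measurable_integrable)
  show int: "integrable lborel (\<lambda>z. ln (norm (z - \<zeta>)) * laplacian \<phi> z)"
    by (rule integrable_dominated_convergence[OF meas Lm w_int lim bound])
  have lim1: "(\<lambda>n. \<integral>z. L n z * laplacian \<phi> z \<partial>lborel) \<longlonglongrightarrow> (\<integral>z. ln (norm (z - \<zeta>)) * laplacian \<phi> z \<partial>lborel)"
    by (rule integral_dominated_convergence[OF meas Lm w_int lim bound])
  define t where "t n z = indicat_real B z * ((\<phi> z - \<phi> \<zeta>) * k n z)" for n z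
  have k_cont: "continuous_on UNIV (k n)" for n
    unfolding k_def by (intro continuous_intros) (use d(1)[of n] in \<open>auto simp: add_nonneg_eq_0_iff\<close>)
  have k_int: "integrable lborel (\<lambda>z. indicat_real B z * k n z)" for n
    using borel_integrable_compact[of B "k n"] continuous_on_subset[OF k_cont] by (simp add: B_def)
  have t_int: "integrable lborel (t n)" for n
    using borel_integrable_compact[of B "\<lambda>z. (\<phi> z - \<phi> \<zeta>) * k n z"]
      continuous_on_subset[OF k_cont, of B n] continuous_on_subset[OF test_function_dir_deriv(3)[OF \<phi>], of B]
    by (simp add: B_def t_def[abs_def] continuous_intros)
  \<comment> \<open>The constant part \<phi> \<zeta> sees exactly the mass of the kernel in the
    disc; the remainder vanishes at \<zeta>.\<close>
  have split: "(\<integral>z. \<phi> z * k n z \<partial>lborel) = (\<integral>z. t n z \<partial>lborel) + \<phi> \<zeta> * (2 * pi * (R\<^sup>2 / (R\<^sup>2 + (d n)\<^sup>2)))" for n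
  proof -
    have "(\<integral>z. \<phi> z * k n z \<partial>lborel) = (\<integral>z. t n z + \<phi> \<zeta> * (indicat_real B z * k n z) \<partial>lborel)"
      using \<phi>0 by (intro Bochner_Integration.integral_cong) (auto simp: t_def indicator_def algebra_simps)
    also have "\<dots> = (\<integral>z. t n z \<partial>lborel) + \<phi> \<zeta> * (\<integral>z. indicat_real B z * k n z \<partial>lborel)"
      using t_int[of n] k_int[of n] by simp
    also have "(\<integral>z. indicat_real B z * k n z \<partial>lborel) = 2 * pi * (R\<^sup>2 / (R\<^sup>2 + (d n)\<^sup>2))"
      unfolding B_def k_def using integral_approximate_identity[OF d(1)] R by simp
    finally show ?thesis .
  qed
  have t_lim: "(\<lambda>n. \<integral>z. t n z \<partial>lborel) \<longlonglongrightarrow> (\<integral>z. 0 \<partial>(lborel :: complex measure))"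
  proof (rule integral_dominated_convergence)
    show "integrable lborel (\<lambda>z. M' * (indicat_real B z *\<^sub>R (1 / norm (z - \<zeta>))))"
      using inverse_norm_integrable[of \<zeta> R] unfolding set_integrable_def B_def by (rule integrable_mult_right)
    show "t n \<in> borel_measurable lborel" for n using t_int[of n] by (rule borel_measurable_integrable)
    show "AE z in lborel. (\<lambda>n. t n z) \<longlonglongrightarrow> 0"
      using AE_lborel_neq[of \<zeta>]
    proof eventually_elim
      case (elim z)
      have "(\<lambda>n. t n z) \<longlonglongrightarrow> indicat_real B z * ((\<phi> z - \<phi> \<zeta>) * (2 * 0\<^sup>2 / ((norm (z - \<zeta>))\<^sup>2 + 0\<^sup>2)\<^sup>2))"
        unfolding t_def k_def by (intro tendsto_intros d_lim) (use elim in auto)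
      then show ?case by simp
    qed
    show "AE z in lborel. norm (t n z) \<le> M' * (indicat_real B z *\<^sub>R (1 / norm (z - \<zeta>)))" for n
      using AE_lborel_neq[of \<zeta>]
    proof eventually_elim
      case (elim z)
      define r where "r = norm (z - \<zeta>)"
      have r: "0 < r" using elim by (simp add: r_def)
      have dn: "0 < d n" by (rule d)
      have "0 \<le> (r - d n)\<^sup>2" by simp
      \<comment> \<open>This bounds the kernel by 1 / r ^ 2 uniformly in d. The Lipschitz bound on
        \<phi> supplies one factor r, leaving the integrable majorant 1 / r.\<close>
      then have "2 * r * d n \<le> r\<^sup>2 + (d n)\<^sup>2" by (simp add: power2_diff)
      then have "(2 * r * d n)\<^sup>2 \<le> (r\<^sup>2 + (d n)\<^sup>2)\<^sup>2" using r dn by (intro power_mono) auto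
      then have "2 * (d n)\<^sup>2 / (r\<^sup>2 + (d n)\<^sup>2)\<^sup>2 \<le> 2 * (d n)\<^sup>2 / (2 * r * d n)\<^sup>2"
        using r dn by (intro divide_left_mono) (auto intro!: mult_pos_pos add_pos_pos)
      also have "\<dots> \<le> 1 / r\<^sup>2" using r dn by (simp add: power_mult_distrib field_simps)
      finally have "k n z \<le> 1 / r\<^sup>2" by (simp add: k_def r_def)
      moreover have "0 \<le> k n z" by (simp add: k_def)
      ultimately have "\<bar>\<phi> z - \<phi> \<zeta>\<bar> * k n z \<le> (M' * r) * (1 / r\<^sup>2)"
        using M' r by (intro mult_mono) (auto simp: r_def)
      also have "\<dots> = M' * (1 / r)" using r by (simp add: power2_eq_square)
      finally show ?case using \<open>0 \<le> k n z\<close> by (auto simp: t_def indicator_def abs_mult r_def)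
    qed
  qed auto
  have "(\<lambda>n. (\<integral>z. t n z \<partial>lborel) + \<phi> \<zeta> * (2 * pi * (R\<^sup>2 / (R\<^sup>2 + (d n)\<^sup>2)))) \<longlonglongrightarrow> 0 + \<phi> \<zeta> * (2 * pi * (R\<^sup>2 / (R\<^sup>2 + 0\<^sup>2)))"
    using t_lim R by (intro tendsto_intros d_lim) auto
  moreover have "0 + \<phi> \<zeta> * (2 * pi * (R\<^sup>2 / (R\<^sup>2 + 0\<^sup>2))) = 2 * pi * \<phi> \<zeta>"
    using R by simp
  ultimately have "(\<lambda>n. \<integral>z. L n z * laplacian \<phi> z \<partial>lborel) \<longlonglongrightarrow> 2 * pi * \<phi> \<zeta>"
    unfolding reg(3) split by (simp only:)
  then show "(\<integral>z. ln (norm (z - \<zeta>)) * laplacian \<phi> z \<partial>lborel) = 2 * pi * \<phi> \<zeta>"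
    using lim1 LIMSEQ_unique by blast
qed

lemma ln_cmod_has_directional_derivative:
  assumes f: "(f has_field_derivative f') (at z)" and nz: "f z \<noteq> 0"
  shows "((\<lambda>t. ln (cmod (f (z + t *\<^sub>R v)))) has_real_derivative Re (v * f' / f z)) (at 0)"
proof -
  have "((\<lambda>t::real. f (z + t *\<^sub>R v)) has_vector_derivative v * f') (at 0)"
  proof -
    have "((\<lambda>t::real. z + t *\<^sub>R v) has_vector_derivative v) (at 0)"
      by (auto intro!: derivative_eq_intros)
    from field_vector_diff_chain_at[OF this, of f f'] show ?thesis using f by (simp add: o_def)
  qed
  note d = bounded_linear.has_vector_derivative[OF bounded_linear_Re this] bounded_linear.has_vector_derivative[OF bounded_linear_Im this]
  let ?N = "\<lambda>t::real. (Re (f (z + t *\<^sub>R v)))\<^sup>2 + (Im (f (z + t *\<^sub>R v)))\<^sup>2"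
  have N0: "0 < ?N 0" using nz by (simp add: complex_neq_0)
  have "((\<lambda>t. ln (?N t) / 2) has_real_derivative Re (v * f' / f z)) (at 0)"
  proof -
    note dr = d[folded has_real_derivative_iff_has_vector_derivative]
    have "(?N has_real_derivative 2 * Re (f z) * Re (v * f') + 2 * Im (f z) * Im (v * f')) (at 0)"
      by (rule DERIV_cong[OF DERIV_add[OF DERIV_power[OF dr(1), of 2] DERIV_power[OF dr(2), of 2]]]) (simp del: times_complex.simps)
    from DERIV_cdivide[OF DERIV_chain2[where f = ln, OF DERIV_ln_divide[OF N0] this], of 2] show ?thesis
    proof (rule DERIV_cong)
      define A B where "A = Re (v * f')" and "B = Im (v * f')"
      have "Re (v * f' / f z) = (A * Re (f z) + B * Im (f z)) / ((Re (f z))\<^sup>2 + (Im (f z))\<^sup>2)"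
        by (simp add: Re_divide A_def B_def del: times_complex.simps)
      then show "1 / ?N 0 * (2 * Re (f z) * Re (v * f') + 2 * Im (f z) * Im (v * f')) / 2 = Re (v * f' / f z)"
        unfolding A_def[symmetric] B_def[symmetric]
      proof -
        assume eq: "Re (v * f' / f z) = (A * Re (f z) + B * Im (f z)) / ((Re (f z))\<^sup>2 + (Im (f z))\<^sup>2)"
        have "2 * Re (f z) * A + 2 * Im (f z) * B = 2 * (A * Re (f z) + B * Im (f z))" by (simp add: algebra_simps)
        moreover have "1 / m * (2 * s) / 2 = s / m" for m s :: real by simp
        ultimately show "1 / ?N 0 * (2 * Re (f z) * A + 2 * Im (f z) * B) / 2 = Re (v * f' / f z)"
          unfolding eq by (simp only: scale_zero_left add_0_right)
      qed
    qed
  qed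
  moreover have "ln (?N t) / 2 = ln (cmod (f (z + t *\<^sub>R v)))" for t
    by (simp add: cmod_def ln_sqrt)
  ultimately show ?thesis by simp
qed

lemma Re_holomorphic_has_directional_derivative:
  assumes "(f has_field_derivative f') (at z)"
  shows "((\<lambda>t. Re (c * f (z + t *\<^sub>R v))) has_real_derivative Re (c * v * f')) (at 0)"
proof -
  have "((\<lambda>t::real. f (z + t *\<^sub>R v)) has_vector_derivative v * f') (at 0)"
  proof -
    have "((\<lambda>t::real. z + t *\<^sub>R v) has_vector_derivative v) (at 0)"
      by (auto intro!: derivative_eq_intros)
    from field_vector_diff_chain_at[OF this, of f f'] show ?thesis using assms by (simp add: o_def)
  qed
  from bounded_linear.has_vector_derivative[OF bounded_linear_Re has_vector_derivative_mult_right[OF this, of c]]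
  show ?thesis by (simp add: has_real_derivative_iff_has_vector_derivative mult.assoc)
qed

text \<open>Along a direction v the second derivative of ln (cmod q) is Re (v ^ 2 * (q' / q)'), and
  the contributions of v = 1 and v = \<i> cancel.\<close>

lemma ln_cmod_holomorphic_laplacian:
  assumes D: "open D" and q: "q holomorphic_on D" "\<And>z. z \<in> D \<Longrightarrow> q z \<noteq> 0" and \<phi>: "test_function D \<phi>"
  shows "set_integrable lborel D (\<lambda>z. ln (cmod (q z)) * laplacian \<phi> z)"
    and "(LINT z:D|lborel. ln (cmod (q z)) * laplacian \<phi> z) = 0"
proof -
  define r where "r z = deriv q z / q z" for z
  have r: "r holomorphic_on D"
    unfolding r_def by (intro holomorphic_intros q holomorphic_deriv D)
  have r': "deriv r holomorphic_on D" by (rule holomorphic_deriv[OF r D])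
  have dq: "(q has_field_derivative deriv q z) (at z)" and dr: "(r has_field_derivative deriv r z) (at z)" if "z \<in> D" for z
    using q(1) r D that by (auto intro: holomorphic_derivI)
  have d1: "((\<lambda>t. ln (cmod (q (z + t *\<^sub>R v)))) has_real_derivative Re (v * r z)) (at 0)" if "z \<in> D" for z v
    using ln_cmod_has_directional_derivative[OF dq[OF that] q(2)[OF that], of v] by (simp add: r_def)
  have d2: "((\<lambda>t. Re (v * r (z + t *\<^sub>R v))) has_real_derivative Re (v * v * deriv r z)) (at 0)" if "z \<in> D" for z v
    by (rule Re_holomorphic_has_directional_derivative[OF dr[OF that]])
  have c: "continuous_on D (\<lambda>z. ln (cmod (q z)))" "continuous_on D (\<lambda>z. Re (v * r z))"
    "continuous_on D (\<lambda>z. Re (v * v * deriv r z))" for v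
    by (intro continuous_intros holomorphic_on_imp_continuous_on q r r'; use q(2) in simp)+
  note g = test_function_green_identity[OF D \<phi> d1 d2 c]
  show "set_integrable lborel D (\<lambda>z. ln (cmod (q z)) * laplacian \<phi> z)"
    using set_integral_add(1)[OF g(1)[of 1] g(1)[of \<i>]] by (simp add: laplacian_def ring_distribs)
  have "(LINT z:D|lborel. ln (cmod (q z)) * laplacian \<phi> z)
    = (LINT z:D|lborel. \<phi> z * Re (1 * 1 * deriv r z)) + (LINT z:D|lborel. \<phi> z * Re (\<i> * \<i> * deriv r z))"
    using set_integral_add(2)[OF g(1)[of 1] g(1)[of \<i>]] g(3)[of 1] g(3)[of \<i>] by (simp add: laplacian_def ring_distribs)
  also have "\<dots> = (LINT z:D|lborel. \<phi> z * Re (1 * 1 * deriv r z) + \<phi> z * Re (\<i> * \<i> * deriv r z))"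
    using set_integral_add(2)[OF g(2)[of 1] g(2)[of \<i>]] by simp
  also have "\<dots> = 0" by (simp add: set_lebesgue_integral_def)
  finally show "(LINT z:D|lborel. ln (cmod (q z)) * laplacian \<phi> z) = 0" .
qed

text \<open>The term with \<open>q\<close> is harmonic and the logarithmic pole contributes the
  point mass. Since \<open>u\<close> is arbitrary at \<zeta>, integrals are compared almost
  everywhere with the explicit u'.\<close>

lemma log_pole_neg_laplacian:
  assumes D: "open D" and q: "q holomorphic_on D" "\<And>z. z \<in> D \<Longrightarrow> q z \<noteq> 0"
    and u: "\<And>z. z \<in> D - {\<zeta>} \<Longrightarrow> u z = (ln (cmod (q z)) - ln (cmod (z - \<zeta>))) / (2 * pi)" and \<zeta>: "\<zeta> \<in> D"
  shows "neg_laplacian_eq_delta D \<zeta> u"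
proof -
  define u' where "u' z = (ln (cmod (q z)) - ln (cmod (z - \<zeta>))) / (2 * pi)" for z
  have Dm: "D \<in> sets borel" using D by simp
  have qc: "continuous_on D (\<lambda>z. ln (cmod (q z)))"
    by (intro continuous_intros holomorphic_on_imp_continuous_on q; use q(2) in simp)
  have ae: "AE z in lborel. indicat_real A z * (u z * g z) = indicat_real A z * (u' z * g z)" if "A \<subseteq> D" for A g
    using AE_lborel_neq[of \<zeta>] by eventually_elim (use u that in \<open>auto simp: u'_def indicator_def\<close>)
  have qm: "(\<lambda>z. indicat_real D z * ln (cmod (q z))) \<in> borel_measurable borel"
    using borel_measurable_continuous_on_indicator[OF Dm qc] by simp
  have u'm: "(\<lambda>z. indicat_real D z * u' z) \<in> borel_measurable borel"
  proof -
    have "(\<lambda>z. (indicat_real D z * ln (cmod (q z)) - indicat_real D z * ln (cmod (z - \<zeta>))) / (2 * pi)) \<in> borel_measurable borel"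
      using qm Dm by measurable
    then show ?thesis by (simp add: u'_def algebra_simps diff_divide_distrib)
  qed
  have um: "(\<lambda>z. indicat_real D z * u z) \<in> borel_measurable borel"
  proof -
    have "(\<lambda>z. if z = \<zeta> then u \<zeta> else indicat_real D z * u' z) \<in> borel_measurable borel"
      using u'm by (intro measurable_If) auto
    moreover have "(\<lambda>z. if z = \<zeta> then u \<zeta> else indicat_real D z * u' z) = (\<lambda>z. indicat_real D z * u z)"
      using u \<zeta> by (auto simp: u'_def indicator_def)
    ultimately show ?thesis by simp
  qed
  show ?thesis unfolding neg_laplacian_eq_delta_def
  proof (intro conjI allI impI)
    show "locally_integrable D u" unfolding locally_integrable_def
    proof (intro allI impI, elim conjE)
      fix K assume K: "compact K" "K \<subseteq> D"
      have Km: "K \<in> sets borel" using K(1) by (simp add: borel_compact)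
      have "set_integrable lborel K (\<lambda>z. ln (cmod (q z)) - ln (cmod (z - \<zeta>)))"
      proof (rule set_integral_diff)
        show "set_integrable lborel K (\<lambda>z. ln (cmod (q z)))"
          unfolding set_integrable_def using K by (intro borel_integrable_compact continuous_on_subset[OF qc])
        show "set_integrable lborel K (\<lambda>z. ln (cmod (z - \<zeta>)))"
          using K Km by (intro ln_norm_integrable) (auto simp: compact_imp_bounded)
      qed
      then have "set_integrable lborel K u'"
        unfolding u'_def[abs_def] by (rule set_integrable_divide) 
      then have i: "integrable lborel (\<lambda>z. indicat_real K z * (u' z * 1))" by (simp add: set_integrable_def)
      have "(\<lambda>z. indicat_real K z * (indicat_real D z * u z)) \<in> borel_measurable borel"
        using um Km by measurable
      moreover have "(\<lambda>z. indicat_real K z * (indicat_real D z * u z)) = (\<lambda>z. indicat_real K z * (u z * 1))"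
        by (rule ext) (use K(2) in \<open>auto simp: indicator_def\<close>)
      ultimately have "integrable lborel (\<lambda>z. indicat_real K z * (u z * 1))"
        using i ae[OF K(2), of "\<lambda>_. 1"]
        by (subst integrable_cong_AE) (use borel_measurable_integrable[OF i] in auto)
      then show "set_integrable lborel K u" by (simp add: set_integrable_def)
    qed
  next
    fix \<phi> assume \<phi>: "test_function D \<phi>"
    obtain K where K: "compact K" "K \<subseteq> D" "\<And>z. z \<notin> K \<Longrightarrow> \<phi> z = 0"
      "\<And>v z. z \<notin> K \<Longrightarrow> dir_deriv v \<phi> z = 0" "\<And>v z. z \<notin> K \<Longrightarrow> dir_deriv v (dir_deriv v \<phi>) z = 0"
      using test_function_support[OF \<phi>] by blast
    have lz: "laplacian \<phi> z = 0" if "z \<notin> D" for z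
    proof -
      have "z \<notin> K" using that K(2) by auto
      then show ?thesis using K by (simp add: laplacian_def)
    qed
    have lc: "continuous_on UNIV (laplacian \<phi>)"
      unfolding laplacian_def[abs_def] by (intro continuous_intros test_function_dir_deriv(5)[OF \<phi>])
    have lm: "laplacian \<phi> \<in> borel_measurable borel" using lc by (rule borel_measurable_continuous_onI)
    note ln = ln_norm_laplacian[OF \<phi>, of \<zeta>]
    have e1: "(\<lambda>z. indicat_real D z * (ln (cmod (z - \<zeta>)) * laplacian \<phi> z)) = (\<lambda>z. ln (cmod (z - \<zeta>)) * laplacian \<phi> z)"
      by (rule ext) (use lz in \<open>auto simp: indicator_def\<close>)
    have ln2: "integrable lborel (\<lambda>z. indicat_real D z * (ln (cmod (z - \<zeta>)) * laplacian \<phi> z))"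
      "(\<integral>z. indicat_real D z * (ln (cmod (z - \<zeta>)) * laplacian \<phi> z) \<partial>lborel) = 2 * pi * \<phi> \<zeta>"
      unfolding e1 by (rule ln)+
    note h = ln_cmod_holomorphic_laplacian[OF D q \<phi>, unfolded set_integrable_def set_lebesgue_integral_def real_scaleR_def]
    have "(LINT z:D|lborel. u z * laplacian \<phi> z) = (\<integral>z. indicat_real D z * (u' z * laplacian \<phi> z) \<partial>lborel)"
      unfolding set_lebesgue_integral_def real_scaleR_def
    proof (rule integral_cong_AE)
      have "(\<lambda>z. (indicat_real D z * u z) * laplacian \<phi> z) \<in> borel_measurable borel" using um lm by measurable
      then show "(\<lambda>z. indicat_real D z * (u z * laplacian \<phi> z)) \<in> borel_measurable lborel" by (simp add: mult.assoc)
      have "(\<lambda>z. (indicat_real D z * u' z) * laplacian \<phi> z) \<in> borel_measurable borel" using u'm lm by measurable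
      then show "(\<lambda>z. indicat_real D z * (u' z * laplacian \<phi> z)) \<in> borel_measurable lborel" by (simp add: mult.assoc)
    qed (rule ae[OF subset_refl])
    also have "\<dots> = (\<integral>z. (indicat_real D z * (ln (cmod (q z)) * laplacian \<phi> z)
        - indicat_real D z * (ln (cmod (z - \<zeta>)) * laplacian \<phi> z)) / (2 * pi) \<partial>lborel)"
      by (intro Bochner_Integration.integral_cong) (auto simp: u'_def algebra_simps diff_divide_distrib)
    also have "\<dots> = (0 - 2 * pi * \<phi> \<zeta>) / (2 * pi)"
      using h ln2 by simp
    also have "\<dots> = - \<phi> \<zeta>" by simp
    finally show "- (LINT z:D|lborel. u z * laplacian \<phi> z) = \<phi> \<zeta>" by simp
  qed
qed

section \<open>Bump functions and mean value kernels\<close>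

definition flat :: "real poly \<Rightarrow> real \<Rightarrow> real" where
  "flat P t = (if 0 < t then poly P (1 / t) * exp (- (1 / t)) else 0)"

lemma poly_times_exp_minus_tendsto_0: "((\<lambda>x. poly P x * exp (- x)) \<longlongrightarrow> 0) (at_top :: real filter)"
proof -
  have "((\<lambda>x. \<Sum>i\<le>degree P. coeff P i * (x ^ i / exp x)) \<longlongrightarrow> (\<Sum>i\<le>degree P. coeff P i * 0)) (at_top :: real filter)"
    by (intro tendsto_intros tendsto_power_div_exp_0)
  moreover have "poly P x * exp (- x) = (\<Sum>i\<le>degree P. coeff P i * (x ^ i / exp x))" for x :: real
    by (simp add: poly_altdef sum_distrib_right exp_minus divide_inverse mult.assoc)
  ultimately show ?thesis by simp
qed

lemma flat_tendsto_0: "(flat P \<longlongrightarrow> 0) (at_right 0)"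
proof -
  have "((\<lambda>t. poly P (inverse t) * exp (- inverse t)) \<longlongrightarrow> 0) (at_right (0::real))"
    by (rule filterlim_compose[OF poly_times_exp_minus_tendsto_0 filterlim_inverse_at_top_right])
  moreover have "\<forall>\<^sub>F t in at_right 0. poly P (inverse t) * exp (- inverse t) = flat P t"
    by (auto simp: flat_def inverse_eq_divide eventually_at_right_less intro!: eventually_at_rightI[of 0 1])
  ultimately show ?thesis by (rule Lim_transform_eventually)
qed

text \<open>The polynomial parameter absorbs the chain rule: differentiating P (1 / t) * exp (- 1 /
  t) produces the factor 1 / t ^ 2 and replaces P by P - P'. At t = 0 the right difference quotient
  is again a function of this family, for the polynomial x * P, and hence tends to 0.\<close>

lemma flat_has_derivative:
  "(flat P has_real_derivative flat ([:0, 0, 1:] * (P - pderiv P)) t) (at t)"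
proof (cases t "0::real" rule: linorder_cases)
  case less
  have "((\<lambda>t. 0) has_real_derivative 0) (at t)" by simp
  then have "(flat P has_real_derivative 0) (at t)"
    by (rule has_field_derivative_transform_within_open[where S = "{..<0}"]) (use less in \<open>auto simp: flat_def\<close>)
  then show ?thesis using less by (simp add: flat_def)
next
  case greater
  have "((\<lambda>t. poly P (1 / t) * exp (- (1 / t))) has_real_derivative
    flat ([:0, 0, 1:] * (P - pderiv P)) t) (at t)"
    using greater by (auto intro!: derivative_eq_intros poly_DERIV[THEN DERIV_chain2] simp: flat_def)
      (simp add: field_simps power2_eq_square)
  then show ?thesis
    by (rule has_field_derivative_transform_within_open[where S = "{0<..}"]) (use greater in \<open>auto simp: flat_def\<close>)
next
  case equal
  have "((\<lambda>h. flat P h / h) \<longlongrightarrow> 0) (at 0)"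
  proof (rule filterlim_split_at)
    have "\<forall>\<^sub>F h in at_left 0. 0 = flat P h / h"
      by (auto simp: flat_def intro!: eventually_at_leftI[of "-1"])
    then show "((\<lambda>h. flat P h / h) \<longlongrightarrow> 0) (at_left 0)"
      by (rule Lim_transform_eventually[rotated]) simp
    have "\<forall>\<^sub>F h in at_right 0. flat ([:0, 1:] * P) h = flat P h / h"
      by (auto simp: flat_def intro!: eventually_at_rightI[of 0 1])
    then show "((\<lambda>h. flat P h / h) \<longlongrightarrow> 0) (at_right 0)"
      by (rule Lim_transform_eventually[rotated]) (rule flat_tendsto_0)
  qed
  then show ?thesis using equal by (simp add: has_field_derivative_iff flat_def)
qed

lemma flat_continuous: "continuous_on A (flat P)"
  using flat_has_derivative DERIV_isCont continuous_at_imp_continuous_on by blast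

lemma flat_bounded: "\<exists>M\<ge>0. \<forall>t\<le>1. \<bar>flat P t\<bar> \<le> M"
proof -
  have "bounded (flat P ` {0..1})"
    by (intro compact_imp_bounded compact_continuous_image flat_continuous) auto
  then obtain M where M: "\<forall>y\<in>flat P ` {0..1}. norm y \<le> M" unfolding bounded_iff by blast
  have "\<bar>flat P t\<bar> \<le> max M 0" if "t \<le> 1" for t
    using M that by (cases "0 \<le> t") (auto simp: flat_def max.coboundedI1)
  then show ?thesis by (intro exI[of _ "max M 0"]) auto
qed

text \<open>\<open>smooth\<close> quantifies over all iterated directional derivatives, so bump
  functions are placed in a class whose members have directional derivatives in the same
  class.\<close>

inductive smooth_alg :: "(complex \<Rightarrow> real) \<Rightarrow> bool" where
  const: "smooth_alg (\<lambda>z. c)"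
| Re: "smooth_alg Re"
| Im: "smooth_alg Im"
| flat: "smooth_alg (\<lambda>z. flat P (c - d * ((Re z - a)\<^sup>2 + (Im z - b)\<^sup>2)))"
| add: "smooth_alg f \<Longrightarrow> smooth_alg g \<Longrightarrow> smooth_alg (\<lambda>z. f z + g z)"
| mult: "smooth_alg f \<Longrightarrow> smooth_alg g \<Longrightarrow> smooth_alg (\<lambda>z. f z * g z)"

lemma smooth_alg_derivative:
  assumes "smooth_alg f"
  shows "\<exists>f'. (\<forall>z. (f has_derivative f' z) (at z)) \<and> (\<forall>v. smooth_alg (\<lambda>z. f' z v))"
  using assms
proof induction
  case (const c)
  then show ?case by (intro exI[of _ "\<lambda>z h. 0"]) (auto intro: smooth_alg.const)
next
  case Re
  then show ?case by (intro exI[of _ "\<lambda>z. Re"]) (auto intro: smooth_alg.const bounded_linear_imp_has_derivative bounded_linear_Re)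
next
  case Im
  then show ?case by (intro exI[of _ "\<lambda>z. Im"]) (auto intro: smooth_alg.const bounded_linear_imp_has_derivative bounded_linear_Im)
next
  case (flat P c d a b)
  let ?Q = "[:0, 0, 1:] * (P - pderiv P)"
  define f' where "f' z h = flat ?Q (c - d * ((Re z - a)\<^sup>2 + (Im z - b)\<^sup>2)) * ((- 2 * d) * ((Re z + (- a)) * Re h + (Im z + (- b)) * Im h))" for z h
  have "((\<lambda>z. flat P (c - d * ((Re z - a)\<^sup>2 + (Im z - b)\<^sup>2))) has_derivative f' z) (at z)" for z
  proof -
    have "((\<lambda>z. c - d * ((Re z - a)\<^sup>2 + (Im z - b)\<^sup>2)) has_derivative (\<lambda>h. (- 2 * d) * ((Re z + (- a)) * Re h + (Im z + (- b)) * Im h))) (at z)"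
      by (auto intro!: derivative_eq_intros simp: algebra_simps)
    from has_derivative_compose[OF this flat_has_derivative[unfolded has_field_derivative_def]]
    show ?thesis unfolding f'_def .
  qed
  moreover have "smooth_alg (\<lambda>z. f' z v)" for v
    unfolding f'_def by (intro smooth_alg.intros)
  ultimately show ?case by blast
next
  case (add f g)
  then obtain f' g' where "\<And>z. (f has_derivative f' z) (at z)" "\<And>v. smooth_alg (\<lambda>z. f' z v)"
    "\<And>z. (g has_derivative g' z) (at z)" "\<And>v. smooth_alg (\<lambda>z. g' z v)" by metis
  then show ?case by (intro exI[of _ "\<lambda>z h. f' z h + g' z h"]) (auto intro: smooth_alg.add has_derivative_add)
next
  case (mult f g)
  then obtain f' g' where "\<And>z. (f has_derivative f' z) (at z)" "\<And>v. smooth_alg (\<lambda>z. f' z v)"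
    "\<And>z. (g has_derivative g' z) (at z)" "\<And>v. smooth_alg (\<lambda>z. g' z v)" by metis
  moreover from this have "smooth_alg (\<lambda>z. f z * g' z v + f' z v * g z)" for v
    using mult.hyps by (intro smooth_alg.add smooth_alg.mult) auto
  ultimately show ?case
    by (intro exI[of _ "\<lambda>z h. f z * g' z h + f' z h * g z"]) (auto intro: has_derivative_mult)
qed

lemma dir_deriv_eq_has_derivative:
  assumes "\<And>z. (f has_derivative f' z) (at z)"
  shows "dir_deriv v f = (\<lambda>z. f' z v)"
proof
  fix z
  have "((\<lambda>t::real. z + t *\<^sub>R v) has_derivative (\<lambda>t. t *\<^sub>R v)) (at 0)" by (auto intro!: derivative_eq_intros)
  from has_derivative_compose[OF this, of f "f' z"] assms[of z]
  have "((\<lambda>t::real. f (z + t *\<^sub>R v)) has_derivative (\<lambda>t. f' z (t *\<^sub>R v))) (at 0)" by simp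
  moreover have "(\<lambda>t. f' z (t *\<^sub>R v)) = (*) (f' z v)"
    using has_derivative_bounded_linear[OF assms[of z]] by (auto simp: linear_simps)
  ultimately have "((\<lambda>t::real. f (z + t *\<^sub>R v)) has_real_derivative f' z v) (at 0)"
    by (simp only: has_field_derivative_def)
  then show "dir_deriv v f z = f' z v" unfolding dir_deriv_def by (rule DERIV_imp_deriv)
qed

lemma smooth_alg_imp_smooth: "smooth_alg f \<Longrightarrow> smooth f"
  unfolding smooth_def
proof
  fix vs assume "smooth_alg f"
  then have "smooth_alg (foldr dir_deriv vs f)"
  proof (induction vs)
    case (Cons v vs)
    then have "smooth_alg (foldr dir_deriv vs f)" by simp
    from smooth_alg_derivative[OF this] obtain f' where
      f': "\<And>z. (foldr dir_deriv vs f has_derivative f' z) (at z)" "\<And>v. smooth_alg (\<lambda>z. f' z v)" by blast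
    show ?case using dir_deriv_eq_has_derivative[OF f'(1)] f'(2) by simp
  qed simp
  from smooth_alg_derivative[OF this] show "foldr dir_deriv vs f differentiable_on UNIV"
    by (auto simp: differentiable_on_def differentiable_def)
qed

text \<open>
  The \<open>t\<close>-derivative of \<open>mean_kernel (\<bar>z - p\<bar>\<^sup>2) t\<close> is a multiple of the Laplacian of a test function, so
  the means of a weakly harmonic function against these kernels do not depend on the radius.
\<close>

definition bump :: "complex \<Rightarrow> real \<Rightarrow> complex \<Rightarrow> real" where
  "bump p t z = flat 1 (1 - (norm (z - p))\<^sup>2 / t)"

definition mean_kernel :: "real \<Rightarrow> real \<Rightarrow> real" where
  "mean_kernel s t = flat [:0, 0, 1:] (1 - s / t) / t"

definition mean_kernel' :: "real \<Rightarrow> real \<Rightarrow> real" where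
  "mean_kernel' s t = flat ([:0, 0, 1:] * ([:0, 0, 1:] - [:0, 2:])) (1 - s / t) * s / t ^ 3
     - flat [:0, 0, 1:] (1 - s / t) / t\<^sup>2"

lemma bump_altdef: "bump p t = (\<lambda>z. flat 1 (1 - (1 / t) * ((Re z - Re p)\<^sup>2 + (Im z - Im p)\<^sup>2)))"
  by (auto simp: bump_def cmod_power2)

lemma bump_test_function:
  assumes "0 < t" "cball p (sqrt t) \<subseteq> D"
  shows "test_function D (bump p t)"
proof -
  have "{z. bump p t z \<noteq> 0} \<subseteq> cball p (sqrt t)"
  proof
    fix z assume "z \<in> {z. bump p t z \<noteq> 0}"
    then have "0 < 1 - (norm (z - p))\<^sup>2 / t" by (auto simp: bump_def flat_def split: if_splits)
    then have "(norm (z - p))\<^sup>2 \<le> t" using assms by (simp add: field_simps)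
    then show "z \<in> cball p (sqrt t)" by (simp add: dist_norm norm_minus_commute real_le_rsqrt)
  qed
  then have cl: "closure {z. bump p t z \<noteq> 0} \<subseteq> cball p (sqrt t)" by (rule closure_minimal) simp
  moreover have "smooth (bump p t)"
    unfolding bump_altdef by (intro smooth_alg_imp_smooth smooth_alg.flat)
  moreover have "compact (closure {z. bump p t z \<noteq> 0})"
    using cl compact_cball bounded_subset by (auto simp: compact_eq_bounded_closed intro: bounded_subset[OF bounded_cball])
  ultimately show ?thesis using assms(2) by (auto simp: test_function_def)
qed

lemma dir_deriv_eqI:
  assumes "\<And>z. ((\<lambda>t. f (z + t *\<^sub>R v)) has_real_derivative g z) (at 0)"
  shows "dir_deriv v f = g"
  unfolding dir_deriv_def using assms by (auto intro: DERIV_imp_deriv)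

text \<open>With s the squared distance and Q1, Q2 the polynomials of the first two derivatives of
  \<open>flat 1\<close>, the Laplacian at parameter 1 - s / t is (4 s / t ^ 2) times
  \<open>flat Q2\<close> minus (4 / t) times \<open>flat Q1\<close>. This is 4 t times the
  t-derivative of \<open>flat Q1\<close> (1 - s / t) / t.\<close>

lemma laplacian_bump:
  assumes t: "0 < t"
  shows "laplacian (bump p t) z = 4 * t * mean_kernel' ((norm (z - p))\<^sup>2) t"
proof -
  define Q1 Q2 :: "real poly" where "Q1 = [:0, 0, 1:]" and "Q2 = [:0, 0, 1:] * ([:0, 0, 1:] - [:0, 2:])"
  have f0: "(flat 1 has_real_derivative flat Q1 x) (at x)" for x
    using flat_has_derivative[of 1 x] by (simp add: Q1_def)
  have f1: "(flat Q1 has_real_derivative flat Q2 x) (at x)" for x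
    using flat_has_derivative[of Q1 x] by (simp add: Q1_def Q2_def pderiv_pCons)
  define \<sigma> where "\<sigma> z = 1 - ((Re z - Re p)\<^sup>2 + (Im z - Im p)\<^sup>2) / t" for z
  have s1: "((\<lambda>h. \<sigma> (z + h *\<^sub>R 1)) has_real_derivative - 2 * (Re z - Re p) / t) (at 0)" for z
    unfolding \<sigma>_def using t by (auto intro!: derivative_eq_intros simp: field_simps)
  have s2: "((\<lambda>h. \<sigma> (z + h *\<^sub>R \<i>)) has_real_derivative - 2 * (Im z - Im p) / t) (at 0)" for z
    unfolding \<sigma>_def using t by (auto intro!: derivative_eq_intros simp: field_simps)
  have b: "bump p t z = flat 1 (\<sigma> z)" for z by (simp add: bump_altdef \<sigma>_def)
  have d1: "dir_deriv 1 (bump p t) = (\<lambda>z. flat Q1 (\<sigma> z) * (- 2 * (Re z - Re p) / t))"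
    unfolding b using DERIV_chain2[OF f0 s1] by (intro dir_deriv_eqI) (simp add: b)
  have d2: "dir_deriv \<i> (bump p t) = (\<lambda>z. flat Q1 (\<sigma> z) * (- 2 * (Im z - Im p) / t))"
    unfolding b using DERIV_chain2[OF f0 s2] by (intro dir_deriv_eqI) (simp add: b)
  have d11: "dir_deriv 1 (dir_deriv 1 (bump p t)) z = flat Q2 (\<sigma> z) * (- 2 * (Re z - Re p) / t) * (- 2 * (Re z - Re p) / t) + (- 2 / t) * flat Q1 (\<sigma> z)"
  proof -
    have l: "((\<lambda>h. - 2 * (Re (z + h *\<^sub>R 1) - Re p) / t) has_real_derivative - 2 / t) (at 0)"
      using t by (auto intro!: derivative_eq_intros)
    show ?thesis unfolding d1 dir_deriv_def
      by (rule DERIV_imp_deriv, rule DERIV_cong[OF DERIV_mult[OF DERIV_chain2[OF f1 s1] l]]) simp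
  qed
  have d22: "dir_deriv \<i> (dir_deriv \<i> (bump p t)) z = flat Q2 (\<sigma> z) * (- 2 * (Im z - Im p) / t) * (- 2 * (Im z - Im p) / t) + (- 2 / t) * flat Q1 (\<sigma> z)"
  proof -
    have l: "((\<lambda>h. - 2 * (Im (z + h *\<^sub>R \<i>) - Im p) / t) has_real_derivative - 2 / t) (at 0)"
      using t by (auto intro!: derivative_eq_intros)
    show ?thesis unfolding d2 dir_deriv_def
      by (rule DERIV_imp_deriv, rule DERIV_cong[OF DERIV_mult[OF DERIV_chain2[OF f1 s2] l]]) simp
  qed
  define s where "s = (norm (z - p))\<^sup>2"
  have s: "s = (Re z - Re p)\<^sup>2 + (Im z - Im p)\<^sup>2" by (simp add: s_def cmod_power2)
  have "laplacian (bump p t) z = flat Q2 (\<sigma> z) * (4 * s / t\<^sup>2) - (4 / t) * flat Q1 (\<sigma> z)"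
    unfolding laplacian_def d11 d22 s using t by (simp add: field_simps power2_eq_square)
  also have "\<sigma> z = 1 - s / t" by (simp add: \<sigma>_def s)
  also have "flat Q2 (1 - s / t) * (4 * s / t\<^sup>2) - (4 / t) * flat Q1 (1 - s / t) = 4 * t * mean_kernel' s t"
    using t unfolding mean_kernel'_def Q2_def[symmetric] unfolding Q1_def[symmetric]
    by (simp add: field_simps power2_eq_square power3_eq_cube)
  finally show ?thesis by (simp add: s_def)
qed

lemma mean_kernel_has_derivative:
  assumes t: "0 < t"
  shows "(mean_kernel s has_real_derivative mean_kernel' s t) (at t)"
proof -
  define Q1 Q2 :: "real poly" where "Q1 = [:0, 0, 1:]" and "Q2 = [:0, 0, 1:] * ([:0, 0, 1:] - [:0, 2:])"
  have f1: "(flat Q1 has_real_derivative flat Q2 x) (at x)" for x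
    using flat_has_derivative[of Q1 x] by (simp add: Q1_def Q2_def pderiv_pCons)
  have "((\<lambda>t. 1 - s / t) has_real_derivative s / t\<^sup>2) (at t)"
    using t by (auto intro!: derivative_eq_intros simp: power2_eq_square)
  from DERIV_divide[OF DERIV_chain2[OF f1 this] DERIV_ident] t
  have "((\<lambda>t. flat Q1 (1 - s / t) / t) has_real_derivative
      (flat Q2 (1 - s / t) * (s / t\<^sup>2) * t - flat Q1 (1 - s / t) * 1) / (t * t)) (at t)" by simp
  then show ?thesis
    unfolding mean_kernel_def mean_kernel'_def Q2_def[symmetric] unfolding Q1_def[symmetric]
    by (rule DERIV_cong) (use t in \<open>simp add: field_simps power2_eq_square power3_eq_cube\<close>)
qed

lemma mean_kernel_eq_0: "0 < t \<Longrightarrow> t \<le> s \<Longrightarrow> mean_kernel s t = 0" "0 < t \<Longrightarrow> t \<le> s \<Longrightarrow> mean_kernel' s t = 0"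
  by (auto simp: mean_kernel_def mean_kernel'_def flat_def field_simps)

lemma mean_kernel_pos: "0 < t \<Longrightarrow> s < t \<Longrightarrow> 0 < mean_kernel s t"
proof -
  assume "0 < t" "s < t"
  then have x: "0 < 1 - s / t" by (simp add: field_simps)
  then have "flat [:0, 0, 1:] (1 - s / t) = (1 / (1 - s / t)) * (1 / (1 - s / t)) * exp (- (1 / (1 - s / t)))"
    by (simp add: flat_def)
  also have "\<dots> > 0" using x by (intro mult_pos_pos) auto
  finally show ?thesis using \<open>0 < t\<close> by (simp add: mean_kernel_def)
qed

lemma mean_kernel_nonneg: "0 < t \<Longrightarrow> 0 \<le> mean_kernel s t"
  using mean_kernel_pos[of t s] mean_kernel_eq_0(1)[of t s] by (cases "s < t") auto

text \<open>Both kernels are supported in s < t, where s / t is bounded. The height 1 / t matches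
  the area \<pi> t of the support, so the means stay bounded as t tends to 0.\<close>

lemma mean_kernel_bounds:
  "\<exists>M\<ge>0. \<forall>s t. 0 \<le> s \<longrightarrow> 0 < t \<longrightarrow> mean_kernel s t \<le> M / t \<and> \<bar>mean_kernel' s t\<bar> \<le> M / t\<^sup>2"
proof -
  define Q1 Q2 :: "real poly" where "Q1 = [:0, 0, 1:]" and "Q2 = [:0, 0, 1:] * ([:0, 0, 1:] - [:0, 2:])"
  obtain M1 where M1: "M1 \<ge> 0" "\<And>x. x \<le> 1 \<Longrightarrow> \<bar>flat Q1 x\<bar> \<le> M1" using flat_bounded[of Q1] by blast
  obtain M2 where M2: "M2 \<ge> 0" "\<And>x. x \<le> 1 \<Longrightarrow> \<bar>flat Q2 x\<bar> \<le> M2" using flat_bounded[of Q2] by blast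
  have "mean_kernel s t \<le> (M1 + M2) / t \<and> \<bar>mean_kernel' s t\<bar> \<le> (M1 + M2) / t\<^sup>2" if s: "0 \<le> s" and t: "0 < t" for s t
  proof (cases "s < t")
    case True
    have x: "1 - s / t \<le> 1" using s t by simp
    have "flat Q1 (1 - s / t) / t \<le> (M1 + M2) / t"
      using M1(2)[OF x] M2(1) t by (intro divide_right_mono) auto
    then have 1: "mean_kernel s t \<le> (M1 + M2) / t" by (simp add: mean_kernel_def Q1_def)
    have "mean_kernel' s t = (flat Q2 (1 - s / t) * (s / t) - flat Q1 (1 - s / t)) / t\<^sup>2"
      unfolding mean_kernel'_def Q2_def[symmetric] unfolding Q1_def[symmetric]
      using t by (simp add: field_simps power2_eq_square power3_eq_cube)
    moreover have "\<bar>flat Q2 (1 - s / t) * (s / t) - flat Q1 (1 - s / t)\<bar> \<le> M2 * 1 + M1"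
      using M1(2)[OF x] M2 s t True
      by (intro order_trans[OF abs_triangle_ineq4] add_mono) (auto simp only: abs_mult intro!: mult_mono M2(2) x, auto)
    ultimately have "\<bar>mean_kernel' s t\<bar> \<le> (M1 + M2) / t\<^sup>2"
      using t by (simp add: abs_divide divide_right_mono)
    with 1 show ?thesis by blast
  next
    case False
    then show ?thesis using mean_kernel_eq_0[of t s] t M1(1) M2(1) by simp
  qed
  then show ?thesis using M1(1) M2(1) by (intro exI[of _ "M1 + M2"]) auto
qed

lemma mean_kernel_continuous: "t \<noteq> 0 \<Longrightarrow> continuous_on A (\<lambda>z::complex. mean_kernel ((norm (z - p))\<^sup>2) t)"
  unfolding mean_kernel_def
  by (intro continuous_intros continuous_on_compose2[OF flat_continuous[of UNIV]]) auto

lemma mean_kernel'_continuous: "t \<noteq> 0 \<Longrightarrow> continuous_on A (\<lambda>z::complex. mean_kernel' ((norm (z - p))\<^sup>2) t)"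
  unfolding mean_kernel'_def
  by (intro continuous_intros continuous_on_compose2[OF flat_continuous[of UNIV]]) auto

lemma integrable_mult_bounded:
  fixes f h :: "complex \<Rightarrow> real"
  assumes "integrable lborel f" "h \<in> borel_measurable borel" "\<And>z. \<bar>h z\<bar> \<le> M"
  shows "integrable lborel (\<lambda>z. f z * h z)"
proof (rule Bochner_Integration.integrable_bound[OF integrable_mult_right[OF assms(1), of M]])
  show "(\<lambda>z. f z * h z) \<in> borel_measurable lborel" using assms(1,2) by (intro borel_measurable_times) auto
  have "0 \<le> M" using assms(3)[of 0] by linarith
  then show "AE z in lborel. norm (f z * h z) \<le> norm (M * f z)"
    using assms(3) by (intro AE_I2) (auto simp: abs_mult mult.commute[of "\<bar>f _\<bar>"] intro: mult_right_mono)
qed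

lemma weighted_mean_has_derivative:
  fixes f :: "complex \<Rightarrow> real"
  assumes f: "integrable lborel f" and t: "0 < t"
  shows "((\<lambda>t. \<integral>z. f z * mean_kernel ((norm (z - p))\<^sup>2) t \<partial>lborel) has_real_derivative
    (\<integral>z. f z * mean_kernel' ((norm (z - p))\<^sup>2) t \<partial>lborel)) (at t)"
proof -
  let ?k = "\<lambda>t z. mean_kernel ((norm (z - p))\<^sup>2) t" and ?k' = "\<lambda>t z. mean_kernel' ((norm (z - p))\<^sup>2) t"
  obtain M where M: "M \<ge> 0" "\<And>s t. 0 \<le> s \<Longrightarrow> 0 < t \<Longrightarrow> mean_kernel s t \<le> M / t"
     "\<And>s t. 0 \<le> s \<Longrightarrow> 0 < t \<Longrightarrow> \<bar>mean_kernel' s t\<bar> \<le> M / t\<^sup>2"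
    using mean_kernel_bounds by blast
  \<comment> \<open>By the mean value theorem this bounds every difference quotient between t and a
    parameter above t / 2; there 1 / x ^ 2 is largest at t / 2.\<close>
  define M' where "M' = M / (t / 2)\<^sup>2"
  have km: "?k t \<in> borel_measurable borel" "?k' t \<in> borel_measurable borel" if "0 < t" for t
    using that by (auto intro!: borel_measurable_continuous_onI mean_kernel_continuous mean_kernel'_continuous)
  have ki: "integrable lborel (\<lambda>z. f z * ?k t z)" if "0 < t" for t
    using M(2)[OF _ that] mean_kernel_nonneg[OF that] by (intro integrable_mult_bounded[OF f km(1)[OF that], of "M / t"]) auto
  have quot: "\<bar>(?k y z - ?k t z) / (y - t)\<bar> \<le> M'" if y: "t / 2 < y" "y \<noteq> t" for y z
  proof -
    have "norm (mean_kernel ((norm (z - p))\<^sup>2) y - mean_kernel ((norm (z - p))\<^sup>2) t) \<le> M' * norm (y - t)"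
    proof (rule field_differentiable_bound[where S = "{t/2..}" and f' = "mean_kernel' ((norm (z - p))\<^sup>2)"])
      fix x assume "x \<in> {t/2..}"
      then have x: "t / 2 \<le> x" "0 < x" using t by auto
      show "(mean_kernel ((norm (z - p))\<^sup>2) has_field_derivative mean_kernel' ((norm (z - p))\<^sup>2) x) (at x within {t/2..})"
        using mean_kernel_has_derivative[OF x(2)] by (rule has_field_derivative_at_within)
      have "\<bar>mean_kernel' ((norm (z - p))\<^sup>2) x\<bar> \<le> M / x\<^sup>2" using x by (intro M(3)) auto
      also have "\<dots> \<le> M'" unfolding M'_def using x t M(1)
        by (intro divide_left_mono power_mono) auto
      finally show "norm (mean_kernel' ((norm (z - p))\<^sup>2) x) \<le> M'" by simp
    qed (use y t in auto)
    then show ?thesis using y by (simp add: divide_le_eq)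
  qed
  show ?thesis unfolding has_field_derivative_iff tendsto_at_iff_sequentially o_def
  proof (intro allI impI)
    fix X :: "nat \<Rightarrow> real" assume X: "\<forall>i. X i \<in> UNIV - {t}" "X \<longlonglongrightarrow> t"
    obtain N where N: "\<And>n. n \<ge> N \<Longrightarrow> t / 2 < X n"
      using order_tendstoD(1)[OF X(2), of "t/2"] t by (auto simp: eventually_sequentially)
    define Y where "Y n = X (n + N)" for n
    have Y: "t / 2 < Y n" "Y n \<noteq> t" "0 < Y n" for n using N[of "n + N"] X(1) t by (auto simp: Y_def)
    have Yl: "Y \<longlonglongrightarrow> t" unfolding Y_def using X(2) by (rule LIMSEQ_ignore_initial_segment)
    have "(\<lambda>n. \<integral>z. f z * ((?k (Y n) z - ?k t z) / (Y n - t)) \<partial>lborel) \<longlonglongrightarrow> (\<integral>z. f z * ?k' t z \<partial>lborel)"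
    proof (rule integral_dominated_convergence)
      show "(\<lambda>z. f z * ?k' t z) \<in> borel_measurable lborel" using f km(2)[OF t] by (intro borel_measurable_times) auto
      show "(\<lambda>z. f z * ((?k (Y n) z - ?k t z) / (Y n - t))) \<in> borel_measurable lborel" for n
        using f km(1)[OF t] km(1)[OF Y(3)] by (intro borel_measurable_times borel_measurable_divide borel_measurable_diff) auto
      show "integrable lborel (\<lambda>z. M' * \<bar>f z\<bar>)" using f by simp
      show "AE z in lborel. norm (f z * ((?k (Y n) z - ?k t z) / (Y n - t))) \<le> M' * \<bar>f z\<bar>" for n
      proof (rule AE_I2)
        fix z
        show "norm (f z * ((?k (Y n) z - ?k t z) / (Y n - t))) \<le> M' * \<bar>f z\<bar>"
          unfolding real_norm_def abs_mult[of "f z"] mult.commute[of "\<bar>f z\<bar>"]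
          by (rule mult_right_mono[OF quot[OF Y(1,2)] abs_ge_zero])
      qed
      show "AE z in lborel. (\<lambda>n. f z * ((?k (Y n) z - ?k t z) / (Y n - t))) \<longlonglongrightarrow> f z * ?k' t z"
      proof (rule AE_I2)
        fix z
        have "((\<lambda>y. (?k y z - ?k t z) / (y - t)) \<longlongrightarrow> ?k' t z) (at t)"
          using mean_kernel_has_derivative[OF t, of "(norm (z - p))\<^sup>2"] by (simp add: has_field_derivative_iff)
        moreover have "filterlim Y (at t) sequentially"
          using Yl Y(2) by (intro filterlim_atI) auto
        ultimately have "(\<lambda>n. (?k (Y n) z - ?k t z) / (Y n - t)) \<longlonglongrightarrow> ?k' t z"
          by (rule filterlim_compose)
        then show "(\<lambda>n. f z * ((?k (Y n) z - ?k t z) / (Y n - t))) \<longlonglongrightarrow> f z * ?k' t z"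
          by (rule tendsto_mult_left)
      qed
    qed
    moreover have "(\<integral>z. f z * ((?k (Y n) z - ?k t z) / (Y n - t)) \<partial>lborel)
       = ((\<integral>z. f z * ?k (Y n) z \<partial>lborel) - (\<integral>z. f z * ?k t z \<partial>lborel)) / (Y n - t)" for n
      using ki[OF Y(3)[of n]] ki[OF t] by (simp add: right_diff_distrib diff_divide_distrib)
    ultimately have "(\<lambda>n. ((\<integral>z. f z * ?k (Y n) z \<partial>lborel) - (\<integral>z. f z * ?k t z \<partial>lborel)) / (Y n - t))
       \<longlonglongrightarrow> (\<integral>z. f z * ?k' t z \<partial>lborel)" by (simp only:)
    then show "(\<lambda>n. ((\<integral>z. f z * ?k (X n) z \<partial>lborel) - (\<integral>z. f z * ?k t z \<partial>lborel)) / (X n - t))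
       \<longlonglongrightarrow> (\<integral>z. f z * ?k' t z \<partial>lborel)" unfolding Y_def by (rule LIMSEQ_offset)
  qed
qed

section \<open>Weakly harmonic functions and uniqueness of the Green function\<close>

definition weakly_harmonic :: "complex set \<Rightarrow> (complex \<Rightarrow> real) \<Rightarrow> bool" where
  "weakly_harmonic D W \<longleftrightarrow> locally_integrable D W \<and>
     (\<forall>\<phi>. test_function D \<phi> \<longrightarrow> (LINT z:D|lborel. W z * laplacian \<phi> z) = 0)"

text \<open>The constant function exp 1 has logarithm 1, so this is the holomorphic case with a
  constant.\<close>

lemma laplacian_integral_0:
  assumes "open D" "test_function D \<phi>"
  shows "set_integrable lborel D (laplacian \<phi>)" "(LINT z:D|lborel. laplacian \<phi> z) = 0"
  using ln_cmod_holomorphic_laplacian[OF assms(1) holomorphic_on_const[of "exp 1"] _ assms(2)] by auto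

text \<open>The weighted mean of W - L is constant in the squared radius t, because its t-derivative
  tests W against a bump. As t tends to 0 it is controlled by the oscillation of W - L near p.
  Formulating this with a limit at p lets p be the pole itself, where the value of W is
  arbitrary.\<close>

lemma weakly_harmonic_mean_value:
  assumes D: "open D" "cball p r \<subseteq> D" "0 < r" and W: "weakly_harmonic D W" and lim: "(W \<longlongrightarrow> L) (at p)"
  shows "(\<integral>z. (indicat_real (cball p r) z * (W z - L)) * mean_kernel ((norm (z - p))\<^sup>2) (r\<^sup>2) \<partial>lborel) = 0"
proof -
  define f where "f z = indicat_real (cball p r) z * (W z - L)" for z
  have fint: "integrable lborel f"
  proof -
    have "set_integrable lborel (cball p r) (\<lambda>z. W z - L)"
    proof (rule set_integral_diff)
      show "set_integrable lborel (cball p r) W" using W D by (auto simp: weakly_harmonic_def locally_integrable_def)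
      show "set_integrable lborel (cball p r) (\<lambda>z. L)"
        unfolding set_integrable_def by (intro borel_integrable_compact) auto
    qed
    then show ?thesis by (simp add: set_integrable_def f_def[abs_def])
  qed
  define J where "J t = (\<integral>z. f z * mean_kernel ((norm (z - p))\<^sup>2) t \<partial>lborel)" for t
  have J': "(J has_real_derivative 0) (at t)" if t: "0 < t" "t \<le> r\<^sup>2" for t
  proof -
    have sq: "sqrt t \<le> r" using t D(3) by (simp add: real_le_lsqrt)
    then have "cball p (sqrt t) \<subseteq> D" using D(2) by (meson order_trans subset_cball)
    then have test: "test_function D (bump p t)" by (rule bump_test_function[OF t(1)])
    have lap: "laplacian (bump p t) z = 4 * t * mean_kernel' ((norm (z - p))\<^sup>2) t" for z
      by (rule laplacian_bump[OF t(1)])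
    have supp: "mean_kernel' ((norm (z - p))\<^sup>2) t = 0" if "z \<notin> cball p r" for z
    proof (rule mean_kernel_eq_0(2)[OF t(1)])
      have "r < norm (z - p)" using that by (simp add: dist_norm norm_minus_commute)
      then have "r\<^sup>2 \<le> (norm (z - p))\<^sup>2" using D(3) by (intro power_mono) auto
      then show "t \<le> (norm (z - p))\<^sup>2" using t by simp
    qed
    have mk: "(\<lambda>z. mean_kernel' ((norm (z - p))\<^sup>2) t) \<in> borel_measurable borel"
      using t by (intro borel_measurable_continuous_onI mean_kernel'_continuous) auto
    obtain M where "\<And>s t. 0 \<le> s \<Longrightarrow> 0 < t \<Longrightarrow> \<bar>mean_kernel' s t\<bar> \<le> M / t\<^sup>2"
      using mean_kernel_bounds by blast
    then have Mt: "\<bar>mean_kernel' ((norm (z - p))\<^sup>2) t\<bar> \<le> M / t\<^sup>2" for z using t by simp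
    have i1: "integrable lborel (\<lambda>z. indicat_real (cball p r) z * W z)"
      using W D by (auto simp: weakly_harmonic_def locally_integrable_def set_integrable_def)
    have i2: "integrable lborel (\<lambda>z. (indicat_real (cball p r) z * W z) * mean_kernel' ((norm (z - p))\<^sup>2) t)"
      by (rule integrable_mult_bounded[OF i1 mk Mt])
    have i3: "integrable lborel (\<lambda>z. mean_kernel' ((norm (z - p))\<^sup>2) t)"
      and z3: "(\<integral>z. mean_kernel' ((norm (z - p))\<^sup>2) t \<partial>lborel) = 0"
    proof -
      have e: "(\<lambda>z. indicat_real D z * laplacian (bump p t) z) = (\<lambda>z. 4 * t * mean_kernel' ((norm (z - p))\<^sup>2) t)"
      proof
        fix z
        show "indicat_real D z * laplacian (bump p t) z = 4 * t * mean_kernel' ((norm (z - p))\<^sup>2) t"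
          using supp[of z] D(2) by (cases "z \<in> cball p r") (auto simp: lap indicator_def subset_iff)
      qed
      show "integrable lborel (\<lambda>z. mean_kernel' ((norm (z - p))\<^sup>2) t)"
        using laplacian_integral_0(1)[OF D(1) test] t unfolding set_integrable_def real_scaleR_def e by simp
      show "(\<integral>z. mean_kernel' ((norm (z - p))\<^sup>2) t \<partial>lborel) = 0"
        using laplacian_integral_0(2)[OF D(1) test] t unfolding set_lebesgue_integral_def real_scaleR_def e by simp
    qed
    have "(\<integral>z. f z * mean_kernel' ((norm (z - p))\<^sup>2) t \<partial>lborel)
      = (\<integral>z. (indicat_real (cball p r) z * W z) * mean_kernel' ((norm (z - p))\<^sup>2) t - L * mean_kernel' ((norm (z - p))\<^sup>2) t \<partial>lborel)"
      by (intro Bochner_Integration.integral_cong) (use supp in \<open>auto simp: f_def indicator_def algebra_simps\<close>)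
    also have "\<dots> = (\<integral>z. (indicat_real (cball p r) z * W z) * mean_kernel' ((norm (z - p))\<^sup>2) t \<partial>lborel)"
      using i2 i3 z3 by simp
    also have "\<dots> = 0"
    proof -
      have "(LINT z:D|lborel. W z * laplacian (bump p t) z) = 0" using W test by (simp add: weakly_harmonic_def)
      moreover have "(\<lambda>z. indicat_real D z * (W z * laplacian (bump p t) z))
         = (\<lambda>z. 4 * t * ((indicat_real (cball p r) z * W z) * mean_kernel' ((norm (z - p))\<^sup>2) t))"
      proof
        fix z
        show "indicat_real D z * (W z * laplacian (bump p t) z)
          = 4 * t * ((indicat_real (cball p r) z * W z) * mean_kernel' ((norm (z - p))\<^sup>2) t)"
          using supp[of z] D(2) by (cases "z \<in> cball p r") (auto simp: lap indicator_def subset_iff)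
      qed
      ultimately show ?thesis using t unfolding set_lebesgue_integral_def real_scaleR_def by simp
    qed
    finally have "(\<integral>z. f z * mean_kernel' ((norm (z - p))\<^sup>2) t \<partial>lborel) = 0" .
    then show ?thesis
      using weighted_mean_has_derivative[OF fint t(1), of p] by (simp add: J_def[abs_def])
  qed
  obtain M where M: "M \<ge> 0" "\<And>s t. 0 \<le> s \<Longrightarrow> 0 < t \<Longrightarrow> mean_kernel s t \<le> M / t"
    using mean_kernel_bounds by blast
  have "\<bar>J (r\<^sup>2)\<bar> \<le> e" if "0 < e" for e
  proof -
    \<comment> \<open>M \<pi> bounds the mass of the kernel, height M / t on a disc of area \<pi> t;
      the summand 1 keeps the denominator positive when M = 0.\<close>
    define e' where "e' = e / (M * pi + 1)"
    have M\<pi>: "0 < M * pi + 1" using M(1) by (simp add: add_nonneg_pos)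
    have e': "0 < e'" "e' * (M * pi) \<le> e"
      using that M\<pi> mult_left_mono[of "M * pi" "M * pi + 1" e]
      by (simp_all add: e'_def pos_divide_le_eq del: distrib_left)
    obtain \<delta> where \<delta>: "0 < \<delta>" "\<And>z. z \<noteq> p \<Longrightarrow> dist z p < \<delta> \<Longrightarrow> \<bar>W z - L\<bar> < e'"
      using lim e'(1) unfolding Lim_at dist_real_def by (metis zero_less_dist_iff)
    define t where "t = (min r (\<delta> / 2))\<^sup>2"
    have t: "0 < t" "t \<le> r\<^sup>2" using D(3) \<delta>(1) by (auto simp: t_def intro!: power_mono)
    have st: "sqrt t < \<delta>" "sqrt t \<le> r" using D(3) \<delta>(1) by (auto simp: t_def)
    have "J (r\<^sup>2) = J t"
    proof (cases "t = r\<^sup>2")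
      case False
      then have lt: "t < r\<^sup>2" using t by simp
      show ?thesis
      proof (rule DERIV_isconst_end[OF lt])
        show "continuous_on {t..r\<^sup>2} J"
        proof (intro continuous_at_imp_continuous_on ballI)
          fix x assume "x \<in> {t..r\<^sup>2}"
          then show "isCont J x" using DERIV_isCont[OF J'[of x]] t by auto
        qed
      qed (use J' t in auto)
    qed simp
    also have "\<bar>J t\<bar> \<le> (\<integral>z. indicat_real (cball p (sqrt t)) z * (e' * (M / t)) \<partial>lborel)"
      unfolding J_def
    proof (rule integral_abs_bound[THEN order_trans], rule integral_mono_AE')
      show "integrable lborel (\<lambda>z. indicat_real (cball p (sqrt t)) z * (e' * (M / t)))"
        by (intro integrable_mult_left integrable_real_indicator) (auto simp: emeasure_lborel_cball_finite[unfolded infinity_ennreal_def])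
      show "AE z in lborel. \<bar>f z * mean_kernel ((norm (z - p))\<^sup>2) t\<bar> \<le> indicat_real (cball p (sqrt t)) z * (e' * (M / t))"
        using AE_lborel_neq[of p]
      proof eventually_elim
        case (elim z)
        show ?case
        proof (cases "z \<in> cball p (sqrt t)")
          case True
          have "\<bar>f z\<bar> \<le> e'"
            using \<delta>(2)[OF elim] True st by (auto simp: f_def indicator_def dist_commute)
          moreover have "\<bar>mean_kernel ((norm (z - p))\<^sup>2) t\<bar> \<le> M / t"
            using M(2)[of "(norm (z - p))\<^sup>2" t] mean_kernel_nonneg[OF t(1), of "(norm (z - p))\<^sup>2"] t by simp
          ultimately have "\<bar>f z\<bar> * \<bar>mean_kernel ((norm (z - p))\<^sup>2) t\<bar> \<le> e' * (M / t)"
            using e'(1) by (intro mult_mono) auto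
          then show ?thesis using True by (simp add: abs_mult)
        next
          case False
          then have "sqrt t < norm (z - p)" by (simp add: dist_norm norm_minus_commute)
          then have "(sqrt t)\<^sup>2 < (norm (z - p))\<^sup>2" using t by (intro power_strict_mono) auto
          then show ?thesis using False mean_kernel_eq_0(1)[OF t(1)] t by simp
        qed
      qed
      show "AE z in lborel. 0 \<le> indicat_real (cball p (sqrt t)) z * (e' * (M / t))"
        using e'(1) M(1) t(1) by (intro AE_I2) simp
    qed
    also have "\<dots> = e' * (M * pi)"
    proof -
      have "measure lborel (cball p (sqrt t)) = pi * t"
        using t content_cball[of "sqrt t" p] by (simp add: unit_ball_vol_2)
      then show ?thesis using t by simp
    qed
    also have "\<dots> \<le> e" by (rule e'(2))
    finally show ?thesis .
  qed
  then have "J (r\<^sup>2) = 0" by (meson abs_le_zero_iff field_le_epsilon abs_ge_zero antisym dense_ge)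
  then show ?thesis by (simp add: J_def f_def)
qed

lemma mean_kernel_support:
  assumes "0 < r" "z \<notin> cball p r"
  shows "mean_kernel ((norm (z - p))\<^sup>2) (r\<^sup>2) = 0"
proof (rule mean_kernel_eq_0(1))
  have "r < norm (z - p)" using assms(2) by (simp add: dist_norm norm_minus_commute)
  then show "r\<^sup>2 \<le> (norm (z - p))\<^sup>2" using assms(1) by (intro power_mono) auto
qed (use assms in simp)

lemma mean_kernel_integrable:
  assumes "0 < r"
  shows "integrable lborel (\<lambda>z::complex. mean_kernel ((norm (z - p))\<^sup>2) (r\<^sup>2))"
proof (rule integrable_compact_support)
  show "continuous_on UNIV (\<lambda>z::complex. mean_kernel ((norm (z - p))\<^sup>2) (r\<^sup>2))"
    using assms by (intro mean_kernel_continuous) simp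
  show "mean_kernel ((norm (z - p))\<^sup>2) (r\<^sup>2) = 0" if "norm z > norm p + r" for z
  proof (rule mean_kernel_support[OF assms])
    have "norm z - norm p \<le> norm (z - p)" by (rule norm_triangle_ineq2)
    then show "z \<notin> cball p r" using that by (simp add: dist_norm norm_minus_commute)
  qed
qed

lemma continuous_integral_pos:
  fixes g :: "complex \<Rightarrow> real"
  assumes g: "integrable lborel g" "\<And>z. 0 \<le> g z" and p: "0 < g p" and S: "open S" "p \<in> S" "continuous_on S g"
  shows "0 < (\<integral>z. g z \<partial>lborel)"
proof -
  have "isCont g p" using S by (simp add: continuous_on_eq_continuous_at)
  then obtain d where d: "d > 0" "\<And>z. dist z p < d \<Longrightarrow> dist (g z) (g p) < g p / 2"
    unfolding continuous_at_eps_delta using p half_gt_zero by blast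
  have "0 < (\<integral>z. indicat_real (ball p d) z * (g p / 2) \<partial>lborel)"
    using d(1) p content_ball_pos[of d p] by simp
  also have "\<dots> \<le> (\<integral>z. g z \<partial>lborel)"
  proof (rule integral_mono)
    show "integrable lborel (\<lambda>z. indicat_real (ball p d) z * (g p / 2))"
      by (intro integrable_mult_left integrable_real_indicator) (auto simp: emeasure_lborel_ball_finite[unfolded infinity_ennreal_def])
    show "indicat_real (ball p d) z * (g p / 2) \<le> g z" for z
    proof (cases "z \<in> ball p d")
      case True
      then have "\<bar>g z - g p\<bar> < g p / 2" using d(2)[of z] by (simp add: dist_real_def dist_commute)
      then have "g p / 2 \<le> g z" by linarith
      then show ?thesis using True by simp
    qed (use g(2) in simp)
  qed (use g in auto)
  finally show ?thesis .
qed

lemma mean_kernel_integral_pos: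
  assumes "0 < r"
  shows "0 < (\<integral>z. mean_kernel ((norm (z - p))\<^sup>2) (r\<^sup>2) \<partial>(lborel :: complex measure))"
proof (rule continuous_integral_pos[where p = p and S = UNIV])
  show "integrable lborel (\<lambda>z. mean_kernel ((norm (z - p))\<^sup>2) (r\<^sup>2))" by (rule mean_kernel_integrable[OF assms])
  show "0 \<le> mean_kernel ((norm (z - p))\<^sup>2) (r\<^sup>2)" for z
    by (rule mean_kernel_nonneg) (use assms in simp)
  show "0 < mean_kernel ((norm (p - p))\<^sup>2) (r\<^sup>2)" by (rule mean_kernel_pos) (use assms in simp_all)
  show "continuous_on UNIV (\<lambda>z. mean_kernel ((norm (z - p))\<^sup>2) (r\<^sup>2))"
    by (rule mean_kernel_continuous) (use assms in simp)
qed auto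

lemma mean_kernel_integral_translate:
  assumes "0 < r"
  shows "(\<integral>z. mean_kernel ((norm (z - p))\<^sup>2) (r\<^sup>2) \<partial>(lborel :: complex measure))
     = (\<integral>z. mean_kernel ((norm z)\<^sup>2) (r\<^sup>2) \<partial>(lborel :: complex measure))"
proof -
  have "(\<lambda>z::complex. mean_kernel ((norm (z - p))\<^sup>2) (r\<^sup>2)) \<in> borel_measurable borel"
    using mean_kernel_integrable[OF assms, of p] by simp
  from lborel_integral_translate[OF this, of p] show ?thesis by simp
qed

text \<open>Near \<zeta> the values of W equal its kernel means with one common radius. Such a mean
  is an integral of a fixed integrable function against a kernel depending continuously on the
  centre, so it is continuous at \<zeta> as well. Radius R / 2 keeps all discs inside the disc of
  radius R.\<close>

lemma weakly_harmonic_removable: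
  assumes D: "open D" "\<zeta> \<in> D" and W: "weakly_harmonic D W" "continuous_on (D - {\<zeta>}) W"
  shows "\<exists>L. (W \<longlongrightarrow> L) (at \<zeta>)"
proof -
  obtain R where R: "0 < R" "cball \<zeta> R \<subseteq> D" using D open_contains_cball by blast
  define r where "r = R / 2"
  have r: "0 < r" using R by (simp add: r_def)
  have r2: "r\<^sup>2 \<noteq> 0" "0 < r\<^sup>2" using r by auto
  let ?k = "\<lambda>p (z::complex). mean_kernel ((norm (z - p))\<^sup>2) (r\<^sup>2)"
  define \<kappa> where "\<kappa> = (\<integral>z. mean_kernel ((norm z)\<^sup>2) (r\<^sup>2) \<partial>(lborel :: complex measure))"
  have \<kappa>: "(\<integral>z. ?k p z \<partial>lborel) = \<kappa>" for p
    unfolding \<kappa>_def by (rule mean_kernel_integral_translate[OF r])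
  have \<kappa>pos: "0 < \<kappa>" using mean_kernel_integral_pos[OF r, of 0] by (simp add: \<kappa>_def)
  define f where "f z = indicat_real (cball \<zeta> R) z * W z" for z
  have f: "integrable lborel f"
    using W(1) R(2) by (auto simp: weakly_harmonic_def locally_integrable_def set_integrable_def f_def[abs_def])
  obtain M where "\<And>s t. 0 \<le> s \<Longrightarrow> 0 < t \<Longrightarrow> mean_kernel s t \<le> M / t" using mean_kernel_bounds by blast
  then have M: "\<bar>?k p z\<bar> \<le> M / r\<^sup>2" for p z using mean_kernel_nonneg[OF r2(2)] r2 by simp
  have km: "?k p \<in> borel_measurable borel" for p
    using r2 by (intro borel_measurable_continuous_onI mean_kernel_continuous) auto
  define m where "m p = (\<integral>z. f z * ?k p z \<partial>lborel)" for p
  have Wm: "W p = m p / \<kappa>" if p: "p \<in> ball \<zeta> r - {\<zeta>}" for p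
  proof -
    have sub: "cball p r \<subseteq> cball \<zeta> R"
    proof
      fix z assume "z \<in> cball p r"
      then show "z \<in> cball \<zeta> R" using p dist_triangle[of \<zeta> z p] by (simp add: r_def)
    qed
    have pD: "p \<in> D - {\<zeta>}" using p R r by (auto simp: r_def)
    have "open (D - {\<zeta>})" using D by (simp add: open_delete)
    then have "isCont W p" using W(2) pD by (simp add: continuous_on_eq_continuous_at)
    then have "(W \<longlongrightarrow> W p) (at p)" by (simp add: isCont_def)
    from weakly_harmonic_mean_value[OF D(1) _ r W(1) this] sub R(2)
    have "(\<integral>z. (indicat_real (cball p r) z * (W z - W p)) * ?k p z \<partial>lborel) = 0" by blast
    moreover have "(\<integral>z. (indicat_real (cball p r) z * (W z - W p)) * ?k p z \<partial>lborel)
       = (\<integral>z. f z * ?k p z - W p * ?k p z \<partial>lborel)"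
    proof (rule Bochner_Integration.integral_cong)
      fix z
      show "(indicat_real (cball p r) z * (W z - W p)) * ?k p z = f z * ?k p z - W p * ?k p z"
        using mean_kernel_support[OF r, of z p] sub by (cases "z \<in> cball p r") (auto simp: f_def indicator_def algebra_simps subset_iff)
    qed simp
    moreover have "\<dots> = m p - W p * \<kappa>"
      using integrable_mult_bounded[OF f km M] mean_kernel_integrable[OF r, of p] by (simp add: m_def \<kappa>)
    ultimately show ?thesis using \<kappa>pos by (simp add: field_simps)
  qed
  have "(m \<longlongrightarrow> m \<zeta>) (at \<zeta>)"
    unfolding tendsto_at_iff_sequentially o_def
  proof (intro allI impI)
    fix X :: "nat \<Rightarrow> complex" assume X: "\<forall>i. X i \<in> UNIV - {\<zeta>}" "X \<longlonglongrightarrow> \<zeta>"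
    show "(\<lambda>n. m (X n)) \<longlonglongrightarrow> m \<zeta>" unfolding m_def
    proof (rule integral_dominated_convergence)
      show "integrable lborel (\<lambda>z. M / r\<^sup>2 * \<bar>f z\<bar>)" using f by simp
      show "AE z in lborel. norm (f z * ?k (X n) z) \<le> M / r\<^sup>2 * \<bar>f z\<bar>" for n
        
      proof (rule AE_I2)
        fix z
        show "norm (f z * ?k (X n) z) \<le> M / r\<^sup>2 * \<bar>f z\<bar>"
          unfolding real_norm_def abs_mult mult.commute[of "\<bar>f z\<bar>"]
          by (rule mult_right_mono[OF M abs_ge_zero])
      qed
      show "AE z in lborel. (\<lambda>n. f z * ?k (X n) z) \<longlonglongrightarrow> f z * ?k \<zeta> z"
      proof (rule AE_I2)
        fix z
        have "continuous_on UNIV (\<lambda>p::complex. mean_kernel ((norm (p - z))\<^sup>2) (r\<^sup>2))" by (rule mean_kernel_continuous[OF r2(1)])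
        then have "isCont (\<lambda>p::complex. mean_kernel ((norm (p - z))\<^sup>2) (r\<^sup>2)) \<zeta>" by (simp add: continuous_on_eq_continuous_at)
        from isCont_tendsto_compose[OF this X(2)]
        show "(\<lambda>n. f z * ?k (X n) z) \<longlonglongrightarrow> f z * ?k \<zeta> z" by (intro tendsto_mult_left) (simp add: norm_minus_commute)
      qed
    qed (use f km in \<open>auto intro!: borel_measurable_times\<close>)
  qed
  then have "((\<lambda>p. m p / \<kappa>) \<longlongrightarrow> m \<zeta> / \<kappa>) (at \<zeta>)" using \<kappa>pos by (intro tendsto_intros) auto
  moreover have "\<forall>\<^sub>F p in at \<zeta>. m p / \<kappa> = W p"
    using eventually_at_ball[OF r, of \<zeta> UNIV] eventually_neq_at_within[of \<zeta> \<zeta> UNIV]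
    by eventually_elim (simp add: Wm)
  ultimately have "(W \<longlongrightarrow> m \<zeta> / \<kappa>) (at \<zeta>)" by (rule Lim_transform_eventually)
  then show ?thesis by blast
qed

text \<open>A positive value is compared with the compact set outside of which W stays below it. The
  continuous extension over \<zeta> then attains its supremum over D in a compact set, to which the
  mean value property is applied.\<close>

lemma weakly_harmonic_max_principle:
  assumes D: "open D" "\<zeta> \<in> D" and W: "weakly_harmonic D W" "continuous_on (D - {\<zeta>}) W"
    and small: "\<And>\<eta>. \<eta> > 0 \<Longrightarrow> \<exists>K. compact K \<and> K \<subseteq> D \<and> (\<forall>z\<in>D - K - {\<zeta>}. W z < \<eta>)"
    and z: "z \<in> D - {\<zeta>}"
  shows "W z \<le> 0"
proof (rule ccontr)
  assume "\<not> W z \<le> 0"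
  then have \<eta>: "0 < W z" by simp
  obtain L where L: "(W \<longlongrightarrow> L) (at \<zeta>)" using weakly_harmonic_removable[OF D W] by blast
  define V where "V w = (if w = \<zeta> then L else W w)" for w
  have Vlim: "(W \<longlongrightarrow> V p) (at p)" and Vcont: "isCont V p" if "p \<in> D" for p
  proof -
    show l: "(W \<longlongrightarrow> V p) (at p)"
    proof (cases "p = \<zeta>")
      case False
      have "open (D - {\<zeta>})" using D by (simp add: open_delete)
      then have "isCont W p" using W(2) that False by (simp add: continuous_on_eq_continuous_at)
      then show ?thesis using False by (simp add: isCont_def V_def)
    qed (use L in \<open>simp add: V_def\<close>)
    have "\<forall>\<^sub>F w in at p. W w = V w"
    proof (cases "p = \<zeta>")
      case True
      show ?thesis using eventually_neq_at_within[of p p UNIV] by eventually_elim (simp add: V_def True)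
    next
      case False
      show ?thesis using eventually_neq_at_within[of \<zeta> p UNIV] by eventually_elim (simp add: V_def)
    qed
    from Lim_transform_eventually[OF l this] show "isCont V p" by (simp add: isCont_def)
  qed
  have Vc: "continuous_on D V" using Vcont by (simp add: continuous_at_imp_continuous_on)
  obtain K0 where K0: "compact K0" "K0 \<subseteq> D" "\<And>w. w \<in> D - K0 - {\<zeta>} \<Longrightarrow> W w < W z"
    using small[OF \<eta>] by blast
  define K where "K = insert \<zeta> K0"
  have K: "compact K" "K \<subseteq> D" "\<And>w. w \<in> D - K \<Longrightarrow> V w < W z"
    using K0 D(2) by (auto simp: K_def V_def)
  have zK: "z \<in> K" using z K(3)[of z] by (auto simp: V_def)
  have VKc: "continuous_on K V" using continuous_on_subset[OF Vc K(2)] .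
  obtain p0 where p0: "p0 \<in> K" "\<And>w. w \<in> K \<Longrightarrow> V w \<le> V p0"
    using continuous_attains_sup[OF K(1) _ VKc] zK by blast
  define S where "S = V p0"
  have zS: "W z \<le> S" using p0(2)[OF zK] z by (simp add: S_def V_def)
  have VS: "V w \<le> S" if "w \<in> D" for w
    using that p0(2)[of w] K(3)[of w] zS by (cases "w \<in> K") (auto simp: S_def)
  define M where "M = {w\<in>K. V w = S}"
  have "closed M" unfolding M_def using continuous_closed_preimage_constant[OF VKc compact_imp_closed[OF K(1)]] by simp
  moreover have "K \<inter> M = M" by (auto simp: M_def)
  ultimately have "compact M" using compact_Int_closed[OF K(1), of M] by simp
  moreover have "p0 \<in> M" using p0 by (simp add: M_def S_def)
  \<comment> \<open>Taking the rightmost maximum point guarantees that points immediately to its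
    right, such as \<open>b\<close>, have strictly smaller values. The kernel is positive there,
    which contradicts the mean value property at \<open>p\<close>.\<close>
  ultimately obtain p where p: "p \<in> M" "\<And>w. w \<in> M \<Longrightarrow> Re w \<le> Re p"
    using continuous_attains_sup[of M Re] continuous_on_Re[OF continuous_on_id] by (metis empty_iff id_apply)
  have pD: "p \<in> D" using p(1) K(2) by (auto simp: M_def)
  obtain r where r: "0 < r" "cball p r \<subseteq> D" using D(1) pD open_contains_cball by blast
  define b where "b = p + of_real (r / 2)"
  have b: "b \<in> ball p r" "b \<in> D" "Re p < Re b"
    using r by (auto simp: b_def dist_norm subset_iff)
  have "b \<notin> M" using p(2)[of b] b(3) by auto
  then have Vb: "V b < S" using VS[OF b(2)] K(3)[OF DiffI[OF b(2)]] zS by (cases "b \<in> K") (auto simp: M_def)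
  let ?k = "\<lambda>z::complex. mean_kernel ((norm (z - p))\<^sup>2) (r\<^sup>2)"
  define g where "g w = (indicat_real (cball p r) w * (S - V w)) * ?k w" for w
  have r2: "0 < r\<^sup>2" "r\<^sup>2 \<noteq> 0" using r by auto
  have "0 < (\<integral>w. g w \<partial>lborel)"
  proof (rule continuous_integral_pos[where p = b and S = "ball p r"])
    have cb: "continuous_on (cball p r) (\<lambda>w. (S - V w) * ?k w)"
      using r2 by (intro continuous_intros continuous_on_subset[OF Vc r(2)] mean_kernel_continuous) auto
    show "integrable lborel g"
      using borel_integrable_compact[OF compact_cball cb] by (simp add: g_def[abs_def] mult.assoc)
    show "continuous_on (ball p r) g"
      by (rule continuous_on_eq[OF continuous_on_subset[OF cb ball_subset_cball]]) (auto simp: g_def)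
    show "0 \<le> g w" for w
      using VS r(2) mean_kernel_nonneg[OF r2(1)] by (cases "w \<in> cball p r") (auto simp: g_def subset_iff intro!: mult_nonneg_nonneg)
    have "norm (b - p) = r / 2" using r by (simp add: b_def)
    then have "0 < ?k b" using r by (intro mean_kernel_pos) (auto simp: power2_eq_square intro!: mult_strict_mono)
    then show "0 < g b" using Vb b by (auto simp: g_def)
  qed (use b in auto)
  moreover have "(\<integral>w. g w \<partial>lborel) = - (\<integral>w. (indicat_real (cball p r) w * (W w - V p)) * ?k w \<partial>lborel)"
  proof -
    have "(\<integral>w. g w \<partial>lborel) = (\<integral>w. - ((indicat_real (cball p r) w * (W w - V p)) * ?k w) \<partial>lborel)"
    proof (rule integral_cong_AE)
      have "integrable lborel (\<lambda>w. indicat_real (cball p r) w * W w)"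
        using W(1) r(2) by (auto simp: weakly_harmonic_def locally_integrable_def set_integrable_def)
      from borel_measurable_integrable[OF this]
      have m1: "(\<lambda>w. indicat_real (cball p r) w * W w) \<in> borel_measurable borel" by simp
      have m2: "?k \<in> borel_measurable borel"
        using r2 by (intro borel_measurable_continuous_onI mean_kernel_continuous) auto
      have m3: "indicat_real (cball p r) \<in> borel_measurable borel" by (rule borel_measurable_indicator) simp
      have "(\<lambda>w. - ((indicat_real (cball p r) w * W w - indicat_real (cball p r) w * V p) * ?k w)) \<in> borel_measurable borel"
        by (rule borel_measurable_uminus[OF borel_measurable_times[OF borel_measurable_diff[OF m1 borel_measurable_times[OF m3 borel_measurable_const]] m2]])
      then show "(\<lambda>w. - ((indicat_real (cball p r) w * (W w - V p)) * ?k w)) \<in> borel_measurable lborel"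
        by (simp add: right_diff_distrib)
      have "continuous_on (cball p r) (\<lambda>w. (S - V w) * ?k w)"
        using r2 by (intro continuous_intros continuous_on_subset[OF Vc r(2)] mean_kernel_continuous) auto
      from borel_measurable_integrable[OF borel_integrable_compact[OF compact_cball this]]
      show "g \<in> borel_measurable lborel" by (simp add: g_def[abs_def] mult.assoc)
      show "AE w in lborel. g w = - ((indicat_real (cball p r) w * (W w - V p)) * ?k w)"
        using AE_lborel_neq[of \<zeta>] by eventually_elim (use p(1) in \<open>auto simp: g_def V_def M_def indicator_def algebra_simps\<close>)
    qed
    then show ?thesis by simp
  qed
  ultimately show False
    using weakly_harmonic_mean_value[OF D(1) r(2,1) W(1) Vlim[OF pD]] by simp
qed

lemma locally_integrable_laplacian_integrable:
  assumes "locally_integrable D u" "test_function D \<phi>"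
  shows "set_integrable lborel D (\<lambda>z. u z * laplacian \<phi> z)"
proof -
  obtain K where K: "compact K" "K \<subseteq> D" "\<And>z. z \<notin> K \<Longrightarrow> \<phi> z = 0"
    "\<And>v z. z \<notin> K \<Longrightarrow> dir_deriv v \<phi> z = 0" "\<And>v z. z \<notin> K \<Longrightarrow> dir_deriv v (dir_deriv v \<phi>) z = 0"
    using test_function_support[OF assms(2)] by blast
  have l0: "laplacian \<phi> z = 0" if "z \<notin> K" for z using K(5)[OF that] by (simp add: laplacian_def)
  have lc: "continuous_on UNIV (laplacian \<phi>)"
    unfolding laplacian_def[abs_def] by (intro continuous_intros test_function_dir_deriv(5)[OF assms(2)])
  have "bounded (laplacian \<phi> ` K)"
    by (intro compact_imp_bounded compact_continuous_image continuous_on_subset[OF lc] K(1)) auto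
  then obtain M where M: "\<forall>y\<in>laplacian \<phi> ` K. norm y \<le> M" unfolding bounded_iff by blast
  have "integrable lborel (\<lambda>z. (indicat_real K z * u z) * laplacian \<phi> z)"
  proof (rule integrable_mult_bounded[where M = "max M 0"])
    show "integrable lborel (\<lambda>z. indicat_real K z * u z)"
      using assms(1) K(1,2) by (auto simp: locally_integrable_def set_integrable_def)
    show "laplacian \<phi> \<in> borel_measurable borel" using lc by (rule borel_measurable_continuous_onI)
    show "\<bar>laplacian \<phi> z\<bar> \<le> max M 0" for z
      using M l0[of z] by (cases "z \<in> K") (auto simp: max.coboundedI1)
  qed
  moreover have "(indicat_real K z * u z) * laplacian \<phi> z = indicat_real D z *\<^sub>R (u z * laplacian \<phi> z)" for z
    using l0[of z] K(2) by (cases "z \<in> K") (auto simp: indicator_def subset_iff)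
  ultimately show ?thesis by (simp add: set_integrable_def)
qed

text \<open>For a competitor v the poles cancel in u - v, which is therefore weakly harmonic across
  \<zeta>; as v > 0, it lies below u. Smallness of u off compact subsets of D handles the finite
  boundary and infinity at once, so the maximum principle gives minimality.\<close>

lemma green_function_eqI:
  assumes D: "open D" "\<zeta> \<in> D" and q: "q holomorphic_on D" "\<And>z. z \<in> D \<Longrightarrow> q z \<noteq> 0"
    and u: "\<And>z. z \<in> D - {\<zeta>} \<Longrightarrow> u z = (ln (cmod (q z)) - ln (cmod (z - \<zeta>))) / (2 * pi)"
    and pos: "\<And>z. z \<in> D - {\<zeta>} \<Longrightarrow> 0 < u z"
    and small: "\<And>\<eta>. \<eta> > 0 \<Longrightarrow> \<exists>K. compact K \<and> K \<subseteq> D \<and> (\<forall>z\<in>D - K - {\<zeta>}. u z < \<eta>)"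
    and z: "z \<in> D - {\<zeta>}"
  shows "green_function D z \<zeta> = u z"
proof -
  have nl: "neg_laplacian_eq_delta D \<zeta> u" by (rule log_pole_neg_laplacian[OF D(1) q u D(2)])
  have uc: "continuous_on (D - {\<zeta>}) u"
  proof -
    have "continuous_on (D - {\<zeta>}) (\<lambda>z. (ln (cmod (q z)) - ln (cmod (z - \<zeta>))) / (2 * pi))"
      by (intro continuous_intros continuous_on_subset[OF holomorphic_on_imp_continuous_on[OF q(1)]]) (use q(2) in auto)
    then show ?thesis by (rule continuous_on_eq) (use u in simp)
  qed
  have sol: "positive_dirichlet_solution D \<zeta> u"
    unfolding positive_dirichlet_solution_def
  proof (intro conjI ballI uc nl)
    fix p assume p: "p \<in> frontier D"
    show "(u \<longlongrightarrow> 0) (at p within D)"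
    proof (rule tendstoI)
      fix e :: real assume e: "0 < e"
      obtain K where K: "compact K" "K \<subseteq> D" "\<And>z. z \<in> D - K - {\<zeta>} \<Longrightarrow> u z < e"
        using small[OF e] by blast
      have "p \<notin> D" using p D(1) by (simp add: frontier_def interior_open)
      then have "p \<in> - insert \<zeta> K" using K D(2) by auto
      moreover have "open (- insert \<zeta> K)" using K(1) by (intro open_Compl compact_imp_closed compact_insert)
      ultimately have "\<forall>\<^sub>F z in at p within D. z \<in> - insert \<zeta> K"
        unfolding eventually_at_topological by blast
      moreover have "\<forall>\<^sub>F z in at p within D. z \<in> D" by (simp add: eventually_at_filter)
      ultimately show "\<forall>\<^sub>F z in at p within D. dist (u z) 0 < e"
        by eventually_elim (use K(3) pos in force)
    qed
  qed (use pos in auto)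
  have green: "is_green_function D \<zeta> u"
    unfolding is_green_function_def
  proof (intro conjI allI impI ballI sol)
    fix v z assume v: "positive_dirichlet_solution D \<zeta> v" and z: "z \<in> D - {\<zeta>}"
    have li: "locally_integrable D u" "locally_integrable D v"
      using nl v by (auto simp: positive_dirichlet_solution_def neg_laplacian_eq_delta_def)
    have "u z - v z \<le> 0"
    proof (rule weakly_harmonic_max_principle[OF D _ _ _ z])
      show "weakly_harmonic D (\<lambda>z. u z - v z)"
        unfolding weakly_harmonic_def
      proof (intro conjI allI impI)
        show "locally_integrable D (\<lambda>z. u z - v z)"
          using li by (auto simp: locally_integrable_def intro: set_integral_diff)
        fix \<phi> assume \<phi>: "test_function D \<phi>"
        have "(LINT z:D|lborel. u z * laplacian \<phi> z) = (LINT z:D|lborel. v z * laplacian \<phi> z)"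
          using nl v \<phi> by (auto simp: positive_dirichlet_solution_def neg_laplacian_eq_delta_def) (metis minus_equation_iff)
        then show "(LINT z:D|lborel. (u z - v z) * laplacian \<phi> z) = 0"
          using set_integral_diff(2)[OF locally_integrable_laplacian_integrable[OF li(1) \<phi>] locally_integrable_laplacian_integrable[OF li(2) \<phi>]]
          by (simp add: left_diff_distrib)
      qed
      show "continuous_on (D - {\<zeta>}) (\<lambda>z. u z - v z)"
        using uc v by (auto simp: positive_dirichlet_solution_def intro: continuous_on_diff)
      fix \<eta> :: real assume \<eta>: "0 < \<eta>"
      obtain K where K: "compact K" "K \<subseteq> D" "\<And>z. z \<in> D - K - {\<zeta>} \<Longrightarrow> u z < \<eta>"
        using small[OF \<eta>] by blast
      have "u z - v z < \<eta>" if "z \<in> D - K - {\<zeta>}" for z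
      proof -
        have "0 < v z" using v that by (auto simp: positive_dirichlet_solution_def)
        then show ?thesis using K(3)[OF that] by linarith
      qed
      then show "\<exists>K. compact K \<and> K \<subseteq> D \<and> (\<forall>z\<in>D - K - {\<zeta>}. u z - v z < \<eta>)" using K by blast
    qed
    then show "u z \<le> v z" by simp
  qed
  \<comment> \<open>Two minimal solutions bound each other, so the representative picked by
    \<open>SOME\<close> agrees with u off the pole.\<close>
  define v where "v = (SOME u. is_green_function D \<zeta> u)"
  have v: "is_green_function D \<zeta> v" unfolding v_def by (rule someI[where P = "is_green_function D \<zeta>", OF green])
  have "u z \<le> v z" "v z \<le> u z"
    using green v z by (auto simp: is_green_function_def)
  then show ?thesis unfolding green_function_def v_def[symmetric] by simp
qed

section \<open>Green and Robin functions through a map to the half plane\<close>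

lemma cmod_reflected_diff: "(cmod (w - cnj w0))\<^sup>2 = (cmod (w - w0))\<^sup>2 + 4 * Im w * Im w0"
  unfolding cmod_power2 by (simp add: power2_eq_square algebra_simps)

text \<open>Closed hyperbolic discs, the superlevel sets of the half plane Green function with pole
  w0. They are bounded since the left side grows quadratically in the distance from w0 and the right
  side linearly; c > 0 forces Im w > 0 away from w0.\<close>

lemma compact_hyperbolic_disc:
  assumes c: "0 < c" and w0: "0 < Im w0"
  shows "compact {w. c * (cmod (w - w0))\<^sup>2 \<le> 4 * Im w * Im w0}" (is "compact ?T")
    and "{w. c * (cmod (w - w0))\<^sup>2 \<le> 4 * Im w * Im w0} \<subseteq> {w. 0 < Im w}"
proof -
  have cl: "closed ?T" by (intro closed_Collect_le continuous_intros)
  define b where "b = 4 * Im w0 / c"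
  have b: "0 < b" using c w0 by (simp add: b_def)
  have "?T \<subseteq> cball w0 (b + Im w0)"
  proof
    fix w assume w: "w \<in> ?T"
    define r where "r = cmod (w - w0)"
    have r0: "0 \<le> r" by (simp add: r_def)
    have "Im w = Im w0 + Im (w - w0)" by simp
    then have "Im w \<le> Im w0 + r" using abs_Im_le_cmod[of "w - w0"] unfolding r_def by linarith
    then have "4 * Im w * Im w0 \<le> 4 * (Im w0 + r) * Im w0" using w0 by (intro mult_right_mono) auto
    then have "c * r\<^sup>2 \<le> 4 * (Im w0 + r) * Im w0" using w unfolding r_def by simp
    then have rb: "r\<^sup>2 \<le> b * (Im w0 + r)" using c by (simp add: b_def field_simps)
    have "r \<le> b + Im w0"
    proof (rule ccontr)
      assume "\<not> r \<le> b + Im w0"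
      then have r: "b + Im w0 < r" by simp
      have "b * (Im w0 + r) \<le> r * Im w0 + b * r" using r w0 b by (simp add: distrib_left mult_right_mono)
      also have "\<dots> = r * (b + Im w0)" by (simp add: algebra_simps)
      also have "\<dots> < r * r" using r b w0 by (intro mult_strict_left_mono) auto
      finally show False using rb by (simp add: power2_eq_square)
    qed
    then show "w \<in> cball w0 (b + Im w0)" by (simp add: r_def dist_norm norm_minus_commute)
  qed
  then show "compact ?T" using cl bounded_subset[OF bounded_cball] by (simp add: compact_eq_bounded_closed)
  show "?T \<subseteq> {w. 0 < Im w}"
  proof
    fix w assume w: "w \<in> ?T"
    show "w \<in> {w. 0 < Im w}"
    proof (cases "w = w0")
      case False
      then have "0 < c * (cmod (w - w0))\<^sup>2" using c by simp
      also have "\<dots> \<le> 4 * Im w * Im w0" using w by simp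
      finally have "0 < 4 * Im w * Im w0" .
      then show ?thesis using w0 by (simp add: zero_less_mult_iff)
    qed (use w0 in simp)
  qed
qed

text \<open>Continuity of \<open>g\<close> carries compact hyperbolic discs back to compact subsets
  of D, which provides the decay condition of \<open>green_function_eqI\<close>.\<close>

locale half_plane_map =
  fixes D :: "complex set" and e g :: "complex \<Rightarrow> complex"
  assumes D: "open D" and e: "e holomorphic_on D" "\<And>z. z \<in> D \<Longrightarrow> 0 < Im (e z)" "\<And>z. z \<in> D \<Longrightarrow> g (e z) = z"
    and g: "continuous_on {w. 0 < Im w} g" "\<And>w. 0 < Im w \<Longrightarrow> g w \<in> D" "\<And>w. 0 < Im w \<Longrightarrow> e (g w) = w"
begin

lemma inj: "inj_on e D"
  by (rule inj_on_inverseI) (rule e(3))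

lemma deriv_nonzero: "z \<in> D \<Longrightarrow> deriv e z \<noteq> 0"
  by (rule holomorphic_injective_imp_regular[OF e(1) D inj])

lemma green_function_eq:
  assumes \<zeta>: "\<zeta> \<in> D" and z: "z \<in> D - {\<zeta>}"
  shows "green_function D z \<zeta> = ln (cmod (e z - cnj (e \<zeta>)) / cmod (e z - e \<zeta>)) / (2 * pi)"
proof (rule green_function_eqI[OF D \<zeta> _ _ _ _ _ z])
  \<comment> \<open>Divides out the simple zero of e - e \<zeta> at \<zeta>. Injectivity makes the
    quotient zero-free, so it can serve as a denominator of the holomorphic factor q.\<close>
  define dq where "dq z = (if z = \<zeta> then deriv e \<zeta> else (e z - e \<zeta>) / (z - \<zeta>))" for z
  have ne: "e z \<noteq> e \<zeta>" if "z \<in> D - {\<zeta>}" for z using inj that \<zeta> by (auto simp: inj_on_def)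
  have nr: "e z \<noteq> cnj (e \<zeta>)" if "z \<in> D" for z
    using e(2)[OF that] e(2)[OF \<zeta>] by (auto simp: complex_eq_iff)
  have dq: "dq holomorphic_on D" unfolding dq_def by (rule pole_lemma_open[OF e(1) D])
  have dq0: "dq z \<noteq> 0" if "z \<in> D" for z using ne[of z] deriv_nonzero[OF \<zeta>] that by (auto simp: dq_def)
  show "(\<lambda>z. (e z - cnj (e \<zeta>)) / dq z) holomorphic_on D"
    by (intro holomorphic_intros e(1) dq dq0)
  show "(e z - cnj (e \<zeta>)) / dq z \<noteq> 0" if "z \<in> D" for z using dq0[OF that] nr[OF that] by simp
  show "ln (cmod (e z - cnj (e \<zeta>)) / cmod (e z - e \<zeta>)) / (2 * pi)
      = (ln (cmod ((e z - cnj (e \<zeta>)) / dq z)) - ln (cmod (z - \<zeta>))) / (2 * pi)" if "z \<in> D - {\<zeta>}" for z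
    using that ne[OF that] nr[of z] by (simp add: dq_def norm_divide norm_mult ln_div ln_mult)
  have sq: "(cmod (e z - cnj (e \<zeta>)) / cmod (e z - e \<zeta>))\<^sup>2 = 1 + 4 * Im (e z) * Im (e \<zeta>) / (cmod (e z - e \<zeta>))\<^sup>2"
    if "z \<in> D - {\<zeta>}" for z
    using ne[OF that] by (simp add: power_divide cmod_reflected_diff add_divide_distrib)
  show "0 < ln (cmod (e z - cnj (e \<zeta>)) / cmod (e z - e \<zeta>)) / (2 * pi)" if "z \<in> D - {\<zeta>}" for z
  proof -
    have "0 < 4 * Im (e z) * Im (e \<zeta>) / (cmod (e z - e \<zeta>))\<^sup>2"
      using e(2)[of z] e(2)[OF \<zeta>] ne[OF that] that by simp
    then have "1\<^sup>2 < (cmod (e z - cnj (e \<zeta>)) / cmod (e z - e \<zeta>))\<^sup>2" unfolding sq[OF that] by simp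
    then have "1 < cmod (e z - cnj (e \<zeta>)) / cmod (e z - e \<zeta>)" by (rule power2_less_imp_less) simp
    then show ?thesis by (simp add: ln_gt_zero)
  qed
  show "\<exists>K. compact K \<and> K \<subseteq> D \<and> (\<forall>z\<in>D - K - {\<zeta>}. ln (cmod (e z - cnj (e \<zeta>)) / cmod (e z - e \<zeta>)) / (2 * pi) < \<eta>)"
    if "0 < \<eta>" for \<eta>
  proof -
    \<comment> \<open>The Green function is below \<eta> exactly when the squared quotient of
      distances is below 1 + c.\<close>
    define c where "c = (exp (2 * pi * \<eta>))\<^sup>2 - 1"
    have "1 < exp (2 * pi * \<eta>)" using that by simp
    then have c: "0 < c" using power_strict_mono[of 1 "exp (2 * pi * \<eta>)" 2] by (simp add: c_def)
    define T where "T = {w. c * (cmod (w - e \<zeta>))\<^sup>2 \<le> 4 * Im w * Im (e \<zeta>)}"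
    have T: "compact T" "T \<subseteq> {w. 0 < Im w}"
      unfolding T_def using compact_hyperbolic_disc[OF c e(2)[OF \<zeta>]] by auto
    show ?thesis
    proof (intro exI[of _ "g ` T"] conjI ballI)
      show "compact (g ` T)" by (rule compact_continuous_image[OF continuous_on_subset[OF g(1) T(2)] T(1)])
      show "g ` T \<subseteq> D" using g(2) T(2) by auto
      fix z assume z: "z \<in> D - g ` T - {\<zeta>}"
      then have zD: "z \<in> D - {\<zeta>}" by auto
      have "e z \<notin> T" using z e(3)[of z] by force
      then have "4 * Im (e z) * Im (e \<zeta>) / (cmod (e z - e \<zeta>))\<^sup>2 < c"
        using ne[OF zD] by (simp add: T_def divide_less_eq)
      then have "(cmod (e z - cnj (e \<zeta>)) / cmod (e z - e \<zeta>))\<^sup>2 < (exp (2 * pi * \<eta>))\<^sup>2"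
        unfolding sq[OF zD] by (simp add: c_def)
      then have lt: "cmod (e z - cnj (e \<zeta>)) / cmod (e z - e \<zeta>) < exp (2 * pi * \<eta>)"
        by (rule power2_less_imp_less) simp
      have "0 < cmod (e z - cnj (e \<zeta>)) / cmod (e z - e \<zeta>)" using ne[OF zD] nr[of z] zD by simp
      then have "ln (cmod (e z - cnj (e \<zeta>)) / cmod (e z - e \<zeta>)) < ln (exp (2 * pi * \<eta>))"
        using lt by (subst ln_less_cancel_iff) auto
      then show "ln (cmod (e z - cnj (e \<zeta>)) / cmod (e z - e \<zeta>)) / (2 * pi) < \<eta>"
        by (simp add: divide_less_eq mult.commute)
    qed
  qed
qed

text \<open>The moving variable is the pole \<zeta>. The added logarithm of \<bar>z - \<zeta>\<bar>
  combines with the distance of the images into a difference quotient, whose limit is e'; the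
  reflected distance tends to 2 * Im (e z).\<close>

lemma robin_function_eq:
  assumes z: "z \<in> D"
  shows "robin_function D z = ln (2 * Im (e z) / cmod (deriv e z)) / (2 * pi)"
proof -
  have dz: "deriv e z \<noteq> 0" by (rule deriv_nonzero[OF z])
  have d: "(e has_field_derivative deriv e z) (at z)" by (rule holomorphic_derivI[OF e(1) D z])
  have "((\<lambda>\<zeta>. (e \<zeta> - e z) / (\<zeta> - z)) \<longlongrightarrow> deriv e z) (at z)" using d by (simp add: has_field_derivative_iff)
  moreover have "(e \<longlongrightarrow> e z) (at z)" using DERIV_isCont[OF d] by (simp add: isCont_def)
  ultimately have "((\<lambda>\<zeta>. ln (cmod (e z - cnj (e \<zeta>)) / cmod ((e \<zeta> - e z) / (\<zeta> - z))) / (2 * pi))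
    \<longlongrightarrow> ln (cmod (e z - cnj (e z)) / cmod (deriv e z)) / (2 * pi)) (at z)"
    by (intro tendsto_intros) (use dz e(2)[OF z] in \<open>auto simp: complex_eq_iff\<close>)
  moreover have "cmod (e z - cnj (e z)) = 2 * Im (e z)"
    using e(2)[OF z] by (simp add: complex_diff_cnj norm_mult)
  moreover have "\<forall>\<^sub>F \<zeta> in at z. ln (cmod (e z - cnj (e \<zeta>)) / cmod ((e \<zeta> - e z) / (\<zeta> - z))) / (2 * pi)
     = green_function D z \<zeta> + 1 / (2 * pi) * ln (cmod (z - \<zeta>))"
    using eventually_at_in_open'[OF D z] eventually_neq_at_within[of z z UNIV]
  proof eventually_elim
    case (elim \<zeta>)
    have ne: "e z \<noteq> e \<zeta>" using inj elim z by (auto simp: inj_on_def)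
    have nr: "e z \<noteq> cnj (e \<zeta>)" using e(2)[OF z] e(2)[OF elim(1)] by (auto simp: complex_eq_iff)
    have "green_function D z \<zeta> = ln (cmod (e z - cnj (e \<zeta>)) / cmod (e z - e \<zeta>)) / (2 * pi)"
      using elim z by (intro green_function_eq) auto
    moreover have "cmod ((e \<zeta> - e z) / (\<zeta> - z)) = cmod (e z - e \<zeta>) / cmod (z - \<zeta>)"
      by (simp add: norm_divide norm_minus_commute)
    moreover have "ln (a / (b / c)) / (2 * pi) = ln (a / b) / (2 * pi) + 1 / (2 * pi) * ln c"
      if "0 < a" "0 < b" "0 < c" for a b c :: real
      using that by (simp add: ln_div ln_mult add_divide_distrib diff_divide_distrib)
    ultimately show ?case using ne nr elim by simp
  qed
  ultimately have "((\<lambda>\<zeta>. green_function D z \<zeta> + 1 / (2 * pi) * ln (cmod (z - \<zeta>)))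
     \<longlongrightarrow> ln (2 * Im (e z) / cmod (deriv e z)) / (2 * pi)) (at z)"
    using Lim_transform_eventually by fastforce
  then show ?thesis unfolding robin_function_def by (intro tendsto_Lim) simp_all
qed

end

section \<open>The Robin function of a straightened channel\<close>

text \<open>The bound 1/2 on F' - 1 makes F injective and expanding up to a factor 2. The condition
  on \<epsilon> makes the upper boundary a graph with Lipschitz constant below 1; the two together
  keep the image below that graph. The width 5/4 exceeds \<rho> \<le> 21/20, so the closed strip
  lies inside.\<close>

locale channel_map =
  fixes n :: nat and a \<epsilon> \<rho> :: real and F :: "complex \<Rightarrow> complex"
  assumes n: "2 \<le> n" and \<rho>: "\<bar>\<rho> - 1\<bar> \<le> 1/20" and \<epsilon>: "\<bar>\<epsilon>\<bar> * (1 + \<bar>a\<bar> * real n) < 1"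
    and F_holo: "F holomorphic_on {w. \<bar>Im w\<bar> < 5/4}"
    and F_odd: "\<And>w. \<bar>Im w\<bar> < 5/4 \<Longrightarrow> F (- w) = - F w"
    and F_cnj: "\<And>w. \<bar>Im w\<bar> < 5/4 \<Longrightarrow> F (cnj w) = cnj (F w)"
    and F_periodic: "\<And>w. \<bar>Im w\<bar> < 5/4 \<Longrightarrow> F (w + 2 * pi) = F w + 2 * pi"
    and F_top: "\<And>u::real. Im (F (u + \<i> * \<rho>)) = 1 + \<epsilon> * (cos (Re (F (u + \<i> * \<rho>))) + a * cos (real n * Re (F (u + \<i> * \<rho>))))"
    and F_deriv: "\<And>w. \<bar>Im w\<bar> < 5/4 \<Longrightarrow> cmod (deriv F w - 1) \<le> 1/2"
begin

definition U where "U = {w::complex. \<bar>Im w\<bar> < 5/4}"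
definition S where "S = {w::complex. 0 < Im w \<and> Im w < \<rho>}"
definition \<kappa> where "\<kappa> = pi / \<rho>"
definition T where "T w = deriv (deriv F) w / deriv F w"
definition h where "h x = cos x + a * cos (real n * x)"

lemma \<rho>_bounds: "19/20 \<le> \<rho>" "\<rho> \<le> 21/20" "0 < \<rho>"
  using \<rho> by linarith+

lemma \<kappa>_bounds: "2 < \<kappa>" "\<kappa> < 4" "0 < \<kappa>" "\<kappa> * \<rho> = pi"
proof -
  show "\<kappa> * \<rho> = pi" using \<rho>_bounds by (simp add: \<kappa>_def)
  have "2 * \<rho> < pi" using \<rho>_bounds pi_gt3 by linarith
  then show "2 < \<kappa>" using \<rho>_bounds by (simp add: \<kappa>_def pos_less_divide_eq)
  then show "0 < \<kappa>" by linarith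
  have "pi < 19/5" by (rule le_less_trans[OF pi_approx(2)]) simp
  then have "pi < 4 * \<rho>" using \<rho>_bounds by linarith
  then show "\<kappa> < 4" using \<rho>_bounds by (simp add: \<kappa>_def pos_divide_less_eq)
qed

lemma U_open: "open U" and U_convex: "convex U"
proof -
  have U: "U = {w. Im w < 5/4} \<inter> {w. Im w > - (5/4)}" by (auto simp: U_def)
  show "open U" unfolding U by (intro open_Int open_halfspace_Im_lt open_halfspace_Im_gt)
  show "convex U" unfolding U by (intro convex_Int convex_halfspace_Im_lt convex_halfspace_Im_gt)
qed

lemma S_subset_U: "S \<subseteq> U" using \<rho>_bounds by (auto simp: S_def U_def)

lemma S_open: "open S"
proof -
  have S: "S = {w. Im w < \<rho>} \<inter> {w. Im w > 0}" by (auto simp: S_def)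
  show "open S" unfolding S by (intro open_Int open_halfspace_Im_lt open_halfspace_Im_gt)
qed

lemma F_holo_U: "F holomorphic_on U" using F_holo by (simp add: U_def)

lemma F_has_derivative: "w \<in> U \<Longrightarrow> (F has_field_derivative deriv F w) (at w)"
  using F_holo_U U_open by (rule holomorphic_derivI)

lemma F_near_id: "w \<in> U \<Longrightarrow> w' \<in> U \<Longrightarrow> cmod ((F w - F w') - (w - w')) \<le> 1/2 * cmod (w - w')"
proof -
  assume w: "w \<in> U" "w' \<in> U"
  have "cmod ((\<lambda>w. F w - w) w - (\<lambda>w. F w - w) w') \<le> 1/2 * cmod (w - w')"
  proof (rule field_differentiable_bound[OF U_convex _ _ w(1,2), where f' = "\<lambda>w. deriv F w - 1"])
    show "((\<lambda>w. F w - w) has_field_derivative deriv F x - 1) (at x within U)" if "x \<in> U" for x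
      by (rule DERIV_diff[OF has_field_derivative_at_within[OF F_has_derivative[OF that]] DERIV_ident])
    show "cmod (deriv F x - 1) \<le> 1/2" if "x \<in> U" for x using F_deriv that by (simp add: U_def)
  qed
  then show ?thesis by (simp add: algebra_simps)
qed

lemma F_expanding: "w \<in> U \<Longrightarrow> w' \<in> U \<Longrightarrow> cmod (w - w') \<le> 2 * cmod (F w - F w')"
  using F_near_id[of w w'] norm_triangle_ineq2[of "w - w'" "F w - F w'"]
    norm_minus_commute[of "w - w'" "F w - F w'"] by linarith

lemma F_inj: "inj_on F U"
proof (rule inj_onI)
  fix x y assume "x \<in> U" "y \<in> U" "F x = F y"
  then show "x = y" using F_expanding[of x y] by simp
qed

lemma F'_nonzero: "w \<in> U \<Longrightarrow> deriv F w \<noteq> 0" and Re_F'_pos: "w \<in> U \<Longrightarrow> 0 < Re (deriv F w)"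
proof -
  assume "w \<in> U"
  then have "cmod (deriv F w - 1) \<le> 1/2" using F_deriv[of w] by (simp add: U_def)
  then have "\<bar>Re (deriv F w) - 1\<bar> \<le> 1/2"
    using abs_Re_le_cmod[of "deriv F w - 1"] by simp
  then show "0 < Re (deriv F w)" by linarith
  then show "deriv F w \<noteq> 0" by auto
qed

lemma h_bound: "\<bar>\<epsilon> * h x\<bar> < 1"
proof -
  have "\<bar>h x\<bar> \<le> 1 + \<bar>a\<bar> * 1"
    unfolding h_def by (intro order_trans[OF abs_triangle_ineq] add_mono) (auto simp: abs_mult mult_left_le)
  also have "\<dots> \<le> 1 + \<bar>a\<bar> * real n" using n by (intro add_left_mono mult_left_mono) auto
  finally have "\<bar>\<epsilon>\<bar> * \<bar>h x\<bar> \<le> \<bar>\<epsilon>\<bar> * (1 + \<bar>a\<bar> * real n)" by (intro mult_left_mono) auto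
  then show ?thesis using \<epsilon> by (simp add: abs_mult)
qed

lemma h_lipschitz: "\<bar>\<epsilon> * h x - \<epsilon> * h y\<bar> \<le> \<bar>\<epsilon>\<bar> * (1 + \<bar>a\<bar> * real n) * \<bar>x - y\<bar>"
proof -
  have "norm (h x - h y) \<le> (1 + \<bar>a\<bar> * real n) * norm (x - y)"
  proof (rule field_differentiable_bound[where S = UNIV and f' = "\<lambda>x. - sin x - a * (real n * sin (real n * x))"])
    show "(h has_field_derivative - sin x - a * (real n * sin (real n * x))) (at x within UNIV)" for x
      unfolding h_def by (auto intro!: derivative_eq_intros)
    show "norm (- sin x - a * (real n * sin (real n * x))) \<le> 1 + \<bar>a\<bar> * real n" for x
      by (rule order_trans[OF norm_triangle_ineq4])
        (auto simp: abs_mult intro!: add_mono mult_left_mono mult_left_le)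
  qed auto
  then have "\<bar>\<epsilon>\<bar> * \<bar>h x - h y\<bar> \<le> \<bar>\<epsilon>\<bar> * ((1 + \<bar>a\<bar> * real n) * \<bar>x - y\<bar>)"
    by (intro mult_left_mono) auto
  then show ?thesis by (simp add: mult.assoc flip: right_diff_distrib abs_mult)
qed

lemma channel_eq: "channel n a \<epsilon> = {z. 0 < Im z \<and> Im z < 1 + \<epsilon> * h (Re z)}"
  by (simp add: channel_def h_def)

lemma F_real: "Im (F (of_real u)) = 0"
  using F_cnj[of "of_real u"] by (simp add: complex_eq_iff)

lemma F_S_subset: "F ` S \<subseteq> channel n a \<epsilon>"
proof
  fix z assume "z \<in> F ` S"
  then obtain w where w: "w \<in> S" "z = F w" by blast
  define u v where "u = Re w" and "v = Im w"
  have weq: "w = u + \<i> * v" by (simp add: u_def v_def complex_eq_iff)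
  have v: "0 < v" "v < \<rho>" using w by (auto simp: S_def v_def)
  have wU: "w \<in> U" using w S_subset_U by blast
  have low: "of_real u \<in> U" by (simp add: U_def)
  have top: "u + \<i> * \<rho> \<in> U" using \<rho>_bounds by (simp add: U_def)
  have "\<bar>Im ((F w - F (of_real u)) - (w - of_real u))\<bar> \<le> 1/2 * cmod (w - of_real u)"
    using F_near_id[OF wU low] abs_Im_le_cmod order_trans by blast
  moreover have "cmod (w - of_real u) = v" using v by (simp add: weq norm_mult)
  ultimately have "\<bar>Im (F w) - v\<bar> \<le> 1/2 * v" using F_real[of u] by (simp add: v_def)
  then have 1: "0 < Im z" using v unfolding w(2) by linarith
  \<comment> \<open>The depth below the line Im w = \<rho>. Relative to the boundary point above,
    the image descends by at least d / 2 and moves sideways by at most d / 2; a graph of slope below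
    1 cannot descend as far.\<close>
  define d where "d = \<rho> - v"
  have d: "0 < d" using v by (simp add: d_def)
  have cd: "cmod (w - (u + \<i> * \<rho>)) = d"
  proof -
    have "w - (u + \<i> * \<rho>) = \<i> * of_real (v - \<rho>)" by (simp add: weq algebra_simps)
    then show ?thesis using v by (simp only: norm_mult norm_of_real) (simp add: d_def)
  qed
  have N: "cmod ((F w - F (u + \<i> * \<rho>)) - (w - (u + \<i> * \<rho>))) \<le> d / 2"
    using F_near_id[OF wU top] unfolding cd by simp
  have Im: "\<bar>Im (F w) - Im (F (u + \<i> * \<rho>)) + d\<bar> \<le> d / 2"
    using order_trans[OF abs_Im_le_cmod N] by (simp add: d_def v_def algebra_simps)
  have Re: "\<bar>Re (F w) - Re (F (u + \<i> * \<rho>))\<bar> \<le> d / 2"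
    using order_trans[OF abs_Re_le_cmod N] by (simp add: u_def)
  have "\<bar>\<epsilon> * h (Re (F (u + \<i> * \<rho>))) - \<epsilon> * h (Re (F w))\<bar> \<le> \<bar>\<epsilon>\<bar> * (1 + \<bar>a\<bar> * real n) * \<bar>Re (F (u + \<i> * \<rho>)) - Re (F w)\<bar>"
    by (rule h_lipschitz)
  also have "\<dots> \<le> \<bar>\<epsilon>\<bar> * (1 + \<bar>a\<bar> * real n) * (d / 2)"
    using Re by (intro mult_left_mono) (auto simp: abs_minus_commute)
  also have "\<dots> < 1 * (d / 2)" using \<epsilon> d by (intro mult_strict_right_mono) auto
  finally have H: "\<epsilon> * h (Re (F (u + \<i> * \<rho>))) - \<epsilon> * h (Re (F w)) < d / 2" by linarith
  have "Im (F (u + \<i> * \<rho>)) = 1 + \<epsilon> * h (Re (F (u + \<i> * \<rho>)))" using F_top[of u] by (simp add: h_def)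
  then have 2: "Im z < 1 + \<epsilon> * h (Re z)" using H Im d unfolding w(2) by linarith
  show "z \<in> channel n a \<epsilon>" using 1 2 by (simp add: channel_eq)
qed

lemma channel_connected: "connected (channel n a \<epsilon>)"
proof -
  define P where "P = (\<lambda>w. of_real (Re w) + \<i> * of_real (Im w * (1 + \<epsilon> * h (Re w))))"
  have pos: "0 < 1 + \<epsilon> * h x" for x using h_bound[of x] by linarith
  have "P ` {w. 0 < Im w \<and> Im w < 1} = channel n a \<epsilon>"
  proof (intro equalityI subsetI)
    fix z assume "z \<in> P ` {w. 0 < Im w \<and> Im w < 1}"
    then show "z \<in> channel n a \<epsilon>" using pos by (auto simp: P_def channel_eq intro!: mult_pos_pos)
  next
    fix z assume z: "z \<in> channel n a \<epsilon>"
    have "z = P (Complex (Re z) (Im z / (1 + \<epsilon> * h (Re z))))"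
      using pos[of "Re z"] by (simp add: P_def complex_eq_iff)
    moreover have "Complex (Re z) (Im z / (1 + \<epsilon> * h (Re z))) \<in> {w. 0 < Im w \<and> Im w < 1}"
      using z pos[of "Re z"] by (simp add: channel_eq)
    ultimately show "z \<in> P ` {w. 0 < Im w \<and> Im w < 1}" by blast
  qed
  moreover have "connected (P ` {w. 0 < Im w \<and> Im w < 1})"
  proof (rule connected_continuous_image)
    show "continuous_on {w. 0 < Im w \<and> Im w < 1} P"
      unfolding P_def h_def by (intro continuous_intros)
    have "{w. 0 < Im w \<and> Im w < 1} = {w. Im w < 1} \<inter> {w. Im w > 0}" by auto
    then have "convex {w. 0 < Im w \<and> Im w < 1}"
      by (simp only:) (intro convex_Int convex_halfspace_Im_lt convex_halfspace_Im_gt)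
    then show "connected {w. 0 < Im w \<and> Im w < 1}" by (rule convex_connected)
  qed
  ultimately show ?thesis by simp
qed

text \<open>The image is open by injectivity. It is also relatively closed in the connected channel,
  because the expansion property turns convergent image sequences from the closed strip into Cauchy
  sequences of preimages.\<close>

lemma F_image: "F ` S = channel n a \<epsilon>"
proof -
  define C where "C = {w::complex. 0 \<le> Im w \<and> Im w \<le> \<rho>}"
  have CU: "C \<subseteq> U" using \<rho>_bounds by (auto simp: C_def U_def)
  have Ccl: "closed C" unfolding C_def by (intro closed_Collect_conj closed_Collect_le continuous_intros)
  have "closed (F ` C)"
    unfolding closed_sequential_limits
  proof (intro allI impI, elim conjE)
    fix x l assume x: "\<forall>k. x k \<in> F ` C" and l: "x \<longlonglongrightarrow> l"
    from x have "\<forall>k. \<exists>w\<in>C. x k = F w" by blast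
    then obtain w where w: "\<And>k. w k \<in> C" "\<And>k. x k = F (w k)" by metis
    have "Cauchy w"
    proof (rule metric_CauchyI)
      fix e :: real assume "0 < e"
      then obtain N where N: "\<And>i j. i \<ge> N \<Longrightarrow> j \<ge> N \<Longrightarrow> dist (x i) (x j) < e / 2"
        using metric_CauchyD[OF LIMSEQ_imp_Cauchy[OF l], of "e/2"] by auto
      have "dist (w i) (w j) < e" if "i \<ge> N" "j \<ge> N" for i j
        using N[OF that] F_expanding[of "w i" "w j"] w CU by (auto simp: dist_norm subset_iff)
      then show "\<exists>N. \<forall>i\<ge>N. \<forall>j\<ge>N. dist (w i) (w j) < e" by blast
    qed
    then obtain w0 where w0: "w \<longlonglongrightarrow> w0" using Cauchy_convergent convergent_def by blast
    have w0C: "w0 \<in> C" using Ccl w(1) w0 closed_sequentially by blast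
    have "continuous_on C F" using holomorphic_on_imp_continuous_on[OF F_holo_U] CU continuous_on_subset by blast
    then have "(\<lambda>k. F (w k)) \<longlonglongrightarrow> F w0" using w0 w(1) w0C by (auto simp: continuous_on_sequentially o_def)
    then have "x \<longlonglongrightarrow> F w0" by (simp flip: w(2))
    then have "l = F w0" using l LIMSEQ_unique by blast
    then show "l \<in> F ` C" using w0C by blast
  qed
  \<comment> \<open>The two edges of the closed strip go to the two boundary curves, which the open
    channel excludes.\<close>
  have eq: "F ` S = channel n a \<epsilon> \<inter> F ` C"
  proof (intro equalityI subsetI)
    fix z assume "z \<in> F ` S" then show "z \<in> channel n a \<epsilon> \<inter> F ` C"
      using F_S_subset by (auto simp: S_def C_def)
  next
    fix z assume z: "z \<in> channel n a \<epsilon> \<inter> F ` C"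
    then obtain w where w: "w \<in> C" "z = F w" by blast
    have weq: "w = Re w + \<i> * Im w" by (simp add: complex_eq_iff)
    have "Im w \<noteq> 0"
    proof
      assume "Im w = 0"
      then have "w = of_real (Re w)" by (simp add: complex_eq_iff)
      then have "Im z = 0" using w(2) F_real by metis
      then show False using z by (simp add: channel_eq)
    qed
    moreover have "Im w \<noteq> \<rho>"
    proof
      assume "Im w = \<rho>"
      then have "w = Re w + \<i> * \<rho>" using weq by simp
      then have "Im z = 1 + \<epsilon> * h (Re z)" using w(2) F_top[of "Re w"] by (simp add: h_def)
      then show False using z by (simp add: channel_eq)
    qed
    ultimately have "w \<in> S" using w(1) by (simp add: S_def C_def)
    then show "z \<in> F ` S" using w by blast
  qed
  have "open (F ` S)"
    using holomorphic_on_subset[OF F_holo_U S_subset_U] S_open inj_on_subset[OF F_inj S_subset_U]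
    by (rule open_mapping_thm3)
  then have "openin (top_of_set (channel n a \<epsilon>)) (F ` S)" using F_S_subset by (simp add: open_subset)
  moreover have "closedin (top_of_set (channel n a \<epsilon>)) (F ` S)"
    unfolding eq using \<open>closed (F ` C)\<close> by (rule closedin_closed_Int)
  moreover have "F ` S \<noteq> {}"
  proof -
    have "\<i> * of_real (\<rho> / 2) \<in> S" using \<rho>_bounds by (simp add: S_def)
    then show ?thesis by blast
  qed
  ultimately show ?thesis using channel_connected by (auto simp: connected_clopen)
qed

lemma F_imaginary: "\<bar>v\<bar> < 5/4 \<Longrightarrow> Re (F (\<i> * of_real v)) = 0"
  using F_odd[of "\<i> * of_real v"] F_cnj[of "\<i> * of_real v"] by (simp add: complex_eq_iff)

text \<open>Oddness and conjugation send the imaginary axis to itself, periodicity does the same for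
  its translate by 2 \<pi>. Along a horizontal segment from such a line, F' within 1/2 of 1
  preserves the sign of the horizontal displacement, so the half-open period is respected
  exactly.\<close>

lemma F_period_iff:
  assumes "w \<in> U"
  shows "0 \<le> Re (F w) \<longleftrightarrow> 0 \<le> Re w" "Re (F w) < 2 * pi \<longleftrightarrow> Re w < 2 * pi"
proof -
  define v where "v = Im w"
  have v: "\<bar>v\<bar> < 5/4" using assms by (simp add: U_def v_def)
  have sgn: "(0 \<le> Re (F w) - c \<longleftrightarrow> 0 \<le> Re w - c)" if w': "w' \<in> U" "Im w' = v" "Re w' = c" "Re (F w') = c" for w' c
  proof -
    have "\<bar>Re ((F w - F w') - (w - w'))\<bar> \<le> 1/2 * cmod (w - w')"
      using F_near_id[OF assms w'(1)] abs_Re_le_cmod order_trans by blast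
    moreover have "w - w' = of_real (Re w - c)" using w' by (simp add: complex_eq_iff v_def)
    then have "cmod (w - w') = \<bar>Re w - c\<bar>" by (simp only: norm_of_real)
    ultimately have "\<bar>(Re (F w) - c) - (Re w - c)\<bar> \<le> 1/2 * \<bar>Re w - c\<bar>" using w' by simp
    then show ?thesis by (auto simp: abs_if split: if_splits)
  qed
  have iv: "\<i> * of_real v \<in> U" using v by (simp add: U_def)
  show "0 \<le> Re (F w) \<longleftrightarrow> 0 \<le> Re w"
    using sgn[OF iv, of 0] F_imaginary[OF v] by simp
  have "Re (F (\<i> * of_real v + 2 * pi)) = 2 * pi"
    using F_periodic[of "\<i> * of_real v"] F_imaginary[OF v] v by simp
  then have "0 \<le> Re (F w) - 2 * pi \<longleftrightarrow> 0 \<le> Re w - 2 * pi"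
    using v by (intro sgn[of "\<i> * of_real v + 2 * pi"]) (auto simp: U_def)
  then show "Re (F w) < 2 * pi \<longleftrightarrow> Re w < 2 * pi" by linarith
qed

end

section \<open>Gradient and Hessian in straightened coordinates\<close>

lemma bij_if_linear_injective:
  fixes H :: "complex \<Rightarrow> complex"
  assumes "linear H" "\<And>x. H x = 0 \<Longrightarrow> x = 0"
  shows "bij H"
proof -
  have "inj H" using assms linear_injective_0 by blast
  then show ?thesis using linear_injective_imp_surjective[OF assms(1)] by (simp add: bij_def)
qed

lemma GDERIV_unique:
  assumes "GDERIV f z :> D" "GDERIV f z :> D'"
  shows "D = D'"
proof -
  have "(\<lambda>h. h \<bullet> D) = (\<lambda>h. h \<bullet> D')"
    using assms unfolding gderiv_def by (rule has_derivative_unique)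
  then have "(D - D') \<bullet> D = (D - D') \<bullet> D'" by (rule fun_cong)
  then have "(D - D') \<bullet> (D - D') = 0" by (simp add: inner_diff_right)
  then show ?thesis by simp
qed

lemma critical_point_iff:
  assumes "GDERIV f z :> D"
  shows "critical_point f z \<longleftrightarrow> D = 0"
  using assms GDERIV_unique unfolding critical_point_def by blast

context channel_map
begin

definition f where "f = (SOME g. g holomorphic_on (F ` S) \<and> (\<forall>w\<in>S. deriv F w * deriv g (F w) = 1) \<and> (\<forall>w\<in>S. g (F w) = w))"

lemma f: "f holomorphic_on channel n a \<epsilon>" "\<And>w. w \<in> S \<Longrightarrow> deriv F w * deriv f (F w) = 1" "\<And>w. w \<in> S \<Longrightarrow> f (F w) = w"
proof -
  obtain g where "g holomorphic_on (F ` S)" "\<And>w. w \<in> S \<Longrightarrow> deriv F w * deriv g (F w) = 1" "\<And>w. w \<in> S \<Longrightarrow> g (F w) = w"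
    by (rule holomorphic_has_inverse[OF holomorphic_on_subset[OF F_holo_U S_subset_U] S_open inj_on_subset[OF F_inj S_subset_U]]) blast
  then have "\<exists>g. g holomorphic_on (F ` S) \<and> (\<forall>w\<in>S. deriv F w * deriv g (F w) = 1) \<and> (\<forall>w\<in>S. g (F w) = w)" by blast
  from someI_ex[OF this]
  show "f holomorphic_on channel n a \<epsilon>" "\<And>w. w \<in> S \<Longrightarrow> deriv F w * deriv f (F w) = 1" "\<And>w. w \<in> S \<Longrightarrow> f (F w) = w"
    unfolding f_def[symmetric] unfolding F_image by auto
qed

lemma channel_open: "open (channel n a \<epsilon>)"
  unfolding F_image[symmetric]
  by (rule open_mapping_thm3[OF holomorphic_on_subset[OF F_holo_U S_subset_U] S_open inj_on_subset[OF F_inj S_subset_U]])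

lemma f_mem: "z \<in> channel n a \<epsilon> \<Longrightarrow> f z \<in> S" and F_f: "z \<in> channel n a \<epsilon> \<Longrightarrow> F (f z) = z"
  unfolding F_image[symmetric] using f(3) by auto

lemma deriv_f: "w \<in> S \<Longrightarrow> deriv f (F w) = 1 / deriv F w"
  using f(2)[of w] F'_nonzero[of w] S_subset_U by (auto simp: field_simps)

lemma f_has_derivative: "z \<in> channel n a \<epsilon> \<Longrightarrow> (f has_field_derivative deriv f z) (at z)"
  using f(1) channel_open by (rule holomorphic_derivI)

lemma \<kappa>_Im: "w \<in> S \<Longrightarrow> 0 < \<kappa> * Im w \<and> \<kappa> * Im w < pi"
  using \<kappa>_bounds mult_strict_left_mono[of "Im w" \<rho> \<kappa>] by (auto simp: S_def)

lemma half_plane_map: "half_plane_map (channel n a \<epsilon>) (\<lambda>z. exp (\<kappa> * f z)) (\<lambda>w. F (Ln w / \<kappa>))"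
proof
  have LnS: "Ln w / \<kappa> \<in> S" if "0 < Im w" for w
  proof -
    have "w \<noteq> 0" using that by auto
    then have "0 < Im (Ln w)" "Im (Ln w) < pi" using that Im_Ln_pos_lt_imp[of w] Im_Ln_pos_lt[of w] by auto
    moreover have "Im (Ln w) < \<rho> * \<kappa>" using calculation \<kappa>_bounds by (simp add: mult.commute)
    ultimately show ?thesis using \<kappa>_bounds by (simp add: S_def pos_divide_less_eq Im_divide_of_real)
  qed
  show "open (channel n a \<epsilon>)" by (rule channel_open)
  show "(\<lambda>z. exp (\<kappa> * f z)) holomorphic_on channel n a \<epsilon>" by (intro holomorphic_intros f(1))
  show "0 < Im (exp (\<kappa> * f z))" if "z \<in> channel n a \<epsilon>" for z
    using \<kappa>_Im[OF f_mem[OF that]] by (simp add: Im_exp sin_gt_zero)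
  show "F (Ln (exp (\<kappa> * f z)) / \<kappa>) = z" if "z \<in> channel n a \<epsilon>" for z
  proof -
    have "Ln (exp (\<kappa> * f z)) = \<kappa> * f z" using \<kappa>_Im[OF f_mem[OF that]] by (intro Ln_exp) auto
    then show ?thesis using F_f[OF that] \<kappa>_bounds by simp
  qed
  show "continuous_on {w. 0 < Im w} (\<lambda>w. F (Ln w / \<kappa>))"
  proof (rule continuous_on_compose2[OF holomorphic_on_imp_continuous_on[OF F_holo_U]])
    show "continuous_on {w. 0 < Im w} (\<lambda>w. Ln w / \<kappa>)"
      using \<kappa>_bounds by (intro continuous_intros) (auto simp: complex_nonpos_Reals_iff)
  qed (use LnS S_subset_U in auto)
  show "F (Ln w / \<kappa>) \<in> channel n a \<epsilon>" if "0 < Im w" for w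
    using LnS[OF that] unfolding F_image[symmetric] by blast
  show "exp (\<kappa> * f (F (Ln w / \<kappa>))) = w" if "0 < Im w" for w
  proof -
    have "w \<noteq> 0" using that by auto
    then show ?thesis using f(3)[OF LnS[OF that]] \<kappa>_bounds by (simp add: exp_Ln)
  qed
qed

text \<open>The modulus of exp (\<kappa> f) cancels between its imaginary part and its derivative,
  leaving a sine and \<bar>F'\<bar>. Since Re F' > 0 the last logarithm is the real part of a
  holomorphic branch, ready for differentiation.\<close>

lemma robin_function_channel:
  assumes z: "z \<in> channel n a \<epsilon>"
  shows "robin_function (channel n a \<epsilon>) z
    = (ln (2 / \<kappa>) + ln (sin (\<kappa> * Im (f z))) + Re (Ln (deriv F (f z)))) / (2 * pi)"
proof -
  have w: "f z \<in> S" by (rule f_mem[OF z])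
  then have F': "deriv F (f z) \<noteq> 0" using F'_nonzero S_subset_U by blast
  have "((\<lambda>z. exp (\<kappa> * f z)) has_field_derivative exp (\<kappa> * f z) * (\<kappa> * deriv f z)) (at z)"
    using f_has_derivative[OF z] by (auto intro!: derivative_eq_intros)
  then have d: "deriv (\<lambda>z. exp (\<kappa> * f z)) z = exp (\<kappa> * f z) * (\<kappa> / deriv F (f z))"
    using deriv_f[OF w] F_f[OF z] by (simp add: DERIV_imp_deriv)
  have sp: "0 < sin (\<kappa> * Im (f z))" using \<kappa>_Im[OF w] by (intro sin_gt_zero) auto
  have "2 * Im (exp (\<kappa> * f z)) / cmod (deriv (\<lambda>z. exp (\<kappa> * f z)) z)
    = (2 / \<kappa>) * sin (\<kappa> * Im (f z)) * cmod (deriv F (f z))"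
    unfolding d using \<kappa>_bounds F' by (simp add: Im_exp norm_mult norm_divide field_simps)
  then have "robin_function (channel n a \<epsilon>) z = ln ((2 / \<kappa>) * sin (\<kappa> * Im (f z)) * cmod (deriv F (f z))) / (2 * pi)"
    using half_plane_map.robin_function_eq[OF half_plane_map z] by simp
  also have "ln ((2 / \<kappa>) * sin (\<kappa> * Im (f z)) * cmod (deriv F (f z)))
     = ln (2 / \<kappa>) + ln (sin (\<kappa> * Im (f z))) + ln (cmod (deriv F (f z)))"
  proof -
    have *: "ln (p * q * r) = ln p + ln q + ln r" if "0 < p" "0 < q" "0 < r" for p q r :: real
      using that by (simp add: ln_mult)
    show ?thesis by (rule *) (use sp F' \<kappa>_bounds(3) in simp_all)
  qed
  also have "ln (cmod (deriv F (f z))) = Re (Ln (deriv F (f z)))" using F' by simp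
  finally show ?thesis .
qed

lemma F'_holo: "deriv F holomorphic_on U"
  by (rule holomorphic_deriv[OF F_holo_U U_open])

lemma T_holo: "T holomorphic_on U"
  unfolding T_def by (intro holomorphic_intros holomorphic_deriv F'_holo U_open F'_nonzero)

text \<open>Gradient in the coordinate w: the real part of a holomorphic G has gradient cnj G', here
  with G = Ln F' and G' = T, and the height-dependent term points along \<i>.\<close>

definition W where "W w = (cnj (T w) + \<i> * of_real (\<kappa> * cot (\<kappa> * Im w))) / of_real (2 * pi)"

lemma W_eq_0_iff: "W w = 0 \<longleftrightarrow> Re (T w) = 0 \<and> \<kappa> * cot (\<kappa> * Im w) = Im (T w)"
  by (auto simp: W_def complex_eq_iff)

lemma robin_gradient:
  assumes w: "w \<in> S"
  shows "GDERIV (robin_function (channel n a \<epsilon>)) (F w) :> cnj (deriv f (F w)) * W w"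
proof -
  define z where "z = F w"
  have z: "z \<in> channel n a \<epsilon>" using w unfolding F_image[symmetric] z_def by blast
  have fz: "f z = w" using f(3)[OF w] by (simp add: z_def)
  have wU: "w \<in> U" using w S_subset_U by blast
  have sp: "0 < sin (\<kappa> * Im w)" using \<kappa>_Im[OF w] by (intro sin_gt_zero) auto
  have df: "(f has_derivative (\<lambda>k. deriv f z * k)) (at z)"
    using f_has_derivative[OF z] by (simp add: has_field_derivative_def)
  have d1: "((\<lambda>w. ln (sin (\<kappa> * Im w))) has_derivative (\<lambda>k. \<kappa> * cot (\<kappa> * Im w) * Im k)) (at w)"
  proof -
    have "((\<lambda>w. \<kappa> * Im w) has_derivative (\<lambda>k. \<kappa> * Im k)) (at w)"
      by (auto intro!: derivative_eq_intros)
    moreover have "((\<lambda>t. ln (sin t)) has_real_derivative cot (\<kappa> * Im w)) (at (\<kappa> * Im w))"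
      using sp by (auto intro!: derivative_eq_intros simp: cot_def)
    then have "((\<lambda>t. ln (sin t)) has_derivative (*) (cot (\<kappa> * Im w))) (at (\<kappa> * Im w))"
      by (simp only: has_field_derivative_def)
    ultimately have "((\<lambda>w. ln (sin (\<kappa> * Im w))) has_derivative (\<lambda>k. cot (\<kappa> * Im w) * (\<kappa> * Im k))) (at w)"
      by (rule has_derivative_compose)
    then show ?thesis by (simp only: mult.assoc mult.left_commute[of \<kappa>])
  qed
  have d2: "((\<lambda>w. Re (Ln (deriv F w))) has_derivative (\<lambda>k. Re (T w * k))) (at w)"
  proof -
    have "(deriv F has_field_derivative deriv (deriv F) w) (at w)"
      using F'_holo U_open wU by (rule holomorphic_derivI)
    moreover have "deriv F w \<notin> \<real>\<^sub>\<le>\<^sub>0" using Re_F'_pos[OF wU] by (auto simp: complex_nonpos_Reals_iff)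
    ultimately have "((\<lambda>w. Ln (deriv F w)) has_field_derivative T w) (at w)"
      by (auto intro!: derivative_eq_intros simp: T_def divide_inverse mult.commute)
    then have "((\<lambda>w. Ln (deriv F w)) has_derivative (\<lambda>k. T w * k)) (at w)" by (simp add: has_field_derivative_def)
    then show ?thesis by (rule has_derivative_Re)
  qed
  have "((\<lambda>w. (ln (2 / \<kappa>) + ln (sin (\<kappa> * Im w)) + Re (Ln (deriv F w))) / (2 * pi)) has_derivative
     (\<lambda>k. (0 + \<kappa> * cot (\<kappa> * Im w) * Im k + Re (T w * k)) / (2 * pi))) (at w)"
    by (rule bounded_linear.has_derivative[OF bounded_linear_divide
      has_derivative_add[OF has_derivative_add[OF has_derivative_const d1] d2]])
  then have "((\<lambda>w. (ln (2 / \<kappa>) + ln (sin (\<kappa> * Im w)) + Re (Ln (deriv F w))) / (2 * pi)) has_derivative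
     (\<lambda>k. (\<kappa> * cot (\<kappa> * Im w) * Im k + Re (T w * k)) / (2 * pi))) (at w)"
    by (simp only: add_0_left)
  from has_derivative_compose[OF df this[folded fz]]
  have "((\<lambda>z. (ln (2 / \<kappa>) + ln (sin (\<kappa> * Im (f z))) + Re (Ln (deriv F (f z)))) / (2 * pi)) has_derivative
     (\<lambda>k. (\<kappa> * cot (\<kappa> * Im w) * Im (deriv f z * k) + Re (T w * (deriv f z * k))) / (2 * pi))) (at z)"
    unfolding fz .
  then have "(robin_function (channel n a \<epsilon>) has_derivative
     (\<lambda>k. (\<kappa> * cot (\<kappa> * Im w) * Im (deriv f z * k) + Re (T w * (deriv f z * k))) / (2 * pi))) (at z)"
    by (rule has_derivative_transform_within_open[OF _ channel_open z]) (simp add: robin_function_channel)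
  moreover have "(\<kappa> * cot (\<kappa> * Im w) * Im (deriv f z * k) + Re (T w * (deriv f z * k))) / (2 * pi)
     = k \<bullet> (cnj (deriv f z) * W w)" for k
  proof -
    define m where "m = deriv f z * k"
    have "k \<bullet> (cnj (deriv f z) * W w) = Re (m * cnj (W w))"
      by (simp add: inner_complex_def m_def algebra_simps)
    also have "\<dots> = (\<kappa> * cot (\<kappa> * Im w) * Im m + Re (T w * m)) / (2 * pi)"
      by (simp add: W_def algebra_simps add_divide_distrib diff_divide_distrib)
    finally show ?thesis by (simp add: m_def)
  qed
  ultimately show ?thesis unfolding gderiv_def z_def by simp
qed

lemma critical_point_channel_iff:
  assumes w: "w \<in> S"
  shows "critical_point (robin_function (channel n a \<epsilon>)) (F w) \<longleftrightarrow> W w = 0"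
proof -
  have "deriv f (F w) \<noteq> 0" using f(2)[OF w] by auto
  then show ?thesis using critical_point_iff[OF robin_gradient[OF w]] by simp
qed

lemma critical_points_eq:
  "critical_points_per_period n a \<epsilon> = F ` {w \<in> S. 0 \<le> Re w \<and> Re w < 2 * pi \<and> W w = 0}"
proof (intro equalityI subsetI)
  fix z assume z: "z \<in> critical_points_per_period n a \<epsilon>"
  then have "z \<in> channel n a \<epsilon>" by (simp add: critical_points_per_period_def)
  then obtain w where w: "w \<in> S" "z = F w" unfolding F_image[symmetric] by blast
  then show "z \<in> F ` {w \<in> S. 0 \<le> Re w \<and> Re w < 2 * pi \<and> W w = 0}"
    using z critical_point_channel_iff[OF w(1)] F_period_iff[of w] S_subset_U
    by (auto simp: critical_points_per_period_def subset_iff)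
next
  fix z assume "z \<in> F ` {w \<in> S. 0 \<le> Re w \<and> Re w < 2 * pi \<and> W w = 0}"
  then obtain w where w: "w \<in> S" "z = F w" "0 \<le> Re w" "Re w < 2 * pi" "W w = 0" by blast
  moreover have "z \<in> channel n a \<epsilon>" using w(1,2) unfolding F_image[symmetric] by blast
  ultimately show "z \<in> critical_points_per_period n a \<epsilon>"
    using critical_point_channel_iff[OF w(1)] F_period_iff[of w] S_subset_U
    by (auto simp: critical_points_per_period_def subset_iff)
qed

text \<open>At a zero of W the product rule for cnj f' * W leaves only the derivative of W. The
  Hessian is this derivative composed with multiplications by nonzero numbers, and the last
  hypothesis is the injectivity of the derivative.\<close>

lemma nondegenerate_if:
  assumes w: "w \<in> S" and W0: "W w = 0"
    and nd: "\<And>k. cnj (deriv T w * k) = \<i> * of_real (\<kappa>\<^sup>2 / (sin (\<kappa> * Im w))\<^sup>2 * Im k) \<Longrightarrow> k = 0"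
  shows "nondegenerate_critical_point (robin_function (channel n a \<epsilon>)) (F w)"
proof -
  define z where "z = F w"
  have z: "z \<in> channel n a \<epsilon>" using w unfolding F_image[symmetric] z_def by blast
  have fz: "f z = w" using f(3)[OF w] by (simp add: z_def)
  have wU: "w \<in> U" using w S_subset_U by blast
  have sp: "0 < sin (\<kappa> * Im w)" using \<kappa>_Im[OF w] by (intro sin_gt_zero) auto
  have f0: "deriv f z \<noteq> 0" using f(2)[OF w] by (auto simp: z_def)
  define DW where "DW k = (cnj (deriv T w * k) - \<i> * of_real (\<kappa>\<^sup>2 / (sin (\<kappa> * Im w))\<^sup>2 * Im k)) / of_real (2 * pi)" for k
  have dW: "(W has_derivative DW) (at w)"
  proof -
    have "(T has_derivative (\<lambda>k. deriv T w * k)) (at w)"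
      using holomorphic_derivI[OF T_holo U_open wU] by (simp add: has_field_derivative_def)
    then have 1: "((\<lambda>w. cnj (T w)) has_derivative (\<lambda>k. cnj (deriv T w * k))) (at w)"
      by (rule bounded_linear.has_derivative[OF bounded_linear_cnj])
    have "((\<lambda>w. \<kappa> * Im w) has_derivative (\<lambda>k. \<kappa> * Im k)) (at w)"
      by (auto intro!: derivative_eq_intros)
    moreover have "(cot has_real_derivative - inverse ((sin (\<kappa> * Im w))\<^sup>2)) (at (\<kappa> * Im w))"
      using sp by (intro DERIV_cot) auto
    then have "(cot has_derivative (*) (- inverse ((sin (\<kappa> * Im w))\<^sup>2))) (at (\<kappa> * Im w))"
      by (simp only: has_field_derivative_def)
    ultimately have "((\<lambda>w. cot (\<kappa> * Im w)) has_derivative (\<lambda>k. - inverse ((sin (\<kappa> * Im w))\<^sup>2) * (\<kappa> * Im k))) (at w)"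
      by (rule has_derivative_compose)
    from has_derivative_mult_right[OF this, of \<kappa>]
    have 2: "((\<lambda>w. complex_of_real (\<kappa> * cot (\<kappa> * Im w))) has_derivative
        (\<lambda>k. of_real (\<kappa> * (- inverse ((sin (\<kappa> * Im w))\<^sup>2) * (\<kappa> * Im k))))) (at w)"
      by (rule has_derivative_of_real)
    from has_derivative_add[OF 1 has_derivative_mult_right[OF 2, of \<i>]]
    have "((\<lambda>w. (cnj (T w) + \<i> * of_real (\<kappa> * cot (\<kappa> * Im w))) * inverse (of_real (2 * pi))) has_derivative
       (\<lambda>k. (cnj (deriv T w * k) + \<i> * of_real (\<kappa> * (- inverse ((sin (\<kappa> * Im w))\<^sup>2) * (\<kappa> * Im k)))) * inverse (of_real (2 * pi)))) (at w)"
      by (rule has_derivative_mult_left)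
    moreover have "(cnj (deriv T w * k) + \<i> * of_real (\<kappa> * (- inverse ((sin (\<kappa> * Im w))\<^sup>2) * (\<kappa> * Im k)))) * inverse (of_real (2 * pi))
      = DW k" for k
    proof -
      have "\<kappa> * (- inverse ((sin (\<kappa> * Im w))\<^sup>2) * (\<kappa> * Im k)) = - (\<kappa>\<^sup>2 / (sin (\<kappa> * Im w))\<^sup>2 * Im k)"
        by (simp add: divide_inverse power2_eq_square)
      then show ?thesis by (simp only: DW_def divide_inverse of_real_minus mult_minus_right add_uminus_conv_diff)
    qed
    ultimately show ?thesis unfolding W_def[abs_def] divide_inverse by simp
  qed
  define G where "G z = cnj (deriv f z) * W (f z)" for z
  have grad: "\<forall>\<^sub>F y in nhds z. GDERIV (robin_function (channel n a \<epsilon>)) y :> G y"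
    using eventually_nhds_in_open[OF channel_open z]
  proof eventually_elim
    case (elim y)
    from robin_gradient[OF f_mem[OF elim]] show ?case by (simp add: G_def F_f[OF elim])
  qed
  define H where "H k = cnj (deriv f z) * DW (deriv f z * k)" for k
  have dG: "(G has_derivative H) (at z)"
  proof -
    have "(f has_derivative (\<lambda>k. deriv f z * k)) (at z)"
      using f_has_derivative[OF z] by (simp add: has_field_derivative_def)
    from has_derivative_compose[OF this dW[folded fz]]
    have 1: "((\<lambda>z. W (f z)) has_derivative (\<lambda>k. DW (deriv f z * k))) (at z)" .
    have "deriv f holomorphic_on channel n a \<epsilon>" by (rule holomorphic_deriv[OF f(1) channel_open])
    from holomorphic_derivI[OF this channel_open z]
    have "(deriv f has_derivative (\<lambda>k. deriv (deriv f) z * k)) (at z)" by (simp add: has_field_derivative_def)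
    then have 2: "((\<lambda>z. cnj (deriv f z)) has_derivative (\<lambda>k. cnj (deriv (deriv f) z * k))) (at z)"
      by (rule bounded_linear.has_derivative[OF bounded_linear_cnj])
    show ?thesis using has_derivative_mult[OF 2 1] fz W0 by (simp add: G_def[abs_def] H_def[abs_def])
  qed
  have "bij H"
  proof (rule bij_if_linear_injective)
    show "linear H" using has_derivative_linear[OF dG] .
    fix k assume "H k = 0"
    then have "DW (deriv f z * k) = 0" using f0 by (simp add: H_def)
    then have "deriv f z * k = 0" by (intro nd) (simp add: DW_def)
    then show "k = 0" using f0 by simp
  qed
  moreover have "critical_point (robin_function (channel n a \<epsilon>)) z"
    using critical_point_channel_iff[OF w] W0 by (simp add: z_def)
  ultimately show ?thesis
    unfolding nondegenerate_critical_point_def z_def[symmetric] using grad dG by blast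
qed

end

section \<open>Persistence of simple zeros\<close>

text \<open>f changes by at least c d on either side of x, more than its value at x, so it changes
  sign within distance d. The interval cannot overrun A or B: the slope of g would contradict g = 0
  both at x and at the end.\<close>

lemma nearby_zero:
  fixes f g :: "real \<Rightarrow> real"
  assumes cont: "continuous_on {A..B} f" and ends: "f A = 0" "f B = 0" "g A = 0" "g B = 0"
    and x: "x \<in> {A..B}" "g x = 0" and close: "\<bar>f x - g x\<bar> \<le> \<eta>"
    and d: "0 < d" "d < \<delta>" "\<eta> < c * d" and c: "0 < c" and \<sigma>: "\<sigma> \<in> {1, -1}"
    and fs: "\<And>s t. s \<in> {A..B} \<Longrightarrow> t \<in> {A..B} \<Longrightarrow> \<bar>s - x\<bar> < \<delta> \<Longrightarrow> \<bar>t - x\<bar> < \<delta> \<Longrightarrow> t \<le> s \<Longrightarrow> c * (s - t) \<le> \<sigma> * (f s - f t)"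
    and gs: "\<And>s t. s \<in> {A..B} \<Longrightarrow> t \<in> {A..B} \<Longrightarrow> \<bar>s - x\<bar> < \<delta> \<Longrightarrow> \<bar>t - x\<bar> < \<delta> \<Longrightarrow> t \<le> s \<Longrightarrow> c * (s - t) \<le> \<sigma> * (g s - g t)"
  shows "\<exists>z\<in>{A..B}. f z = 0 \<and> \<bar>z - x\<bar> \<le> d"
proof (cases "x = A \<or> x = B")
  case True
  then show ?thesis using ends d x by (intro bexI[of _ x]) auto
next
  case False
  have "A \<le> x - d"
  proof (rule ccontr)
    assume "\<not> A \<le> x - d"
    then have "c * (x - A) \<le> \<sigma> * (g x - g A)" using x d by (intro gs) auto
    then have "c * (x - A) \<le> 0" using x ends by simp
    then show False using c x False by (simp add: mult_le_0_iff)
  qed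
  moreover have "x + d \<le> B"
  proof (rule ccontr)
    assume "\<not> x + d \<le> B"
    then have "c * (B - x) \<le> \<sigma> * (g B - g x)" using x d by (intro gs) auto
    then have "c * (B - x) \<le> 0" using x ends by simp
    then show False using c x False by (simp add: mult_le_0_iff)
  qed
  ultimately have I: "{x - d..x + d} \<subseteq> {A..B}" by auto
  have up: "c * d \<le> \<sigma> * (f (x + d) - f x)" using fs[of "x + d" x] I d x by auto
  have dn: "c * d \<le> \<sigma> * (f x - f (x - d))" using fs[of x "x - d"] I d x by auto
  have "\<bar>\<sigma> * f x\<bar> \<le> \<eta>" using close x \<sigma> by (auto simp: abs_mult)
  then have "\<sigma> * f (x - d) \<le> 0" "0 \<le> \<sigma> * f (x + d)"
    using up dn d by (auto simp: right_diff_distrib abs_le_iff)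
  moreover have "continuous_on {x - d..x + d} (\<lambda>t. \<sigma> * f t)"
    by (intro continuous_intros continuous_on_subset[OF cont I])
  ultimately obtain z where z: "x - d \<le> z" "z \<le> x + d" "\<sigma> * f z = 0"
    using IVT'[of "\<lambda>t. \<sigma> * f t" "x - d" 0 "x + d"] d by auto
  then show ?thesis using \<sigma> I by (intro bexI[of _ z]) auto
qed

text \<open>A small Lipschitz constant of q - q0 lets q inherit the direction and half of the slope
  of q0 near almost-zeros. Nearby zeros are then matched injectively both ways. The prescribed zeros
  at A and B prevent any gain or loss through the ends.\<close>

lemma simple_zeros_stable:
  fixes q0 q0' :: "real \<Rightarrow> real"
  assumes AB: "A < B" and deriv: "\<And>x. (q0 has_real_derivative q0' x) (at x)" and cont': "continuous_on UNIV q0'"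
    and ends: "q0 A = 0" "q0 B = 0" and fin: "finite {x\<in>{A..B}. q0 x = 0}"
    and simple: "\<And>x. x \<in> {A..B} \<Longrightarrow> q0 x = 0 \<Longrightarrow> q0' x \<noteq> 0"
  shows "\<exists>m>0. \<exists>\<eta>0>0. \<forall>q. q A = 0 \<longrightarrow> q B = 0 \<longrightarrow> (\<forall>x\<in>{A..B}. \<bar>q x - q0 x\<bar> \<le> \<eta>0) \<longrightarrow>
    (\<forall>x\<in>{A..B}. \<forall>y\<in>{A..B}. \<bar>(q x - q0 x) - (q y - q0 y)\<bar> \<le> \<eta>0 * \<bar>x - y\<bar>) \<longrightarrow>
    finite {x\<in>{A..B}. q x = 0} \<and> card {x\<in>{A..B}. q x = 0} = card {x\<in>{A..B}. q0 x = 0} \<and>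
    (\<forall>x\<in>{A..B}. q x = 0 \<longrightarrow> m \<le> \<bar>q0' x\<bar>)"
proof -
  have c0: "continuous_on UNIV q0" using deriv DERIV_isCont continuous_at_imp_continuous_on by blast
  define k where "k x = \<bar>q0 x\<bar> + \<bar>q0' x\<bar>" for x
  have "continuous_on {A..B} k" unfolding k_def
    by (intro continuous_intros continuous_on_subset[OF c0] continuous_on_subset[OF cont']) auto
  then obtain x0 where x0: "x0 \<in> {A..B}" "\<And>x. x \<in> {A..B} \<Longrightarrow> k x0 \<le> k x"
    using continuous_attains_inf[of "{A..B}" k] AB by auto
  \<comment> \<open>By simplicity and compactness \<bar>q0\<bar> + \<bar>q0'\<bar> \<ge> 2 m > 0, so
    \<bar>q0\<bar> \<le> m forces \<bar>q0'\<bar> \<ge> m.\<close>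
  define m where "m = k x0 / 2"
  have m: "0 < m" using simple[OF x0(1)] by (cases "q0 x0 = 0") (auto simp: m_def k_def add_pos_nonneg)
  have dich: "m \<le> \<bar>q0' x\<bar>" if "x \<in> {A..B}" "\<bar>q0 x\<bar> \<le> m" for x
    using x0(2)[OF that(1)] that(2) by (simp add: m_def k_def)
  have "uniformly_continuous_on {A..B} q0'"
    by (intro compact_uniformly_continuous continuous_on_subset[OF cont']) auto
  then obtain \<delta> where \<delta>: "0 < \<delta>" "\<And>x y. x \<in> {A..B} \<Longrightarrow> y \<in> {A..B} \<Longrightarrow> \<bar>y - x\<bar> < \<delta> \<Longrightarrow> \<bar>q0' y - q0' x\<bar> < m / 2"
    using m unfolding uniformly_continuous_on_def dist_real_def by (metis half_gt_zero)
  have slope0: "\<exists>\<sigma>\<in>{1,-1}. \<forall>s\<in>{A..B}. \<forall>t\<in>{A..B}. \<bar>s - x\<bar> < \<delta> \<longrightarrow> \<bar>t - x\<bar> < \<delta> \<longrightarrow> t \<le> s \<longrightarrow> m / 2 * (s - t) \<le> \<sigma> * (q0 s - q0 t)"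
    if x: "x \<in> {A..B}" "\<bar>q0 x\<bar> \<le> m" for x
  proof -
    define \<sigma> :: real where "\<sigma> = sgn (q0' x)"
    have \<sigma>: "\<sigma> \<in> {1, -1}" "\<sigma> * q0' x = \<bar>q0' x\<bar>"
      using dich[OF x] m by (auto simp: \<sigma>_def sgn_if)
    have "m / 2 * (s - t) \<le> \<sigma> * (q0 s - q0 t)"
      if st: "s \<in> {A..B}" "t \<in> {A..B}" "\<bar>s - x\<bar> < \<delta>" "\<bar>t - x\<bar> < \<delta>" "t \<le> s" for s t
    proof -
      have "\<sigma> * q0 t - m / 2 * t \<le> \<sigma> * q0 s - m / 2 * s"
      proof (rule DERIV_nonneg_imp_nondecreasing[OF st(5)])
        fix y assume y: "t \<le> y" "y \<le> s"
        have "\<bar>q0' y - q0' x\<bar> < m / 2" using y st x by (intro \<delta>(2)) auto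
        then have "\<bar>\<sigma> * q0' y - \<sigma> * q0' x\<bar> < m / 2" using \<sigma>(1) by (auto simp: abs_minus_commute)
        then have "m / 2 \<le> \<sigma> * q0' y" using \<sigma>(2) dich[OF x] by linarith
        moreover have "((\<lambda>y. \<sigma> * q0 y - m / 2 * y) has_real_derivative \<sigma> * q0' y - m / 2) (at y)"
          using deriv[of y] by (auto intro!: derivative_eq_intros)
        ultimately show "\<exists>d. ((\<lambda>y. \<sigma> * q0 y - m / 2 * y) has_real_derivative d) (at y) \<and> 0 \<le> d"
          by (intro exI[of _ "\<sigma> * q0' y - m / 2"]) auto
      qed
      then show ?thesis by (simp add: field_simps)
    qed
    then show ?thesis using \<sigma>(1) by blast
  qed
  \<comment> \<open>Two zeros matched to the same partner are at most 2 d = \<delta> / 2 apart,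
    inside the range of monotonicity.\<close>
  define d where "d = \<delta> / 4"
  \<comment> \<open>m / 4 as a Lipschitz constant leaves slope m / 4 of the original m / 2; the
    other bound keeps the value perturbation below that slope times d.\<close>
  define \<eta>0 where "\<eta>0 = min (m / 4) (m / 4 * d / 2)"
  have d: "0 < d" "d < \<delta>" using \<delta> by (auto simp: d_def)
  have md: "0 < m / 4 * d" using m d by simp
  have \<eta>0: "0 < \<eta>0" "\<eta>0 \<le> m / 4" "\<eta>0 < m / 4 * d" "\<eta>0 \<le> m"
    using m d md unfolding \<eta>0_def by (auto simp: min_def)
  have main: "finite {x\<in>{A..B}. q x = 0} \<and> card {x\<in>{A..B}. q x = 0} = card {x\<in>{A..B}. q0 x = 0} \<and>
    (\<forall>x\<in>{A..B}. q x = 0 \<longrightarrow> m \<le> \<bar>q0' x\<bar>)"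
    if q: "q A = 0" "q B = 0" "\<And>x. x \<in> {A..B} \<Longrightarrow> \<bar>q x - q0 x\<bar> \<le> \<eta>0"
      "\<And>x y. x \<in> {A..B} \<Longrightarrow> y \<in> {A..B} \<Longrightarrow> \<bar>(q x - q0 x) - (q y - q0 y)\<bar> \<le> \<eta>0 * \<bar>x - y\<bar>" for q
  proof -
    have qc: "continuous_on {A..B} q"
    proof -
      have "continuous_on {A..B} (\<lambda>x. q x - q0 x)"
      proof (rule continuous_on_iff[THEN iffD2], intro ballI allI impI)
        fix x e :: real assume x: "x \<in> {A..B}" and e: "0 < e"
        show "\<exists>d>0. \<forall>x'\<in>{A..B}. dist x' x < d \<longrightarrow> dist (q x' - q0 x') (q x - q0 x) < e"
        proof (intro exI[of _ "e / \<eta>0"] conjI ballI impI)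
          show "0 < e / \<eta>0" using e \<eta>0 by simp
          fix x' assume x': "x' \<in> {A..B}" "dist x' x < e / \<eta>0"
          then have "\<eta>0 * \<bar>x' - x\<bar> < e" using \<eta>0(1) by (simp add: dist_real_def field_simps)
          then show "dist (q x' - q0 x') (q x - q0 x) < e" using q(4)[OF x'(1) x] by (simp add: dist_real_def)
        qed
      qed
      then have "continuous_on {A..B} (\<lambda>x. (q x - q0 x) + q0 x)"
        by (intro continuous_on_add continuous_on_subset[OF c0]) auto
      then show ?thesis by simp
    qed
    have slopes: "\<exists>\<sigma>\<in>{1,-1}. \<forall>s\<in>{A..B}. \<forall>t\<in>{A..B}. \<bar>s - x\<bar> < \<delta> \<longrightarrow> \<bar>t - x\<bar> < \<delta> \<longrightarrow> t \<le> s \<longrightarrow>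
        m / 4 * (s - t) \<le> \<sigma> * (q0 s - q0 t) \<and> m / 4 * (s - t) \<le> \<sigma> * (q s - q t)"
      if x: "x \<in> {A..B}" "\<bar>q0 x\<bar> \<le> m" for x
    proof -
      obtain \<sigma> :: real where \<sigma>: "\<sigma> \<in> {1,-1}" "\<And>s t. s \<in> {A..B} \<Longrightarrow> t \<in> {A..B} \<Longrightarrow> \<bar>s - x\<bar> < \<delta> \<Longrightarrow> \<bar>t - x\<bar> < \<delta> \<Longrightarrow> t \<le> s \<Longrightarrow> m / 2 * (s - t) \<le> \<sigma> * (q0 s - q0 t)"
        using slope0[OF x] by blast
      have "m / 4 * (s - t) \<le> \<sigma> * (q0 s - q0 t) \<and> m / 4 * (s - t) \<le> \<sigma> * (q s - q t)"
        if st: "s \<in> {A..B}" "t \<in> {A..B}" "\<bar>s - x\<bar> < \<delta>" "\<bar>t - x\<bar> < \<delta>" "t \<le> s" for s t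
      proof -
        have a: "m / 2 * (s - t) \<le> \<sigma> * (q0 s - q0 t)" by (rule \<sigma>(2)[OF st])
        have "\<bar>\<sigma> * ((q s - q0 s) - (q t - q0 t))\<bar> \<le> \<eta>0 * \<bar>s - t\<bar>"
          using q(4)[OF st(1,2)] \<sigma>(1) by (auto simp: abs_mult)
        also have "\<dots> \<le> m / 4 * (s - t)" using mult_right_mono[OF \<eta>0(2), of "s - t"] st(5) by simp
        finally have "- (m / 4 * (s - t)) \<le> \<sigma> * ((q s - q0 s) - (q t - q0 t))" by linarith
        moreover have "\<sigma> * ((q s - q0 s) - (q t - q0 t)) = \<sigma> * (q s - q t) - \<sigma> * (q0 s - q0 t)"
          by (simp add: algebra_simps)
        moreover have "m / 2 * (s - t) = m / 4 * (s - t) + m / 4 * (s - t)" by simp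
        moreover have "0 \<le> m / 4 * (s - t)" using m st(5) by simp
        ultimately show ?thesis using a by linarith
      qed
      then show ?thesis using \<sigma>(1) by blast
    qed
    have near_q: "\<exists>z\<in>{A..B}. q z = 0 \<and> \<bar>z - x\<bar> \<le> d" if x: "x \<in> {A..B}" "q0 x = 0" for x
    proof -
      have "\<bar>q0 x\<bar> \<le> m" using x(2) m by simp
      then obtain \<sigma> :: real where \<sigma>: "\<sigma> \<in> {1,-1}" "\<And>s t. s \<in> {A..B} \<Longrightarrow> t \<in> {A..B} \<Longrightarrow> \<bar>s - x\<bar> < \<delta> \<Longrightarrow> \<bar>t - x\<bar> < \<delta> \<Longrightarrow> t \<le> s \<Longrightarrow>
         m / 4 * (s - t) \<le> \<sigma> * (q0 s - q0 t) \<and> m / 4 * (s - t) \<le> \<sigma> * (q s - q t)"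
        using slopes[OF x(1)] by blast
      have "\<bar>q x - q0 x\<bar> \<le> \<eta>0" by (rule q(3)[OF x(1)])
      moreover have "0 < m / 4" using m by simp
      ultimately show ?thesis
        using nearby_zero[OF qc q(1,2) ends x _ d \<eta>0(3) _ \<sigma>(1)] \<sigma>(2) by blast
    qed
    have near_q0: "\<exists>z\<in>{A..B}. q0 z = 0 \<and> \<bar>z - x\<bar> \<le> d" if x: "x \<in> {A..B}" "q x = 0" for x
    proof -
      have "\<bar>q0 x\<bar> \<le> m" using q(3)[OF x(1)] x(2) \<eta>0 by simp
      then obtain \<sigma> :: real where \<sigma>: "\<sigma> \<in> {1,-1}" "\<And>s t. s \<in> {A..B} \<Longrightarrow> t \<in> {A..B} \<Longrightarrow> \<bar>s - x\<bar> < \<delta> \<Longrightarrow> \<bar>t - x\<bar> < \<delta> \<Longrightarrow> t \<le> s \<Longrightarrow>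
         m / 4 * (s - t) \<le> \<sigma> * (q0 s - q0 t) \<and> m / 4 * (s - t) \<le> \<sigma> * (q s - q t)"
        using slopes[OF x(1)] by blast
      have "\<bar>q0 x - q x\<bar> \<le> \<eta>0" using q(3)[OF x(1)] by (simp add: abs_minus_commute)
      moreover have "0 < m / 4" using m by simp
      moreover have "continuous_on {A..B} q0" using c0 by (rule continuous_on_subset) simp
      ultimately show ?thesis
        using nearby_zero[OF _ ends q(1,2) x _ d \<eta>0(3) _ \<sigma>(1)] \<sigma>(2) by blast
    qed
    have sep: "x = y" if xy: "x \<in> {A..B}" "y \<in> {A..B}" "\<bar>q0 x\<bar> \<le> m" "\<bar>x - y\<bar> < \<delta>" "q x = q y \<or> q0 x = q0 y" for x y
    proof -
      obtain \<sigma> :: real where \<sigma>: "\<sigma> \<in> {1,-1}" "\<And>s t. s \<in> {A..B} \<Longrightarrow> t \<in> {A..B} \<Longrightarrow> \<bar>s - x\<bar> < \<delta> \<Longrightarrow> \<bar>t - x\<bar> < \<delta> \<Longrightarrow> t \<le> s \<Longrightarrow>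
         m / 4 * (s - t) \<le> \<sigma> * (q0 s - q0 t) \<and> m / 4 * (s - t) \<le> \<sigma> * (q s - q t)"
        using slopes[OF xy(1,3)] by blast
      have "m / 4 * \<bar>x - y\<bar> \<le> 0"
        using \<sigma>(2)[of x y] \<sigma>(2)[of y x] xy \<delta>(1) by (cases "x \<le> y") (auto simp: abs_minus_commute)
      then show ?thesis using m by (simp add: mult_le_0_iff)
    qed
    let ?Zq = "{x\<in>{A..B}. q x = 0}" and ?Z0 = "{x\<in>{A..B}. q0 x = 0}"
    have small0: "\<bar>q0 x\<bar> \<le> m" if "x \<in> ?Zq" for x using q(3)[of x] that \<eta>0 by auto
    obtain \<phi> where \<phi>: "\<And>x. x \<in> ?Zq \<Longrightarrow> \<phi> x \<in> ?Z0 \<and> \<bar>\<phi> x - x\<bar> \<le> d"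
      using near_q0 by (metis (mono_tags, lifting) mem_Collect_eq)
    obtain \<psi> where \<psi>: "\<And>x. x \<in> ?Z0 \<Longrightarrow> \<psi> x \<in> ?Zq \<and> \<bar>\<psi> x - x\<bar> \<le> d"
      using near_q by (metis (mono_tags, lifting) mem_Collect_eq)
    have "inj_on \<phi> ?Zq"
    proof (rule inj_onI)
      fix x y assume xy: "x \<in> ?Zq" "y \<in> ?Zq" "\<phi> x = \<phi> y"
      have "\<bar>x - y\<bar> \<le> 2 * d" using \<phi>[OF xy(1)] \<phi>[OF xy(2)] xy(3) by linarith
      then show "x = y" using xy small0[OF xy(1)] \<delta>(1) by (intro sep) (auto simp: d_def)
    qed
    moreover have "\<phi> ` ?Zq \<subseteq> ?Z0" using \<phi> by blast
    ultimately have 1: "finite ?Zq" "card ?Zq \<le> card ?Z0"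
      using fin inj_on_finite card_inj_on_le by blast+
    have "inj_on \<psi> ?Z0"
    proof (rule inj_onI)
      fix x y assume xy: "x \<in> ?Z0" "y \<in> ?Z0" "\<psi> x = \<psi> y"
      have "\<bar>x - y\<bar> \<le> 2 * d" using \<psi>[OF xy(1)] \<psi>[OF xy(2)] xy(3) by linarith
      then show "x = y" using xy m \<delta>(1) by (intro sep) (auto simp: d_def)
    qed
    moreover have "\<psi> ` ?Z0 \<subseteq> ?Zq" using \<psi> by blast
    ultimately have 2: "card ?Z0 \<le> card ?Zq"
      using 1(1) card_inj_on_le by blast
    show ?thesis using 1 2 dich small0 by auto
  qed
  show ?thesis
    by (rule exI[of _ m], rule conjI[OF m], rule exI[of _ \<eta>0], rule conjI[OF \<eta>0(1)]) (use main in blast)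
qed

text \<open>The derivative of cot is - 1 / sin ^ 2 \<le> -1 on (0, \<pi>).\<close>

lemma cot_diff_ge:
  assumes "0 < x" "x \<le> y" "y < pi"
  shows "y - x \<le> cot x - cot y"
proof -
  have "cot y + y \<le> cot x + x"
  proof (rule DERIV_nonpos_imp_nonincreasing[OF assms(2)])
    fix t assume t: "x \<le> t" "t \<le> y"
    have s: "0 < sin t" using t assms by (intro sin_gt_zero) auto
    then have "(sin t)\<^sup>2 \<le> 1" by (simp add: abs_square_le_1 power2_eq_square mult_le_one)
    then have "1 \<le> inverse ((sin t)\<^sup>2)" using s by (simp add: one_le_inverse)
    moreover have "((\<lambda>t. cot t + t) has_real_derivative - inverse ((sin t)\<^sup>2) + 1) (at t)"
      using s by (intro DERIV_add DERIV_cot DERIV_ident) auto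
    ultimately show "\<exists>d. ((\<lambda>t. cot t + t) has_real_derivative d) (at t) \<and> d \<le> 0"
      by (intro exI[of _ "- inverse ((sin t)\<^sup>2) + 1"]) auto
  qed
  then show ?thesis by linarith
qed

lemma abs_cot_diff_ge:
  assumes "0 < x" "x < pi" "0 < y" "y < pi"
  shows "\<bar>x - y\<bar> \<le> \<bar>cot x - cot y\<bar>"
  using cot_diff_ge[of x y] cot_diff_ge[of y x] assms by (cases "x \<le> y") auto

section \<open>Expansion of the straightening map\<close>

text \<open>Cauchy's inequality on discs of radius 1/16; giving up 1/8 of the half-width leaves room
  for them. Repetition along the half-widths 3/2, 11/8, 5/4, 9/8, 1 produces the powers of 16 among
  the later constants.\<close>

lemma cmod_deriv_le_strip:
  fixes f :: "complex \<Rightarrow> complex" and w :: complex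
  assumes f: "f holomorphic_on {w. \<bar>Im w\<bar> < R}" and B: "\<And>w. \<bar>Im w\<bar> < R \<Longrightarrow> cmod (f w) \<le> B"
    and w: "\<bar>Im w\<bar> < R - 1/8"
  shows "cmod (deriv f w) \<le> 16 * B"
proof -
  have sub: "cball w (1/16) \<subseteq> {w. \<bar>Im w\<bar> < R}"
  proof
    fix z assume "z \<in> cball w (1/16)"
    then have "\<bar>Im z - Im w\<bar> \<le> 1/16"
      using abs_Im_le_cmod[of "z - w"] by (simp add: dist_norm norm_minus_commute)
    then show "z \<in> {w. \<bar>Im w\<bar> < R}" using w unfolding mem_Collect_eq by linarith
  qed
  have "cmod ((deriv ^^ 1) f w) \<le> fact 1 * B / (1/16) ^ 1"
  proof (rule Cauchy_inequality)
    show "f holomorphic_on ball w (1/16)" using f sub ball_subset_cball holomorphic_on_subset by blast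
    show "continuous_on (cball w (1/16)) f"
      using f sub holomorphic_on_imp_continuous_on holomorphic_on_subset by blast
    show "cmod (f z) \<le> B" if "cmod (w - z) = 1/16" for z
      using B sub that by (auto simp: dist_norm subset_iff)
  qed simp
  then show ?thesis by simp
qed

lemma strip_open: "open {w::complex. \<bar>Im w\<bar> < R}" and strip_convex: "convex {w::complex. \<bar>Im w\<bar> < R}"
proof -
  have U: "{w::complex. \<bar>Im w\<bar> < R} = {w. Im w < R} \<inter> {w. Im w > - R}" by auto
  show "open {w::complex. \<bar>Im w\<bar> < R}" unfolding U by (intro open_Int open_halfspace_Im_lt open_halfspace_Im_gt)
  show "convex {w::complex. \<bar>Im w\<bar> < R}" unfolding U by (intro convex_Int convex_halfspace_Im_lt convex_halfspace_Im_gt)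
qed

lemma strip_holo_subset: "f holomorphic_on {w. \<bar>Im w\<bar> < R} \<Longrightarrow> r \<le> R \<Longrightarrow> f holomorphic_on {w. \<bar>Im w\<bar> < r}"
  by (rule holomorphic_on_subset) auto

lemma strip_lipschitz:
  fixes f :: "complex \<Rightarrow> complex"
  assumes f: "f holomorphic_on {w. \<bar>Im w\<bar> < R}" and B: "\<And>w. \<bar>Im w\<bar> < R \<Longrightarrow> cmod (deriv f w) \<le> B"
    and w: "\<bar>Im w\<bar> < R" "\<bar>Im w'\<bar> < R"
  shows "cmod (f w - f w') \<le> B * cmod (w - w')"
proof (rule field_differentiable_bound[OF strip_convex, where f' = "deriv f"])
  show "(f has_field_derivative deriv f x) (at x within {w. \<bar>Im w\<bar> < R})" if "x \<in> {w. \<bar>Im w\<bar> < R}" for x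
    using holomorphic_derivI[OF f strip_open that] by (rule has_field_derivative_at_within)
qed (use B w in auto)

definition lead :: "nat \<Rightarrow> real \<Rightarrow> complex \<Rightarrow> complex" where
  "lead n a w = sin w / of_real (sinh 1) + of_real a * sin (of_nat n * w) / of_real (sinh (real n))"

text \<open>The second derivative of \<open>lead\<close>, and hence the limit of T / \<epsilon> as
  \<epsilon> tends to 0.\<close>

definition lead2 :: "nat \<Rightarrow> real \<Rightarrow> complex \<Rightarrow> complex" where
  "lead2 n a w = - (sin w / of_real (sinh 1) + of_real (a * (real n)\<^sup>2) * sin (of_nat n * w) / of_real (sinh (real n)))"

definition lead_bound :: "nat \<Rightarrow> real \<Rightarrow> real" where
  "lead_bound n a = exp (3/2) / sinh 1 + \<bar>a\<bar> * exp (3/2 * real n) / sinh (real n)"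

lemma lead_bound_nonneg: "0 \<le> lead_bound n a"
  by (simp add: lead_bound_def)

lemma lead_h: "lead n a holomorphic_on A"
proof (cases "n = 0")
  case True
  then have "lead n a = (\<lambda>w. sin w / of_real (sinh 1))" by (auto simp: lead_def)
  then show ?thesis by (auto intro!: holomorphic_intros)
next
  case False
  then show ?thesis unfolding lead_def by (intro holomorphic_intros) auto
qed

lemma deriv_deriv_lead: "deriv (deriv (lead n a)) = lead2 n a"
proof -
  have "deriv (lead n a) w = cos w / of_real (sinh 1) + of_real a * (of_nat n * cos (of_nat n * w)) / of_real (sinh (real n))" for w
    unfolding lead_def
    by (rule DERIV_imp_deriv, cases "n = 0") (auto intro!: derivative_eq_intros simp: algebra_simps)
  then have d: "deriv (lead n a) = (\<lambda>w. cos w / of_real (sinh 1) + of_real a * (of_nat n * cos (of_nat n * w)) / of_real (sinh (real n)))"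
    by blast
  show ?thesis
  proof
    fix w
    show "deriv (deriv (lead n a)) w = lead2 n a w" unfolding d lead2_def
      by (rule DERIV_imp_deriv, cases "n = 0") (auto intro!: derivative_eq_intros simp: power2_eq_square algebra_simps)
  qed
qed

lemma lead'_h: "deriv (lead n a) holomorphic_on A"
  using holomorphic_deriv[OF lead_h open_UNIV] holomorphic_on_subset by blast

lemma lead2_h: "lead2 n a holomorphic_on A"
  using holomorphic_deriv[OF lead'_h open_UNIV] holomorphic_on_subset unfolding deriv_deriv_lead by blast

lemma lead2'_h: "deriv (lead2 n a) holomorphic_on A"
  using holomorphic_deriv[OF lead2_h open_UNIV] holomorphic_on_subset by blast

lemma cmod_lead_le:
  assumes "\<bar>Im w\<bar> < 3/2"
  shows "cmod (lead n a w) \<le> lead_bound n a"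
proof -
  have 1: "cmod (sin w) \<le> exp (3/2)" using cmod_sin_of_nat_le[of w 1] assms by simp
  have 2: "cmod (sin (of_nat n * w)) \<le> exp (3/2 * real n)" using cmod_sin_of_nat_le[of w n] assms by simp
  have "cmod (lead n a w) \<le> cmod (sin w / of_real (sinh 1)) + cmod (of_real a * sin (of_nat n * w) / of_real (sinh (real n)))"
    unfolding lead_def by (rule norm_triangle_ineq)
  also have "\<dots> \<le> lead_bound n a"
    unfolding lead_bound_def norm_divide norm_mult norm_of_real using 1 2
    by (intro add_mono) (auto intro!: divide_right_mono mult_left_mono)
  finally show ?thesis .
qed

text \<open>M is a square so that it also dominates the product of two first-order bounds, which
  appears when lead2 meets F' - 1. The factor 10 ^ 9 makes every numerical constant times M *
  \<bar>\<epsilon>\<bar> below small enough for absorption.\<close>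

locale channel_expansion =
  fixes n :: nat and a C \<epsilon> \<rho> M :: real and F :: "complex \<Rightarrow> complex"
  assumes n2: "2 \<le> n" and C: "0 \<le> C" and M_def: "M = (1 + \<bar>a\<bar> * real n + lead_bound n a + C)\<^sup>2"
    and \<epsilon>_nz: "\<epsilon> \<noteq> 0" and \<epsilon>_small: "10 ^ 9 * M * \<bar>\<epsilon>\<bar> \<le> 1"
    and \<rho>_near: "\<bar>\<rho> - 1\<bar> \<le> 1/20" "\<bar>\<rho> - 1\<bar> \<le> C * \<bar>\<epsilon>\<bar>"
    and F_holomorphic: "F holomorphic_on {w. \<bar>Im w\<bar> < 3/2}"
    and F_minus: "\<And>w. \<bar>Im w\<bar> < 3/2 \<Longrightarrow> F (- w) = - F w"
    and F_conj: "\<And>w. \<bar>Im w\<bar> < 3/2 \<Longrightarrow> F (cnj w) = cnj (F w)"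
    and F_plus: "\<And>w. \<bar>Im w\<bar> < 3/2 \<Longrightarrow> F (w + 2 * pi) = F w + 2 * pi"
    and F_approx: "\<And>w. \<bar>Im w\<bar> < 3/2 \<Longrightarrow> cmod (F w - w - of_real \<epsilon> * lead n a w) \<le> C * \<epsilon>\<^sup>2"
    and F_upper: "\<And>u::real. Im (F (u + \<i> * \<rho>)) = 1 + \<epsilon> * (cos (Re (F (u + \<i> * \<rho>))) + a * cos (real n * Re (F (u + \<i> * \<rho>))))"
begin

definition P where "P w = F w - w - of_real \<epsilon> * lead n a w"

lemma M_bounds: "1 \<le> M" "lead_bound n a \<le> M" "C \<le> M" "lead_bound n a * (lead_bound n a + C) \<le> M"
  "1 + \<bar>a\<bar> * real n \<le> M"
proof -
  define b where "b = 1 + \<bar>a\<bar> * real n + lead_bound n a + C"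
  have b: "1 \<le> b" "lead_bound n a \<le> b" "C \<le> b" "lead_bound n a + C \<le> b" "1 + \<bar>a\<bar> * real n \<le> b"
    using C lead_bound_nonneg[of n a] by (auto simp: b_def)
  have "b \<le> M" using b(1) by (simp add: M_def b_def[symmetric] power2_eq_square)
  then show "1 \<le> M" "lead_bound n a \<le> M" "C \<le> M" "1 + \<bar>a\<bar> * real n \<le> M" using b by auto
  show "lead_bound n a * (lead_bound n a + C) \<le> M" unfolding M_def b_def[symmetric] power2_eq_square
    using b C lead_bound_nonneg[of n a] by (intro mult_mono) auto
qed

lemma \<epsilon>_le: "x \<le> M \<Longrightarrow> x * \<bar>\<epsilon>\<bar> \<le> 1 / 10 ^ 9"
  using mult_right_mono[of x M "\<bar>\<epsilon>\<bar>"] \<epsilon>_small by simp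

lemma \<epsilon>_le_1: "\<bar>\<epsilon>\<bar> \<le> 1 / 10 ^ 9"
  using \<epsilon>_le[of 1] M_bounds by simp

lemma P_holo: "P holomorphic_on {w. \<bar>Im w\<bar> < 3/2}"
  unfolding P_def by (intro holomorphic_intros F_holomorphic lead_h)

lemma P'_holo: "deriv P holomorphic_on {w. \<bar>Im w\<bar> < 3/2}"
  by (rule holomorphic_deriv[OF P_holo strip_open])

lemma P_le: "\<bar>Im w\<bar> < 3/2 \<Longrightarrow> cmod (P w) \<le> C * \<epsilon>\<^sup>2"
  using F_approx by (simp add: P_def)

lemma P'_le: "\<bar>Im w\<bar> < 11/8 \<Longrightarrow> cmod (deriv P w) \<le> 16 * (C * \<epsilon>\<^sup>2)"
  using cmod_deriv_le_strip[OF P_holo P_le] by simp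

lemma P''_le: "\<bar>Im w\<bar> < 5/4 \<Longrightarrow> cmod (deriv (deriv P) w) \<le> 16 * (16 * (C * \<epsilon>\<^sup>2))"
  using cmod_deriv_le_strip[OF strip_holo_subset[OF P'_holo, of "11/8"] P'_le] by simp

lemma lead'_le: "\<bar>Im w\<bar> < 11/8 \<Longrightarrow> cmod (deriv (lead n a) w) \<le> 16 * lead_bound n a"
  using cmod_deriv_le_strip[OF lead_h cmod_lead_le, where w = w and R = "3/2"] by simp


lemma lead2_le: "\<bar>Im w\<bar> < 5/4 \<Longrightarrow> cmod (lead2 n a w) \<le> 256 * M"
  using cmod_deriv_le_strip[OF lead'_h lead'_le, where w = w and R = "11/8"] M_bounds(2) by (simp add: deriv_deriv_lead)


lemma lead2'_le: "\<bar>Im w\<bar> < 9/8 \<Longrightarrow> cmod (deriv (lead2 n a) w) \<le> 4096 * M"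
  using cmod_deriv_le_strip[OF lead2_h lead2_le, where w = w and R = "5/4"] by simp

lemma lead2''_le: "\<bar>Im w\<bar> < 1 \<Longrightarrow> cmod (deriv (deriv (lead2 n a)) w) \<le> 65536 * M"
  using cmod_deriv_le_strip[OF lead2'_h lead2'_le, where w = w and R = "9/8"] by simp

lemma deriv_F: "\<bar>Im w\<bar> < 3/2 \<Longrightarrow> deriv F w = 1 + of_real \<epsilon> * deriv (lead n a) w + deriv P w"
proof -
  assume w: "\<bar>Im w\<bar> < 3/2"
  have F: "F = (\<lambda>w. w + of_real \<epsilon> * lead n a w + P w)" by (simp add: P_def)
  have l: "(lead n a has_field_derivative deriv (lead n a) w) (at w)"
    using lead_h[where A = UNIV] open_UNIV by (rule holomorphic_derivI) simp
  have p: "(P has_field_derivative deriv P w) (at w)"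
    using P_holo strip_open by (rule holomorphic_derivI) (use w in simp)
  show ?thesis
    by (subst (1) F, rule DERIV_imp_deriv, rule DERIV_add[OF DERIV_add[OF DERIV_ident DERIV_cmult[OF l]] p])
qed

lemma deriv_deriv_F: "\<bar>Im w\<bar> < 3/2 \<Longrightarrow> deriv (deriv F) w = of_real \<epsilon> * lead2 n a w + deriv (deriv P) w"
proof -
  assume w: "\<bar>Im w\<bar> < 3/2"
  have l: "(deriv (lead n a) has_field_derivative lead2 n a w) (at w)"
    unfolding deriv_deriv_lead[symmetric] using lead'_h[where A = UNIV] open_UNIV by (rule holomorphic_derivI) simp
  have p: "(deriv P has_field_derivative deriv (deriv P) w) (at w)"
    using P'_holo strip_open by (rule holomorphic_derivI) (use w in simp)
  have "deriv (deriv F) w = deriv (\<lambda>w. 1 + of_real \<epsilon> * deriv (lead n a) w + deriv P w) w"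
  proof (rule deriv_cong_ev)
    have "eventually (\<lambda>x. x \<in> {w::complex. \<bar>Im w\<bar> < 3/2}) (nhds w)"
      using strip_open by (rule eventually_nhds_in_open) (use w in simp)
    then show "\<forall>\<^sub>F x in nhds w. deriv F x = 1 + of_real \<epsilon> * deriv (lead n a) x + deriv P x"
      by (rule eventually_mono) (use deriv_F in simp)
  qed simp
  also have "\<dots> = 0 + of_real \<epsilon> * lead2 n a w + deriv (deriv P) w"
    by (rule DERIV_imp_deriv, rule DERIV_add[OF DERIV_add[OF DERIV_const DERIV_cmult[OF l]] p])
  finally show ?thesis by simp
qed

lemma F'_near_1: "\<bar>Im w\<bar> < 11/8 \<Longrightarrow> cmod (deriv F w - 1) \<le> 16 * (lead_bound n a + C) * \<bar>\<epsilon>\<bar>"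
proof -
  assume w: "\<bar>Im w\<bar> < 11/8"
  have "\<epsilon>\<^sup>2 \<le> \<bar>\<epsilon>\<bar>" using mult_left_le_one_le[of "\<bar>\<epsilon>\<bar>" "\<bar>\<epsilon>\<bar>"] \<epsilon>_le_1 by (simp add: power2_eq_square)
  then have "C * \<epsilon>\<^sup>2 \<le> C * \<bar>\<epsilon>\<bar>" using C by (rule mult_left_mono)
  then have p: "cmod (deriv P w) \<le> 16 * (C * \<bar>\<epsilon>\<bar>)" using P'_le[OF w] by linarith
  have "deriv F w - 1 = of_real \<epsilon> * deriv (lead n a) w + deriv P w"
    using deriv_F[of w] w by simp
  also have "cmod \<dots> \<le> \<bar>\<epsilon>\<bar> * cmod (deriv (lead n a) w) + cmod (deriv P w)"
    by (rule norm_triangle_le) (simp add: norm_mult)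
  also have "\<dots> \<le> \<bar>\<epsilon>\<bar> * (16 * lead_bound n a) + 16 * (C * \<bar>\<epsilon>\<bar>)"
    using lead'_le[OF w] p by (intro add_mono mult_left_mono) auto
  finally show ?thesis by (simp add: algebra_simps)
qed

lemma F'_near_1_half: "\<bar>Im w\<bar> < 11/8 \<Longrightarrow> cmod (deriv F w - 1) \<le> 1/2"
  using F'_near_1[of w] \<epsilon>_le[OF M_bounds(2)] \<epsilon>_le[OF M_bounds(3)] by (simp add: algebra_simps)

end

sublocale channel_expansion \<subseteq> channel_map n a \<epsilon> \<rho> F
proof
  show "2 \<le> n" by (rule n2)
  show "\<bar>\<rho> - 1\<bar> \<le> 1/20" by (rule \<rho>_near)
  show "\<bar>\<epsilon>\<bar> * (1 + \<bar>a\<bar> * real n) < 1" using \<epsilon>_le[OF M_bounds(5)] by (simp add: mult.commute)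
  show "F holomorphic_on {w. \<bar>Im w\<bar> < 5/4}" using F_holomorphic by (rule strip_holo_subset) simp
qed (use F_minus F_conj F_plus F_upper F'_near_1_half in auto)

context channel_expansion
begin

definition t where "t w = T w / of_real \<epsilon>"

lemma T_eq: "T w = of_real \<epsilon> * t w"
  using \<epsilon>_nz by (simp add: t_def)

lemma t_holo: "t holomorphic_on {w. \<bar>Im w\<bar> < 5/4}"
  unfolding t_def using T_holo \<epsilon>_nz by (intro holomorphic_intros) (auto simp: U_def)

text \<open>Over the denominator F', whose modulus is at least 1/2, the error is lead2 * (1 - F')
  plus P'' / \<epsilon>. Both are of order \<epsilon>, with constants 4096 and 256, and 2 * (4096 +
  256) = 8704.\<close>

lemma t_near:
  assumes w: "\<bar>Im w\<bar> < 5/4"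
  shows "cmod (t w - lead2 n a w) \<le> 8704 * M * \<bar>\<epsilon>\<bar>"
proof -
  have nz: "deriv F w \<noteq> 0" using F'_nonzero w by (simp add: U_def)
  have h: "1/2 \<le> cmod (deriv F w)"
    using F'_near_1_half[of w] w norm_triangle_ineq2[of 1 "deriv F w"] by (simp add: norm_minus_commute)
  have eq: "t w - lead2 n a w = (lead2 n a w * (1 - deriv F w) + deriv (deriv P) w / of_real \<epsilon>) / deriv F w"
    using nz \<epsilon>_nz deriv_deriv_F[of w] w by (simp add: t_def T_def field_simps)
  have l: "cmod (lead2 n a w) \<le> 256 * lead_bound n a"
    using cmod_deriv_le_strip[OF lead'_h lead'_le, where w = w and R = "11/8"] w by (simp add: deriv_deriv_lead)
  have 1: "cmod (lead2 n a w * (1 - deriv F w)) \<le> 256 * lead_bound n a * (16 * (lead_bound n a + C) * \<bar>\<epsilon>\<bar>)"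
    unfolding norm_mult using l F'_near_1[of w] w lead_bound_nonneg[of n a]
    by (intro mult_mono) (auto simp: norm_minus_commute)
  also have "\<dots> = 4096 * (lead_bound n a * (lead_bound n a + C)) * \<bar>\<epsilon>\<bar>" by simp
  also have "\<dots> \<le> 4096 * M * \<bar>\<epsilon>\<bar>" using M_bounds(4) by (intro mult_right_mono) auto
  finally have 1: "cmod (lead2 n a w * (1 - deriv F w)) \<le> 4096 * M * \<bar>\<epsilon>\<bar>" .
  have "cmod (deriv (deriv P) w / of_real \<epsilon>) \<le> 256 * (C * \<epsilon>\<^sup>2) / \<bar>\<epsilon>\<bar>"
    unfolding norm_divide norm_of_real using P''_le[OF w] by (intro divide_right_mono) auto
  also have "\<dots> = 256 * C * \<bar>\<epsilon>\<bar>"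
    using \<epsilon>_nz by (simp add: power2_eq_square field_simps abs_mult_self_eq)
  also have "\<dots> \<le> 256 * M * \<bar>\<epsilon>\<bar>" using M_bounds(3) by (intro mult_right_mono) auto
  finally have 2: "cmod (lead2 n a w * (1 - deriv F w) + deriv (deriv P) w / of_real \<epsilon>) \<le> 4352 * M * \<bar>\<epsilon>\<bar>"
    using 1 norm_triangle_ineq[of "lead2 n a w * (1 - deriv F w)" "deriv (deriv P) w / of_real \<epsilon>"] by linarith
  have "cmod (t w - lead2 n a w) \<le> 4352 * M * \<bar>\<epsilon>\<bar> / (1/2)"
    unfolding eq norm_divide using 2 h M_bounds(1) by (intro frac_le) auto
  then show ?thesis by simp
qed

lemma diff_holo: "(\<lambda>w. t w - lead2 n a w) holomorphic_on {w. \<bar>Im w\<bar> < 5/4}"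
  using t_holo lead2_h by (rule holomorphic_on_diff)

lemma deriv_t_diff: "\<bar>Im w\<bar> < 5/4 \<Longrightarrow> deriv (\<lambda>w. t w - lead2 n a w) w = deriv t w - deriv (lead2 n a) w"
  using holomorphic_on_imp_differentiable_at[OF t_holo strip_open] holomorphic_on_imp_differentiable_at[OF lead2_h[where A = UNIV] open_UNIV]
  by (intro deriv_diff) auto

lemma t'_near: "\<bar>Im w\<bar> < 9/8 \<Longrightarrow> cmod (deriv t w - deriv (lead2 n a) w) \<le> 139264 * M * \<bar>\<epsilon>\<bar>"
  using cmod_deriv_le_strip[OF diff_holo t_near, where w = w] by (simp add: deriv_t_diff)

lemma t_le: "\<bar>Im w\<bar> < 5/4 \<Longrightarrow> cmod (t w) \<le> 257 * M"
proof -
  assume w: "\<bar>Im w\<bar> < 5/4"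
  have "cmod (t w) \<le> cmod (lead2 n a w) + cmod (t w - lead2 n a w)"
    using norm_triangle_ineq[of "lead2 n a w" "t w - lead2 n a w"] by simp
  then show ?thesis using lead2_le[OF w] t_near[OF w] \<epsilon>_le[OF order_refl] M_bounds(1) by simp
qed

lemma t'_le: "\<bar>Im w\<bar> < 9/8 \<Longrightarrow> cmod (deriv t w) \<le> 4097 * M"
proof -
  assume w: "\<bar>Im w\<bar> < 9/8"
  have "cmod (deriv t w) \<le> cmod (deriv (lead2 n a) w) + cmod (deriv t w - deriv (lead2 n a) w)"
    using norm_triangle_ineq[of "deriv (lead2 n a) w" "deriv t w - deriv (lead2 n a) w"] by simp
  then show ?thesis using lead2'_le[OF w] t'_near[OF w] \<epsilon>_le[OF order_refl] M_bounds(1) by simp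
qed

lemma T_lipschitz:
  "\<bar>Im w\<bar> < 9/8 \<Longrightarrow> \<bar>Im w'\<bar> < 9/8 \<Longrightarrow> cmod (T w - T w') \<le> 4097 * M * \<bar>\<epsilon>\<bar> * cmod (w - w')"
  using mult_left_mono[OF strip_lipschitz[OF strip_holo_subset[OF t_holo, of "9/8"] t'_le, of w w'], of "\<bar>\<epsilon>\<bar>"]
  by (simp add: T_eq norm_mult mult_ac flip: right_diff_distrib)

lemma T_le: "\<bar>Im w\<bar> < 5/4 \<Longrightarrow> cmod (T w) \<le> 257 * M * \<bar>\<epsilon>\<bar>"
  using mult_left_mono[OF t_le, of w "\<bar>\<epsilon>\<bar>"] by (simp add: T_eq norm_mult mult_ac)

text \<open>Periodicity up to an additive constant becomes periodicity after one derivative; the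
  argument runs for F and then for F'.\<close>

lemma T_periodic:
  assumes w: "\<bar>Im w\<bar> < 5/4" shows "T (w + 2 * pi) = T w"
proof -
  let ?V = "{w::complex. \<bar>Im w\<bar> < 5/4}"
  have per: "deriv f (z + 2 * pi) = deriv f z"
    if "f holomorphic_on ?V" "\<And>z. z \<in> ?V \<Longrightarrow> f (z + 2 * pi) = f z + c" "z \<in> ?V" for f :: "complex \<Rightarrow> complex" and c z
  proof -
    have z: "z + 2 * pi \<in> ?V" using that(3) by simp
    have "((\<lambda>x. f (x + 2 * pi)) has_field_derivative deriv f (z + 2 * pi)) (at z)"
      unfolding DERIV_shift[symmetric] by (rule holomorphic_derivI[OF that(1) strip_open z])
    moreover have "((\<lambda>x. f (x + 2 * pi)) has_field_derivative deriv f z + 0) (at z)"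
      by (rule has_field_derivative_transform_within_open[OF DERIV_add[OF holomorphic_derivI[OF that(1) strip_open that(3)] DERIV_const] strip_open that(3)])
        (use that(2) in simp)
    ultimately show ?thesis by (auto dest: DERIV_unique)
  qed
  have F: "F holomorphic_on ?V" by (rule strip_holo_subset[OF F_holomorphic]) simp
  have 1: "deriv F (z + 2 * pi) = deriv F z" if "z \<in> ?V" for z
    by (rule per[OF F _ that]) (use F_plus in auto)
  have 2: "deriv (deriv F) (z + 2 * pi) = deriv (deriv F) z" if "z \<in> ?V" for z
    by (rule per[OF holomorphic_deriv[OF F strip_open] _ that, where c = 0]) (use 1 in auto)
  show ?thesis using 1 2 w by (simp add: T_def)
qed

text \<open>Under the reflection w -> - cnj w the map F is antisymmetric and each derivative flips
  the sign. So F' is symmetric, F'' antisymmetric, and their quotient is purely imaginary on the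
  axis of reflection.\<close>

lemma Re_T_imag_axis:
  assumes w: "\<bar>v\<bar> < 5/4" shows "Re (T (\<i> * of_real v)) = 0"
proof -
  let ?V = "{w::complex. \<bar>Im w\<bar> < 5/4}"
  have sym: "cnj (deriv f (- cnj z)) = - s * deriv f z"
    if "f holomorphic_on ?V" "\<And>z. z \<in> ?V \<Longrightarrow> cnj (f (- cnj z)) = s * f z" "z \<in> ?V" for f :: "complex \<Rightarrow> complex" and s z
  proof -
    have z: "- cnj z \<in> ?V" using that(3) by simp
    have m: "((\<lambda>x. f (- x)) has_field_derivative deriv f (- cnj z) * -1) (at (cnj z))"
      using holomorphic_derivI[OF that(1) strip_open z]
      by (intro DERIV_chain2[of f _ uminus] DERIV_minus DERIV_ident) auto
    have "((cnj \<circ> (\<lambda>x. f (- x)) \<circ> cnj) has_field_derivative cnj (deriv f (- cnj z) * -1)) (at z)"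
      using has_field_derivative_cnj_cnj[of "\<lambda>x. f (- x)" "deriv f (- cnj z) * -1" z] m by simp
    then have "((\<lambda>x. cnj (f (- cnj x))) has_field_derivative - cnj (deriv f (- cnj z))) (at z)"
      by (simp add: o_def)
    moreover have "((\<lambda>x. cnj (f (- cnj x))) has_field_derivative s * deriv f z) (at z)"
      by (rule has_field_derivative_transform_within_open[OF DERIV_cmult[OF holomorphic_derivI[OF that(1) strip_open that(3)]] strip_open that(3)])
        (use that(2) in simp)
    ultimately have "- cnj (deriv f (- cnj z)) = s * deriv f z" by (rule DERIV_unique)
    then show ?thesis by (metis minus_equation_iff mult_minus_left)
  qed
  have F: "F holomorphic_on ?V" by (rule strip_holo_subset[OF F_holomorphic]) simp
  have 0: "cnj (F (- cnj z)) = - 1 * F z" if "z \<in> ?V" for z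
    using F_minus[of "cnj z"] F_conj[of z] that by simp
  have 1: "cnj (deriv F (- cnj z)) = 1 * deriv F z" if "z \<in> ?V" for z
    using sym[OF F 0 that] by simp
  have 2: "cnj (deriv (deriv F) (- cnj z)) = - deriv (deriv F) z" if "z \<in> ?V" for z
    using sym[OF holomorphic_deriv[OF F strip_open] 1 that] by simp
  have "cnj (T (\<i> * of_real v)) = - T (\<i> * of_real v)"
    using 1[of "\<i> * of_real v"] 2[of "\<i> * of_real v"] w by (simp add: T_def)
  then have "Re (cnj (T (\<i> * of_real v))) = - Re (T (\<i> * of_real v))" by simp
  then show ?thesis by simp
qed

end

section \<open>The curve where the vertical equation holds\<close>

lemma cmod_vertical: "cmod (Complex u v - Complex u v') = \<bar>v - v'\<bar>"
  by (simp add: cmod_def)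

text \<open>Limit, as \<epsilon> tends to 0, of the horizontal equation divided by \<epsilon>: the
  curve degenerates to Im w = 1/2.\<close>

definition lead_ridge :: "nat \<Rightarrow> real \<Rightarrow> real \<Rightarrow> real" where
  "lead_ridge n a u = Re (lead2 n a (Complex u (1/2)))"

context channel_expansion
begin

lemma \<rho>_strip: "0 < v \<Longrightarrow> v < \<rho> \<Longrightarrow> \<bar>v\<bar> < 9/8"
  using \<rho>_bounds by linarith

text \<open>Since \<kappa> > 2 and cot has slope at most -1, the left side separates two heights by
  a factor 4, whereas T varies with a constant of order \<epsilon>. The vertical variation of T is
  absorbed. For u = u' this is uniqueness of the height.\<close>

lemma ridge_lipschitz:
  assumes v: "0 < v" "v < \<rho>" "\<kappa> * cot (\<kappa> * v) = Im (T (Complex u v))"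
    and v': "0 < v'" "v' < \<rho>" "\<kappa> * cot (\<kappa> * v') = Im (T (Complex u' v'))"
  shows "\<bar>v - v'\<bar> \<le> 4097 * M * \<bar>\<epsilon>\<bar> * \<bar>u - u'\<bar>"
proof -
  let ?L = "4097 * M * \<bar>\<epsilon>\<bar>"
  have L: "?L \<le> 1" "0 \<le> ?L" using \<epsilon>_le[OF order_refl] M_bounds(1) by auto
  have "\<bar>\<kappa> * v - \<kappa> * v'\<bar> \<le> \<bar>cot (\<kappa> * v) - cot (\<kappa> * v')\<bar>"
    using \<kappa>_Im[of "Complex u v"] \<kappa>_Im[of "Complex u' v'"] v v' by (intro abs_cot_diff_ge) (auto simp: S_def)
  then have "\<kappa> * \<bar>\<kappa> * v - \<kappa> * v'\<bar> \<le> \<kappa> * \<bar>cot (\<kappa> * v) - cot (\<kappa> * v')\<bar>"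
    using \<kappa>_bounds(3) by (intro mult_left_mono) auto
  also have "\<dots> = \<bar>\<kappa> * cot (\<kappa> * v) - \<kappa> * cot (\<kappa> * v')\<bar>"
    using \<kappa>_bounds(3) by (simp add: abs_mult flip: right_diff_distrib)
  also have "\<dots> = \<bar>Im (T (Complex u v) - T (Complex u' v'))\<bar>" using v v' by simp
  also have "\<dots> \<le> cmod (T (Complex u v) - T (Complex u' v'))" by (rule abs_Im_le_cmod)
  also have "\<dots> \<le> ?L * cmod (Complex u v - Complex u' v')"
    using \<rho>_strip v v' by (intro T_lipschitz) auto
  also have "\<dots> \<le> ?L * (\<bar>u - u'\<bar> + \<bar>v - v'\<bar>)"
    using cmod_le[of "Complex u v - Complex u' v'"] L by (intro mult_left_mono) auto
  also have "\<dots> \<le> ?L * \<bar>u - u'\<bar> + \<bar>v - v'\<bar>"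
    using mult_right_mono[OF L(1), of "\<bar>v - v'\<bar>"] by (simp add: distrib_left)
  finally have "\<kappa> * \<bar>\<kappa> * v - \<kappa> * v'\<bar> \<le> ?L * \<bar>u - u'\<bar> + \<bar>v - v'\<bar>" .
  moreover have "\<kappa> * \<bar>\<kappa> * v - \<kappa> * v'\<bar> = \<kappa> * \<kappa> * \<bar>v - v'\<bar>"
    using \<kappa>_bounds(3) by (simp add: abs_mult flip: right_diff_distrib)
  moreover have "2 * 2 * \<bar>v - v'\<bar> \<le> \<kappa> * \<kappa> * \<bar>v - v'\<bar>"
    using \<kappa>_bounds by (intro mult_right_mono mult_mono) auto
  moreover have "0 \<le> ?L * \<bar>u - u'\<bar>" using L by simp
  ultimately show ?thesis by linarith
qed

lemma ridge_exists: "\<exists>v. 0 < v \<and> v < \<rho> \<and> \<kappa> * cot (\<kappa> * v) = Im (T (Complex u v))"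
proof -
  let ?g = "\<lambda>v. \<kappa> * cot (\<kappa> * v) - Im (T (Complex u v))"
  have T1: "\<bar>Im (T (Complex u v))\<bar> \<le> 1" if "0 < v" "v < \<rho>" for v
    using abs_Im_le_cmod[of "T (Complex u v)"] T_le[of "Complex u v"] \<rho>_strip[OF that]
      \<epsilon>_le[OF order_refl] by simp
  \<comment> \<open>At one and three quarters of the height \<kappa> * cot takes the values \<kappa>
    and - \<kappa>, which exceed \<bar>Im T\<bar> \<le> 1 and give the sign change.\<close>
  have q: "\<kappa> * (\<rho> / 4) = pi / 4" "\<kappa> * (3 * \<rho> / 4) = pi / 2 + pi / 4" using \<kappa>_bounds(4) by simp_all
  have "cot (pi / 4) = (1::real)" by (simp add: cot_def sin_45 cos_45)
  moreover have "cot (pi / 2 + pi / 4) = (-1::real)" unfolding cot_def sin_add cos_add by (simp add: sin_45 cos_45)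
  ultimately have ends: "?g (3 * \<rho> / 4) \<le> 0" "0 \<le> ?g (\<rho> / 4)"
    using T1[of "\<rho> / 4"] T1[of "3 * \<rho> / 4"] \<kappa>_bounds \<rho>_bounds unfolding q by auto
  have "continuous_on {\<rho>/4..3*\<rho>/4} ?g"
  proof (intro continuous_on_diff continuous_on_mult continuous_on_const continuous_on_id continuous_on_cot continuous_on_Im ballI continuous_on_compose2[OF holomorphic_on_imp_continuous_on[OF T_holo]])
    show "sin (\<kappa> * v) \<noteq> 0" if "v \<in> {\<rho>/4..3*\<rho>/4}" for v
      using \<kappa>_Im[of "Complex 0 v"] that \<rho>_bounds sin_gt_zero[of "\<kappa> * v"] by (auto simp: S_def)
    show "continuous_on {\<rho>/4..3*\<rho>/4} (Complex u)"
      unfolding Complex_eq by (intro continuous_intros)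
    show "Complex u ` {\<rho>/4..3*\<rho>/4} \<subseteq> U" using \<rho>_bounds by (auto simp: U_def)
  qed
  then obtain v where "\<rho>/4 \<le> v" "v \<le> 3*\<rho>/4" "?g v = 0"
    using IVT2'[of ?g "3*\<rho>/4" 0 "\<rho>/4"] ends \<rho>_bounds by auto
  then show ?thesis using \<rho>_bounds by (intro exI[of _ v]) auto
qed

definition ridge where "ridge u = (SOME v. 0 < v \<and> v < \<rho> \<and> \<kappa> * cot (\<kappa> * v) = Im (T (Complex u v)))"

lemma ridge: "0 < ridge u" "ridge u < \<rho>" "\<kappa> * cot (\<kappa> * ridge u) = Im (T (Complex u (ridge u)))"
  using someI_ex[OF ridge_exists[of u], folded ridge_def] by auto

lemma ridge_unique: "0 < v \<Longrightarrow> v < \<rho> \<Longrightarrow> \<kappa> * cot (\<kappa> * v) = Im (T (Complex u v)) \<Longrightarrow> v = ridge u"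
  using ridge_lipschitz[of v u "ridge u" u] ridge[of u] by simp

lemma ridge_diff: "\<bar>ridge u - ridge u'\<bar> \<le> 4097 * M * \<bar>\<epsilon>\<bar> * \<bar>u - u'\<bar>"
  by (rule ridge_lipschitz[OF ridge ridge])

text \<open>Comparison with cot (pi / 2) = 0 bounds the distance from \<rho> / 2 by 257/4 * M *
  \<bar>\<epsilon>\<bar>; passing from \<rho> / 2 to 1/2 adds at most another half of M *
  \<bar>\<epsilon>\<bar>.\<close>

lemma ridge_near: "\<bar>ridge u - 1/2\<bar> \<le> 66 * M * \<bar>\<epsilon>\<bar>"
proof -
  let ?v = "ridge u"
  have "\<bar>\<kappa> * ?v - pi / 2\<bar> \<le> \<bar>cot (\<kappa> * ?v) - cot (pi / 2)\<bar>"
    using \<kappa>_Im[of "Complex u ?v"] ridge[of u] by (intro abs_cot_diff_ge) (auto simp: S_def)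
  also have "\<dots> = \<bar>cot (\<kappa> * ?v)\<bar>" by (simp add: cot_def)
  finally have "\<kappa> * \<bar>\<kappa> * ?v - pi / 2\<bar> \<le> \<kappa> * \<bar>cot (\<kappa> * ?v)\<bar>"
    using \<kappa>_bounds(3) by (intro mult_left_mono) auto
  also have "\<dots> = \<bar>Im (T (Complex u ?v))\<bar>" using \<kappa>_bounds(3) ridge(3)[of u] by (metis abs_mult abs_of_pos)
  also have "\<dots> \<le> 257 * M * \<bar>\<epsilon>\<bar>"
    using abs_Im_le_cmod[of "T (Complex u ?v)"] T_le[of "Complex u ?v"] \<rho>_strip[OF ridge(1,2), of u] by simp
  also have "\<kappa> * \<bar>\<kappa> * ?v - pi / 2\<bar> = \<kappa> * \<kappa> * \<bar>?v - \<rho> / 2\<bar>"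
  proof -
    have "\<kappa> * ?v - pi / 2 = \<kappa> * (?v - \<rho> / 2)" using \<kappa>_bounds(4) by (simp add: right_diff_distrib)
    then show ?thesis using \<kappa>_bounds(3) by (simp add: abs_mult)
  qed
  finally have "\<kappa> * \<kappa> * \<bar>?v - \<rho> / 2\<bar> \<le> 257 * M * \<bar>\<epsilon>\<bar>" .
  moreover have "2 * 2 * \<bar>?v - \<rho> / 2\<bar> \<le> \<kappa> * \<kappa> * \<bar>?v - \<rho> / 2\<bar>"
    using \<kappa>_bounds by (intro mult_right_mono mult_mono) auto
  moreover have "\<bar>\<rho> - 1\<bar> \<le> M * \<bar>\<epsilon>\<bar>"
    using \<rho>_near(2) mult_right_mono[OF M_bounds(3), of "\<bar>\<epsilon>\<bar>"] by simp
  moreover have "\<bar>?v - 1/2\<bar> \<le> \<bar>?v - \<rho> / 2\<bar> + \<bar>\<rho> - 1\<bar> / 2"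
    using abs_triangle_ineq[of "?v - \<rho> / 2" "(\<rho> - 1) / 2"] unfolding abs_divide by (simp add: field_simps)
  moreover have "0 \<le> M * \<bar>\<epsilon>\<bar>" using M_bounds(1) by simp
  ultimately show ?thesis by linarith
qed

text \<open>The horizontal equation restricted to the curve, with the common factor \<epsilon>
  removed so that a nontrivial limit remains.\<close>

definition q where "q u = Re (t (Complex u (ridge u)))"

lemma Re_T_ridge: "Re (T (Complex u (ridge u))) = \<epsilon> * q u"
  by (simp add: T_eq q_def)

lemma ridge_Im: "\<bar>Im (Complex u (ridge u'))\<bar> < 1"
proof -
  have "66 * M * \<bar>\<epsilon>\<bar> \<le> 1/4" using \<epsilon>_le[OF order_refl] by simp
  then show ?thesis using ridge_near[of u'] by simp
qed

lemma lead2_ridge: "cmod (lead2 n a (Complex u (ridge u)) - lead2 n a (Complex u (1/2))) \<le> 270336 * M\<^sup>2 * \<bar>\<epsilon>\<bar>"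
proof -
  have "cmod (lead2 n a (Complex u (ridge u)) - lead2 n a (Complex u (1/2)))
      \<le> 4096 * M * cmod (Complex u (ridge u) - Complex u (1/2))"
    using lead2'_le ridge_Im[of u u] by (intro strip_lipschitz[OF lead2_h, of "9/8"]) auto
  also have "\<dots> = 4096 * M * \<bar>ridge u - 1/2\<bar>" by (simp add: cmod_vertical)
  also have "\<dots> \<le> 4096 * M * (66 * M * \<bar>\<epsilon>\<bar>)"
    using ridge_near[of u] M_bounds(1) by (intro mult_left_mono) auto
  finally show ?thesis by (simp add: power2_eq_square mult_ac)
qed

lemma lead2'_ridge:
  "cmod (deriv (lead2 n a) (Complex u (ridge u')) - deriv (lead2 n a) (Complex u (1/2))) \<le> 4325376 * M\<^sup>2 * \<bar>\<epsilon>\<bar>"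
proof -
  have "cmod (deriv (lead2 n a) (Complex u (ridge u')) - deriv (lead2 n a) (Complex u (1/2)))
      \<le> 65536 * M * cmod (Complex u (ridge u') - Complex u (1/2))"
    using lead2''_le ridge_Im[of u u'] by (intro strip_lipschitz[OF lead2'_h, of 1]) auto
  also have "\<dots> = 65536 * M * \<bar>ridge u' - 1/2\<bar>" by (simp add: cmod_vertical)
  also have "\<dots> \<le> 65536 * M * (66 * M * \<bar>\<epsilon>\<bar>)"
    using ridge_near[of u'] M_bounds(1) by (intro mult_left_mono) auto
  finally show ?thesis by (simp add: power2_eq_square mult_ac)
qed

lemma M_sq: "M * \<bar>\<epsilon>\<bar> \<le> M\<^sup>2 * \<bar>\<epsilon>\<bar>" "0 \<le> M\<^sup>2 * \<bar>\<epsilon>\<bar>"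
  using M_bounds(1) self_le_power[of M 2] by (auto intro: mult_right_mono)

lemma q_near: "\<bar>q u - lead_ridge n a u\<bar> \<le> 100000000 * (M\<^sup>2 * \<bar>\<epsilon>\<bar>)"
proof -
  let ?w = "Complex u (ridge u)"
  have "\<bar>q u - lead_ridge n a u\<bar> \<le> cmod (t ?w - lead2 n a (Complex u (1/2)))"
    using abs_Re_le_cmod[of "t ?w - lead2 n a (Complex u (1/2))"] by (simp add: q_def lead_ridge_def)
  also have "\<dots> \<le> cmod (t ?w - lead2 n a ?w) + cmod (lead2 n a ?w - lead2 n a (Complex u (1/2)))"
    using norm_triangle_ineq[of "t ?w - lead2 n a ?w" "lead2 n a ?w - lead2 n a (Complex u (1/2))"] by simp
  finally show ?thesis
    using t_near[of ?w] ridge_Im[of u u] lead2_ridge[of u] M_sq by simp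
qed

text \<open>The variation is split into three parts: t - lead2 between the two points of the curve,
  lead2 between the actual height and 1/2 with the height frozen, and the vertical motion of the
  curve. Each is the product of a small factor and \<bar>u - u'\<bar>, so only the Lipschitz bound
  on \<open>ridge\<close> enters.\<close>

lemma q_diff_lipschitz: "\<bar>(q u - lead_ridge n a u) - (q u' - lead_ridge n a u')\<bar> \<le> 100000000 * (M\<^sup>2 * \<bar>\<epsilon>\<bar> * \<bar>u - u'\<bar>)"
proof -
  let ?w = "Complex u (ridge u)" and ?w' = "Complex u' (ridge u')" and ?m = "Complex u' (ridge u)"
  let ?d = "\<lambda>w. t w - lead2 n a w"
  \<comment> \<open>Freezing the height at \<open>ridge u\<close> makes this a holomorphic function
    of w, whose derivative is small since the height is close to 1/2.\<close>
  let ?e = "\<lambda>w. lead2 n a (w + \<i> * of_real (ridge u)) - lead2 n a (w + \<i> * of_real (1/2))"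
  have "cmod (?d ?w - ?d ?w') \<le> 139264 * M * \<bar>\<epsilon>\<bar> * cmod (?w - ?w')"
    using t'_near deriv_t_diff ridge_Im[of u u] ridge_Im[of u' u']
    by (intro strip_lipschitz[OF strip_holo_subset[OF diff_holo, of "9/8"]]) auto
  also have "\<dots> \<le> 139264 * M * \<bar>\<epsilon>\<bar> * (2 * \<bar>u - u'\<bar>)"
  proof (rule mult_left_mono)
    have "\<bar>ridge u - ridge u'\<bar> \<le> 1 * \<bar>u - u'\<bar>"
      using \<epsilon>_le[OF order_refl] by (intro order_trans[OF ridge_diff] mult_right_mono) auto
    then show "cmod (?w - ?w') \<le> 2 * \<bar>u - u'\<bar>" using cmod_le[of "?w - ?w'"] by simp
  qed (use M_bounds(1) in simp)
  finally have 1: "cmod (?d ?w - ?d ?w') \<le> 278528 * (M * \<bar>\<epsilon>\<bar> * \<bar>u - u'\<bar>)" by simp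
  have hd: "(lead2 n a has_field_derivative deriv (lead2 n a) w) (at w)" for w
    using lead2_h[where A = UNIV] open_UNIV by (rule holomorphic_derivI) simp
  have ed: "(?e has_field_derivative deriv (lead2 n a) (w + \<i> * of_real (ridge u)) - deriv (lead2 n a) (w + \<i> * of_real (1/2))) (at w)" for w
    using hd DERIV_shift by (intro DERIV_diff) blast+
  have "cmod (?e (of_real u) - ?e (of_real u')) \<le> 4325376 * M\<^sup>2 * \<bar>\<epsilon>\<bar> * cmod (of_real u - of_real u')"
  proof (rule field_differentiable_bound[of "\<real>"])
    show "convex (\<real> :: complex set)" by (rule convex_Reals)
    show "(?e has_field_derivative deriv (lead2 n a) (w + \<i> * of_real (ridge u)) - deriv (lead2 n a) (w + \<i> * of_real (1/2))) (at w within \<real>)" for w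
      using ed by (rule has_field_derivative_at_within)
    show "cmod (deriv (lead2 n a) (w + \<i> * of_real (ridge u)) - deriv (lead2 n a) (w + \<i> * of_real (1/2))) \<le> 4325376 * M\<^sup>2 * \<bar>\<epsilon>\<bar>" if "w \<in> \<real>" for w
      using lead2'_ridge[of "Re w" u] that by (auto simp: Complex_eq elim!: Reals_cases)
  qed auto
  then have 2: "cmod (?e (of_real u) - ?e (of_real u')) \<le> 4325376 * (M\<^sup>2 * \<bar>\<epsilon>\<bar> * \<bar>u - u'\<bar>)"
    by (simp add: cmod_def flip: of_real_diff)
  have "cmod (lead2 n a ?m - lead2 n a ?w') \<le> 4096 * M * cmod (?m - ?w')"
    using lead2'_le ridge_Im[of u' u] ridge_Im[of u' u'] by (intro strip_lipschitz[OF lead2_h, of "9/8"]) auto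
  also have "\<dots> = 4096 * M * \<bar>ridge u - ridge u'\<bar>" by (simp add: cmod_vertical)
  also have "\<dots> \<le> 4096 * M * (4097 * M * \<bar>\<epsilon>\<bar> * \<bar>u - u'\<bar>)"
    using ridge_diff[of u u'] M_bounds(1) by (intro mult_left_mono) auto
  finally have 3: "cmod (lead2 n a ?m - lead2 n a ?w') \<le> 16781312 * (M\<^sup>2 * \<bar>\<epsilon>\<bar> * \<bar>u - u'\<bar>)"
    by (simp add: power2_eq_square mult_ac)
  have eq: "(q u - lead_ridge n a u) - (q u' - lead_ridge n a u')
      = Re ((?d ?w - ?d ?w') + (?e (of_real u) - ?e (of_real u')) + (lead2 n a ?m - lead2 n a ?w'))"
    by (simp add: q_def lead_ridge_def Complex_eq)
  have "\<bar>(q u - lead_ridge n a u) - (q u' - lead_ridge n a u')\<bar> \<le> cmod (?d ?w - ?d ?w') + cmod (?e (of_real u) - ?e (of_real u')) + cmod (lead2 n a ?m - lead2 n a ?w')"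
    unfolding eq by (rule order_trans[OF abs_Re_le_cmod order_trans[OF norm_triangle_ineq add_right_mono[OF norm_triangle_ineq]]])
  then have "\<bar>(q u - lead_ridge n a u) - (q u' - lead_ridge n a u')\<bar> \<le> 278528 * (M * \<bar>\<epsilon>\<bar> * \<bar>u - u'\<bar>) + 4325376 * (M\<^sup>2 * \<bar>\<epsilon>\<bar> * \<bar>u - u'\<bar>) + 16781312 * (M\<^sup>2 * \<bar>\<epsilon>\<bar> * \<bar>u - u'\<bar>)"
    using 1 2 3 by linarith
  moreover have "M * \<bar>\<epsilon>\<bar> * \<bar>u - u'\<bar> \<le> M\<^sup>2 * \<bar>\<epsilon>\<bar> * \<bar>u - u'\<bar>" "0 \<le> M\<^sup>2 * \<bar>\<epsilon>\<bar> * \<bar>u - u'\<bar>"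
    using M_sq by (auto intro!: mult_right_mono)
  ultimately show ?thesis by linarith
qed

lemma ridge_periodic: "ridge (u + 2 * pi) = ridge u"
proof (rule ridge_unique[OF ridge(1,2)])
  have "Complex (u + 2 * pi) v = Complex u v + 2 * pi" for v by (simp add: complex_eq_iff)
  then show "\<kappa> * cot (\<kappa> * ridge (u + 2 * pi)) = Im (T (Complex u (ridge (u + 2 * pi))))"
    using ridge[of "u + 2 * pi"] T_periodic[of "Complex u (ridge (u + 2 * pi))"] ridge_Im[of u "u + 2 * pi"] by simp
qed

lemma q_periodic: "q (u + 2 * pi) = q u"
proof -
  have "Complex (u + 2 * pi) v = Complex u v + 2 * pi" for v by (simp add: complex_eq_iff)
  then show ?thesis
    using T_periodic[of "Complex u (ridge u)"] ridge_Im[of u u] by (simp add: q_def ridge_periodic t_def)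
qed

text \<open>Reflection symmetry pins this zero, and periodicity carries it to 2 \<pi>. These are the
  exact endpoint zeros required by \<open>simple_zeros_stable\<close>.\<close>

lemma q_0: "q 0 = 0"
proof -
  have "\<epsilon> * q 0 = 0"
    using Re_T_imag_axis[of "ridge 0"] ridge_Im[of 0 0] by (simp add: Complex_eq flip: Re_T_ridge)
  then show ?thesis using \<epsilon>_nz by simp
qed

lemma W_zeros:
  "{w \<in> S. 0 \<le> Re w \<and> Re w < 2 * pi \<and> W w = 0} = (\<lambda>u. Complex u (ridge u)) ` {u \<in> {0..<2*pi}. q u = 0}" (is "?A = ?B")
proof
  show "?A \<subseteq> ?B"
  proof
    fix w assume w: "w \<in> ?A"
    then have W: "Re (T w) = 0" "\<kappa> * cot (\<kappa> * Im w) = Im (T w)" by (auto simp: W_eq_0_iff)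
    then have r: "Im w = ridge (Re w)" using w by (intro ridge_unique) (auto simp: S_def)
    then have e: "w = Complex (Re w) (ridge (Re w))" by (metis complex_surj)
    then have "q (Re w) = 0" using W(1) Re_T_ridge[of "Re w"] \<epsilon>_nz by simp
    then show "w \<in> ?B" using e w by (intro image_eqI[of _ _ "Re w"]) auto
  qed
  show "?B \<subseteq> ?A" using ridge Re_T_ridge by (auto simp: W_eq_0_iff S_def)
qed

text \<open>Transfers the slope of the limiting equation at u to the holomorphic derivative of
  \<open>t\<close> at the actual point of the curve.\<close>

lemma Re_T'_lower: "\<bar>Re (deriv (lead2 n a) (Complex u (1/2)))\<bar> - 100000000 * (M\<^sup>2 * \<bar>\<epsilon>\<bar>) \<le> \<bar>Re (deriv t (Complex u (ridge u)))\<bar>"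
proof -
  let ?w = "Complex u (ridge u)" and ?v = "Complex u (1/2)"
  have "\<bar>Re (deriv t ?w - deriv (lead2 n a) ?w)\<bar> \<le> 139264 * (M\<^sup>2 * \<bar>\<epsilon>\<bar>)"
    using abs_Re_le_cmod[of "deriv t ?w - deriv (lead2 n a) ?w"] t'_near[of ?w] ridge_Im[of u u] M_sq by simp
  moreover have "\<bar>Re (deriv (lead2 n a) ?w - deriv (lead2 n a) ?v)\<bar> \<le> 4325376 * (M\<^sup>2 * \<bar>\<epsilon>\<bar>)"
    using abs_Re_le_cmod[of "deriv (lead2 n a) ?w - deriv (lead2 n a) ?v"] lead2'_ridge[of u u] by simp
  ultimately show ?thesis using M_sq unfolding minus_complex.sel by linarith
qed

lemma deriv_T: "\<bar>Im w\<bar> < 5/4 \<Longrightarrow> deriv T w = of_real \<epsilon> * deriv t w"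
proof -
  assume w: "\<bar>Im w\<bar> < 5/4"
  have "T = (\<lambda>w. of_real \<epsilon> * t w)" by (simp add: T_eq fun_eq_iff)
  moreover have "t field_differentiable at w"
    using holomorphic_on_imp_differentiable_at[OF t_holo strip_open] w by simp
  ultimately show ?thesis by (simp add: deriv_cmult)
qed

text \<open>A kernel vector k satisfies Re (t' * k) = 0, so the slope m / 2 bounds \<bar>Re k\<bar>
  by a multiple of \<bar>Im k\<bar>. The remaining equation has coefficient at least 1 in front of
  Im k and order \<epsilon> in front of k, so \<bar>Im k\<bar> is at most of order \<epsilon> times
  cmod k. Together cmod k is bounded by a fraction of itself.\<close>

lemma nondegenerate_on_ridge:
  assumes u: "q u = 0" and m: "0 < m" "m \<le> \<bar>Re (deriv (lead2 n a) (Complex u (1/2)))\<bar>"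
    and small: "100000000 * (M\<^sup>2 * \<bar>\<epsilon>\<bar>) \<le> m / 2" "4097 * M * (1 + 8194 * M / m) * \<bar>\<epsilon>\<bar> < 1"
  shows "nondegenerate_critical_point (robin_function (channel n a \<epsilon>)) (F (Complex u (ridge u)))"
proof (rule nondegenerate_if)
  let ?w = "Complex u (ridge u)"
  show "?w \<in> S" using ridge by (simp add: S_def)
  show "W ?w = 0" using u ridge Re_T_ridge by (simp add: W_eq_0_iff)
  fix k assume k: "cnj (deriv T ?w * k) = \<i> * of_real (\<kappa>\<^sup>2 / (sin (\<kappa> * Im ?w))\<^sup>2 * Im k)"
  define d where "d = deriv t ?w"
  have Td: "deriv T ?w = of_real \<epsilon> * d" using deriv_T[of ?w] ridge_Im[of u u] by (simp add: d_def)
  have d: "cmod d \<le> 4097 * M" "m / 2 \<le> \<bar>Re d\<bar>"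
    using t'_le[of ?w] ridge_Im[of u u] Re_T'_lower[of u] m small by (auto simp: d_def)
  have "0 < sin (\<kappa> * ridge u)" using \<kappa>_Im[OF \<open>?w \<in> S\<close>] by (intro sin_gt_zero) auto
  then have s: "0 < (sin (\<kappa> * ridge u))\<^sup>2" "(sin (\<kappa> * ridge u))\<^sup>2 \<le> 1"
    by (auto simp: abs_square_le_1 power_le_one)
  have Re0: "Re (d * k) = 0"
    using arg_cong[OF k, of Re] \<epsilon>_nz by (simp add: Td mult.assoc)
  have "\<bar>Im k\<bar> \<le> \<kappa>\<^sup>2 / (sin (\<kappa> * ridge u))\<^sup>2 * \<bar>Im k\<bar>"
  proof -
    have "1 \<le> \<kappa>\<^sup>2" using \<kappa>_bounds by simp
    then have "1 \<le> \<kappa>\<^sup>2 / (sin (\<kappa> * ridge u))\<^sup>2" using s by (simp add: pos_le_divide_eq)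
    then show ?thesis using mult_right_mono[OF _ abs_ge_zero, of 1 _ "Im k"] by (simp only: mult_1)
  qed
  also have "\<dots> = cmod (cnj (deriv T ?w * k))" unfolding k norm_mult norm_of_real abs_mult by (simp add: norm_power norm_divide)
  also have "\<dots> = \<bar>\<epsilon>\<bar> * (cmod d * cmod k)"
    unfolding complex_mod_cnj Td norm_mult norm_of_real mult.assoc ..
  also have "\<dots> \<le> \<bar>\<epsilon>\<bar> * (4097 * M * cmod k)" using d by (intro mult_left_mono mult_right_mono) auto
  finally have Imk: "\<bar>Im k\<bar> \<le> 4097 * M * \<bar>\<epsilon>\<bar> * cmod k" by (simp add: mult_ac)
  have "m / 2 * \<bar>Re k\<bar> \<le> \<bar>Re d\<bar> * \<bar>Re k\<bar>" using d by (intro mult_right_mono) auto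
  also have "\<dots> = \<bar>Im d\<bar> * \<bar>Im k\<bar>" unfolding abs_mult[symmetric] using Re0 by simp
  also have "\<dots> \<le> 4097 * M * \<bar>Im k\<bar>" using d abs_Im_le_cmod[of d] by (intro mult_right_mono) auto
  finally have "\<bar>Re k\<bar> \<le> 8194 * M / m * \<bar>Im k\<bar>" using m by (simp add: field_simps)
  then have "cmod k \<le> (1 + 8194 * M / m) * \<bar>Im k\<bar>" using cmod_le[of k] by (simp add: distrib_right)
  also have "\<dots> \<le> (1 + 8194 * M / m) * (4097 * M * \<bar>\<epsilon>\<bar> * cmod k)"
    using Imk M_bounds(1) m by (intro mult_left_mono) auto
  finally have "cmod k * (1 - 4097 * M * (1 + 8194 * M / m) * \<bar>\<epsilon>\<bar>) \<le> 0" by (simp add: algebra_simps)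
  then show "k = 0" using small(2) by (simp add: mult_le_0_iff)
qed

lemma critical_points_ridge:
  "critical_points_per_period n a \<epsilon> = (\<lambda>u. F (Complex u (ridge u))) ` {u \<in> {0..<2*pi}. q u = 0}"
  unfolding critical_points_eq W_zeros image_image ..

lemma card_critical_points_ridge:
  "card (critical_points_per_period n a \<epsilon>) = card {u \<in> {0..<2*pi}. q u = 0}"
proof -
  have "inj_on (\<lambda>u. F (Complex u (ridge u))) A" for A
  proof (rule inj_onI)
    fix u u' assume "F (Complex u (ridge u)) = F (Complex u' (ridge u'))"
    moreover have "Complex u (ridge u) \<in> U" for u using ridge_Im[of u u] by (simp add: U_def)
    ultimately have "Complex u (ridge u) = Complex u' (ridge u')" using F_inj by (meson inj_onD)
    then show "u = u'" by simp
  qed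
  then show ?thesis unfolding critical_points_ridge by (rule card_image)
qed

end

section \<open>Chebyshev polynomials and the limiting zeros\<close>

lemma Re_sin_Complex: "Re (sin (Complex u v)) = sin u * cosh v"
  by (simp add: Re_sin cosh_field_def)

lemma cosh_half_over_sinh: "x \<noteq> 0 \<Longrightarrow> cosh (x / 2) / sinh x = 1 / (2 * sinh (x / 2))" for x :: real
  using sinh_double[of "x / 2"] by (simp add: field_simps)

text \<open>At height 1/2 the two modes carry the factors cosh (k / 2) / sinh k = 1 / (2 sinh (k /
  2)) for k = 1 and k = n, the second also a * n ^ 2. Taking the second as common factor leaves the
  quotient that defines \<open>Lambda\<close>, with its sign.\<close>

lemma lead_ridge_eq:
  assumes n: "1 \<le> n" and a: "a \<noteq> 0"
  shows "lead_ridge n a u = - (a * (real n)\<^sup>2 / (2 * sinh (real n / 2))) * (sin u * (poly (cheb_U (n - 1)) (cos u) - Lambda n a))"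
    (is "_ = - ?K * _")
proof -
  have nw: "of_nat n * Complex u (1/2) = Complex (real n * u) (real n / 2)" by (simp add: complex_eq_iff)
  have "lead_ridge n a u = - (sin u * (cosh (1/2) / sinh 1) + a * (real n)\<^sup>2 * sin (real n * u) * (cosh (real n / 2) / sinh (real n)))"
    unfolding lead_ridge_def lead2_def nw
    by (simp add: Re_divide_of_real Re_sin_Complex mult.assoc del: of_real_mult of_real_power)
  also have "\<dots> = - (sin u / (2 * sinh (1/2)) + a * (real n)\<^sup>2 * sin (real n * u) / (2 * sinh (real n / 2)))"
    using cosh_half_over_sinh[of 1] cosh_half_over_sinh[of "real n"] n by simp
  also have "sin (real n * u) = sin u * poly (cheb_U (n - 1)) (cos u)"
    using sin_cheb_U[of "n - 1" u] n by simp
  finally have l: "lead_ridge n a u = - (sin u / (2 * sinh (1/2)) + ?K * (sin u * poly (cheb_U (n - 1)) (cos u)))"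
    by (simp add: mult_ac)
  have K: "?K * Lambda n a = - (1 / (2 * sinh (1/2)))" using a n by (simp add: Lambda_def)
  have "- ?K * (sin u * (poly (cheb_U (n - 1)) (cos u) - Lambda n a))
      = - (?K * (sin u * poly (cheb_U (n - 1)) (cos u))) + sin u * (?K * Lambda n a)"
    unfolding right_diff_distrib by (simp only: mult_minus_left mult.left_commute diff_minus_eq_add minus_diff_eq minus_mult_right[symmetric])
  then show ?thesis unfolding l K by simp
qed

lemma lead_ridge_deriv: "(lead_ridge n a has_real_derivative Re (deriv (lead2 n a) (Complex u (1/2)))) (at u)"
proof -
  have "(lead2 n a has_field_derivative deriv (lead2 n a) (Complex u (1/2))) (at (Complex u (1/2)))"
    using lead2_h[where A = UNIV] open_UNIV by (rule holomorphic_derivI) simp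
  then have "((\<lambda>x. lead2 n a (Complex x (1/2))) has_vector_derivative 1 * deriv (lead2 n a) (Complex u (1/2))) (at u)"
    by (intro field_vector_diff_chain_at[where f = "\<lambda>x. Complex x (1/2)", unfolded o_def])
      (auto simp: Complex_eq intro!: derivative_eq_intros)
  then have "((\<lambda>x. Re (lead2 n a (Complex x (1/2)))) has_vector_derivative Re (deriv (lead2 n a) (Complex u (1/2)))) (at u)"
    using bounded_linear.has_vector_derivative[OF bounded_linear_Re] by fastforce
  then show ?thesis unfolding lead_ridge_def[abs_def] has_real_derivative_iff_has_vector_derivative .
qed

lemma lead_ridge_deriv_eq:
  assumes n: "1 \<le> n" and a: "a \<noteq> 0"
  shows "Re (deriv (lead2 n a) (Complex u (1/2))) = - (a * (real n)\<^sup>2 / (2 * sinh (real n / 2))) *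
    (cos u * (poly (cheb_U (n - 1)) (cos u) - Lambda n a) - (sin u)\<^sup>2 * poly (pderiv (cheb_U (n - 1))) (cos u))"
proof -
  define K where "K = - (a * (real n)\<^sup>2 / (2 * sinh (real n / 2)))"
  have "((\<lambda>u. K * (sin u * (poly (cheb_U (n - 1)) (cos u) - Lambda n a))) has_real_derivative
      K * (cos u * (poly (cheb_U (n - 1)) (cos u) - Lambda n a) - (sin u)\<^sup>2 * poly (pderiv (cheb_U (n - 1))) (cos u))) (at u)"
    by (rule DERIV_cong[OF DERIV_cmult[OF DERIV_mult[OF DERIV_sin DERIV_diff[OF DERIV_chain2[OF poly_DERIV DERIV_cos] DERIV_const]]]])
      (simp add: power2_eq_square algebra_simps)
  moreover have "lead_ridge n a = (\<lambda>u. K * (sin u * (poly (cheb_U (n - 1)) (cos u) - Lambda n a)))"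
    using lead_ridge_eq[OF assms] by (auto simp: K_def)
  ultimately show ?thesis using DERIV_unique[OF lead_ridge_deriv[of n a u]] unfolding K_def by simp
qed

section \<open>Values and interior roots of the Chebyshev polynomials\<close>

lemma cheb_U_at_1: "poly (cheb_U m) 1 = real m + 1" and cheb_U_at_minus_1: "poly (cheb_U m) (-1) = (-1) ^ m * (real m + 1)"
  by (induction m rule: cheb_U.induct) (auto simp: algebra_simps)

lemma degree_cheb_U: "degree (cheb_U m) \<le> m"
proof (induction m rule: cheb_U.induct)
  case (3 m)
  have "degree ([:0, 2:] * cheb_U (Suc m)) \<le> 1 + Suc m"
    using 3 by (intro order_trans[OF degree_mult_le]) auto
  moreover have "degree (cheb_U m) \<le> Suc (Suc m)" using 3 by simp
  ultimately show ?case by (simp add: degree_diff_le)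
qed auto

lemma abs_sin_of_nat_mult_le: "\<bar>sin (real k * x)\<bar> \<le> real k * \<bar>sin x\<bar>"
proof (induction k)
  case (Suc k)
  have "\<bar>sin (real (Suc k) * x)\<bar> \<le> \<bar>sin (real k * x)\<bar> * \<bar>cos x\<bar> + \<bar>cos (real k * x)\<bar> * \<bar>sin x\<bar>"
  proof -
    have "sin (real (Suc k) * x) = sin (real k * x) * cos x + cos (real k * x) * sin x"
      unfolding sin_add[symmetric] by (simp add: distrib_right add.commute)
    then show ?thesis
      using abs_triangle_ineq[of "sin (real k * x) * cos x" "cos (real k * x) * sin x"] by (simp only: abs_mult)
  qed
  also have "\<dots> \<le> \<bar>sin (real k * x)\<bar> * 1 + 1 * \<bar>sin x\<bar>"
    by (intro add_mono mult_left_mono mult_right_mono) auto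
  finally show ?case using Suc by (simp add: distrib_right)
qed simp

lemma abs_cheb_U_le:
  assumes c: "c \<in> {-1<..<1}"
  shows "\<bar>poly (cheb_U m) c\<bar> \<le> real (Suc m)"
proof -
  have s: "0 < sin (arccos c)" using c arccos_lt_bounded[of c] by (intro sin_gt_zero) auto
  have "\<bar>sin (arccos c) * poly (cheb_U m) c\<bar> \<le> real (Suc m) * \<bar>sin (arccos c)\<bar>"
    using abs_sin_of_nat_mult_le[of "Suc m" "arccos c"] sin_cheb_U[of m "arccos c"] c by simp
  then have "sin (arccos c) * \<bar>poly (cheb_U m) c\<bar> \<le> sin (arccos c) * real (Suc m)"
    using s by (simp add: abs_mult mult.commute)
  then show ?thesis using s by (simp only: mult_le_cancel_left_pos)
qed

text \<open>There are m + 1 nodes with alternating signs and modulus at least 1, so any level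
  \<bar>l\<bar> < 1 is crossed at least m times. The degree allows at most m roots counted with
  multiplicity, hence the count is exact and every root simple.\<close>

lemma card_cheb_U_roots:
  assumes l: "\<bar>l\<bar> < 1"
  shows "card {c\<in>{-1<..<1}. poly (cheb_U m) c = l} = m"
    and "\<And>c. c \<in> {-1<..<1} \<Longrightarrow> poly (cheb_U m) c = l \<Longrightarrow> poly (pderiv (cheb_U m)) c \<noteq> 0"
proof -
  \<comment> \<open>The m + 1 angles in (0, \<pi>) with sin ((m + 1) x) = (-1) ^ j; dividing by 0 <
    sin x \<le> 1 can only increase the modulus.\<close>
  define x where "x j = (real j + 1/2) * pi / real (Suc m)" for j
  have x_mono: "x j < x k" if "j < k" for j k using that by (simp add: x_def divide_strict_right_mono)
  have x_bounds: "0 < x j" "x j < pi" if "j \<le> m" for j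
    using that by (auto simp: x_def pos_divide_less_eq mult.commute[of pi] intro!: mult_strict_right_mono divide_pos_pos mult_pos_pos)
  have node: "1 \<le> (-1) ^ j * poly (cheb_U m) (cos (x j))" if "j \<le> m" for j
  proof -
    have s: "0 < sin (x j)" "sin (x j) \<le> 1" using x_bounds[OF that] by (auto intro: sin_gt_zero)
    have "real (Suc m) * x j = real j * pi + pi / 2" by (simp add: x_def field_simps)
    then have "sin (real (Suc m) * x j) = (-1) ^ j" by (simp add: sin_add)
    then have "(-1) ^ j * (sin (x j) * poly (cheb_U m) (cos (x j))) = (-1) ^ j * (-1) ^ j"
      unfolding sin_cheb_U by (simp only:)
    also have "\<dots> = (1::real)" by (simp only: power_mult_distrib[symmetric]) simp
    finally have "sin (x j) * ((-1) ^ j * poly (cheb_U m) (cos (x j))) = 1" by (simp add: mult_ac)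
    then have "(-1) ^ j * poly (cheb_U m) (cos (x j)) = 1 / sin (x j)" using s by (simp add: field_simps)
    then show ?thesis using s by simp
  qed
  have "\<exists>y. x j < y \<and> y < x (Suc j) \<and> poly (cheb_U m) (cos y) = l" if j: "j < m" for j
  proof -
    define g where "g y = (-1) ^ j * (l - poly (cheb_U m) (cos y))" for y
    have sl: "\<bar>(-1) ^ j * l\<bar> < 1" using l by (simp add: abs_mult power_abs)
    have g1: "g (x j) < 0" using node[of j] sl j by (simp add: g_def right_diff_distrib)
    have g2: "0 < g (x (Suc j))" using node[of "Suc j"] sl j by (simp add: g_def right_diff_distrib)
    have "continuous_on A g" for A unfolding g_def by (intro continuous_intros)
    then obtain y where y: "x j \<le> y" "y \<le> x (Suc j)" "g y = 0"
      using IVT'[of g "x j" 0 "x (Suc j)"] g1 g2 x_mono[of j "Suc j"] by auto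
    moreover have "y \<noteq> x j" "y \<noteq> x (Suc j)" using y g1 g2 by auto
    ultimately show ?thesis by (intro exI[of _ y]) (auto simp: g_def)
  qed
  then obtain r where r: "\<And>j. j < m \<Longrightarrow> x j < r j \<and> r j < x (Suc j) \<and> poly (cheb_U m) (cos (r j)) = l" by metis
  have r_bounds: "0 < r j" "r j < pi" if "j < m" for j
    using r[OF that] x_bounds[of j] x_bounds[of "Suc j"] that by auto
  have r_mono: "r j < r k" if "j < k" "k < m" for j k
  proof -
    have "x (Suc j) \<le> x k" using x_mono[of "Suc j" k] that by (cases "Suc j = k") auto
    then show ?thesis using r[of j] r[of k] that by auto
  qed
  have inj: "inj_on (\<lambda>j. cos (r j)) {..<m}"
  proof (rule inj_onI)
    fix j k assume jk: "j \<in> {..<m}" "k \<in> {..<m}" "cos (r j) = cos (r k)"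
    then have m: "j < m" "k < m" by auto
    have "r j = r k" by (rule cos_inj_pi[OF _ _ _ _ jk(3)]) (use r_bounds[OF m(1)] r_bounds[OF m(2)] in linarith)+
    then show "j = k" using r_mono[of j k] r_mono[of k j] m by (metis less_irrefl linorder_neqE_nat)
  qed
  let ?Z = "{c\<in>{-1<..<1}. poly (cheb_U m) c = l}"
  have cos_in: "cos y \<in> {-1<..<1}" if "0 < y" "y < pi" for y :: real
    using cos_monotone_0_pi[of 0 y] cos_monotone_0_pi[of y pi] that by simp
  have img: "(\<lambda>j. cos (r j)) ` {..<m} \<subseteq> ?Z" using r r_bounds cos_in by auto
  define p where "p = cheb_U m - [:l:]"
  have p: "poly p c = poly (cheb_U m) c - l" for c by (simp add: p_def)
  have p0: "p \<noteq> 0"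
  proof
    assume "p = 0"
    then have "l = real m + 1" using p[of 1] by (simp add: cheb_U_at_1)
    then show False using l by simp
  qed
  have deg: "degree p \<le> m" unfolding p_def using degree_cheb_U by (intro degree_diff_le) auto
  have finR: "finite {c. poly p c = 0}" using p0 by (rule poly_roots_finite)
  have sub: "?Z \<subseteq> {c. poly p c = 0}" by (auto simp: p)
  have mZ: "m \<le> card ?Z" using card_mono[OF finite_subset[OF sub finR] img] card_image[OF inj] by simp
  have ord: "1 \<le> order c p" if "poly p c = 0" for c using that p0 order_root[of p c] by simp
  have sumle: "(\<Sum>c | poly p c = 0. order c p) \<le> m" using sum_order_le_degree[OF p0] deg by simp
  have "card {c. poly p c = 0} \<le> (\<Sum>c | poly p c = 0. order c p)"
    using sum_mono[of "{c. poly p c = 0}" "\<lambda>_. 1" "\<lambda>c. order c p"] ord by simp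
  then show cardZ: "card ?Z = m" using mZ sumle card_mono[OF finR sub] by linarith
  show "poly (pderiv (cheb_U m)) c \<noteq> 0" if c: "c \<in> {-1<..<1}" "poly (cheb_U m) c = l" for c
  proof
    assume "poly (pderiv (cheb_U m)) c = 0"
    then have d0: "poly (pderiv p) c = 0" by (simp add: p_def pderiv_diff pderiv_pCons)
    have pc: "poly p c = 0" using c by (simp add: p)
    have "pderiv p \<noteq> 0"
    proof
      assume "pderiv p = 0"
      then obtain k where "p = [:k:]" using pderiv_iszero by blast
      then show False using pc p0 by simp
    qed
    then have "2 \<le> order c p" using order_pderiv[OF p0 pc] d0 order_root[of "pderiv p" c] by simp
    \<comment> \<open>A double root contributes one more to the multiplicity sum than to the number
      of roots, which would exceed the degree.\<close>
    have "card {c. poly p c = 0} + 1 = (\<Sum>d | poly p d = 0. 1) + (\<Sum>d | poly p d = 0. if d = c then 1 else 0)"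
      using finR pc by simp
    also have "\<dots> = (\<Sum>d | poly p d = 0. 1 + (if d = c then 1 else 0))" by (rule sum.distrib[symmetric])
    also have "\<dots> \<le> (\<Sum>d | poly p d = 0. order d p)"
      using ord \<open>2 \<le> order c p\<close> by (intro sum_mono) auto
    finally show False using sumle mZ card_mono[OF finR sub] by linarith
  qed
qed

section \<open>Zeros of the limiting equation over one period\<close>

lemma card_arccos_pairs:
  assumes fin: "finite Z" and Z: "Z \<subseteq> {-1<..<1}"
  shows "card ({0, pi, 2 * pi} \<union> (arccos ` Z \<union> (\<lambda>c. 2 * pi - arccos c) ` Z)) = 3 + 2 * card Z"
proof -
  have b: "0 < arccos c" "arccos c < pi" if "c \<in> Z" for c using arccos_lt_bounded[of c] that Z by auto
  have "inj_on arccos Z"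
    by (rule inj_on_inverseI[where g = cos]) (use Z in auto)
  moreover have "inj_on (\<lambda>c. 2 * pi - arccos c) Z"
    by (rule inj_on_inverseI[where g = cos]) (use Z in \<open>auto simp: cos_diff\<close>)
  moreover have A: "arccos ` Z \<subseteq> {0<..<pi}" and B: "(\<lambda>c. 2 * pi - arccos c) ` Z \<subseteq> {pi<..<2 * pi}"
    using b by (auto simp: image_subset_iff)
  moreover have "arccos ` Z \<inter> (\<lambda>c. 2 * pi - arccos c) ` Z = {}"
    using A B by fastforce
  moreover have "{0, pi, 2 * pi} \<inter> (arccos ` Z \<union> (\<lambda>c. 2 * pi - arccos c) ` Z) = {}"
    using A B by fastforce
  ultimately show ?thesis using fin by (simp add: card_Un_disjoint card_image del: Un_insert_left)
qed

lemma card_lead_ridge_zeros: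
  assumes n: "1 \<le> n" and a: "a \<noteq> 0" and fin: "finite {c\<in>{-1<..<1}. poly (cheb_U (n - 1)) c = Lambda n a}"
  shows "finite {u\<in>{0..2*pi}. lead_ridge n a u = 0}"
    and "card {u\<in>{0..2*pi}. lead_ridge n a u = 0} = 3 + 2 * N_count n (Lambda n a)"
proof -
  let ?Z = "{c\<in>{-1<..<1}. poly (cheb_U (n - 1)) c = Lambda n a}"
  have "a * (real n)\<^sup>2 / (2 * sinh (real n / 2)) \<noteq> 0" using n a by simp
  then have z: "lead_ridge n a u = 0 \<longleftrightarrow> sin u = 0 \<or> poly (cheb_U (n - 1)) (cos u) = Lambda n a" for u
    unfolding lead_ridge_eq[OF n a] mult_eq_0_iff neg_equal_0_iff_equal by auto
  have eq: "{u\<in>{0..2*pi}. lead_ridge n a u = 0} = {0, pi, 2 * pi} \<union> (arccos ` ?Z \<union> (\<lambda>c. 2 * pi - arccos c) ` ?Z)" (is "?L = ?R")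
  proof
    show "?R \<subseteq> ?L"
    proof -
      have "arccos c \<in> ?L" "2 * pi - arccos c \<in> ?L" if c: "c \<in> ?Z" for c
      proof -
        have "0 \<le> arccos c" "arccos c \<le> pi" using c arccos_bounded[of c] by auto
        moreover have "cos (2 * pi - arccos c) = c" "cos (arccos c) = c" using c by (simp_all add: cos_diff)
        ultimately show "arccos c \<in> ?L" "2 * pi - arccos c \<in> ?L" using c by (simp_all add: z)
      qed
      moreover have "{0, pi, 2 * pi} \<subseteq> ?L" by (simp add: z)
      ultimately show ?thesis by blast
    qed
    show "?L \<subseteq> ?R"
    proof
      fix u assume u: "u \<in> ?L"
      consider "u = 0" | "u = pi" | "u = 2 * pi" | "0 < u" "u < pi" | "pi < u" "u < 2 * pi" using u by force
      then show "u \<in> ?R"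
      proof cases
        case 4
        then have "sin u \<noteq> 0" using sin_gt_zero[of u] by auto
        moreover have "- 1 < cos u" "cos u < 1" using cos_monotone_0_pi[of 0 u] cos_monotone_0_pi[of u pi] 4 by auto
        ultimately have "cos u \<in> ?Z" using u z[of u] by auto
        moreover have "u = arccos (cos u)" using 4 by (simp add: arccos_cos)
        ultimately show ?thesis by blast
      next
        case 5
        define v where "v = 2 * pi - u"
        have v: "0 < v" "v < pi" "cos v = cos u" "sin v = - sin u" using 5 by (auto simp: v_def sin_diff cos_diff)
        then have "sin u \<noteq> 0" using sin_gt_zero[of v] by auto
        moreover have "- 1 < cos v" "cos v < 1" using cos_monotone_0_pi[of 0 v] cos_monotone_0_pi[of v pi] v by auto
        ultimately have "cos v \<in> ?Z" using u z[of u] v by auto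
        moreover have "u = 2 * pi - arccos (cos v)" using v(1,2) by (simp add: arccos_cos v_def[symmetric]) (simp add: v_def)
        ultimately show ?thesis by blast
      qed auto
    qed
  qed
  have Z: "?Z \<subseteq> {-1<..<1}" by blast
  show "finite ?L" unfolding eq using fin by simp
  show "card ?L = 3 + 2 * N_count n (Lambda n a)"
    unfolding eq N_count_def by (rule card_arccos_pairs[OF fin Z])
qed

text \<open>Where sin u = 0 the derivative is a nonzero multiple of the endpoint value of the
  polynomial minus \<open>Lambda\<close>, so the two excluded values mean exactly simplicity there.
  At the other zeros only the term with the derivative of the polynomial survives.\<close>

lemma lead_ridge_simple:
  assumes n: "1 \<le> n" and a: "a \<noteq> 0"
    and simple: "\<And>c. c \<in> {-1<..<1} \<Longrightarrow> poly (cheb_U (n - 1)) c = Lambda n a \<Longrightarrow> poly (pderiv (cheb_U (n - 1))) c \<noteq> 0"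
    and ends: "Lambda n a \<notin> {real n, (-1) ^ (n - 1) * real n}"
    and zero: "lead_ridge n a u = 0"
  shows "Re (deriv (lead2 n a) (Complex u (1/2))) \<noteq> 0"
proof -
  have K: "a * (real n)\<^sup>2 / (2 * sinh (real n / 2)) \<noteq> 0" using n a by simp
  have "cos u * (poly (cheb_U (n - 1)) (cos u) - Lambda n a) - (sin u)\<^sup>2 * poly (pderiv (cheb_U (n - 1))) (cos u) \<noteq> 0"
  proof (cases "sin u = 0")
    case True
    then have "cos u = 1 \<or> cos u = -1" using sin_zero_abs_cos_one by fastforce
    then show ?thesis using True ends n cheb_U_at_1[of "n - 1"] cheb_U_at_minus_1[of "n - 1"] by auto
  next
    case False
    then have U: "poly (cheb_U (n - 1)) (cos u) = Lambda n a"
      using zero K unfolding lead_ridge_eq[OF n a] mult_eq_0_iff neg_equal_0_iff_equal by auto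
    have "0 < (sin u)\<^sup>2" using False by simp
    then have "(cos u)\<^sup>2 < 1" using sin_cos_squared_add[of u] by linarith
    then have "cos u \<in> {-1<..<1}" by (simp add: abs_square_less_1 abs_less_iff)
    then show ?thesis using False U simple by simp
  qed
  then show ?thesis using K unfolding lead_ridge_deriv_eq[OF n a] mult_eq_0_iff neg_equal_0_iff_equal by blast
qed

lemma channel_critical_points:
  assumes n: "2 \<le> n" and a: "a \<noteq> 0"
    and simple: "\<And>c. c \<in> {-1<..<1} \<Longrightarrow> poly (cheb_U (n - 1)) c = Lambda n a \<Longrightarrow> poly (pderiv (cheb_U (n - 1))) c \<noteq> 0"
    and ends: "Lambda n a \<notin> {real n, (-1) ^ (n - 1) * real n}"
  shows "\<exists>\<epsilon>0>0. \<forall>\<epsilon>. 0 < \<bar>\<epsilon>\<bar> \<and> \<bar>\<epsilon>\<bar> < \<epsilon>0 \<longrightarrow>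
    finite (critical_points_per_period n a \<epsilon>) \<and>
    card (critical_points_per_period n a \<epsilon>) = 2 + 2 * N_count n (Lambda n a) \<and>
    (\<forall>z \<in> critical_points_per_period n a \<epsilon>. nondegenerate_critical_point (robin_function (channel n a \<epsilon>)) z)"
proof -
  have n1: "1 \<le> n" using n by simp
  let ?Z = "{c\<in>{-1<..<1}. poly (cheb_U (n - 1)) c = Lambda n a}"
  \<comment> \<open>One root with nonvanishing derivative already shows that the polynomial minus
    \<open>Lambda n a\<close> is not zero.\<close>
  have finZ: "finite ?Z"
  proof (cases "?Z = {}")
    case False
    then obtain c where "poly (pderiv (cheb_U (n - 1))) c \<noteq> 0" using simple by blast
    then have "pderiv (cheb_U (n - 1) - [:Lambda n a:]) \<noteq> 0" by (auto simp: pderiv_diff pderiv_pCons)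
    then have "cheb_U (n - 1) - [:Lambda n a:] \<noteq> 0" by auto
    then have "finite {c. poly (cheb_U (n - 1) - [:Lambda n a:]) c = 0}" by (rule poly_roots_finite)
    then show ?thesis by (rule finite_subset[rotated]) auto
  qed (use finite.emptyI in metis)
  let ?d = "\<lambda>u. Re (deriv (lead2 n a) (Complex u (1/2)))"
  have cont: "continuous_on UNIV ?d"
    by (intro continuous_on_Re continuous_on_compose2[OF holomorphic_on_imp_continuous_on[OF lead2'_h[where A = UNIV]]])
      (auto simp: Complex_eq intro!: continuous_intros)
  have zeros: "lead_ridge n a 0 = 0" "lead_ridge n a (2 * pi) = 0" by (simp_all add: lead_ridge_eq[OF n1 a])
  have "\<exists>m>0. \<exists>\<eta>0>0. \<forall>q. q 0 = 0 \<longrightarrow> q (2*pi) = 0 \<longrightarrow> (\<forall>x\<in>{0..2*pi}. \<bar>q x - lead_ridge n a x\<bar> \<le> \<eta>0) \<longrightarrow>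
    (\<forall>x\<in>{0..2*pi}. \<forall>y\<in>{0..2*pi}. \<bar>(q x - lead_ridge n a x) - (q y - lead_ridge n a y)\<bar> \<le> \<eta>0 * \<bar>x - y\<bar>) \<longrightarrow>
    finite {x\<in>{0..2*pi}. q x = 0} \<and> card {x\<in>{0..2*pi}. q x = 0} = card {x\<in>{0..2*pi}. lead_ridge n a x = 0} \<and>
    (\<forall>x\<in>{0..2*pi}. q x = 0 \<longrightarrow> m \<le> \<bar>?d x\<bar>)"
    by (rule simple_zeros_stable[OF _ lead_ridge_deriv cont zeros card_lead_ridge_zeros(1)[OF n1 a finZ] lead_ridge_simple[OF n1 a simple ends]])
      auto
  then obtain m \<eta> where m: "0 < m" and \<eta>: "0 < \<eta>" and stable: "\<forall>q. q 0 = 0 \<longrightarrow> q (2*pi) = 0 \<longrightarrow>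
      (\<forall>x\<in>{0..2*pi}. \<bar>q x - lead_ridge n a x\<bar> \<le> \<eta>) \<longrightarrow>
      (\<forall>x\<in>{0..2*pi}. \<forall>y\<in>{0..2*pi}. \<bar>(q x - lead_ridge n a x) - (q y - lead_ridge n a y)\<bar> \<le> \<eta> * \<bar>x - y\<bar>) \<longrightarrow>
      finite {x\<in>{0..2*pi}. q x = 0} \<and> card {x\<in>{0..2*pi}. q x = 0} = card {x\<in>{0..2*pi}. lead_ridge n a x = 0} \<and>
      (\<forall>x\<in>{0..2*pi}. q x = 0 \<longrightarrow> m \<le> \<bar>?d x\<bar>)"
    by (elim exE conjE) (rule that)
  obtain \<epsilon>1 C where \<epsilon>1: "0 < \<epsilon>1" and C: "0 \<le> C" and maps: "\<forall>\<epsilon>. \<bar>\<epsilon>\<bar> < \<epsilon>1 \<longrightarrow> (\<exists>\<rho> F. \<bar>\<rho> - 1\<bar> \<le> 1/20 \<and> \<bar>\<rho> - 1\<bar> \<le> C * \<bar>\<epsilon>\<bar> \<and>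
      F holomorphic_on {w. \<bar>Im w\<bar> < 3/2} \<and>
      (\<forall>w. \<bar>Im w\<bar> < 3/2 \<longrightarrow> F (- w) = - F w \<and> F (cnj w) = cnj (F w) \<and> F (w + 2 * pi) = F w + 2 * pi \<and>
        cmod (F w - w - of_real \<epsilon> * (sin w / of_real (sinh 1) + of_real a * sin (of_nat n * w) / of_real (sinh (real n)))) \<le> C * \<epsilon>\<^sup>2) \<and>
      (\<forall>u::real. Im (F (u + \<i> * \<rho>)) = 1 + \<epsilon> * (cos (Re (F (u + \<i> * \<rho>))) + a * cos (real n * Re (F (u + \<i> * \<rho>))))))"
    using channel_map_exists[OF n, of a] by (elim exE conjE) (rule that)
  define M where "M = (1 + \<bar>a\<bar> * real n + lead_bound n a + C)\<^sup>2"
  have M: "0 < M" unfolding M_def using C lead_bound_nonneg[of n a] by (intro zero_less_power) (simp add: add_pos_nonneg)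
  \<comment> \<open>The four summands ensure, in order, the hypotheses of the expansion, closeness
    to the limiting equation within \<eta>, preservation of half of the slope m, and the final
    absorption in the nondegeneracy argument.\<close>
  define E where "E = 10 ^ 9 * M + 100000000 * M\<^sup>2 / \<eta> + 200000000 * M\<^sup>2 / m + 4097 * M * (1 + 8194 * M / m)"
  have parts: "10 ^ 9 * M \<le> E" "100000000 * M\<^sup>2 / \<eta> \<le> E" "200000000 * M\<^sup>2 / m \<le> E" "4097 * M * (1 + 8194 * M / m) \<le> E"
    using M m \<eta> unfolding E_def by (simp_all add: add_nonneg_nonneg)
  have "0 < 10 ^ 9 * M" using M by simp
  then have E: "0 < E" using parts(1) by (rule less_le_trans)
  show ?thesis
  proof (intro exI[of _ "min \<epsilon>1 (1 / E)"] conjI allI impI)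
    show "0 < min \<epsilon>1 (1 / E)" using \<epsilon>1 E by simp
    fix \<epsilon> :: real assume \<epsilon>: "0 < \<bar>\<epsilon>\<bar> \<and> \<bar>\<epsilon>\<bar> < min \<epsilon>1 (1 / E)"
    then have E\<epsilon>: "E * \<bar>\<epsilon>\<bar> < 1" using E by (simp add: field_simps)
    have small: "x * \<bar>\<epsilon>\<bar> < 1" if "x \<le> E" for x
      using mult_right_mono[OF that, of "\<bar>\<epsilon>\<bar>"] E\<epsilon> by simp
    have \<epsilon>1': "\<bar>\<epsilon>\<bar> < \<epsilon>1" using \<epsilon> by simp
    obtain \<rho> F where F: "\<bar>\<rho> - 1\<bar> \<le> 1/20" "\<bar>\<rho> - 1\<bar> \<le> C * \<bar>\<epsilon>\<bar>" "F holomorphic_on {w. \<bar>Im w\<bar> < 3/2}"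
      "\<And>w. \<bar>Im w\<bar> < 3/2 \<Longrightarrow> F (- w) = - F w \<and> F (cnj w) = cnj (F w) \<and> F (w + 2 * pi) = F w + 2 * pi \<and>
        cmod (F w - w - of_real \<epsilon> * (sin w / of_real (sinh 1) + of_real a * sin (of_nat n * w) / of_real (sinh (real n)))) \<le> C * \<epsilon>\<^sup>2"
      "\<And>u::real. Im (F (u + \<i> * \<rho>)) = 1 + \<epsilon> * (cos (Re (F (u + \<i> * \<rho>))) + a * cos (real n * Re (F (u + \<i> * \<rho>))))"
      using mp[OF spec[OF maps] \<epsilon>1'] by (elim exE conjE) (rule that, assumption+, blast, blast)
    interpret channel_expansion n a C \<epsilon> \<rho> M F
    proof
      show "\<epsilon> \<noteq> 0" using \<epsilon> by auto
      show "10 ^ 9 * M * \<bar>\<epsilon>\<bar> \<le> 1" using small[OF parts(1)] by simp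
    qed (use n C F M_def in \<open>auto simp: lead_def\<close>)
    have s\<eta>: "100000000 * (M\<^sup>2 * \<bar>\<epsilon>\<bar>) \<le> \<eta>" using small[OF parts(2)] \<eta> by (simp add: field_simps)
    have sm: "100000000 * (M\<^sup>2 * \<bar>\<epsilon>\<bar>) \<le> m / 2" using small[OF parts(3)] m by (simp add: field_simps)
    have q2: "q (2 * pi) = 0" using q_periodic[of 0] q_0 by simp
    have q_stable: "finite {x\<in>{0..2*pi}. q x = 0} \<and> card {x\<in>{0..2*pi}. q x = 0} = card {x\<in>{0..2*pi}. lead_ridge n a x = 0} \<and>
      (\<forall>x\<in>{0..2*pi}. q x = 0 \<longrightarrow> m \<le> \<bar>?d x\<bar>)"
    proof (rule mp[OF mp[OF mp[OF mp[OF spec[OF stable, of q] q_0] q2]]]; intro ballI)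
      show "\<bar>q x - lead_ridge n a x\<bar> \<le> \<eta>" for x using q_near[of x] s\<eta> by linarith
      show "\<bar>(q x - lead_ridge n a x) - (q y - lead_ridge n a y)\<bar> \<le> \<eta> * \<bar>x - y\<bar>" for x y
        using q_diff_lipschitz[of x y] mult_right_mono[OF s\<eta>, of "\<bar>x - y\<bar>"] by (simp add: mult.assoc)
    qed
    \<comment> \<open>Stability counts zeros on the closed interval, 3 + 2 N of them; the half-open
      period drops the copy at 2 \<pi>.\<close>
    have split: "{x\<in>{0..2*pi}. q x = 0} = insert (2 * pi) {u \<in> {0..<2*pi}. q u = 0}"
      using q2 by (auto simp: le_less)
    have fin: "finite {u \<in> {0..<2*pi}. q u = 0}" using q_stable split by (metis finite_insert)
    have "card {x\<in>{0..2*pi}. q x = 0} = Suc (card {u \<in> {0..<2*pi}. q u = 0})"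
      unfolding split using fin by simp
    then have "card {u \<in> {0..<2*pi}. q u = 0} = 2 + 2 * N_count n (Lambda n a)"
      using q_stable card_lead_ridge_zeros(2)[OF n1 a finZ] by simp
    then show "card (critical_points_per_period n a \<epsilon>) = 2 + 2 * N_count n (Lambda n a)"
      by (simp only: card_critical_points_ridge)
    show "finite (critical_points_per_period n a \<epsilon>)" unfolding critical_points_ridge using fin by (rule finite_imageI)
    show "\<forall>z \<in> critical_points_per_period n a \<epsilon>. nondegenerate_critical_point (robin_function (channel n a \<epsilon>)) z"
      unfolding critical_points_ridge ball_simps(9)
    proof (intro ballI)
      fix u assume "u \<in> {u \<in> {0..<2*pi}. q u = 0}"
      then have u: "u \<in> {0..2*pi}" "q u = 0" by auto
      show "nondegenerate_critical_point (robin_function (channel n a \<epsilon>)) (F (Complex u (ridge u)))"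
        using q_stable u by (intro nondegenerate_on_ridge[OF u(2) m _ sm small[OF parts(4)]]) blast
    qed
  qed
qed

lemma abs_Lambda: "a \<noteq> 0 \<Longrightarrow> \<bar>Lambda n a\<bar> * \<bar>a\<bar> = sinh (real n / 2) / ((real n)\<^sup>2 * sinh (1/2))"
  by (simp add: Lambda_def abs_mult)

theorem proposition6p2:
  fixes n :: nat
  assumes "2 \<le> n"
  shows
    "(\<forall>a::real. a \<noteq> 0 \<longrightarrow>
        (\<forall>c \<in> {-1<..<1}. poly (cheb_U (n - 1)) c = Lambda n a \<longrightarrow>
            poly (pderiv (cheb_U (n - 1))) c \<noteq> 0) \<longrightarrow>
        Lambda n a \<notin> {real n, (-1) ^ (n - 1) * real n} \<longrightarrow>
        (\<exists>\<epsilon>0>0. \<forall>\<epsilon>::real. 0 < \<bar>\<epsilon>\<bar> \<and> \<bar>\<epsilon>\<bar> < \<epsilon>0 \<longrightarrow>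
            finite (critical_points_per_period n a \<epsilon>) \<and>
            card (critical_points_per_period n a \<epsilon>) = 2 + 2 * N_count n (Lambda n a) \<and>
            (\<forall>z \<in> critical_points_per_period n a \<epsilon>.
                nondegenerate_critical_point (robin_function (channel n a \<epsilon>)) z)))
     \<and> (\<exists>a0>0. \<forall>a::real. 0 < \<bar>a\<bar> \<and> \<bar>a\<bar> < a0 \<longrightarrow>
        (\<exists>\<epsilon>0>0. \<forall>\<epsilon>::real. 0 < \<bar>\<epsilon>\<bar> \<and> \<bar>\<epsilon>\<bar> < \<epsilon>0 \<longrightarrow>
            finite (critical_points_per_period n a \<epsilon>) \<and>
            card (critical_points_per_period n a \<epsilon>) = 2))
     \<and> (\<exists>A>0. \<forall>a::real. \<bar>a\<bar> > A \<longrightarrow>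
        (\<exists>\<epsilon>0>0. \<forall>\<epsilon>::real. 0 < \<bar>\<epsilon>\<bar> \<and> \<bar>\<epsilon>\<bar> < \<epsilon>0 \<longrightarrow>
            finite (critical_points_per_period n a \<epsilon>) \<and>
            card (critical_points_per_period n a \<epsilon>) = 2 * n))"
proof (intro conjI)
  \<comment> \<open>The product of \<bar>Lambda n a\<bar> and \<bar>a\<bar> does not depend on a.
    The thresholds L / n and L below are the values of \<bar>a\<bar> at which \<bar>Lambda n a\<bar>
    equals n and 1.\<close>
  define L where "L = sinh (real n / 2) / ((real n)\<^sup>2 * sinh (1/2))"
  have L: "0 < L" using assms by (simp add: L_def)
  have \<Lambda>: "\<bar>Lambda n a\<bar> * \<bar>a\<bar> = L" if "a \<noteq> 0" for a using abs_Lambda[OF that] by (simp add: L_def)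
  \<comment> \<open>Both excluded values have modulus n, which \<bar>Lambda n a\<bar> > n and
    \<bar>Lambda n a\<bar> < 1 each rule out.\<close>
  have ends: "\<bar>x\<bar> = real n" if "x \<in> {real n, (-1) ^ (n - 1) * real n}" for x :: real
    using that by (auto simp: abs_mult power_abs)
  show "\<forall>a::real. a \<noteq> 0 \<longrightarrow>
        (\<forall>c \<in> {-1<..<1}. poly (cheb_U (n - 1)) c = Lambda n a \<longrightarrow>
            poly (pderiv (cheb_U (n - 1))) c \<noteq> 0) \<longrightarrow>
        Lambda n a \<notin> {real n, (-1) ^ (n - 1) * real n} \<longrightarrow>
        (\<exists>\<epsilon>0>0. \<forall>\<epsilon>::real. 0 < \<bar>\<epsilon>\<bar> \<and> \<bar>\<epsilon>\<bar> < \<epsilon>0 \<longrightarrow>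
            finite (critical_points_per_period n a \<epsilon>) \<and>
            card (critical_points_per_period n a \<epsilon>) = 2 + 2 * N_count n (Lambda n a) \<and>
            (\<forall>z \<in> critical_points_per_period n a \<epsilon>.
                nondegenerate_critical_point (robin_function (channel n a \<epsilon>)) z))"
    using channel_critical_points[OF assms] by blast
  show "\<exists>a0>0. \<forall>a::real. 0 < \<bar>a\<bar> \<and> \<bar>a\<bar> < a0 \<longrightarrow>
        (\<exists>\<epsilon>0>0. \<forall>\<epsilon>::real. 0 < \<bar>\<epsilon>\<bar> \<and> \<bar>\<epsilon>\<bar> < \<epsilon>0 \<longrightarrow>
            finite (critical_points_per_period n a \<epsilon>) \<and>
            card (critical_points_per_period n a \<epsilon>) = 2)"
  proof (rule exI[of _ "L / real n"], intro conjI allI impI)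
    show "0 < L / real n" using L assms by simp
    fix a :: real assume a: "0 < \<bar>a\<bar> \<and> \<bar>a\<bar> < L / real n"
    then have a0: "a \<noteq> 0" by auto
    have big: "real n < \<bar>Lambda n a\<bar>"
    proof (rule ccontr)
      assume "\<not> real n < \<bar>Lambda n a\<bar>"
      then have "\<bar>Lambda n a\<bar> * \<bar>a\<bar> \<le> real n * \<bar>a\<bar>" by (intro mult_right_mono) auto
      also have "\<dots> < L" using a assms by (simp add: pos_less_divide_eq mult.commute)
      finally show False using \<Lambda>[OF a0] by simp
    qed
    have none: "poly (cheb_U (n - 1)) c \<noteq> Lambda n a" if "c \<in> {-1<..<1}" for c
      using abs_cheb_U_le[OF that, of "n - 1"] big assms by auto
    have "{c\<in>{-1<..<1}. poly (cheb_U (n - 1)) c = Lambda n a} = {}" using none by blast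
    then have "N_count n (Lambda n a) = 0" unfolding N_count_def by (simp only: card.empty)
    moreover have "Lambda n a \<notin> {real n, (-1) ^ (n - 1) * real n}" using ends[of "Lambda n a"] big by force
    ultimately show "\<exists>\<epsilon>0>0. \<forall>\<epsilon>::real. 0 < \<bar>\<epsilon>\<bar> \<and> \<bar>\<epsilon>\<bar> < \<epsilon>0 \<longrightarrow>
            finite (critical_points_per_period n a \<epsilon>) \<and> card (critical_points_per_period n a \<epsilon>) = 2"
      using channel_critical_points[OF assms a0] none by (simp only: mult_0_right add_0_right) blast
  qed
  show "\<exists>A>0. \<forall>a::real. \<bar>a\<bar> > A \<longrightarrow>
        (\<exists>\<epsilon>0>0. \<forall>\<epsilon>::real. 0 < \<bar>\<epsilon>\<bar> \<and> \<bar>\<epsilon>\<bar> < \<epsilon>0 \<longrightarrow>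
            finite (critical_points_per_period n a \<epsilon>) \<and>
            card (critical_points_per_period n a \<epsilon>) = 2 * n)"
  proof (rule exI[of _ L], intro conjI allI impI)
    show "0 < L" by (rule L)
    fix a :: real assume a: "\<bar>a\<bar> > L"
    then have a0: "a \<noteq> 0" using L by auto
    have less1: "\<bar>Lambda n a\<bar> < 1"
    proof (rule ccontr)
      assume "\<not> \<bar>Lambda n a\<bar> < 1"
      then have "1 * \<bar>a\<bar> \<le> \<bar>Lambda n a\<bar> * \<bar>a\<bar>" by (intro mult_right_mono) auto
      then show False using \<Lambda>[OF a0] a by simp
    qed
    have "N_count n (Lambda n a) = n - 1" unfolding N_count_def by (rule card_cheb_U_roots(1)[OF less1])
    then have "2 + 2 * N_count n (Lambda n a) = 2 * n" using assms by simp
    moreover have "Lambda n a \<notin> {real n, (-1) ^ (n - 1) * real n}" using ends[of "Lambda n a"] less1 assms by force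
    ultimately show "\<exists>\<epsilon>0>0. \<forall>\<epsilon>::real. 0 < \<bar>\<epsilon>\<bar> \<and> \<bar>\<epsilon>\<bar> < \<epsilon>0 \<longrightarrow>
            finite (critical_points_per_period n a \<epsilon>) \<and> card (critical_points_per_period n a \<epsilon>) = 2 * n"
      using channel_critical_points[OF assms a0 card_cheb_U_roots(2)[OF less1]] by (simp only:) blast
  qed
qed

end
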